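(* Let $z_1,z_2\in\mathbb{C}\setminus(-\infty,1]$ and $\nu,\mu\in\mathbb{C}^\ast$, such that $\Re(\nu+\mu)>-3$. Then $$P_\nu^{-\mu}(z_1)P_\nu^{-\mu}(z_2)=\frac{\sin(\pi\nu)\Gamma(\nu+1)}{\pi\,\Gamma(\nu+\mu+1)(z_1z_2)^{\nu+1}}\int_{1}^{\frac{1+z_1z_2}{z_1+z_2}}P_\nu^{-\mu}(z_3)\frac{(C-1)^{-\nu-1}}{z_3^{\nu+1}(1-z_3^2)}\,dz_3 ,$$ where $$C=C(z_1,z_2,z_3)=\frac{1-z_1^2z_2^2-z_1^2z_3^2-z_2^2z_3^2+2z_1^2z_2^2z_3^2}{2z_1z_2z_3\sqrt{(z_1^2-1)(z_2^2-1)(z_3^2-1)}}.$$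
   Context: $\mathbb{C}^\ast=\mathbb{C}\setminus\{0\}$. The associated Legendre function of the first kind on $\mathbb{C}\setminus(-\infty,1]$ is $P_\nu^\mu(z)=\left(\frac{z+1}{z-1}\right)^{\frac12\mu}\mathbf{F}\big(-\nu,\nu+1;1-\mu;\frac{1-z}{2}\big)$, where $\mathbf{F}(a,b;c;z)=\sum_{n\ge0}\frac{(a)_n(b)_n}{\Gamma(c+n)}\frac{z^n}{n!}$ (continued analytically) is the regularized Gauss hypergeometric function.
   Formalization: Added: the integral, taken along the segment, converges (it diverges for ν=μ=1, z1=z2=2), and (z1,z2) lies in the connected region around real pairs >1 where the upper limit exists off the cut and C−1 avoids (−∞,0] on the segment (z1=i, z2=−i has no upper limit). *)

theory Defs
  imports "HOL-Complex_Analysis.Complex_Analysis"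
begin

definition cut_plane :: "complex set" where
  "cut_plane = - (of_real ` {..(1::real)})"

definition hyp2F1_reg_series :: "complex \<Rightarrow> complex \<Rightarrow> complex \<Rightarrow> complex \<Rightarrow> complex" where
  "hyp2F1_reg_series a b c z =
     (\<Sum>n. pochhammer a n * pochhammer b n * rGamma (c + of_nat n) * z ^ n / fact n)"

text \<open>
  The series converges for \<open>norm z < 1\<close>. Its sum has exactly one holomorphic continuation to
  the plane cut along \<open>[1, \<infinity>)\<close>, which is what the choice operator selects; the values on
  the cut itself are unspecified and never used.
\<close>

definition hyp2F1_reg :: "complex \<Rightarrow> complex \<Rightarrow> complex \<Rightarrow> complex \<Rightarrow> complex" where
  "hyp2F1_reg a b c =
     (SOME F. F holomorphic_on - (of_real ` {(1::real)..}) \<and>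
              (\<forall>z\<in>ball 0 1. F z = hyp2F1_reg_series a b c z))"

text \<open>
  The upper index \<open>\<mu>\<close> is the second argument. For \<open>z \<in> cut_plane\<close> the base of the power is
  never a non-positive real number, so the principal power is holomorphic there.
\<close>

definition Legendre_P :: "complex \<Rightarrow> complex \<Rightarrow> complex \<Rightarrow> complex" where
  "Legendre_P \<nu> \<mu> z =
     ((z + 1) / (z - 1)) powr (\<mu> / 2) * hyp2F1_reg (-\<nu>) (\<nu> + 1) (1 - \<mu>) ((1 - z) / 2)"

text \<open>
  The branch of the square root of \<open>z\<^sup>2 - 1\<close> that is holomorphic on \<open>cut_plane\<close> and positive
  for \<open>z > 1\<close>; it differs from \<open>csqrt (z\<^sup>2 - 1)\<close> in the left half-plane.
\<close>

definition sqrt_sq_minus_1 :: "complex \<Rightarrow> complex" where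
  "sqrt_sq_minus_1 z = csqrt (z - 1) * csqrt (z + 1)"

definition kernel_C :: "complex \<Rightarrow> complex \<Rightarrow> complex \<Rightarrow> complex" where
  "kernel_C z1 z2 z3 =
     (1 - z1\<^sup>2 * z2\<^sup>2 - z1\<^sup>2 * z3\<^sup>2 - z2\<^sup>2 * z3\<^sup>2 + 2 * z1\<^sup>2 * z2\<^sup>2 * z3\<^sup>2) /
     (2 * z1 * z2 * z3 * (sqrt_sq_minus_1 z1 * sqrt_sq_minus_1 z2 * sqrt_sq_minus_1 z3))"

definition upper_limit :: "complex \<Rightarrow> complex \<Rightarrow> complex" where
  "upper_limit z1 z2 = (1 + z1 * z2) / (z1 + z2)"

definition product_integrand :: "complex \<Rightarrow> complex \<Rightarrow> complex \<Rightarrow> complex \<Rightarrow> complex \<Rightarrow> complex" where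
  "product_integrand \<nu> \<mu> z1 z2 z3 =
     Legendre_P \<nu> (-\<mu>) z3 * ((kernel_C z1 z2 z3 - 1) powr (-\<nu> - 1) /
     (z3 powr (\<nu> + 1) * (1 - z3\<^sup>2)))"

text \<open>
  For non-real \<open>z1, z2\<close> the integral is taken along the segment from \<open>1\<close> to the upper limit.
  The pairs below are those for which the open segment exists in \<open>cut_plane\<close> and meets no
  branch cut of \<open>(C - 1) powr (-\<nu> - 1)\<close>.
\<close>

definition cut_free_pairs :: "(complex \<times> complex) set" where
  "cut_free_pairs = {(z1, z2). z1 \<in> cut_plane \<and> z2 \<in> cut_plane \<and> z1 + z2 \<noteq> 0 \<and>
     upper_limit z1 z2 \<in> cut_plane \<and>
     (\<forall>z3\<in>open_segment 1 (upper_limit z1 z2). kernel_C z1 z2 z3 - 1 \<notin> \<real>\<^sub>\<le>\<^sub>0)}"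

text \<open>
  Absence of cuts on the segment alone does not single out the right branch: it has to be the one
  reached from \<open>z1, z2 > 1\<close>, where every power and root in the integrand has a positive base.
  Hence the connected component of the real pairs.
\<close>

definition principal_region :: "(complex \<times> complex) set" where
  "principal_region = {p. \<exists>x1 x2 :: real. x1 > 1 \<and> x2 > 1 \<and>
     connected_component (interior cut_free_pairs) (of_real x1, of_real x2) p}"


lemma in_cut_plane_iff: "z \<in> cut_plane \<longleftrightarrow> z - 1 \<notin> \<real>\<^sub>\<le>\<^sub>0"
proof -
  have "z \<in> of_real ` {..(1::real)} \<longleftrightarrow> z - 1 \<in> \<real>\<^sub>\<le>\<^sub>0"
  proof
    assume "z - 1 \<in> \<real>\<^sub>\<le>\<^sub>0"
    then have "z = of_real (Re z)" "Re z \<le> 1"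
      by (auto simp: complex_nonpos_Reals_iff complex_eq_iff)
    then show "z \<in> of_real ` {..(1::real)}" by blast
  qed (auto simp: complex_nonpos_Reals_iff)
  then show ?thesis by (simp add: cut_plane_def)
qed

lemma sqrt_sq_minus_1_power2: "(sqrt_sq_minus_1 z)\<^sup>2 = z\<^sup>2 - 1"
  by (simp add: sqrt_sq_minus_1_def power_mult_distrib) (simp add: power2_eq_square algebra_simps)

lemma csqrt_of_real_mult:
  assumes "t \<ge> 0" shows "csqrt (of_real t * w) = of_real (sqrt t) * csqrt w"
proof (cases "t = 0 \<or> w = 0")
  case False
  with assms have "t > 0" by simp
  have "csqrt ((of_real (sqrt t) * csqrt w)\<^sup>2) = of_real (sqrt t) * csqrt w"
  proof (rule csqrt_square)
    show "0 < Re (of_real (sqrt t) * csqrt w) \<or>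
          Re (of_real (sqrt t) * csqrt w) = 0 \<and> 0 \<le> Im (of_real (sqrt t) * csqrt w)"
      using csqrt_principal[of w] \<open>t > 0\<close> by auto
  qed
  moreover have "(of_real (sqrt t) * csqrt w)\<^sup>2 = of_real t * w"
    using \<open>t > 0\<close> by (simp add: power_mult_distrib flip: of_real_power)
  ultimately show ?thesis by simp
qed auto

text \<open>
  All real pairs \<open>z1, z2 > 1\<close> lie in \<open>principal_region\<close>, which is therefore a neighbourhood of
  them. On the segment, \<open>C - 1\<close> is a positive multiple of \<open>kernel_normalised\<close>, and the latter
  is continuous up to both end points.
\<close>

definition segment_point :: "(complex \<times> complex) \<Rightarrow> real \<Rightarrow> complex" where
  "segment_point p t = 1 + of_real t * (upper_limit (fst p) (snd p) - 1)"

definition segment_root :: "(complex \<times> complex) \<Rightarrow> real \<Rightarrow> complex" where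
  "segment_root p t = csqrt (upper_limit (fst p) (snd p) - 1) * csqrt (1 + segment_point p t)"

definition root_product :: "(complex \<times> complex) \<Rightarrow> complex" where
  "root_product p = sqrt_sq_minus_1 (fst p) * sqrt_sq_minus_1 (snd p)"

definition kernel_normalised :: "(complex \<times> complex) \<Rightarrow> real \<Rightarrow> complex" where
  "kernel_normalised p t = (fst p + snd p)\<^sup>2 * (upper_limit (fst p) (snd p) - 1) *
      (upper_limit (fst p) (snd p) + segment_point p t) *
      (segment_point p t * root_product p - (fst p * snd p - 1) * of_real (sqrt t) * segment_root p t) /
     ((segment_point p t * root_product p + (fst p * snd p + 1) * of_real (sqrt t) * segment_root p t) *
      (2 * fst p * snd p * segment_point p t * segment_root p t * root_product p))"

lemma sqrt_seg:
  assumes "t \<ge> 0"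
  shows "sqrt_sq_minus_1 (segment_point p t) = of_real (sqrt t) * segment_root p t"
  using csqrt_of_real_mult[OF assms]
  by (simp add: sqrt_sq_minus_1_def segment_point_def segment_root_def add_ac)

lemma kernel_eq_aux:
  fixes a b z u s r :: complex
  assumes r: "r\<^sup>2 = (a\<^sup>2 - 1) * (b\<^sup>2 - 1)" and s: "s\<^sup>2 = z\<^sup>2 - 1" and u: "1 + a * b = u * (a + b)"
    and nz: "a \<noteq> 0" "b \<noteq> 0" "z \<noteq> 0" "s \<noteq> 0" "r \<noteq> 0" "z * r + (a * b + 1) * s \<noteq> 0"
  shows "(1 - a\<^sup>2 * b\<^sup>2 - a\<^sup>2 * z\<^sup>2 - b\<^sup>2 * z\<^sup>2 + 2 * a\<^sup>2 * b\<^sup>2 * z\<^sup>2) / (2 * a * b * z * (r * s)) - 1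
     = (a + b)\<^sup>2 * (u - z) * (u + z) * (z * r - (a * b - 1) * s) /
       ((z * r + (a * b + 1) * s) * (2 * a * b * z * s * r))"
proof -
  have 1: "(1 - a\<^sup>2 * b\<^sup>2 - a\<^sup>2 * z\<^sup>2 - b\<^sup>2 * z\<^sup>2 + 2 * a\<^sup>2 * b\<^sup>2 * z\<^sup>2) - 2 * a * b * z * (r * s)
      = (z * r - (a * b + 1) * s) * (z * r - (a * b - 1) * s)"
  proof -
    have "(z * r - (a * b + 1) * s) * (z * r - (a * b - 1) * s)
       = z\<^sup>2 * r\<^sup>2 - 2 * a * b * z * (r * s) + ((a * b)\<^sup>2 - 1) * s\<^sup>2"
      by algebra
    then show ?thesis unfolding r s by (simp add: algebra_simps power2_eq_square)
  qed
  have 2: "(z * r - (a * b + 1) * s) * (z * r + (a * b + 1) * s) = (a + b)\<^sup>2 * (u - z) * (u + z)"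
  proof -
    have "(z * r - (a * b + 1) * s) * (z * r + (a * b + 1) * s) = z\<^sup>2 * r\<^sup>2 - (1 + a * b)\<^sup>2 * s\<^sup>2"
      by algebra
    also have "\<dots> = (1 + a * b)\<^sup>2 - (a + b)\<^sup>2 * z\<^sup>2"
      unfolding r s by algebra
    also have "\<dots> = (a + b)\<^sup>2 * (u - z) * (u + z)"
      unfolding u by algebra
    finally show ?thesis .
  qed
  have "(1 - a\<^sup>2 * b\<^sup>2 - a\<^sup>2 * z\<^sup>2 - b\<^sup>2 * z\<^sup>2 + 2 * a\<^sup>2 * b\<^sup>2 * z\<^sup>2) / (2 * a * b * z * (r * s)) - 1
     = (z * r - (a * b + 1) * s) * (z * r - (a * b - 1) * s) / (2 * a * b * z * (r * s))"
    using nz unfolding 1[symmetric] by (simp add: field_simps)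
  also have "\<dots> = ((z * r - (a * b + 1) * s) * (z * r + (a * b + 1) * s)) * (z * r - (a * b - 1) * s) /
       ((z * r + (a * b + 1) * s) * (2 * a * b * z * s * r))"
    using nz by (simp add: divide_simps)
  finally show ?thesis unfolding 2 .
qed

lemma kernel_seg:
  assumes t: "0 < t" "t < 1" and nz: "kernel_normalised p t \<noteq> 0"
  shows "kernel_C (fst p) (snd p) (segment_point p t) - 1 = of_real ((1 - t) / sqrt t) * kernel_normalised p t"
proof -
  define a b z u s r where defs: "a = fst p" "b = snd p" "z = segment_point p t"
    "u = upper_limit a b" "s = sqrt_sq_minus_1 (segment_point p t)" "r = root_product p"
  have s': "s = of_real (sqrt t) * segment_root p t" using t by (simp add: defs sqrt_seg)
  have st: "of_real (sqrt t) \<noteq> (0::complex)" using t by simp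
  have n: "a \<noteq> 0" "b \<noteq> 0" "z \<noteq> 0" "s \<noteq> 0" "r \<noteq> 0" "z * r + (a * b + 1) * s \<noteq> 0" "a + b \<noteq> 0"
    using nz st by (auto simp: kernel_normalised_def defs(1-4,6) s' mult.assoc)
  have uz: "u - z = of_real (1 - t) * (u - 1)"
    by (simp add: defs segment_point_def algebra_simps)
  have "kernel_C a b z - 1 = (a + b)\<^sup>2 * (u - z) * (u + z) * (z * r - (a * b - 1) * s) /
       ((z * r + (a * b + 1) * s) * (2 * a * b * z * s * r))"
    using kernel_eq_aux[of r a b s z u] n
    by (simp add: kernel_C_def defs(5,6) root_product_def power_mult_distrib sqrt_sq_minus_1_power2
        flip: defs(1-3)) (simp add: defs upper_limit_def)
  also have "\<dots> = of_real ((1 - t) / sqrt t) * kernel_normalised p t"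
    unfolding uz kernel_normalised_def defs(1-4,6)[symmetric] s' using st n unfolding s'
    by (simp add: field_simps)
  finally show ?thesis by (simp add: defs)
qed

lemma Re_kernel_normalised_real_pos:
  fixes x y t :: real
  assumes xy: "x > 1" "y > 1" and t: "t \<in> {0..1}"
  defines "p \<equiv> (complex_of_real x, complex_of_real y)"
  shows "Re (kernel_normalised p t) > 0"
proof -
  define u where "u = (1 + x * y) / (x + y)"
  define z where "z = 1 + t * (u - 1)"
  define sg where "sg = sqrt (u - 1) * sqrt (1 + z)"
  define r where "r = (sqrt (x - 1) * sqrt (x + 1)) * (sqrt (y - 1) * sqrt (y + 1))"
  have "u - 1 = (x - 1) * (y - 1) / (x + y)" using xy by (simp add: u_def field_simps)
  then have u1: "u > 1" using xy by (metis add_pos_pos diff_gt_0_iff_gt divide_pos_pos less_trans mult_pos_pos zero_less_one)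
  define k where "k = t * (u - 1)"
  have "0 \<le> k" "k \<le> u - 1"
    using t u1 by (auto simp: k_def intro!: mult_left_le_one_le)
  then have z1: "z \<ge> 1" "z \<le> u" unfolding z_def k_def[symmetric] by linarith+
  have sg0: "sg > 0" using u1 z1 by (simp add: sg_def)
  have r0: "r > 0" using xy by (simp add: r_def)
  have cu: "upper_limit (fst p) (snd p) = of_real u" by (simp add: p_def upper_limit_def u_def)
  have cz: "segment_point p t = of_real z" by (simp add: segment_point_def cu z_def)
  have cs: "segment_root p t = of_real sg"
  proof -
    have "csqrt (of_real (u - 1)) = of_real (sqrt (u - 1))" "csqrt (of_real (1 + z)) = of_real (sqrt (1 + z))"
      using u1 z1 by (intro csqrt_of_real; simp)+
    then show ?thesis by (simp add: segment_root_def cu cz sg_def)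
  qed
  have cr: "root_product p = of_real r"
  proof -
    have "sqrt_sq_minus_1 (of_real v) = of_real (sqrt (v - 1) * sqrt (v + 1))" if "v > 1" for v :: real
    proof -
      have "csqrt (of_real (v - 1)) = of_real (sqrt (v - 1))" "csqrt (of_real (v + 1)) = of_real (sqrt (v + 1))"
        using that by (intro csqrt_of_real; simp)+
      then show ?thesis by (simp add: sqrt_sq_minus_1_def)
    qed
    then show ?thesis using xy by (simp add: root_product_def p_def r_def)
  qed
  define s where "s = sqrt t * sg"
  have s0: "s \<ge> 0" using t sg0 by (simp add: s_def)
  have s2: "s\<^sup>2 = z\<^sup>2 - 1"
    using t u1 z1 by (simp add: s_def sg_def power_mult_distrib z_def) (simp add: algebra_simps power2_eq_square)
  have r2: "r\<^sup>2 = (x\<^sup>2 - 1) * (y\<^sup>2 - 1)"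
    using xy by (simp add: r_def power_mult_distrib) (simp add: algebra_simps power2_eq_square)
  have uxy: "1 + x * y = u * (x + y)" using xy by (simp add: u_def)
  have "(z * r)\<^sup>2 - ((x * y + 1) * s)\<^sup>2 = (1 + x * y)\<^sup>2 - (x + y)\<^sup>2 * z\<^sup>2"
    by (simp only: power_mult_distrib s2 r2) algebra
  also have "\<dots> = (x + y)\<^sup>2 * (u\<^sup>2 - z\<^sup>2)" unfolding uxy by algebra
  also have "\<dots> \<ge> 0" using z1 by (simp add: power_mono)
  finally have "((x * y + 1) * s)\<^sup>2 \<le> (z * r)\<^sup>2" by simp
  then have A: "(x * y + 1) * s \<le> z * r"
    by (rule power2_le_imp_le) (use z1 r0 in simp)
  have B: "z * r - (x * y - 1) * s > 0"
  proof (cases "s = 0")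
    case True then show ?thesis using z1 r0 by simp
  next
    case False
    then have "(x * y - 1) * s < (x * y + 1) * s" using s0 by (intro mult_strict_right_mono) auto
    then show ?thesis using A by simp
  qed
  have D: "z * r + (x * y + 1) * s > 0"
    using z1 r0 s0 xy by (intro add_pos_nonneg mult_pos_pos mult_nonneg_nonneg) auto
  have "kernel_normalised p t = of_real ((x + y)\<^sup>2 * (u - 1) * (u + z) * (z * r - (x * y - 1) * s) /
     ((z * r + (x * y + 1) * s) * (2 * x * y * z * sg * r)))"
    by (simp add: kernel_normalised_def cu cz cs cr s_def mult.assoc) (simp add: p_def)
  moreover have "(x + y)\<^sup>2 * (u - 1) * (u + z) * (z * r - (x * y - 1) * s) /
     ((z * r + (x * y + 1) * s) * (2 * x * y * z * sg * r)) > 0"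
    using B D xy u1 z1 sg0 r0 by (intro divide_pos_pos mult_pos_pos) auto
  ultimately show ?thesis by simp
qed


lemma isCont_kernel_normalised:
  fixes x y t :: real
  assumes xy: "x > 1" "y > 1" and t: "t \<in> {0..1}"
  shows "isCont (\<lambda>(p, t). kernel_normalised p t) ((of_real x, of_real y), t)"
proof -
  let ?p = "(complex_of_real x, complex_of_real y)"
  have nz: "kernel_normalised ?p t \<noteq> 0" using Re_kernel_normalised_real_pos[OF assms] by auto
  then have n: "fst ?p + snd ?p \<noteq> 0"
    "((segment_point ?p t * root_product ?p + (fst ?p * snd ?p + 1) * of_real (sqrt t) * segment_root ?p t) *
      (2 * fst ?p * snd ?p * segment_point ?p t * segment_root ?p t * root_product ?p)) \<noteq> 0"
    unfolding kernel_normalised_def by auto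
  have "(x - 1) * (y - 1) / (x + y) > 0" using xy by simp
  then have u: "(1 + x * y) / (x + y) > 1" using xy by (simp add: field_simps)
  then have sg: "1 + (1 + t * ((1 + x * y) / (x + y) - 1)) > 0"
    using t by (simp add: add_pos_nonneg)
  have up: "isCont (\<lambda>q::(complex \<times> complex) \<times> real. upper_limit (fst (fst q)) (snd (fst q))) (?p, t)"
    unfolding upper_limit_def using n(1) by (intro continuous_intros) auto
  have upr: "upper_limit (fst ?p) (snd ?p) = of_real ((1 + x * y) / (x + y))"
    by (simp add: upper_limit_def)
  have se: "isCont (\<lambda>q. segment_point (fst q) (snd q)) (?p, t)"
    unfolding segment_point_def by (intro continuous_intros up)
  have csq: "isCont (\<lambda>q. csqrt (f q)) a" if "isCont f a" "f a \<notin> \<real>\<^sub>\<le>\<^sub>0"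
    for f :: "(complex \<times> complex) \<times> real \<Rightarrow> complex" and a
    using continuous_at_compose[OF that(1) continuous_at_csqrt[OF that(2)]] by (simp add: o_def)
  have si: "isCont (\<lambda>q. segment_root (fst q) (snd q)) (?p, t)"
    unfolding segment_root_def
  proof (intro continuous_intros csq up se)
    show "upper_limit (fst (fst (?p, t))) (snd (fst (?p, t))) - 1 \<notin> \<real>\<^sub>\<le>\<^sub>0"
      using u unfolding fst_conv snd_conv upr[unfolded fst_conv snd_conv]
      by (simp add: complex_nonpos_Reals_iff)
    have "1 + segment_point ?p t = of_real (1 + (1 + t * ((1 + x * y) / (x + y) - 1)))"
      by (simp add: segment_point_def upper_limit_def)
    then show "1 + segment_point (fst (?p, t)) (snd (?p, t)) \<notin> \<real>\<^sub>\<le>\<^sub>0"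
      using sg by (simp only: fst_conv snd_conv complex_nonpos_Reals_iff Re_complex_of_real) auto
  qed
  have pr: "isCont (\<lambda>q. root_product (fst q)) (?p, t)"
    unfolding root_product_def sqrt_sq_minus_1_def using xy
    by (intro continuous_intros csq) (auto simp: complex_nonpos_Reals_iff)
  have "isCont (\<lambda>q. kernel_normalised (fst q) (snd q)) (?p, t)"
    unfolding kernel_normalised_def using n(2)
    by (intro continuous_intros up se si pr) simp_all
  then show ?thesis by (simp add: case_prod_unfold)
qed

lemma of_real_in_principal_region:
  fixes x y :: real
  assumes xy: "x > 1" "y > 1"
  shows "(of_real x, of_real y) \<in> principal_region"
proof -
  let ?p = "(complex_of_real x, complex_of_real y)"
  define W where "W = interior {q. 0 < Re (case q of (p, t) \<Rightarrow> kernel_normalised p t)}"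
  have "{?p} \<times> {0..1} \<subseteq> W"
  proof clarify
    fix t :: real assume t: "t \<in> {0..1}"
    have "((\<lambda>q. case q of (p, t) \<Rightarrow> kernel_normalised p t) \<longlongrightarrow> (case (?p, t) of (p, t) \<Rightarrow> kernel_normalised p t)) (nhds (?p, t))"
      using isCont_kernel_normalised[OF xy t] unfolding continuous_at tendsto_at_iff_tendsto_nhds .
    then have "((\<lambda>q. Re (case q of (p, t) \<Rightarrow> kernel_normalised p t)) \<longlongrightarrow> Re (kernel_normalised ?p t)) (nhds (?p, t))"
      unfolding prod.case by (rule tendsto_Re)
    then have "eventually (\<lambda>q. 0 < Re (case q of (p, t) \<Rightarrow> kernel_normalised p t)) (nhds (?p, t))"
      by (rule order_tendstoD) (rule Re_kernel_normalised_real_pos[OF xy t])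
    then show "(?p, t) \<in> W"
      unfolding W_def interior_def eventually_nhds by blast
  qed
  moreover have "open W" by (simp add: W_def)
  ultimately obtain X where X: "?p \<in> X" "open X" "X \<times> {0..1} \<subseteq> W"
    using Elementary_Topology.tube_lemma[of "{0..1::real}" W ?p] by auto
  have pos: "Re (kernel_normalised p t) > 0" if "p \<in> X" "t \<in> {0..1}" for p t
  proof -
    have "(p, t) \<in> W" using that X(3) by auto
    then show ?thesis using interior_subset by (fastforce simp: W_def)
  qed
  define Y where "Y = {p. fst p - 1 \<notin> \<real>\<^sub>\<le>\<^sub>0 \<and> snd p - 1 \<notin> \<real>\<^sub>\<le>\<^sub>0 \<and> 0 < Re (upper_limit (fst p) (snd p) - 1)}"
  have "eventually (\<lambda>p. p \<in> Y) (nhds ?p)"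
  proof -
    have f: "((\<lambda>p. Re (fst p - 1)) \<longlongrightarrow> Re (of_real x - 1)) (nhds ?p)"
      and s: "((\<lambda>p. Re (snd p - 1)) \<longlongrightarrow> Re (of_real y - 1)) (nhds ?p)"
      by (intro tendsto_intros; auto intro!: tendsto_fst[of "\<lambda>p. p" ?p, simplified]
             tendsto_snd[of "\<lambda>p. p" ?p, simplified] tendsto_Re tendsto_diff tendsto_const simp: filterlim_ident)+
    define h where "h = (\<lambda>p :: complex \<times> complex. upper_limit (fst p) (snd p) - 1)"
    have "isCont h ?p"
      unfolding h_def upper_limit_def using xy by (intro continuous_intros) (auto simp flip: of_real_add)
    then have "(h \<longlongrightarrow> h ?p) (nhds ?p)"
      unfolding continuous_at tendsto_at_iff_tendsto_nhds .
    then have "((\<lambda>p. Re (h p)) \<longlongrightarrow> Re (h ?p)) (nhds ?p)" by (rule tendsto_Re)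
    then have u: "((\<lambda>p. Re (upper_limit (fst p) (snd p) - 1)) \<longlongrightarrow> Re (upper_limit (of_real x) (of_real y) - 1)) (nhds ?p)"
      by (simp add: h_def)
    have "(x - 1) * (y - 1) / (x + y) > 0" using xy by simp
    then have "(1 + x * y) / (x + y) > 1" using xy by (simp add: field_simps)
    moreover have "upper_limit (of_real x) (of_real y) = of_real ((1 + x * y) / (x + y))"
      by (simp add: upper_limit_def)
    ultimately have "0 < Re (upper_limit (of_real x) (of_real y) - 1)" by simp
    with order_tendstoD(1)[OF u] have "eventually (\<lambda>p. 0 < Re (upper_limit (fst p) (snd p) - 1)) (nhds ?p)"
      by blast
    moreover have "eventually (\<lambda>p. 0 < Re (fst p - 1)) (nhds ?p)" "eventually (\<lambda>p. 0 < Re (snd p - 1)) (nhds ?p)"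
      using order_tendstoD(1)[OF f, of 0] order_tendstoD(1)[OF s, of 0] xy by simp_all
    ultimately show ?thesis
      by eventually_elim (auto simp: Y_def complex_nonpos_Reals_iff)
  qed
  then obtain Z where Z: "open Z" "?p \<in> Z" "Z \<subseteq> Y"
    unfolding eventually_nhds by blast
  have "X \<inter> Z \<subseteq> cut_free_pairs"
  proof
    fix p assume p: "p \<in> X \<inter> Z"
    obtain a b where ab: "p = (a, b)" by (cases p)
    have Yp: "p \<in> Y" using p Z by auto
    have "kernel_C a b z - 1 \<notin> \<real>\<^sub>\<le>\<^sub>0" if z: "z \<in> open_segment 1 (upper_limit a b)" for z
    proof -
      obtain t where t: "0 < t" "t < 1" "z = (1 - t) *\<^sub>R 1 + t *\<^sub>R upper_limit a b"
        using z by (auto simp: in_segment)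
      then have zs: "z = segment_point p t" by (simp add: segment_point_def ab scaleR_conv_of_real algebra_simps)
      have P: "Re (kernel_normalised p t) > 0" using pos[of p t] p t by auto
      then have "kernel_normalised p t \<noteq> 0" by auto
      from kernel_seg[OF t(1,2) this] have "Re (kernel_C a b z - 1) = (1 - t) / sqrt t * Re (kernel_normalised p t)"
        unfolding zs ab fst_conv snd_conv by (simp only: Re_complex_of_real times_complex.sel Im_complex_of_real mult_zero_left diff_zero)
      moreover have "\<dots> > 0" using t P by simp
      ultimately show ?thesis by (auto simp: complex_nonpos_Reals_iff)
    qed
    moreover have "a + b \<noteq> 0" "upper_limit a b \<in> cut_plane" "a \<in> cut_plane" "b \<in> cut_plane"
      using Yp by (auto simp: Y_def ab in_cut_plane_iff complex_nonpos_Reals_iff upper_limit_def)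
    ultimately show "p \<in> cut_free_pairs" by (simp add: cut_free_pairs_def ab)
  qed
  then have "?p \<in> interior cut_free_pairs"
    using X Z by (intro interiorI[of "X \<inter> Z"]) auto
  then have "connected_component (interior cut_free_pairs) ?p ?p"
    by (simp add: connected_component_refl)
  then show ?thesis unfolding principal_region_def using xy by blast
qed

end

theory Submission
  imports Defs
begin

text \<open>
  With \<open>S = sqrt (x\<^sup>2 - 1)\<close>, Whipple's variable \<open>x / S\<close> turns the Legendre function into
  \<open>G x = S powr \<nu> * Legendre_P \<nu> (-\<mu>) (x / S)\<close>, a solution of
  \<open>(x\<^sup>2 - 1) G'' + (1 - 2\<nu>) x G' = (\<mu> + \<nu>) (\<mu> - \<nu>) G\<close>. For real arguments the integral becomes
  one of \<open>G (a b + sqrt (a\<^sup>2 - 1) sqrt (b\<^sup>2 - 1) t)\<close> over \<open>t > 1\<close> against a power weight. The differential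
  operator in \<open>a\<close> makes the integrand a total derivative in \<open>t\<close>, so the integral solves the same equation;
  among the solutions with the decay of \<open>G\<close> at infinity this leaves a multiple of \<open>G a\<close>, by symmetry a
  constant times \<open>G a G b\<close>, and the constant is a Beta integral, read off at infinity.

  If \<open>Re \<nu> < 0\<close> and \<open>Re (\<nu> + \<mu>) > -1\<close>, both sides are holomorphic in \<open>(z\<^sub>1, z\<^sub>2)\<close>, and the formula continues
  to the whole region. Convergence of the integral forces \<open>Re (\<nu> + \<mu>) > -1\<close>, and moreover \<open>Re \<nu> < 0\<close> unless
  the Legendre function has a (simple) zero at the upper limit, when \<open>Re \<nu> < 1\<close>. The exceptional case follows by
  continuation in \<open>\<nu>\<close> with \<open>\<nu> + \<mu>\<close> fixed, after subtracting the singular part of the integrand at the upper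
  limit. Negative integers \<open>\<mu>\<close>, for which the argument fails at the lower limit, are reduced to \<open>-\<mu>\<close>.
\<close>

section \<open>Integrals over the unit interval depending on a parameter\<close>

text \<open>The equation of \<open>G\<close> is Gegenbauer's with parameter \<open>-\<nu>\<close>,
  and \<open>a b + sqrt (a\<^sup>2 - 1) sqrt (b\<^sup>2 - 1) t\<close> is the variable of Gegenbauer
  product formulas. In it \<open>C - 1\<close> is a positive multiple of
  \<open>t\<^sup>2 - 1\<close>, which is what singles out Whipple's variable. Uniqueness is used at
  infinity because the integral and \<open>G\<close> are there the same power of \<open>x\<close>
  times power series in \<open>1 / x\<^sup>2\<close>, so that one coefficient decides. Two obstacles
  shape the rest. \<open>hyp2F1_reg\<close> is given only by a choice, so a continuation has to be
  exhibited, and it must be holomorphic in the parameters too, since the degree is varied later. And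
  convergence is a hypothesis on a gauge integral, which may converge without converging absolutely:
  the inequalities on \<nu> and \<mu> have to be extracted from it before dominated convergence is
  available. The Gamma factors come from the Beta integral \<open>Gamma (\<nu> + \<mu> + 1) * Gamma
  (-\<nu>) * rGamma (\<mu> + 1)\<close>, the sine from the reflection formula.\<close>

lemma beta_kernel_integrable:
  fixes a b :: real
  assumes "a > 0" "b > 0"
  shows "(\<lambda>t. t powr (a - 1) * (1 - t) powr (b - 1)) integrable_on {0<..<1}"
  using has_integral_Beta_real[OF assms] unfolding has_integral_Icc_iff_Ioo by (rule has_integral_integrable)

text \<open>All integrands below have algebraic singularities at both end points, hence beta kernels
  as majorants. The bound is only local in the parameter: \<open>M\<close>, \<open>a\<close> and
  \<open>b\<close> may depend on \<open>s\<close>, so the exponents of a family may come arbitrarily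
  close to the limit of integrability within \<open>S\<close>.\<close>

definition beta_dominated :: "'a::metric_space set \<Rightarrow> ('a \<Rightarrow> real \<Rightarrow> complex) \<Rightarrow> bool" where
  "beta_dominated S f \<longleftrightarrow>
     (\<forall>s\<in>S. f s \<in> borel_measurable (lebesgue_on {0<..<1})) \<and>
     (\<forall>s\<in>S. \<exists>e>0. \<exists>M. \<exists>a>0. \<exists>b>0. \<forall>s'\<in>S \<inter> ball s e. \<forall>t\<in>{0<..<1}.
        norm (f s' t) \<le> M * (t powr (a - 1) * (1 - t) powr (b - 1)))"

lemma beta_dominated_measurable:
  "beta_dominated S f \<Longrightarrow> s \<in> S \<Longrightarrow> f s \<in> borel_measurable (lebesgue_on {0<..<1})"
  by (simp add: beta_dominated_def)

lemma beta_dominatedE: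
  assumes "beta_dominated S f" "s \<in> S"
  obtains e h where "e > 0" "h integrable_on {0<..<1}"
    "\<forall>s'\<in>S. dist s s' < e \<longrightarrow> (\<forall>t\<in>{0<..<1}. norm (f s' t) \<le> h t)"
proof -
  obtain e M a b where *: "e > 0" "a > 0" "b > 0" "\<forall>s'\<in>S \<inter> ball s e. \<forall>t\<in>{0<..<1}.
      norm (f s' t) \<le> M * (t powr (a - 1) * (1 - t) powr (b - 1))"
    using assms unfolding beta_dominated_def by blast
  show ?thesis
  proof (rule that[of e "\<lambda>t. \<bar>M\<bar> * (t powr (a - 1) * (1 - t) powr (b - 1))"])
    show "(\<lambda>t. \<bar>M\<bar> * (t powr (a - 1) * (1 - t) powr (b - 1))) integrable_on {0<..<1}"
      by (intro integrable_on_mult_right beta_kernel_integrable *)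
    have "norm (f s' t) \<le> \<bar>M\<bar> * (t powr (a - 1) * (1 - t) powr (b - 1))"
      if "s' \<in> S" "dist s s' < e" "t \<in> {0<..<1::real}" for s' t
    proof -
      have "norm (f s' t) \<le> M * (t powr (a - 1) * (1 - t) powr (b - 1))" using *(4) that by simp
      also have "\<dots> \<le> \<bar>M\<bar> * (t powr (a - 1) * (1 - t) powr (b - 1))"
        by (intro mult_right_mono) auto
      finally show ?thesis .
    qed
    then show "\<forall>s'\<in>S. dist s s' < e \<longrightarrow> (\<forall>t\<in>{0<..<1}. norm (f s' t) \<le> \<bar>M\<bar> * (t powr (a - 1) * (1 - t) powr (b - 1)))"
      by blast
  qed (rule *(1))
qed

lemma beta_dominated_absolutely_integrable:
  assumes "beta_dominated S f" "s \<in> S"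
  shows "f s absolutely_integrable_on {0<..<1}"
proof -
  obtain e h where "e > 0" "h integrable_on {0<..<1}"
     "\<forall>s'\<in>S. dist s s' < e \<longrightarrow> (\<forall>t\<in>{0<..<1}. norm (f s' t) \<le> h t)"
    by (rule beta_dominatedE[OF assms])
  then show ?thesis
    using beta_dominated_measurable[OF assms] assms
    by (intro measurable_bounded_by_integrable_imp_absolutely_integrable[where g = h]) auto
qed

lemma beta_dominated_integrable:
  "beta_dominated S f \<Longrightarrow> s \<in> S \<Longrightarrow> f s integrable_on {0<..<1}"
  using beta_dominated_absolutely_integrable by (rule set_lebesgue_integral_eq_integral(1))

lemma beta_dominated_continuous:
  fixes f :: "'a::metric_space \<Rightarrow> real \<Rightarrow> complex"
  assumes dom: "beta_dominated S f" and cont: "\<And>t. t \<in> {0<..<1} \<Longrightarrow> continuous_on S (\<lambda>s. f s t)"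
  shows "continuous_on S (\<lambda>s. integral {0<..<1} (f s))"
  unfolding continuous_on_sequentially
proof (intro allI ballI impI, elim conjE)
  fix x and s assume s: "s \<in> S" "\<forall>n. x n \<in> S" "x \<longlonglongrightarrow> s"
  obtain e h where h: "e > 0" "h integrable_on {0<..<1}"
     "\<forall>s'\<in>S. dist s s' < e \<longrightarrow> (\<forall>t\<in>{0<..<1}. norm (f s' t) \<le> h t)"
    by (rule beta_dominatedE[OF dom s(1)])
  obtain N where N: "\<And>n. n \<ge> N \<Longrightarrow> dist s (x n) < e"
    using metric_LIMSEQ_D[OF s(3) h(1)] by (auto simp: dist_commute)
  have "(\<lambda>n. integral {0<..<1} (f (x (n + N)))) \<longlonglongrightarrow> integral {0<..<1} (f s)"
  proof (rule dominated_convergence(2)[where h = h])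
    show "f (x (n + N)) integrable_on {0<..<1}" for n
      using beta_dominated_integrable[OF dom] s by blast
    show "norm (f (x (n + N)) t) \<le> h t" if "t \<in> {0<..<1}" for n t
      using h(3) s(2) N that by simp
    show "(\<lambda>n. f (x (n + N)) t) \<longlonglongrightarrow> f s t" if "t \<in> {0<..<1}" for t
    proof -
      have "(\<lambda>n. f (x n) t) \<longlonglongrightarrow> f s t"
        using cont[OF that] s unfolding continuous_on_sequentially by (auto simp: o_def)
      then show ?thesis by (rule LIMSEQ_ignore_initial_segment)
    qed
  qed (rule h)
  then show "((\<lambda>s. integral {0<..<1} (f s)) \<circ> x) \<longlonglongrightarrow> integral {0<..<1} (f s)"
    unfolding o_def by (rule LIMSEQ_offset)
qed

text \<open>Cauchy's estimate on the circle of radius \<open>e / 4\<close> about \<open>w\<close>,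
  which stays in \<open>ball s e\<close> because \<open>e / 2 + e / 4 < e\<close>.\<close>

lemma holomorphic_deriv_bound:
  assumes hol: "g holomorphic_on ball s e" and b: "\<And>z. z \<in> ball s e \<Longrightarrow> norm (g z) \<le> B"
    and w: "w \<in> ball s (e / 2)"
  shows "norm (deriv g w) \<le> B / (e / 4)"
proof -
  have e: "e > 0" using w zero_le_dist[of s w] unfolding mem_ball by linarith
  have sub: "cball w (e / 4) \<subseteq> ball s e"
  proof
    fix z assume "z \<in> cball w (e / 4)"
    then have "dist s z \<le> dist s w + dist w z" "dist w z \<le> e / 4" by (auto simp: dist_triangle)
    then show "z \<in> ball s e" using w e by simp
  qed
  have "norm ((deriv ^^ 1) g w) \<le> fact 1 * B / (e / 4) ^ 1"
  proof (rule Cauchy_inequality)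
    show "g holomorphic_on ball w (e / 4)" "continuous_on (cball w (e / 4)) g"
      using hol sub ball_subset_cball[of w "e / 4"]
      by (blast intro: holomorphic_on_imp_continuous_on holomorphic_on_subset subset_trans)+
    show "norm (g x) \<le> B" if "norm (w - x) = e / 4" for x
      using that sub by (intro b) (auto simp: dist_norm)
  qed (use e in auto)
  then show ?thesis by simp
qed

text \<open>Cauchy's estimate turns the bound on the family into one on its derivative, with the
  same beta kernel and a larger constant. So domination passes on to derivatives of every order,
  which the two differentiations in the differential equation below rely on.\<close>

lemma
  fixes f :: "complex \<Rightarrow> real \<Rightarrow> complex"
  assumes dom: "beta_dominated S f" and S: "open S"
    and hol: "\<And>t. t \<in> {0<..<1} \<Longrightarrow> (\<lambda>s. f s t) holomorphic_on S"
  shows beta_dominated_deriv: "beta_dominated S (\<lambda>s t. deriv (\<lambda>z. f z t) s)"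
    and beta_dominated_has_field_derivative: "s \<in> S \<Longrightarrow> ((\<lambda>s. integral {0<..<1} (f s)) has_field_derivative
           integral {0<..<1} (\<lambda>t. deriv (\<lambda>z. f z t) s)) (at s)"
proof -
  have der: "((\<lambda>z. f z t) has_field_derivative deriv (\<lambda>z. f z t) s) (at s)"
    if "s \<in> S" "t \<in> {0<..<1}" for s t
    using hol[OF that(2)] S that(1) by (rule holomorphic_derivI)
  have quot: "(\<lambda>n. (f (x n) t - f s t) / (x n - s)) \<longlonglongrightarrow> deriv (\<lambda>z. f z t) s"
    if "s \<in> S" "t \<in> {0<..<1}" "x \<longlonglongrightarrow> s" "\<And>n. x n \<noteq> s" for s t x
  proof -
    have "filterlim x (at s) sequentially" using that by (auto simp: filterlim_at)
    with der[OF that(1,2)] show ?thesis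
      unfolding has_field_derivative_iff by (rule filterlim_compose)
  qed
  show D: "beta_dominated S (\<lambda>s t. deriv (\<lambda>z. f z t) s)"
    unfolding beta_dominated_def
  proof (intro conjI ballI)
    fix s assume s: "s \<in> S"
    obtain r where r: "r > 0" "cball s r \<subseteq> S" using S s open_contains_cball by blast
    \<comment> \<open>A sequence in \<open>S\<close> avoiding \<open>s\<close>: the derivative is
      the pointwise limit of difference quotients along it, and thereby measurable in
      \<open>t\<close>.\<close>
    define x where "x = (\<lambda>n. s + of_real (r / (real n + 1)))"
    have xl: "x \<longlonglongrightarrow> s"
    proof -
      have "(\<lambda>n. r / (real n + 1)) \<longlonglongrightarrow> 0" by real_asymp
      then have "(\<lambda>n. s + complex_of_real (r / (real n + 1))) \<longlonglongrightarrow> s + of_real 0"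
        by (intro tendsto_intros)
      then show ?thesis by (simp add: x_def)
    qed
    have xS: "x n \<in> S" and xs: "x n \<noteq> s" for n
    proof -
      have "r / (real n + 1) \<le> r" "r / (real n + 1) > 0" using r by (auto simp: field_simps)
      then show "x n \<in> S" "x n \<noteq> s" using r by (auto simp: x_def dist_norm intro!: subsetD[OF r(2)] simp del: of_real_divide)
    qed
    show "(\<lambda>t. deriv (\<lambda>z. f z t) s) \<in> borel_measurable (lebesgue_on {0<..<1})"
    proof (rule borel_measurable_LIMSEQ_metric)
      show "(\<lambda>t. (f (x n) t - f s t) / (x n - s)) \<in> borel_measurable (lebesgue_on {0<..<1})" for n
        using beta_dominated_measurable[OF dom xS] beta_dominated_measurable[OF dom s]
        by (intro borel_measurable_divide borel_measurable_diff) auto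
      show "(\<lambda>n. (f (x n) t - f s t) / (x n - s)) \<longlonglongrightarrow> deriv (\<lambda>z. f z t) s"
        if "t \<in> space (lebesgue_on {0<..<1})" for t
        using quot[OF s _ xl xs] that by simp
    qed
  next
    fix s assume s: "s \<in> S"
    obtain e M a b where *: "e > 0" "a > 0" "b > 0" "\<forall>s'\<in>S \<inter> ball s e. \<forall>t\<in>{0<..<1}.
        norm (f s' t) \<le> M * (t powr (a - 1) * (1 - t) powr (b - 1))"
      using dom s unfolding beta_dominated_def by meson
    obtain r where r: "r > 0" "ball s r \<subseteq> S" using S s openE by blast
    define d where "d = min r e"
    have d: "d > 0" "ball s d \<subseteq> S" "ball s d \<subseteq> ball s e" using r * by (auto simp: d_def)
    have "norm (deriv (\<lambda>z. f z t) s') \<le> M / (d / 4) * (t powr (a - 1) * (1 - t) powr (b - 1))"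
      if "s' \<in> S \<inter> ball s (d / 2)" "t \<in> {0<..<1}" for s' t
    proof -
      have "norm (deriv (\<lambda>z. f z t) s') \<le> (M * (t powr (a - 1) * (1 - t) powr (b - 1))) / (d / 4)"
      proof (rule holomorphic_deriv_bound[where s = s])
        show "(\<lambda>z. f z t) holomorphic_on ball s d" by (rule holomorphic_on_subset[OF hol[OF that(2)] d(2)])
        show "norm (f z t) \<le> M * (t powr (a - 1) * (1 - t) powr (b - 1))" if "z \<in> ball s d" for z
          using *(4) d(2,3) that \<open>t \<in> {0<..<1}\<close> by blast
      qed (use that in auto)
      then show ?thesis by (simp add: mult_ac)
    qed
    then show "\<exists>e>0. \<exists>M. \<exists>a>0. \<exists>b>0. \<forall>s'\<in>S \<inter> ball s e. \<forall>t\<in>{0<..<1}.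
        norm (deriv (\<lambda>z. f z t) s') \<le> M * (t powr (a - 1) * (1 - t) powr (b - 1))"
      using d * by (intro exI[of _ "d/2"] exI[of _ "M / (d/4)"] exI[of _ a] exI[of _ b] conjI) auto
  qed
  assume s: "s \<in> S"
  let ?F = "\<lambda>s. integral {0<..<1} (f s)"
  obtain e h where h: "e > 0" "h integrable_on {0<..<1}"
     "\<forall>s'\<in>S. dist s s' < e \<longrightarrow> (\<forall>t\<in>{0<..<1}. norm (deriv (\<lambda>z. f z t) s') \<le> h t)"
    by (rule beta_dominatedE[OF D s])
  obtain r where r: "r > 0" "ball s r \<subseteq> S" using S s openE by blast
  define d where "d = min r e"
  have d: "d > 0" "ball s d \<subseteq> S" "d \<le> e" using r h by (auto simp: d_def)
  have lip: "norm (f s' t - f s t) \<le> h t * norm (s' - s)" if "s' \<in> ball s d" "t \<in> {0<..<1}" for s' t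
  proof (rule field_differentiable_bound[where S = "ball s d" and f' = "deriv (\<lambda>z. f z t)"])
    fix z assume z: "z \<in> ball s d"
    show "((\<lambda>z. f z t) has_field_derivative deriv (\<lambda>z. f z t) z) (at z within ball s d)"
      by (rule has_field_derivative_at_within, rule der) (use z that d in auto)
    show "norm (deriv (\<lambda>z. f z t) z) \<le> h t" using h z d that by auto
  qed (use that d in auto)
  show "(?F has_field_derivative integral {0<..<1} (\<lambda>t. deriv (\<lambda>z. f z t) s)) (at s)"
    unfolding has_field_derivative_iff tendsto_at_iff_sequentially
  proof (intro allI impI)
    fix x assume x: "\<forall>i. x i \<in> UNIV - {s}" "x \<longlonglongrightarrow> s"
    obtain N where N: "\<And>n. n \<ge> N \<Longrightarrow> dist s (x n) < d"
      using metric_LIMSEQ_D[OF x(2) d(1)] by (auto simp: dist_commute)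
    have xS: "x (n + N) \<in> S" for n using N d(2) by auto
    have "(\<lambda>n. integral {0<..<1} (\<lambda>t. (f (x (n + N)) t - f s t) / (x (n + N) - s)))
        \<longlonglongrightarrow> integral {0<..<1} (\<lambda>t. deriv (\<lambda>z. f z t) s)"
    proof (rule dominated_convergence(2)[where h = h])
      show "(\<lambda>t. (f (x (n + N)) t - f s t) / (x (n + N) - s)) integrable_on {0<..<1}" for n
        by (intro integrable_on_divide integrable_diff beta_dominated_integrable[OF dom] xS s)
      show "norm ((f (x (n + N)) t - f s t) / (x (n + N) - s)) \<le> h t" if "t \<in> {0<..<1}" for n t
        using lip[of "x (n + N)" t] N[of "n + N"] that x(1) by (simp add: norm_divide divide_le_eq)
      show "(\<lambda>n. (f (x (n + N)) t - f s t) / (x (n + N) - s)) \<longlonglongrightarrow> deriv (\<lambda>z. f z t) s"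
        if "t \<in> {0<..<1}" for t
        by (rule quot[OF s that]) (use x in \<open>auto intro: LIMSEQ_ignore_initial_segment\<close>)
    qed (rule h)
    also have "(\<lambda>n. integral {0<..<1} (\<lambda>t. (f (x (n + N)) t - f s t) / (x (n + N) - s)))
       = (\<lambda>n. (?F (x (n + N)) - ?F s) / (x (n + N) - s))"
      by (simp add: integral_diff beta_dominated_integrable[OF dom] xS s)
    finally show "((\<lambda>y. (?F y - ?F s) / (y - s)) \<circ> x) \<longlonglongrightarrow> integral {0<..<1} (\<lambda>t. deriv (\<lambda>z. f z t) s)"
      unfolding o_def by (rule LIMSEQ_offset)
  qed
qed

lemma beta_dominated_holomorphic:
  fixes f :: "complex \<Rightarrow> real \<Rightarrow> complex"
  assumes "beta_dominated S f" "open S" "\<And>t. t \<in> {0<..<1} \<Longrightarrow> (\<lambda>s. f s t) holomorphic_on S"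
  shows "(\<lambda>s. integral {0<..<1} (f s)) holomorphic_on S"
  using beta_dominated_has_field_derivative[OF assms] assms(2) by (auto simp: holomorphic_on_open)

text \<open>\<open>S\<close> is an arbitrary metric set, so compactness is available only in the
  second variable: if parameters tending to \<open>s\<close> had values growing beyond all bounds,
  the points of \<open>K\<close> would converge along a subsequence, against continuity at the
  limit.\<close>

lemma continuous_on_locally_bounded:
  fixes g :: "'a::metric_space \<times> 'b::metric_space \<Rightarrow> 'c::real_normed_vector"
  assumes cont: "continuous_on (S \<times> K) g" and K: "compact K" and s: "s \<in> S"
  shows "\<exists>e>0. \<exists>M. \<forall>s'\<in>S. dist s s' < e \<longrightarrow> (\<forall>t\<in>K. norm (g (s', t)) \<le> M)"
proof (rule ccontr)
  assume not: "\<not> ?thesis"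
  have "\<exists>s' t. s' \<in> S \<and> dist s s' < 1 / (real n + 1) \<and> t \<in> K \<and> norm (g (s', t)) > real n" for n
  proof -
    have "1 / (real n + 1) > 0" by simp
    with not have "\<not> (\<forall>s'\<in>S. dist s s' < 1 / (real n + 1) \<longrightarrow> (\<forall>t\<in>K. norm (g (s', t)) \<le> real n))" by blast
    then show ?thesis by (meson not_le)
  qed
  then obtain x y where xy: "\<And>n. x n \<in> S" "\<And>n. dist s (x n) < 1 / (real n + 1)" "\<And>n. y n \<in> K"
      "\<And>n. norm (g (x n, y n)) > real n"
    by metis
  obtain l r where lr: "l \<in> K" "strict_mono r" "(y \<circ> r) \<longlonglongrightarrow> l"
    using K xy(3) unfolding compact_def by meson
  have "x \<longlonglongrightarrow> s"
  proof (rule metric_LIMSEQ_I)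
    fix e :: real assume "e > 0"
    then obtain N where N: "1 / (real N + 1) < e"
      using reals_Archimedean by (metis inverse_eq_divide of_nat_Suc add.commute)
    have "dist (x n) s < e" if "n \<ge> N" for n
    proof -
      have "1 / (real n + 1) \<le> 1 / (real N + 1)" using that by (intro divide_left_mono) auto
      then show ?thesis using xy(2)[of n] N by (simp add: dist_commute)
    qed
    then show "\<exists>N. \<forall>n\<ge>N. dist (x n) s < e" by blast
  qed
  then have xr: "(x \<circ> r) \<longlonglongrightarrow> s" using lr(2) by (rule LIMSEQ_subseq_LIMSEQ)
  have "(\<lambda>n. (x (r n), y (r n))) \<longlonglongrightarrow> (s, l)" using xr lr(3) by (auto simp: o_def intro: tendsto_Pair)
  moreover have "\<forall>n. (x (r n), y (r n)) \<in> S \<times> K" using xy by auto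
  ultimately have "(\<lambda>n. g (x (r n), y (r n))) \<longlonglongrightarrow> g (s, l)"
    using cont s lr(1) unfolding continuous_on_sequentially by (auto simp: o_def)
  then have "Bseq (\<lambda>n. g (x (r n), y (r n)))" by (intro convergent_imp_Bseq convergentI)
  then obtain B where B: "\<And>n. norm (g (x (r n), y (r n))) \<le> B" unfolding Bseq_def by blast
  obtain n where "real n > B" using reals_Archimedean2 by blast
  moreover have "real (r n) \<ge> real n" using lr(2) by (simp add: seq_suble)
  ultimately show False using xy(4)[of "r n"] B[of n] by linarith
qed

lemma norm_of_real_powr: "t > 0 \<Longrightarrow> norm (complex_of_real t powr z) = t powr Re z"
  by (simp add: norm_powr_real_powr)

lemma beta_dominatedI:
  fixes A B :: "'a::metric_space \<Rightarrow> complex"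
  assumes A: "continuous_on S A" "\<And>s. s \<in> S \<Longrightarrow> Re (A s) > 0"
    and B: "continuous_on S B" "\<And>s. s \<in> S \<Longrightarrow> Re (B s) > 0"
    and meas: "\<And>s. s \<in> S \<Longrightarrow> continuous_on {0<..<1} (\<phi> s)"
    and bnd: "\<And>s. s \<in> S \<Longrightarrow> \<exists>e>0. \<exists>M. \<forall>s'\<in>S. dist s s' < e \<longrightarrow> (\<forall>t\<in>{0<..<1}. norm (\<phi> s' t) \<le> M)"
  shows "beta_dominated S (\<lambda>s t. of_real t powr (A s - 1) * of_real (1 - t) powr (B s - 1) * \<phi> s t)"
  unfolding beta_dominated_def
proof (intro conjI ballI)
  fix s assume s: "s \<in> S"
  have "continuous_on {0<..<1} (\<lambda>t. complex_of_real t powr (A s - 1) * of_real (1 - t) powr (B s - 1) * \<phi> s t)"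
    by (intro continuous_intros meas s) (auto simp: complex_nonpos_Reals_iff)
  then show "(\<lambda>t. of_real t powr (A s - 1) * of_real (1 - t) powr (B s - 1) * \<phi> s t)
      \<in> borel_measurable (lebesgue_on {0<..<1})"
    by (rule continuous_imp_measurable_on_sets_lebesgue) auto
next
  fix s assume s: "s \<in> S"
  obtain e1 M where e1: "e1 > 0" "\<forall>s'\<in>S. dist s s' < e1 \<longrightarrow> (\<forall>t\<in>{0<..<1}. norm (\<phi> s' t) \<le> M)"
    using bnd[OF s] by blast
  \<comment> \<open>Near \<open>s\<close> each exponent keeps more than half of its positive real
    part, and on the unit interval lowering the exponent enlarges the power.\<close>
  have half: "\<exists>e>0. \<forall>s'\<in>S. dist s s' < e \<longrightarrow> Re (C s') > Re (C s) / 2"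
    if Cc: "continuous_on S C" and Cpos: "\<And>s. s \<in> S \<Longrightarrow> Re (C s) > 0" for C :: "'a \<Rightarrow> complex"
  proof -
    have "continuous_on S (\<lambda>s. Re (C s))" by (intro continuous_intros Cc)
    then obtain e where e: "e > 0" "\<forall>s'\<in>S. dist s' s < e \<longrightarrow> dist (Re (C s')) (Re (C s)) < Re (C s) / 2"
      using s Cpos[OF s] unfolding continuous_on_iff by (meson half_gt_zero)
    have "Re (C s') > Re (C s) / 2" if s': "s' \<in> S" "dist s s' < e" for s'
    proof -
      have "\<bar>Re (C s') - Re (C s)\<bar> < Re (C s) / 2" using e s' by (auto simp: dist_commute dist_real_def)
      then show ?thesis by linarith
    qed
    then show ?thesis using e(1) by blast
  qed
  obtain e2 where e2: "e2 > 0" "\<forall>s'\<in>S. dist s s' < e2 \<longrightarrow> Re (A s') > Re (A s) / 2" using half[OF A] by blast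
  obtain e3 where e3: "e3 > 0" "\<forall>s'\<in>S. dist s s' < e3 \<longrightarrow> Re (B s') > Re (B s) / 2" using half[OF B] by blast
  have "norm (complex_of_real t powr (A s' - 1) * of_real (1 - t) powr (B s' - 1) * \<phi> s' t)
      \<le> M * (t powr (Re (A s) / 2 - 1) * (1 - t) powr (Re (B s) / 2 - 1))"
    if s': "s' \<in> S \<inter> ball s (min e1 (min e2 e3))" and t: "t \<in> {0<..<1}" for s' t
  proof -
    have 1: "norm (complex_of_real t powr (A s' - 1)) \<le> t powr (Re (A s) / 2 - 1)"
      using t s' e2 by (subst norm_of_real_powr) (auto intro!: powr_mono')
    have 2: "norm (complex_of_real (1 - t) powr (B s' - 1)) \<le> (1 - t) powr (Re (B s) / 2 - 1)"
      using t s' e3 by (subst norm_of_real_powr) (auto intro!: powr_mono')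
    have 3: "norm (\<phi> s' t) \<le> M" using s' t e1 by auto
    have "norm (complex_of_real t powr (A s' - 1)) * norm (complex_of_real (1 - t) powr (B s' - 1)) * norm (\<phi> s' t)
       \<le> (t powr (Re (A s) / 2 - 1) * (1 - t) powr (Re (B s) / 2 - 1)) * M"
      by (intro mult_mono 1 2 3) (auto intro: order_trans[OF norm_ge_zero 3])
    then show ?thesis by (simp add: norm_mult mult_ac)
  qed
  then show "\<exists>e>0. \<exists>M. \<exists>a>0. \<exists>b>0. \<forall>s'\<in>S \<inter> ball s e. \<forall>t\<in>{0<..<1}.
      norm (complex_of_real t powr (A s' - 1) * of_real (1 - t) powr (B s' - 1) * \<phi> s' t)
      \<le> M * (t powr (a - 1) * (1 - t) powr (b - 1))"
    using e1 e2 e3 A(2)[OF s] B(2)[OF s]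
    by (intro exI[of _ "min e1 (min e2 e3)"] exI[of _ M] exI[of _ "Re (A s) / 2"] exI[of _ "Re (B s) / 2"] conjI)
      auto
qed

lemma beta_dominatedI_compact:
  fixes A B :: "'a::metric_space \<Rightarrow> complex"
  assumes "continuous_on S A" "\<And>s. s \<in> S \<Longrightarrow> Re (A s) > 0"
    and "continuous_on S B" "\<And>s. s \<in> S \<Longrightarrow> Re (B s) > 0"
    and cont: "continuous_on (S \<times> {0..1}) (\<lambda>(s, t). \<phi> s t)"
  shows "beta_dominated S (\<lambda>s t. of_real t powr (A s - 1) * of_real (1 - t) powr (B s - 1) * \<phi> s t)"
proof (rule beta_dominatedI[OF assms(1-4)])
  fix s assume s: "s \<in> S"
  have "continuous_on {0<..<1} (\<lambda>t. case (s, t) of (s, t) \<Rightarrow> \<phi> s t)"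
    by (rule continuous_on_compose2[OF cont]) (use s in \<open>auto intro!: continuous_intros\<close>)
  then show "continuous_on {0<..<1} (\<phi> s)" by simp
  show "\<exists>e>0. \<exists>M. \<forall>s'\<in>S. dist s s' < e \<longrightarrow> (\<forall>t\<in>{0<..<1}. norm (\<phi> s' t) \<le> M)"
  proof -
    obtain e M where e: "e > 0" "\<forall>s'\<in>S. dist s s' < e \<longrightarrow> (\<forall>t\<in>{0..1}. norm (\<phi> s' t) \<le> M)"
      using continuous_on_locally_bounded[OF cont compact_Icc s] unfolding prod.case by blast
    have "t \<in> {0..1}" if "t \<in> {0<..<1}" for t :: real using that by simp
    with e show ?thesis by blast
  qed
qed

section \<open>The Beta integral with complex exponents\<close>

lemma open_halfplane_Re: "open {z. Re z > c}"
  using open_halfspace_Re_gt[of c] by simp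

lemma of_real_powr_holomorphic:
  assumes "t > 0" "A holomorphic_on S"
  shows "(\<lambda>s. complex_of_real t powr A s) holomorphic_on S"
  unfolding powr_def using assms by (auto intro!: holomorphic_intros)

lemma analytic_identity_positive_reals:
  assumes "F holomorphic_on {z. Re z > 0}" "G holomorphic_on {z. Re z > 0}"
    and eq: "\<And>x::real. x > 0 \<Longrightarrow> F (of_real x) = G (of_real x)" and "Re z > 0"
  shows "F z = G z"
proof -
  have "F z - G z = 0"
  proof (rule analytic_continuation[where f = "\<lambda>z. F z - G z" and S = "{z. Re z > 0}" and U = "of_real ` {0<..<2::real}" and \<xi> = 1])
    show "(1::complex) islimpt of_real ` {0<..<2::real}"
    proof -
      have "(1::real) islimpt {0<..<2}" by (simp add: islimpt_greaterThanLessThan1 open_imp_islimpt interior_limit_point)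
      then show ?thesis using islimpt_isCont_image[of 1 "{0<..<2::real}" complex_of_real]
        by (auto simp: eventually_at_filter intro!: always_eventually)
    qed
    show "connected {z::complex. Re z > 0}" by (intro convex_connected convex_halfspace_Re_gt)
    show "(\<lambda>z. F z - G z) holomorphic_on {z. Re z > 0}" by (intro holomorphic_intros assms)
    show "F w - G w = 0" if "w \<in> of_real ` {0<..<2}" for w using that eq by auto
  qed (use \<open>Re z > 0\<close> in \<open>auto intro: open_halfplane_Re\<close>)
  then show ?thesis by simp
qed

text \<open>Both sides are holomorphic in each exponent on the right half-plane. The formula for
  real exponents therefore continues first in \<open>a\<close> with \<open>b\<close> real, then in
  \<open>b\<close> with \<open>a\<close> complex.\<close>

lemma complex_Beta_integral:
  assumes "Re a > 0" "Re b > 0"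
  shows "((\<lambda>t. of_real t powr (a - 1) * of_real (1 - t) powr (b - 1)) has_integral
           Gamma a * Gamma b * rGamma (a + b)) {0<..<1}"
proof -
  define I where "I = (\<lambda>a b. integral {0<..<1} (\<lambda>t. complex_of_real t powr (a - 1) * of_real (1 - t) powr (b - 1)))"
  have d1: "beta_dominated {a. Re a > 0} (\<lambda>a t. of_real t powr (a - 1) * of_real (1 - t) powr (b - 1))"
    if "Re b > 0" for b
  proof -
    have "beta_dominated {a. Re a > 0} (\<lambda>a t. of_real t powr (a - 1) * of_real (1 - t) powr (b - 1) * 1)"
      by (rule beta_dominatedI_compact[where A = "\<lambda>a. a" and B = "\<lambda>_. b" and \<phi> = "\<lambda>_ _. 1"])
        (use that in auto)
    then show ?thesis unfolding mult_1_right .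
  qed
  have d2: "beta_dominated {b. Re b > 0} (\<lambda>b t. of_real t powr (a - 1) * of_real (1 - t) powr (b - 1))"
    if "Re a > 0" for a
  proof -
    have "beta_dominated {b. Re b > 0} (\<lambda>b t. of_real t powr (a - 1) * of_real (1 - t) powr (b - 1) * 1)"
      by (rule beta_dominatedI_compact[where A = "\<lambda>_. a" and B = "\<lambda>b. b" and \<phi> = "\<lambda>_ _. 1"])
        (use that in auto)
    then show ?thesis unfolding mult_1_right .
  qed
  have h1: "(\<lambda>a. I a b) holomorphic_on {a. Re a > 0}" if "Re b > 0" for b
    unfolding I_def
    by (rule beta_dominated_holomorphic[OF d1[OF that] open_halfplane_Re], intro holomorphic_on_mult
        of_real_powr_holomorphic holomorphic_on_diff holomorphic_on_ident holomorphic_on_const) auto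
  have h2: "(\<lambda>b. I a b) holomorphic_on {b. Re b > 0}" if "Re a > 0" for a
    unfolding I_def
    by (rule beta_dominated_holomorphic[OF d2[OF that] open_halfplane_Re], intro holomorphic_on_mult
        of_real_powr_holomorphic holomorphic_on_diff holomorphic_on_ident holomorphic_on_const) auto
  have npi: "z \<notin> \<int>\<^sub>\<le>\<^sub>0" if "Re z > 0" for z using that by (auto elim!: nonpos_Ints_cases)
  have real: "I (of_real x) (of_real y) = Gamma (of_real x) * Gamma (of_real y) * rGamma (of_real x + of_real y)"
    if "x > 0" "y > 0" for x y
  proof -
    have "((\<lambda>t. t powr (x - 1) * (1 - t) powr (y - 1)) has_integral Beta x y) {0<..<1}"
      using has_integral_Beta_real[OF that] by (simp add: has_integral_Icc_iff_Ioo)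
    then have "((\<lambda>t. complex_of_real (t powr (x - 1) * (1 - t) powr (y - 1))) has_integral of_real (Beta x y)) {0<..<1}"
      by (rule has_integral_of_real)
    also have "?this \<longleftrightarrow> ((\<lambda>t. complex_of_real t powr (of_real x - 1) * of_real (1 - t) powr (of_real y - 1))
        has_integral of_real (Beta x y)) {0<..<1}"
    proof (rule has_integral_cong)
      fix t :: real assume t: "t \<in> {0<..<1}"
      show "complex_of_real (t powr (x - 1) * (1 - t) powr (y - 1)) =
        of_real t powr (of_real x - 1) * of_real (1 - t) powr (of_real y - 1)"
        using powr_of_real[of t "x - 1"] powr_of_real[of "1 - t" "y - 1"] t by simp
    qed
    finally have "I (of_real x) (of_real y) = of_real (Beta x y)"
      unfolding I_def by (rule integral_unique)
    also have "\<dots> = Gamma (of_real x) * Gamma (of_real y) * rGamma (of_real x + of_real y)"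
      unfolding Beta_altdef by (simp add: Gamma_complex_of_real rGamma_complex_of_real flip: of_real_add)
    finally show ?thesis .
  qed
  have 1: "I a (of_real y) = Gamma a * Gamma (of_real y) * rGamma (a + of_real y)"
    if y: "y > 0" and a: "Re a > 0" for y a
  proof (rule analytic_identity_positive_reals[where F = "\<lambda>a. I a (of_real y)" and z = a
      and G = "\<lambda>a. Gamma a * Gamma (of_real y) * rGamma (a + of_real y)"])
    show "(\<lambda>a. Gamma a * Gamma (of_real y) * rGamma (a + of_real y)) holomorphic_on {z. 0 < Re z}"
      using npi by (intro holomorphic_intros) blast
    show "(\<lambda>a. I a (of_real y)) holomorphic_on {z. 0 < Re z}" using h1 y by simp
  qed (use real y a in auto)
  have "I a b = Gamma a * Gamma b * rGamma (a + b)"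
  proof (rule analytic_identity_positive_reals[where F = "\<lambda>b. I a b" and z = b
      and G = "\<lambda>b. Gamma a * Gamma b * rGamma (a + b)"])
    show "(\<lambda>b. Gamma a * Gamma b * rGamma (a + b)) holomorphic_on {z. 0 < Re z}"
      using npi by (intro holomorphic_intros) blast
    show "(\<lambda>b. I a b) holomorphic_on {z. 0 < Re z}" using h2 assms by simp
  qed (use 1 assms in auto)
  moreover have "(\<lambda>t. of_real t powr (a - 1) * of_real (1 - t) powr (b - 1)) integrable_on {0<..<1}"
    by (rule beta_dominated_integrable[OF d1[OF assms(2)]]) (use assms in simp)
  ultimately show ?thesis unfolding I_def has_integral_iff by blast
qed

section \<open>The regularized hypergeometric function\<close>

definition slit_plane :: "complex set" where
  "slit_plane = - (complex_of_real ` {(1::real)..})"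

lemma mem_slit_plane_iff: "x \<in> slit_plane \<longleftrightarrow> 1 - x \<notin> \<real>\<^sub>\<le>\<^sub>0"
proof -
  have "x \<in> of_real ` {(1::real)..} \<longleftrightarrow> 1 - x \<in> \<real>\<^sub>\<le>\<^sub>0"
  proof
    assume "1 - x \<in> \<real>\<^sub>\<le>\<^sub>0"
    then have "x = of_real (Re x)" "Re x \<ge> 1" by (auto simp: complex_nonpos_Reals_iff complex_eq_iff)
    then show "x \<in> of_real ` {(1::real)..}" by blast
  qed (auto simp: complex_nonpos_Reals_iff)
  then show ?thesis by (simp add: slit_plane_def)
qed

text \<open>The slit plane is star-shaped about 0. This keeps \<open>1 - t x\<close>, the base of
  the power in Euler's integral, off the branch cut on the whole range of integration, and it also
  yields connectedness.\<close>

lemma slit_plane_scale: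
  assumes "x \<in> slit_plane" "t \<in> {0..1}"
  shows "1 - of_real t * x \<notin> \<real>\<^sub>\<le>\<^sub>0"
proof
  assume *: "1 - of_real t * x \<in> \<real>\<^sub>\<le>\<^sub>0"
  then have t: "t * Re x \<ge> 1" "t * Im x = 0" by (auto simp: complex_nonpos_Reals_iff)
  then have "t \<noteq> 0" by auto
  with t assms(2) have "Im x = 0" "t > 0" by auto
  moreover have "Re x \<ge> 1"
  proof (rule ccontr)
    assume "\<not> Re x \<ge> 1"
    then have "t * Re x < t * 1" using \<open>t > 0\<close> by (intro mult_strict_left_mono) auto
    then show False using t assms(2) by simp
  qed
  ultimately show False using assms(1) by (simp add: mem_slit_plane_iff complex_nonpos_Reals_iff)
qed

lemma open_slit_plane: "open slit_plane"
proof -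
  have "closed (of_real ` {(1::real)..} :: complex set)"
    by (intro closed_injective_linear_image linear_of_real) (auto intro: injI)
  then show ?thesis unfolding slit_plane_def by (rule open_Compl)
qed

lemma connected_slit_plane: "connected slit_plane"
proof (rule starlike_imp_connected)
  show "starlike slit_plane"
    unfolding starlike_def
  proof (intro bexI[of _ 0] ballI subsetI)
    fix x y assume x: "x \<in> slit_plane" and "y \<in> closed_segment 0 x"
    then obtain t where "t \<in> {0..1}" "y = of_real t * x" by (auto simp: in_segment scaleR_conv_of_real)
    then show "y \<in> slit_plane" using slit_plane_scale[OF x] by (simp add: mem_slit_plane_iff)
  qed (simp add: mem_slit_plane_iff complex_nonpos_Reals_iff)
qed

lemma unit_ball_subset_slit_plane: "ball 0 1 \<subseteq> slit_plane"
proof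
  fix x :: complex assume "x \<in> ball 0 1"
  then have "\<bar>Re x\<bar> < 1" using abs_Re_le_cmod[of x] by simp
  then show "x \<in> slit_plane" by (simp add: mem_slit_plane_iff complex_nonpos_Reals_iff)
qed

lemma zero_in_slit_plane: "0 \<in> slit_plane"
  using unit_ball_subset_slit_plane by auto

section \<open>Euler's integral\<close>

lemma continuous_on_cpowr:
  assumes "continuous_on S f" "continuous_on S g" "\<And>s. s \<in> S \<Longrightarrow> f s \<notin> \<real>\<^sub>\<le>\<^sub>0"
  shows "continuous_on S (\<lambda>s. f s powr (g s :: complex))"
proof -
  have "continuous_on S (\<lambda>s. exp (g s * Ln (f s)))"
    by (intro continuous_intros assms)
  also have "?this \<longleftrightarrow> ?thesis"
    by (intro continuous_on_cong) (use assms(3) in \<open>force simp: powr_def\<close>)+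
  finally show ?thesis .
qed

definition euler_integral :: "complex \<Rightarrow> complex \<Rightarrow> complex \<Rightarrow> complex \<Rightarrow> complex" where
  "euler_integral a b c x = integral {0<..<1}
     (\<lambda>t. of_real t powr (b - 1) * of_real (1 - t) powr (c - b - 1) * (1 - of_real t * x) powr (-a))"

text \<open>Parameters and argument are arbitrary continuous functions on a metric space, so that
  one bound serves regularity in \<open>x\<close> as well as in the three parameters; the latter is
  needed when degree and order are varied.\<close>

lemma euler_dominated:
  fixes \<alpha> \<beta> \<gamma> \<xi> :: "'a::metric_space \<Rightarrow> complex"
  assumes c: "continuous_on S \<alpha>" "continuous_on S \<beta>" "continuous_on S \<gamma>" "continuous_on S \<xi>"
    and S: "\<And>s. s \<in> S \<Longrightarrow> Re (\<beta> s) > 0 \<and> Re (\<gamma> s - \<beta> s) > 0 \<and> \<xi> s \<in> slit_plane"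
  shows "beta_dominated S (\<lambda>s t. of_real t powr (\<beta> s - 1) * of_real (1 - t) powr (\<gamma> s - \<beta> s - 1) *
           (1 - of_real t * \<xi> s) powr (- \<alpha> s))"
proof (rule beta_dominatedI_compact[where B = "\<lambda>s. \<gamma> s - \<beta> s"])
  have f: "continuous_on (S \<times> {0..1::real}) (\<lambda>x. g (fst x))" if "continuous_on S g" for g :: "'a \<Rightarrow> complex"
    by (rule continuous_on_compose2[OF that]) (auto intro: continuous_intros)
  show "continuous_on (S \<times> {0..1}) (\<lambda>(s, t). (1 - of_real t * \<xi> s) powr (- \<alpha> s))"
    unfolding case_prod_unfold
  proof (rule continuous_on_cpowr)
    show "1 - of_real (snd s) * \<xi> (fst s) \<notin> \<real>\<^sub>\<le>\<^sub>0" if "s \<in> S \<times> {0..1}" for s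
      using that S by (intro slit_plane_scale) auto
  qed (intro continuous_intros f c)+
qed (use S in \<open>auto intro!: continuous_intros c\<close>)

lemma euler_integral_continuous:
  fixes \<alpha> \<beta> \<gamma> \<xi> :: "'a::metric_space \<Rightarrow> complex"
  assumes c: "continuous_on S \<alpha>" "continuous_on S \<beta>" "continuous_on S \<gamma>" "continuous_on S \<xi>"
    and S: "\<And>s. s \<in> S \<Longrightarrow> Re (\<beta> s) > 0 \<and> Re (\<gamma> s - \<beta> s) > 0 \<and> \<xi> s \<in> slit_plane"
  shows "continuous_on S (\<lambda>s. euler_integral (\<alpha> s) (\<beta> s) (\<gamma> s) (\<xi> s))"
  unfolding euler_integral_def
proof (rule beta_dominated_continuous[OF euler_dominated[OF assms]])
  fix t :: real assume t: "t \<in> {0<..<1}"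
  show "continuous_on S (\<lambda>s. of_real t powr (\<beta> s - 1) * of_real (1 - t) powr (\<gamma> s - \<beta> s - 1) *
           (1 - of_real t * \<xi> s) powr (- \<alpha> s))"
    by (intro continuous_on_mult continuous_on_cpowr continuous_intros c slit_plane_scale)
       (use S t in \<open>auto simp: complex_nonpos_Reals_iff\<close>)
qed

lemma euler_holomorphic_integrand:
  assumes h: "\<alpha> holomorphic_on S" "\<beta> holomorphic_on S" "\<gamma> holomorphic_on S" "\<xi> holomorphic_on S"
    and S: "\<And>s. s \<in> S \<Longrightarrow> \<xi> s \<in> slit_plane" and t: "t \<in> {0<..<1}"
  shows "(\<lambda>s. of_real t powr (\<beta> s - 1) * of_real (1 - t) powr (\<gamma> s - \<beta> s - 1) *
           (1 - of_real t * \<xi> s) powr (- \<alpha> s)) holomorphic_on S"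
proof -
  have "1 - of_real t * \<xi> s \<notin> \<real>\<^sub>\<le>\<^sub>0" if "s \<in> S" for s
    using slit_plane_scale[OF S[OF that], of t] t by simp
  then show ?thesis
    using t by (intro holomorphic_on_mult of_real_powr_holomorphic holomorphic_on_powr holomorphic_intros h) auto
qed

lemma euler_integral_holomorphic:
  assumes h: "\<alpha> holomorphic_on S" "\<beta> holomorphic_on S" "\<gamma> holomorphic_on S" "\<xi> holomorphic_on S"
    and S: "\<And>s. s \<in> S \<Longrightarrow> Re (\<beta> s) > 0 \<and> Re (\<gamma> s - \<beta> s) > 0 \<and> \<xi> s \<in> slit_plane" and op: "open S"
  shows "(\<lambda>s. euler_integral (\<alpha> s) (\<beta> s) (\<gamma> s) (\<xi> s)) holomorphic_on S"
  unfolding euler_integral_def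
proof (rule beta_dominated_holomorphic[OF _ op])
  show "beta_dominated S (\<lambda>s t. of_real t powr (\<beta> s - 1) * of_real (1 - t) powr (\<gamma> s - \<beta> s - 1) *
           (1 - of_real t * \<xi> s) powr (- \<alpha> s))"
    by (intro euler_dominated h[THEN holomorphic_on_imp_continuous_on] S)
qed (use euler_holomorphic_integrand[OF h] S in blast)

text \<open>Differentiating the power brings down a factor \<open>a t\<close>, which raises
  \<open>a\<close> and the exponent \<open>b\<close> by one and, as \<open>c - b\<close> stays the
  same, \<open>c\<close> too.\<close>

lemma deriv_euler_integral:
  assumes b: "Re b > 0" "Re (c - b) > 0" and x: "x \<in> slit_plane"
  shows "deriv (euler_integral a b c) x = a * euler_integral (a + 1) (b + 1) (c + 1) x"
proof -
  let ?f = "\<lambda>x t. of_real t powr (b - 1) * of_real (1 - t) powr (c - b - 1) * (1 - of_real t * x) powr (-a)"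
  have "deriv (euler_integral a b c) x = integral {0<..<1} (\<lambda>t. deriv (\<lambda>x. ?f x t) x)"
    unfolding euler_integral_def
    by (rule DERIV_imp_deriv, rule beta_dominated_has_field_derivative[OF euler_dominated open_slit_plane])
       (use b x euler_holomorphic_integrand[of "\<lambda>_. a" slit_plane "\<lambda>_. b" "\<lambda>_. c" "\<lambda>x. x"]
         in \<open>auto intro!: holomorphic_intros\<close>)
  also have "\<dots> = integral {0<..<1} (\<lambda>t. a * (of_real t powr (b + 1 - 1) * of_real (1 - t) powr (c + 1 - (b + 1) - 1)
      * (1 - of_real t * x) powr (- (a + 1))))"
  proof (rule integral_cong)
    fix t :: real assume t: "t \<in> {0<..<1}"
    then have nz: "1 - of_real t * x \<notin> \<real>\<^sub>\<le>\<^sub>0" using slit_plane_scale[OF x, of t] by simp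
    have "((\<lambda>x. (1 - of_real t * x) powr (-a)) has_field_derivative
        (-a * (1 - of_real t * x) powr (-a - 1)) * (- of_real t)) (at x)"
      using nz by (intro DERIV_chain2[OF has_field_derivative_powr]) (auto intro!: derivative_eq_intros)
    then have "((\<lambda>x. ?f x t) has_field_derivative of_real t powr (b - 1) * of_real (1 - t) powr (c - b - 1) *
       ((-a * (1 - of_real t * x) powr (-a - 1)) * (- of_real t))) (at x)"
      by (rule DERIV_cmult)
    then have "deriv (\<lambda>x. ?f x t) x = of_real t powr (b - 1) * of_real (1 - t) powr (c - b - 1) *
       ((-a * (1 - of_real t * x) powr (-a - 1)) * (- of_real t))"
      by (rule DERIV_imp_deriv)
    moreover have "of_real t powr (b + 1 - 1) = of_real t powr (b - 1) * of_real t"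
      using t by (simp add: powr_diff)
    moreover have "c + 1 - (b + 1) - 1 = c - b - 1" "- (a + 1) = - a - 1" by simp_all
    ultimately show "deriv (\<lambda>x. ?f x t) x = a * (of_real t powr (b + 1 - 1) * of_real (1 - t) powr (c + 1 - (b + 1) - 1)
      * (1 - of_real t * x) powr (- (a + 1)))"
      by (simp only: mult_ac minus_mult_left [symmetric] minus_mult_right [symmetric] minus_minus)
  qed
  also have "\<dots> = a * euler_integral (a + 1) (b + 1) (c + 1) x"
    by (simp add: euler_integral_def)
  finally show ?thesis .
qed

lemma higher_deriv_euler_integral:
  assumes b: "Re b > 0" "Re (c - b) > 0" and x: "x \<in> slit_plane"
  shows "(deriv ^^ n) (euler_integral a b c) x =
    pochhammer a n * euler_integral (a + of_nat n) (b + of_nat n) (c + of_nat n) x"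
  using x
proof (induction n arbitrary: x)
  case (Suc n)
  have "(deriv ^^ Suc n) (euler_integral a b c) x = deriv ((deriv ^^ n) (euler_integral a b c)) x" by simp
  also have "\<dots> = deriv (\<lambda>x. pochhammer a n * euler_integral (a + of_nat n) (b + of_nat n) (c + of_nat n) x) x"
  proof (rule deriv_cong_ev)
    have "eventually (\<lambda>x. x \<in> slit_plane) (nhds x)"
      using open_slit_plane Suc.prems by (rule eventually_nhds_in_open)
    then show "eventually (\<lambda>x. (deriv ^^ n) (euler_integral a b c) x =
        pochhammer a n * euler_integral (a + of_nat n) (b + of_nat n) (c + of_nat n) x) (nhds x)"
      by eventually_elim (rule Suc.IH)
  qed simp
  also have "\<dots> = pochhammer a n * deriv (euler_integral (a + of_nat n) (b + of_nat n) (c + of_nat n)) x"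
  proof (rule deriv_cmult)
    have "euler_integral (a + of_nat n) (b + of_nat n) (c + of_nat n) holomorphic_on slit_plane"
      using euler_integral_holomorphic[of "\<lambda>_. a + of_nat n" slit_plane "\<lambda>_. b + of_nat n" "\<lambda>_. c + of_nat n" "\<lambda>x. x"]
        b open_slit_plane by simp
    then show "euler_integral (a + of_nat n) (b + of_nat n) (c + of_nat n) field_differentiable at x"
      using open_slit_plane Suc.prems by (rule holomorphic_on_imp_differentiable_at)
  qed
  also have "\<dots> = pochhammer a (Suc n) * euler_integral (a + of_nat (Suc n)) (b + of_nat (Suc n)) (c + of_nat (Suc n)) x"
    using b Suc.prems by (subst deriv_euler_integral) (auto simp: pochhammer_Suc add_ac)
  finally show ?case .
qed simp

definition hyp_coeff :: "complex \<Rightarrow> complex \<Rightarrow> complex \<Rightarrow> nat \<Rightarrow> complex" where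
  "hyp_coeff a b c n = pochhammer a n * pochhammer b n * rGamma (c + of_nat n) / fact n"

lemma hyp_coeff_0 [simp]: "hyp_coeff a b c 0 = rGamma c"
  by (simp add: hyp_coeff_def)

lemma hyp_coeff_Suc:
  "of_nat (Suc n) * (c + of_nat n) * hyp_coeff a b c (Suc n) = (a + of_nat n) * (b + of_nat n) * hyp_coeff a b c n"
proof -
  have "(c + of_nat n) * rGamma (c + of_nat (Suc n)) = rGamma (c + of_nat n)"
    using rGamma_plus1[of "c + of_nat n"] by (simp add: add_ac)
  moreover have "of_nat (Suc n) * (c + of_nat n) * hyp_coeff a b c (Suc n)
     = pochhammer a (Suc n) * pochhammer b (Suc n) * ((c + of_nat n) * rGamma (c + of_nat (Suc n))) / fact n"
    using of_nat_neq_0[of n, where 'a = complex]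
    unfolding hyp_coeff_def fact_Suc of_nat_mult by (simp del: of_nat_Suc add: divide_simps)
  ultimately show ?thesis by (simp add: hyp_coeff_def pochhammer_Suc mult_ac)
qed

lemma hyp_coeff_sym: "hyp_coeff a b c n = hyp_coeff b a c n"
  by (simp add: hyp_coeff_def mult_ac)

text \<open>By the shift rule every Taylor coefficient at 0 is a Beta integral, and the Gamma
  quotients become Pochhammer symbols. With this, Euler's integral is recognised as a continuation
  of the series.\<close>

lemma euler_integral_sums:
  assumes b: "Re b > 0" "Re (c - b) > 0" and x: "x \<in> ball 0 1"
  shows "(\<lambda>n. hyp_coeff a b c n * x ^ n) sums (rGamma b * rGamma (c - b) * euler_integral a b c x)"
proof -
  have npi: "z \<notin> \<int>\<^sub>\<le>\<^sub>0" if "Re z > 0" for z using that by (auto elim!: nonpos_Ints_cases)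
  have "euler_integral a b c holomorphic_on slit_plane"
    using euler_integral_holomorphic[of "\<lambda>_. a" slit_plane "\<lambda>_. b" "\<lambda>_. c" "\<lambda>x. x"] b open_slit_plane by simp
  then have "euler_integral a b c holomorphic_on ball 0 1"
    using unit_ball_subset_slit_plane by (rule holomorphic_on_subset)
  then have "(\<lambda>n. (deriv ^^ n) (euler_integral a b c) 0 / fact n * (x - 0) ^ n) sums euler_integral a b c x"
    using x by (rule holomorphic_power_series)
  then have *: "(\<lambda>n. rGamma b * rGamma (c - b) * ((deriv ^^ n) (euler_integral a b c) 0 / fact n * (x - 0) ^ n))
      sums (rGamma b * rGamma (c - b) * euler_integral a b c x)"
    by (rule sums_mult)
  have "rGamma b * rGamma (c - b) * ((deriv ^^ n) (euler_integral a b c) 0 / fact n * (x - 0) ^ n) = hyp_coeff a b c n * x ^ n" for n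
  proof -
    have bn: "Re (b + of_nat n) > 0" using b by simp
    have "euler_integral (a + of_nat n) (b + of_nat n) (c + of_nat n) 0 =
        integral {0<..<1} (\<lambda>t. of_real t powr (b + of_nat n - 1) * of_real (1 - t) powr ((c - b) - 1))"
      unfolding euler_integral_def by (simp add: algebra_simps)
    also have "\<dots> = Gamma (b + of_nat n) * Gamma (c - b) * rGamma (b + of_nat n + (c - b))"
      by (intro integral_unique complex_Beta_integral bn b)
    finally have e: "euler_integral (a + of_nat n) (b + of_nat n) (c + of_nat n) 0 =
      Gamma (b + of_nat n) * Gamma (c - b) * rGamma (c + of_nat n)" by (simp add: add_ac)
    have "rGamma b * rGamma (c - b) * (Gamma (b + of_nat n) * Gamma (c - b)) =
       (rGamma b * Gamma (b + of_nat n)) * (rGamma (c - b) * Gamma (c - b))" by (simp add: mult_ac)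
    also have "rGamma b * Gamma (b + of_nat n) = pochhammer b n"
      using pochhammer_rGamma[of b n] npi[OF bn] by (simp add: Gamma_def rGamma_eq_zero_iff)
    also have "rGamma (c - b) * Gamma (c - b) = 1"
      using npi[OF b(2)] by (simp add: Gamma_def rGamma_eq_zero_iff)
    finally have g: "rGamma b * rGamma (c - b) * (Gamma (b + of_nat n) * Gamma (c - b)) = pochhammer b n" by simp
    have "rGamma b * rGamma (c - b) * ((deriv ^^ n) (euler_integral a b c) 0 / fact n * (x - 0) ^ n)
       = pochhammer a n * (rGamma b * rGamma (c - b) * (Gamma (b + of_nat n) * Gamma (c - b))) * rGamma (c + of_nat n) / fact n * x ^ n"
      unfolding higher_deriv_euler_integral[OF b zero_in_slit_plane] e by (simp add: mult_ac)
    then show ?thesis unfolding g hyp_coeff_def .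
  qed
  with * show ?thesis by simp
qed

text \<open>
  Gauss' contiguous relation \<open>F(a,b;c) = c F(a,b;c+1) + a b x F(a+1,b+1;c+2)\<close> for the regularized
  function removes the restriction \<open>Re c > Re b\<close> of Euler's integral, one unit at a time.
\<close>

fun hyp_lift :: "nat \<Rightarrow> complex \<Rightarrow> complex \<Rightarrow> complex \<Rightarrow> complex \<Rightarrow> complex" where
  "hyp_lift 0 a b c x = rGamma b * rGamma (c - b) * euler_integral a b c x"
| "hyp_lift (Suc n) a b c x = c * hyp_lift n a b (c + 1) x + a * b * x * hyp_lift n (a + 1) (b + 1) (c + 2) x"

lemma hyp_coeff_contiguous:
  "hyp_coeff a b c (Suc n) = c * hyp_coeff a b (c + 1) (Suc n) + a * b * hyp_coeff (a + 1) (b + 1) (c + 2) n"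
proof -
  define w where "w = c + 1 + of_nat n"
  define P where "P = pochhammer (a + 1) n * pochhammer (b + 1) n * rGamma (w + 1)"
  have fs: "fact (Suc n) = (1 + of_nat n :: complex) * fact n" by (simp add: algebra_simps)
  have n1: "(1 + of_nat n :: complex) \<noteq> 0" 
    using of_nat_neq_0[of n, where 'a = complex] by (simp only: of_nat_Suc) simp
  have r: "rGamma w = w * rGamma (w + 1)" using rGamma_plus1[of w] by simp
  have 1: "hyp_coeff a b c (Suc n) = a * b * P * w / ((1 + of_nat n) * fact n)"
    unfolding hyp_coeff_def pochhammer_rec fs P_def
    using r by (simp add: w_def add_ac mult_ac)
  have 2: "hyp_coeff a b (c + 1) (Suc n) = a * b * P / ((1 + of_nat n) * fact n)"
    unfolding hyp_coeff_def pochhammer_rec fs P_def by (simp add: w_def add_ac mult_ac)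
  have 3: "hyp_coeff (a + 1) (b + 1) (c + 2) n = P / fact n"
    unfolding hyp_coeff_def P_def by (simp add: w_def add_ac)
  have "a * b * P * (c + N) / (N * f) = c * (a * b * P / (N * f)) + a * b * (P / f)"
    if "N \<noteq> 0" "f \<noteq> 0" for N f :: complex
    using that by (simp add: field_simps)
  from this[OF n1, of "fact n"] show ?thesis unfolding 1 2 3 by (simp add: w_def add_ac)
qed

lemma hyp_lift_sums:
  assumes "Re b > 0" "Re (c - b) > - real n" and x: "x \<in> ball 0 1"
  shows "(\<lambda>k. hyp_coeff a b c k * x ^ k) sums hyp_lift n a b c x"
  using assms(1,2)
proof (induction n arbitrary: a b c)
  case 0
  then show ?case using euler_integral_sums x by simp
next
  case (Suc n)
  have s1: "(\<lambda>k. hyp_coeff a b (c + 1) k * x ^ k) sums hyp_lift n a b (c + 1) x"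
    and s2: "(\<lambda>k. hyp_coeff (a + 1) (b + 1) (c + 2) k * x ^ k) sums hyp_lift n (a + 1) (b + 1) (c + 2) x"
    using Suc.prems by (auto intro!: Suc.IH)
  have "(\<lambda>k. c * (hyp_coeff a b (c + 1) (Suc k) * x ^ Suc k) + a * b * x * (hyp_coeff (a + 1) (b + 1) (c + 2) k * x ^ k))
     sums (c * (hyp_lift n a b (c + 1) x - rGamma (c + 1)) + a * b * x * hyp_lift n (a + 1) (b + 1) (c + 2) x)"
  proof (intro sums_add sums_mult s2)
    show "(\<lambda>k. hyp_coeff a b (c + 1) (Suc k) * x ^ Suc k) sums (hyp_lift n a b (c + 1) x - rGamma (c + 1))"
      using s1 by (subst sums_Suc_iff) simp
  qed
  also have "(\<lambda>k. c * (hyp_coeff a b (c + 1) (Suc k) * x ^ Suc k) + a * b * x * (hyp_coeff (a + 1) (b + 1) (c + 2) k * x ^ k))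
     = (\<lambda>k. hyp_coeff a b c (Suc k) * x ^ Suc k)"
    unfolding hyp_coeff_contiguous[of a b c] by (simp add: algebra_simps)
  finally have "(\<lambda>k. hyp_coeff a b c k * x ^ k) sums (c * (hyp_lift n a b (c + 1) x - rGamma (c + 1)) +
      a * b * x * hyp_lift n (a + 1) (b + 1) (c + 2) x + hyp_coeff a b c 0 * x ^ 0)"
    by (rule sums_Suc)
  moreover have "c * rGamma (c + 1) = rGamma c" by (rule rGamma_plus1)
  ultimately show ?case by (simp add: algebra_simps)
qed

lemma hyp_lift_continuous:
  fixes \<alpha> \<beta> \<gamma> \<xi> :: "'a::metric_space \<Rightarrow> complex"
  assumes "continuous_on S \<alpha>" "continuous_on S \<beta>" "continuous_on S \<gamma>" "continuous_on S \<xi>"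
    and "\<And>s. s \<in> S \<Longrightarrow> Re (\<beta> s) > 0 \<and> Re (\<gamma> s - \<beta> s) > - real n \<and> \<xi> s \<in> slit_plane"
  shows "continuous_on S (\<lambda>s. hyp_lift n (\<alpha> s) (\<beta> s) (\<gamma> s) (\<xi> s))"
  using assms
proof (induction n arbitrary: \<alpha> \<beta> \<gamma>)
  case 0
  have g: "continuous_on S (\<lambda>s. rGamma (g s))" if "continuous_on S g" for g :: "'a \<Rightarrow> complex"
    using continuous_on_compose2[of UNIV rGamma S g] that
    by (auto intro: holomorphic_on_imp_continuous_on holomorphic_rGamma)
  show ?case using 0 by (auto intro!: continuous_on_mult euler_integral_continuous g continuous_on_diff)
next
  case (Suc n)
  have "Re (\<beta> s) > 0 \<and> Re (\<gamma> s + 1 - \<beta> s) > - real n \<and> \<xi> s \<in> slit_plane"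
     "Re (\<beta> s + 1) > 0 \<and> Re (\<gamma> s + 2 - (\<beta> s + 1)) > - real n \<and> \<xi> s \<in> slit_plane" if "s \<in> S" for s
    using Suc.prems(5)[OF that] by auto
  then show ?case unfolding hyp_lift.simps by (intro continuous_intros Suc.IH Suc.prems) auto
qed

lemma hyp_lift_holomorphic:
  assumes "\<alpha> holomorphic_on S" "\<beta> holomorphic_on S" "\<gamma> holomorphic_on S" "\<xi> holomorphic_on S"
    and "\<And>s. s \<in> S \<Longrightarrow> Re (\<beta> s) > 0 \<and> Re (\<gamma> s - \<beta> s) > - real n \<and> \<xi> s \<in> slit_plane"
    and op: "open S"
  shows "(\<lambda>s. hyp_lift n (\<alpha> s) (\<beta> s) (\<gamma> s) (\<xi> s)) holomorphic_on S"
  using assms(1-5)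
proof (induction n arbitrary: \<alpha> \<beta> \<gamma>)
  case 0
  then show ?case using op by (auto intro!: holomorphic_intros euler_integral_holomorphic)
next
  case (Suc n)
  have "Re (\<beta> s) > 0 \<and> Re (\<gamma> s + 1 - \<beta> s) > - real n \<and> \<xi> s \<in> slit_plane"
     "Re (\<beta> s + 1) > 0 \<and> Re (\<gamma> s + 2 - (\<beta> s + 1)) > - real n \<and> \<xi> s \<in> slit_plane" if "s \<in> S" for s
    using Suc.prems(5)[OF that] by auto
  then show ?case unfolding hyp_lift.simps by (intro holomorphic_intros Suc.IH Suc.prems) auto
qed

text \<open>An explicit continuation \<open>H\<close> does two things at once: it shows that the
  choice in the definition of \<open>hyp2F1_reg\<close> has a witness, and by the identity theorem
  on the connected slit plane it equals whatever was chosen.\<close>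

lemma hyp2F1_reg_eq:
  assumes H: "H holomorphic_on slit_plane" and s: "\<And>x. x \<in> ball 0 1 \<Longrightarrow> (\<lambda>n. hyp_coeff a b c n * x ^ n) sums H x"
    and x: "x \<in> slit_plane"
  shows "hyp2F1_reg a b c x = H x"
proof -
  let ?P = "\<lambda>F. F holomorphic_on - (of_real ` {(1::real)..}) \<and> (\<forall>z\<in>ball 0 1. F z = hyp2F1_reg_series a b c z)"
  have ser: "H z = hyp2F1_reg_series a b c z" if "z \<in> ball 0 1" for z
    using sums_unique[OF s[OF that]] by (simp add: hyp2F1_reg_series_def hyp_coeff_def)
  then have "?P H" using H by (simp add: slit_plane_def)
  then have P: "?P (hyp2F1_reg a b c)" unfolding hyp2F1_reg_def by (rule someI[of ?P H])
  show ?thesis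
  proof (rule analytic_continuation_open[where s = "ball 0 1" and s' = slit_plane and f = "hyp2F1_reg a b c" and g = H and z = x])
    show "hyp2F1_reg a b c holomorphic_on slit_plane" using P by (simp add: slit_plane_def)
    show "hyp2F1_reg a b c z = H z" if "z \<in> ball 0 1" for z using P ser that by simp
  qed (use H x open_slit_plane connected_slit_plane unit_ball_subset_slit_plane in auto)
qed

lemma hyp2F1_reg_eq_hyp_lift:
  assumes "Re b > 0" "Re (c - b) > - real n" "x \<in> slit_plane"
  shows "hyp2F1_reg a b c x = hyp_lift n a b c x"
proof (rule hyp2F1_reg_eq[OF _ _ assms(3)])
  show "hyp_lift n a b c holomorphic_on slit_plane"
    using hyp_lift_holomorphic[of "\<lambda>_. a" slit_plane "\<lambda>_. b" "\<lambda>_. c" "\<lambda>x. x" n] assms open_slit_plane by simp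
qed (use assms hyp_lift_sums in blast)

text \<open>Symmetry in \<open>a\<close> and \<open>b\<close> lets either of them be the exponent in
  Euler's integral. For the Legendre parameters \<open>-\<nu>\<close> and \<open>\<nu> + 1\<close>
  the real parts add up to 1, so that one of them is always positive.\<close>

lemma hyp2F1_reg_sums:
  assumes "Re a > 0 \<or> Re b > 0" "x \<in> ball 0 1"
  shows "(\<lambda>n. hyp_coeff a b c n * x ^ n) sums hyp2F1_reg a b c x"
  using assms(1)
proof
  assume b: "Re b > 0"
  obtain n where "real n > - Re (c - b)" using reals_Archimedean2 by blast
  then have n: "Re (c - b) > - real n" by linarith
  have "x \<in> slit_plane" using assms(2) unit_ball_subset_slit_plane by blast
  then show ?thesis using hyp_lift_sums[OF b n assms(2)] hyp2F1_reg_eq_hyp_lift[OF b n] by simp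
next
  assume b: "Re a > 0"
  obtain n where "real n > - Re (c - a)" using reals_Archimedean2 by blast
  then have n: "Re (c - a) > - real n" by linarith
  have x: "x \<in> slit_plane" using assms(2) unit_ball_subset_slit_plane by blast
  have "hyp2F1_reg a b c x = hyp2F1_reg b a c x"
    by (simp add: hyp2F1_reg_def hyp2F1_reg_series_def mult_ac)
  then show ?thesis using hyp_lift_sums[OF b n assms(2), of b] hyp2F1_reg_eq_hyp_lift[OF b n x] 
    by (simp add: hyp_coeff_sym[of a b])
qed

lemma hyp2F1_reg_sym: "hyp2F1_reg a b c = hyp2F1_reg b a c"
proof -
  have "hyp2F1_reg_series a b c = hyp2F1_reg_series b a c"
    by (simp add: hyp2F1_reg_series_def fun_eq_iff mult_ac)
  then show ?thesis by (simp add: hyp2F1_reg_def)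
qed

lemma continuous_on_Re_gt_nbhd:
  fixes g :: "'a::metric_space \<Rightarrow> complex"
  assumes "continuous_on S g" "s \<in> S" "Re (g s) > c"
  obtains e where "e > 0" "\<forall>s'\<in>S \<inter> ball s e. Re (g s') > c"
proof -
  have "continuous_on S (\<lambda>s. Re (g s))" by (intro continuous_intros assms)
  then obtain e where e: "e > 0" "\<forall>s'\<in>S. dist s' s < e \<longrightarrow> dist (Re (g s')) (Re (g s)) < Re (g s) - c"
    using assms(2,3) unfolding continuous_on_iff by (meson diff_gt_0_iff_gt)
  have "Re (g s') > c" if "s' \<in> S \<inter> ball s e" for s'
  proof -
    have "\<bar>Re (g s') - Re (g s)\<bar> < Re (g s) - c" using e that by (auto simp: dist_commute dist_real_def)
    then show ?thesis by linarith
  qed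
  then show ?thesis using e(1) that by blast
qed

text \<open>The number of lifting steps depends on the parameters but can be kept fixed near
  \<open>s\<close>. There \<open>hyp2F1_reg\<close> coincides with a single
  \<open>hyp_lift n\<close> and inherits its continuity and holomorphy.\<close>

lemma hyp2F1_reg_family_nbhd:
  fixes \<beta> \<gamma> \<xi> :: "'a::metric_space \<Rightarrow> complex"
  assumes c: "continuous_on S \<beta>" "continuous_on S \<gamma>" and s: "s \<in> S" and b: "Re (\<beta> s) > 0"
    and \<xi>: "\<And>s. s \<in> S \<Longrightarrow> \<xi> s \<in> slit_plane"
  obtains e n where "e > 0" "\<forall>s'\<in>S \<inter> ball s e. Re (\<beta> s') > 0 \<and> Re (\<gamma> s' - \<beta> s') > - real n \<and> \<xi> s' \<in> slit_plane"
proof -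
  obtain e1 where e1: "e1 > 0" "\<forall>s'\<in>S \<inter> ball s e1. Re (\<beta> s') > 0"
    by (rule continuous_on_Re_gt_nbhd[OF c(1) s b])
  obtain n where "real n > - Re (\<gamma> s - \<beta> s)" using reals_Archimedean2 by blast
  then have n: "Re (\<gamma> s - \<beta> s) > - real n" by linarith
  have cd: "continuous_on S (\<lambda>s. \<gamma> s - \<beta> s)" by (intro continuous_intros c)
  obtain e2 where e2: "e2 > 0" "\<forall>s'\<in>S \<inter> ball s e2. Re (\<gamma> s' - \<beta> s') > - real n"
    by (rule continuous_on_Re_gt_nbhd[OF cd s n])
  show ?thesis by (rule that[of "min e1 e2" n]) (use e1 e2 \<xi> in auto)
qed

lemma hyp2F1_reg_continuous:
  fixes \<alpha> \<beta> \<gamma> \<xi> :: "'a::metric_space \<Rightarrow> complex"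
  assumes c: "continuous_on S \<alpha>" "continuous_on S \<beta>" "continuous_on S \<gamma>" "continuous_on S \<xi>"
    and ab: "\<And>s. s \<in> S \<Longrightarrow> Re (\<alpha> s) > 0 \<or> Re (\<beta> s) > 0" and \<xi>: "\<And>s. s \<in> S \<Longrightarrow> \<xi> s \<in> slit_plane"
  shows "continuous_on S (\<lambda>s. hyp2F1_reg (\<alpha> s) (\<beta> s) (\<gamma> s) (\<xi> s))"
proof -
  have main: "continuous (at s within S) (\<lambda>s. hyp2F1_reg (\<alpha> s) (\<beta> s) (\<gamma> s) (\<xi> s))"
    if s: "s \<in> S" and c: "continuous_on S \<alpha>" "continuous_on S \<beta>" and b: "Re (\<beta> s) > 0" for s \<alpha> \<beta>
  proof -
    obtain e n where e: "e > 0" and n: "\<forall>s'\<in>S \<inter> ball s e.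
        Re (\<beta> s') > 0 \<and> Re (\<gamma> s' - \<beta> s') > - real n \<and> \<xi> s' \<in> slit_plane"
      by (rule hyp2F1_reg_family_nbhd[OF c(2) \<open>continuous_on S \<gamma>\<close> s b \<xi>])
    have "continuous_on (S \<inter> ball s e) (\<lambda>s. hyp_lift n (\<alpha> s) (\<beta> s) (\<gamma> s) (\<xi> s))"
      by (rule hyp_lift_continuous) (use n c assms in \<open>auto elim!: continuous_on_subset\<close>)
    also have "?this \<longleftrightarrow> continuous_on (S \<inter> ball s e) (\<lambda>s. hyp2F1_reg (\<alpha> s) (\<beta> s) (\<gamma> s) (\<xi> s))"
      by (intro continuous_on_cong refl hyp2F1_reg_eq_hyp_lift[symmetric]) (use n in blast)+
    finally have "continuous (at s within S \<inter> ball s e) (\<lambda>s. hyp2F1_reg (\<alpha> s) (\<beta> s) (\<gamma> s) (\<xi> s))"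
      using s e by (auto simp: continuous_on_eq_continuous_within)
    moreover have "at s within S \<inter> ball s e = at s within S"
      using e by (intro at_within_nhd[of s "ball s e"]) auto
    ultimately show ?thesis by simp
  qed
  show ?thesis
    unfolding continuous_on_eq_continuous_within
  proof
    fix s assume s: "s \<in> S"
    from ab[OF s] show "continuous (at s within S) (\<lambda>s. hyp2F1_reg (\<alpha> s) (\<beta> s) (\<gamma> s) (\<xi> s))"
    proof
      assume "Re (\<alpha> s) > 0"
      then have "continuous (at s within S) (\<lambda>s. hyp2F1_reg (\<beta> s) (\<alpha> s) (\<gamma> s) (\<xi> s))"
        by (intro main s c)
      then show ?thesis by (subst hyp2F1_reg_sym)
    qed (intro main s c)
  qed
qed

lemma hyp2F1_reg_holomorphic:
  assumes h: "\<alpha> holomorphic_on S" "\<beta> holomorphic_on S" "\<gamma> holomorphic_on S" "\<xi> holomorphic_on S"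
    and ab: "\<And>s. s \<in> S \<Longrightarrow> Re (\<alpha> s) > 0 \<or> Re (\<beta> s) > 0" and \<xi>: "\<And>s. s \<in> S \<Longrightarrow> \<xi> s \<in> slit_plane" and S: "open S"
  shows "(\<lambda>s. hyp2F1_reg (\<alpha> s) (\<beta> s) (\<gamma> s) (\<xi> s)) holomorphic_on S"
proof -
  have main: "(\<lambda>s. hyp2F1_reg (\<alpha> s) (\<beta> s) (\<gamma> s) (\<xi> s)) field_differentiable (at s)"
    if s: "s \<in> S" and h: "\<alpha> holomorphic_on S" "\<beta> holomorphic_on S" and b: "Re (\<beta> s) > 0" for s \<alpha> \<beta>
  proof -
    obtain e n where e: "e > 0" and n: "\<forall>s'\<in>S \<inter> ball s e.
        Re (\<beta> s') > 0 \<and> Re (\<gamma> s' - \<beta> s') > - real n \<and> \<xi> s' \<in> slit_plane"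
      by (rule hyp2F1_reg_family_nbhd[OF h(2)[THEN holomorphic_on_imp_continuous_on]
          \<open>\<gamma> holomorphic_on S\<close>[THEN holomorphic_on_imp_continuous_on] s b \<xi>])
    have op: "open (S \<inter> ball s e)" using S by auto
    have "(\<lambda>s. hyp_lift n (\<alpha> s) (\<beta> s) (\<gamma> s) (\<xi> s)) holomorphic_on (S \<inter> ball s e)"
      by (rule hyp_lift_holomorphic) (use n h assms op in \<open>auto elim!: holomorphic_on_subset\<close>)
    also have "?this \<longleftrightarrow> (\<lambda>s. hyp2F1_reg (\<alpha> s) (\<beta> s) (\<gamma> s) (\<xi> s)) holomorphic_on (S \<inter> ball s e)"
      by (intro holomorphic_cong refl hyp2F1_reg_eq_hyp_lift[symmetric]) (use n in blast)+
    finally show ?thesis using op by (rule holomorphic_on_imp_differentiable_at) (use s e in auto)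
  qed
  show ?thesis
    unfolding holomorphic_on_def
  proof
    fix s assume s: "s \<in> S"
    have "(\<lambda>s. hyp2F1_reg (\<alpha> s) (\<beta> s) (\<gamma> s) (\<xi> s)) field_differentiable (at s)"
      using ab[OF s]
    proof
      assume "Re (\<alpha> s) > 0"
      then have "(\<lambda>s. hyp2F1_reg (\<beta> s) (\<alpha> s) (\<gamma> s) (\<xi> s)) field_differentiable (at s)"
        by (intro main s h)
      then show ?thesis by (subst hyp2F1_reg_sym)
    qed (intro main s h)
    then show "(\<lambda>s. hyp2F1_reg (\<alpha> s) (\<beta> s) (\<gamma> s) (\<xi> s)) field_differentiable (at s within S)"
      by (rule field_differentiable_at_within)
  qed
qed

lemma hyp2F1_reg_holomorphic_slit_plane:
  "Re a > 0 \<or> Re b > 0 \<Longrightarrow> hyp2F1_reg a b c holomorphic_on slit_plane"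
  using hyp2F1_reg_holomorphic[of "\<lambda>_. a" slit_plane "\<lambda>_. b" "\<lambda>_. c" "\<lambda>x. x"] open_slit_plane by simp

lemma hyp2F1_reg_0:
  assumes "Re a > 0 \<or> Re b > 0"
  shows "hyp2F1_reg a b c 0 = rGamma c"
proof -
  have "(\<lambda>n. hyp_coeff a b c n * 0 ^ n) sums hyp2F1_reg a b c 0"
    by (rule hyp2F1_reg_sums) (use assms in auto)
  then have "hyp_coeff a b c 0 = hyp2F1_reg a b c 0" by (rule sums_unique2[OF powser_sums_zero])
  then show ?thesis by simp
qed

lemma hyp2F1_reg_has_fps_expansion:
  assumes "Re a > 0 \<or> Re b > 0"
  shows "hyp2F1_reg a b c has_fps_expansion Abs_fps (hyp_coeff a b c)"
proof (rule has_fps_expansionI)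
  have "eventually (\<lambda>u. u \<in> ball 0 1) (nhds (0::complex))" by (rule eventually_nhds_in_open) auto
  then show "eventually (\<lambda>u. (\<lambda>n. fps_nth (Abs_fps (hyp_coeff a b c)) n * u ^ n) sums hyp2F1_reg a b c u) (nhds 0)"
    by eventually_elim (use hyp2F1_reg_sums[OF assms] in simp)
qed

section \<open>Second order linear differential equations\<close>

lemma hypergeometric_fps_ode:
  fixes a b c :: complex
  defines "A \<equiv> Abs_fps (hyp_coeff a b c)"
  shows "fps_X * (1 - fps_X) * fps_deriv (fps_deriv A) + (fps_const c - fps_const (a + b + 1) * fps_X) * fps_deriv A
    - fps_const (a * b) * A = 0"
proof (rule fps_ext)
  fix n :: nat
  have XD2: "fps_nth (fps_X * fps_deriv (fps_deriv A)) n = of_nat n * of_nat (Suc n) * fps_nth A (Suc n)"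
    by (cases n) (simp_all add: algebra_simps)
  have XXD2: "fps_nth (fps_X * (fps_X * fps_deriv (fps_deriv A))) n = of_nat n * (of_nat n - 1) * fps_nth A n"
  proof (cases n)
    case (Suc m) then show ?thesis by (cases m) (simp_all add: algebra_simps)
  qed simp
  have XD: "fps_nth (fps_X * fps_deriv A) n = of_nat n * fps_nth A n"
    by (cases n) (simp_all add: algebra_simps)
  have "fps_X * (1 - fps_X) * fps_deriv (fps_deriv A) + (fps_const c - fps_const (a + b + 1) * fps_X) * fps_deriv A
    - fps_const (a * b) * A = fps_X * fps_deriv (fps_deriv A) - fps_X * (fps_X * fps_deriv (fps_deriv A))
     + fps_const c * fps_deriv A - fps_const (a + b + 1) * (fps_X * fps_deriv A) - fps_const (a * b) * A"
    by (simp add: algebra_simps)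
  then have "fps_nth (fps_X * (1 - fps_X) * fps_deriv (fps_deriv A) + (fps_const c - fps_const (a + b + 1) * fps_X) * fps_deriv A
    - fps_const (a * b) * A) n = of_nat (Suc n) * (c + of_nat n) * fps_nth A (Suc n)
       - (a + of_nat n) * (b + of_nat n) * fps_nth A n"
    by (simp only: fps_sub_nth fps_add_nth fps_mult_left_const_nth XD2 XXD2 XD fps_deriv_nth)
       (simp add: algebra_simps)
  also have "\<dots> = 0" using hyp_coeff_Suc[of n c a b] by (simp add: A_def)
  finally show "fps_nth (fps_X * (1 - fps_X) * fps_deriv (fps_deriv A) + (fps_const c - fps_const (a + b + 1) * fps_X) * fps_deriv A
    - fps_const (a * b) * A) n = fps_nth 0 n" by simp
qed

text \<open>At the origin the equation is the two-term recursion of the coefficients, read as an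
  identity of formal power series; it spreads over the slit plane by analytic continuation.\<close>

lemma hyp2F1_reg_ode:
  fixes a b c x :: complex
  assumes ab: "Re a > 0 \<or> Re b > 0" and x: "x \<in> slit_plane"
  defines "F \<equiv> hyp2F1_reg a b c"
  shows "x * (1 - x) * deriv (deriv F) x + (c - (a + b + 1) * x) * deriv F x - a * b * F x = 0"
proof -
  define A where "A = Abs_fps (hyp_coeff a b c)"
  have F: "F has_fps_expansion A" unfolding F_def A_def by (rule hyp2F1_reg_has_fps_expansion[OF ab])
  have "(\<lambda>x. x * (1 - x) * deriv (deriv F) x + (c - (a + b + 1) * x) * deriv F x - a * b * F x) has_fps_expansion
     (fps_X * (1 - fps_X) * fps_deriv (fps_deriv A) + (fps_const c - fps_const (a + b + 1) * fps_X) * fps_deriv A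
      - fps_const (a * b) * A)"
    by (intro fps_expansion_intros F)
  then have "(\<lambda>x. x * (1 - x) * deriv (deriv F) x + (c - (a + b + 1) * x) * deriv F x - a * b * F x) has_fps_expansion 0"
    unfolding A_def hypergeometric_fps_ode .
  moreover have "F holomorphic_on slit_plane" unfolding F_def by (rule hyp2F1_reg_holomorphic_slit_plane[OF ab])
  then have "(\<lambda>x. x * (1 - x) * deriv (deriv F) x + (c - (a + b + 1) * x) * deriv F x - a * b * F x) holomorphic_on slit_plane"
    by (intro holomorphic_intros holomorphic_deriv open_slit_plane)
  ultimately show ?thesis
    by (rule has_fps_expansion_0_analytic_continuation[OF _ _ open_slit_plane connected_slit_plane zero_in_slit_plane x])
qed

text \<open>
  The bracket \<open>n P\<^sub>0 + Q\<^sub>0\<close> is, up to a factor, the indicial polynomial at the exponent \<open>n + 1\<close>.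
\<close>

lemma fps_ode_unique:
  fixes H P Q R :: "complex fps"
  assumes ode: "fps_X * P * fps_deriv (fps_deriv H) + Q * fps_deriv H + R * H = 0" and H0: "fps_nth H 0 = 0"
    and ind: "\<And>n::nat. fps_nth H (Suc n) = 0 \<or> of_nat n * fps_nth P 0 + fps_nth Q 0 \<noteq> 0"
  shows "H = 0"
proof -
  have dX: "fps_X * fps_deriv (fps_X ^ n) = of_nat n * (fps_X ^ n :: complex fps)" for n
  proof (rule fps_ext)
    fix m show "fps_nth (fps_X * fps_deriv (fps_X ^ n)) m = fps_nth (of_nat n * (fps_X ^ n :: complex fps)) m"
      by (cases m) (auto simp: fps_X_power_iff simp del: of_nat_Suc)
  qed
  have "\<forall>m\<le>n. fps_nth H m = 0" for n
  proof (induction n)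
    case (Suc n)
    \<comment> \<open>The first \<open>n + 1\<close> coefficients vanish, so
      \<open>X ^ (n + 1)\<close> splits off. After cancelling \<open>X ^ n\<close> from the
      equation, its constant term is the bracket times \<open>n + 1\<close> times the next
      coefficient.\<close>
    define G where "G = fps_shift (Suc n) H"
    have H: "H = fps_X ^ Suc n * G"
      unfolding G_def
    proof (rule fps_ext)
      fix m show "fps_nth H m = fps_nth (fps_X ^ Suc n * fps_shift (Suc n) H) m"
        using Suc by (auto simp: fps_X_power_mult_nth simp del: power_Suc)
    qed
    define K where "K = of_nat (Suc n) * G + fps_X * fps_deriv G"
    have H': "fps_deriv H = fps_X ^ n * K"
    proof -
      have "fps_deriv H = fps_deriv (fps_X * (fps_X ^ n * G))" unfolding H by (simp add: mult_ac)
      also have "\<dots> = fps_X ^ n * G + (fps_X * fps_deriv (fps_X ^ n)) * G + fps_X ^ n * (fps_X * fps_deriv G)"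
        unfolding fps_deriv_mult fps_deriv_fps_X by (simp only: algebra_simps mult_1_left)
      finally show ?thesis unfolding dX K_def by (simp add: algebra_simps)
    qed
    have H'': "fps_X * fps_deriv (fps_deriv H) = fps_X ^ n * (of_nat n * K + fps_X * fps_deriv K)"
    proof -
      have "fps_X * fps_deriv (fps_deriv H) = (fps_X * fps_deriv (fps_X ^ n)) * K + fps_X ^ n * (fps_X * fps_deriv K)"
        unfolding H' fps_deriv_mult by (simp only: algebra_simps)
      then show ?thesis unfolding dX by (simp add: algebra_simps)
    qed
    have "fps_X ^ n * (P * (of_nat n * K + fps_X * fps_deriv K) + Q * K + R * (fps_X * G))
        = P * (fps_X * fps_deriv (fps_deriv H)) + Q * fps_deriv H + R * H"
      unfolding H'' unfolding H' unfolding H by (simp add: algebra_simps)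
    also have "\<dots> = 0" using ode by (simp add: mult_ac)
    finally have "P * (of_nat n * K + fps_X * fps_deriv K) + Q * K + R * (fps_X * G) = 0" by simp
    then have "fps_nth (P * (of_nat n * K + fps_X * fps_deriv K) + Q * K + R * (fps_X * G)) 0 = 0" by simp
    then have "(of_nat n * fps_nth P 0 + fps_nth Q 0) * fps_nth K 0 = 0"
      by (simp add: algebra_simps fps_mult_nth_0)
    moreover have "fps_nth K 0 = of_nat (Suc n) * fps_nth H (Suc n)"
      unfolding K_def G_def by (simp add: fps_mult_nth_0)
    ultimately have "fps_nth H (Suc n) = 0" using ind[of n] of_nat_neq_0[of n, where 'a = complex] by (metis mult_eq_0_iff)
    with Suc show ?case by (auto simp: le_Suc_eq)
  qed (use H0 in auto)
  then show ?thesis by (intro fps_ext) (metis fps_zero_nth order_refl)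
qed

text \<open>The factor \<open>x - x0\<close> in the leading term makes \<open>x0\<close> a regular
  singular point in general. An ordinary point is covered too: multiplied by \<open>x - x0\<close>,
  its equation has \<open>q x0 = 0\<close>, and the vanishing of \<open>N1 x0\<close> takes the
  place of the condition for the first coefficient.\<close>

lemma ode_unique:
  assumes A: "open A" "connected A" "x0 \<in> A"
    and N: "\<And>x. x \<in> A \<Longrightarrow> (N has_field_derivative N1 x) (at x)"
      "\<And>x. x \<in> A \<Longrightarrow> (N1 has_field_derivative N2 x) (at x)"
    and h: "p holomorphic_on A" "q holomorphic_on A" "r holomorphic_on A"
    and ode: "\<And>x. x \<in> A \<Longrightarrow> (x - x0) * p x * N2 x + q x * N1 x + r x * N x = 0"
    and N0: "N x0 = 0" and ind: "N1 x0 = 0 \<or> q x0 \<noteq> 0" "\<And>n::nat. n > 0 \<Longrightarrow> of_nat n * p x0 + q x0 \<noteq> 0"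
    and x: "x \<in> A"
  shows "N x = 0"
proof -
  define B where "B = (\<lambda>x. x - x0) ` A"
  have BA: "x0 + y \<in> A \<longleftrightarrow> y \<in> B" for y by (force simp: B_def algebra_simps)
  have B: "open B" "connected B" "0 \<in> B"
    using A open_translation_subtract[of A x0] unfolding B_def
    by (auto intro!: connected_continuous_image continuous_intros)
  let ?s = "\<lambda>f y. f (x0 + y)"
  have d: "(?s N has_field_derivative ?s N1 y) (at y)" "(?s N1 has_field_derivative ?s N2 y) (at y)" if "y \<in> B" for y
  proof -
    have m: "x0 + y \<in> A" using that BA by simp
    have sh: "((\<lambda>y. x0 + y) has_field_derivative 1) (at y)" by (auto intro!: derivative_eq_intros)
    show "(?s N has_field_derivative ?s N1 y) (at y)" "(?s N1 has_field_derivative ?s N2 y) (at y)"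
      using DERIV_chain2[OF N(1)[OF m] sh] DERIV_chain2[OF N(2)[OF m] sh] by simp_all
  qed
  have hol: "?s f holomorphic_on B" if "f holomorphic_on A" for f
    using BA by (intro holomorphic_on_compose_gen[unfolded o_def, OF _ that] holomorphic_intros) auto
  have HN: "?s N holomorphic_on B" "?s N1 holomorphic_on B" using d B(1) by (auto simp: holomorphic_on_open)
  have dev: "eventually (\<lambda>y. y \<in> B) (nhds 0)" using B by (intro eventually_nhds_in_open)
  have e0: "?s f has_fps_expansion fps_expansion (?s f) 0" if "?s f holomorphic_on B" for f
    using B that by (intro has_fps_expansion_fps_expansion)
  define H where "H = fps_expansion (?s N) 0"
  have eN: "?s N has_fps_expansion H" unfolding H_def by (rule e0[OF HN(1)])
  have eN1: "?s N1 has_fps_expansion fps_deriv H"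
    using has_fps_expansion_deriv[OF eN]
    by (rule has_fps_expansion_cong[THEN iffD1, rotated 2]) (use dev d(1) in \<open>auto elim!: eventually_mono intro: DERIV_imp_deriv\<close>)
  have eN2: "?s N2 has_fps_expansion fps_deriv (fps_deriv H)"
    using has_fps_expansion_deriv[OF eN1]
    by (rule has_fps_expansion_cong[THEN iffD1, rotated 2]) (use dev d(2) in \<open>auto elim!: eventually_mono intro: DERIV_imp_deriv\<close>)
  let ?P = "fps_expansion (?s p) 0" and ?Q = "fps_expansion (?s q) 0" and ?R = "fps_expansion (?s r) 0"
  have "(\<lambda>y. y * p (x0 + y) * N2 (x0 + y) + q (x0 + y) * N1 (x0 + y) + r (x0 + y) * N (x0 + y)) has_fps_expansion
      fps_X * ?P * fps_deriv (fps_deriv H) + ?Q * fps_deriv H + ?R * H"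
    by (intro fps_expansion_intros eN eN1 eN2 e0 hol h)
  moreover have "(\<lambda>y. y * p (x0 + y) * N2 (x0 + y) + q (x0 + y) * N1 (x0 + y) + r (x0 + y) * N (x0 + y)) has_fps_expansion 0"
    unfolding has_fps_expansion_0_iff using dev
    by eventually_elim (use ode BA in force)
  ultimately have *: "fps_X * ?P * fps_deriv (fps_deriv H) + ?Q * fps_deriv H + ?R * H = 0"
    by (rule fps_expansion_unique_complex)
  have v0: "fps_nth F 0 = f x0" if "?s f has_fps_expansion F" for f F
    using has_fps_expansion_imp_0_eq_fps_nth_0[OF that] by simp
  have "H = 0"
  proof (rule fps_ode_unique[OF *])
    show "fps_nth H 0 = 0" using v0[OF eN] N0 by simp
    have p0: "fps_nth ?P 0 = p x0" "fps_nth ?Q 0 = q x0" by (intro v0 e0 hol h)+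
    show "fps_nth H (Suc n) = 0 \<or> of_nat n * fps_nth ?P 0 + fps_nth ?Q 0 \<noteq> 0" for n
    proof (cases n)
      case 0
      then show ?thesis using v0[OF eN1] ind(1) p0 by simp
    qed (use ind(2)[of n] p0 in simp)
  qed
  then have "?s N has_fps_expansion 0" using eN by simp
  then have "?s N (x - x0) = 0"
    by (rule has_fps_expansion_0_analytic_continuation[OF _ HN(1) B]) (use x in \<open>auto simp: B_def\<close>)
  then show ?thesis by simp
qed

section \<open>Euler's transformation and integer lower parameters\<close>

lemma hyp2F1_reg_has_derivs:
  assumes "Re a > 0 \<or> Re b > 0" "x \<in> slit_plane"
  shows "(hyp2F1_reg a b c has_field_derivative deriv (hyp2F1_reg a b c) x) (at x)"
    and "(deriv (hyp2F1_reg a b c) has_field_derivative deriv (deriv (hyp2F1_reg a b c)) x) (at x)"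
  using hyp2F1_reg_holomorphic_slit_plane[OF assms(1), of c] assms(2)
  by (auto intro!: holomorphic_derivI[OF _ open_slit_plane] holomorphic_deriv open_slit_plane)

text \<open>Euler's \<open>F(a,b;c) = (1 - x)^(c - a - b) F(c - a, c - b; c)\<close>, where
  \<open>a + b = 1\<close> and \<open>c = 1 + m\<close> give \<open>c - a - b = m\<close>,
  \<open>c - a = b + m\<close> and \<open>c - b = a + m\<close>. Both sides solve the same
  hypergeometric equation with the value \<open>rGamma c\<close> at 0, where a positive
  \<open>c\<close> leaves only one regular solution up to a factor.\<close>

lemma hyp2F1_reg_euler_transformation:
  fixes a b x :: complex and m :: nat
  assumes ab: "Re a > 0 \<or> Re b > 0" and sum: "a + b = 1" and x: "x \<in> slit_plane"
  defines "c \<equiv> 1 + of_nat m"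
  shows "(1 - x) ^ m * hyp2F1_reg (a + of_nat m) (b + of_nat m) c x = hyp2F1_reg a b c x"
proof -
  define F where "F = hyp2F1_reg (a + of_nat m) (b + of_nat m) c"
  define E where "E = hyp2F1_reg a b c"
  have abm: "Re (a + of_nat m) > 0 \<or> Re (b + of_nat m) > 0" using ab by auto
  note dF = hyp2F1_reg_has_derivs[OF abm, of _ c, folded F_def]
  note dE = hyp2F1_reg_has_derivs[OF ab, of _ c, folded E_def]
  have ne: "1 - x \<noteq> 0" if "x \<in> slit_plane" for x using that by (auto simp: mem_slit_plane_iff)
  define M :: complex where "M = of_nat m"
  define w where "w = (\<lambda>x::complex. (1 - x) ^ m)"
  have dw: "(w has_field_derivative - M * w x / (1 - x)) (at x)" if "x \<in> slit_plane" for x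
  proof -
    have "(w has_field_derivative of_nat m * (- 1 * (1 - x) ^ (m - Suc 0))) (at x)"
      unfolding w_def by (rule DERIV_power) (auto intro!: derivative_eq_intros)
    also have "of_nat m * (- 1 * (1 - x) ^ (m - Suc 0)) = - M * w x / (1 - x)"
      using ne[OF that] by (cases m) (auto simp: M_def w_def field_simps)
    finally show ?thesis .
  qed
  define N1 where "N1 = (\<lambda>x. w x * (deriv F x - M / (1 - x) * F x) - deriv E x)"
  define N2 where "N2 = (\<lambda>x. w x * (deriv (deriv F) x - 2 * M / (1 - x) * deriv F x + M * (M - 1) / (1 - x)\<^sup>2 * F x) - deriv (deriv E) x)"
  have "w x * F x - E x = 0"
  \<comment> \<open>The equation of \<open>E\<close> multiplied by \<open>1 - x\<close>, which
    clears the denominators left by differentiating the factor \<open>w\<close>.\<close>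
  proof (rule ode_unique[where A = slit_plane and N = "\<lambda>x. w x * F x - E x" and ?x0.0 = 0 and ?N1.0 = N1 and ?N2.0 = N2
        and p = "\<lambda>x. (1 - x)\<^sup>2" and q = "\<lambda>x. (c - 2 * x) * (1 - x)" and r = "\<lambda>x. - (a * b) * (1 - x)"])
    fix x assume x: "x \<in> slit_plane"
    show "((\<lambda>x. w x * F x - E x) has_field_derivative N1 x) (at x)"
      unfolding N1_def using ne[OF x]
      by (auto intro!: derivative_eq_intros dw dF dE x simp: field_simps)
    show "(N1 has_field_derivative N2 x) (at x)"
    proof -
      have dM: "((\<lambda>x. M / (1 - x)) has_field_derivative M / (1 - x)\<^sup>2) (at x)"
        using ne[OF x] by (auto intro!: derivative_eq_intros simp: power2_eq_square)
      have "(N1 has_field_derivative (- M * w x / (1 - x)) * (deriv F x - M / (1 - x) * F x) +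
          w x * (deriv (deriv F) x - (M / (1 - x)\<^sup>2 * F x + M / (1 - x) * deriv F x)) - deriv (deriv E) x) (at x)"
        unfolding N1_def
        by (rule DERIV_cong, (rule DERIV_diff DERIV_mult dw dM dF dE x)+) (simp add: algebra_simps)
      also have "(- M * w x / (1 - x)) * (deriv F x - M / (1 - x) * F x) +
          w x * (deriv (deriv F) x - (M / (1 - x)\<^sup>2 * F x + M / (1 - x) * deriv F x)) - deriv (deriv E) x = N2 x"
        unfolding N2_def power2_eq_square divide_inverse inverse_mult_distrib by (simp only: algebra_simps) simp
      finally show ?thesis .
    qed
    have b: "b = 1 - a" using sum by (simp add: algebra_simps)
    have oF: "x * (1 - x) * deriv (deriv F) x + (c - (2 + 2 * M) * x) * deriv F x - (a + M) * (b + M) * F x = 0"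
    proof -
      have "a + of_nat m + (b + of_nat m) + 1 = 2 + 2 * M" by (simp add: b M_def)
      then show ?thesis using hyp2F1_reg_ode[OF abm x, of c] by (simp add: F_def M_def)
    qed
    have oE: "x * (1 - x) * deriv (deriv E) x + (c - 2 * x) * deriv E x - a * b * E x = 0"
      using hyp2F1_reg_ode[OF ab x, of c] sum by (simp add: E_def)
    define u where "u = 1 - x"
    have "u * (x * u * deriv (deriv F) x) = u * ((a + M) * (b + M) * F x - (c - (2 + 2 * M) * x) * deriv F x)"
      using oF unfolding u_def by algebra
    then have "x * (u\<^sup>2 * deriv (deriv F) x - 2 * M * u * deriv F x + M * (M - 1) * F x) + (c - 2 * x) * (u * deriv F x - M * F x) - a * b * u * F x
       = u * ((a + M) * (b + M) * F x - (c - (2 + 2 * M) * x) * deriv F x) - 2 * M * x * u * deriv F x + x * M * (M - 1) * F x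
         + (c - 2 * x) * (u * deriv F x - M * F x) - a * b * u * F x"
      by (simp add: algebra_simps power2_eq_square)
    also have "\<dots> = 0"
      unfolding b c_def M_def[symmetric] u_def by algebra
    finally have key: "x * (u\<^sup>2 * deriv (deriv F) x - 2 * M * u * deriv F x + M * (M - 1) * F x) + (c - 2 * x) * (u * deriv F x - M * F x) - a * b * u * F x = 0" .
    have u0: "u \<noteq> 0" using ne[OF x] by (simp add: u_def)
    have "x * u\<^sup>2 * N2 x + (c - 2 * x) * u * N1 x - a * b * u * (w x * F x - E x)
        = w x * (x * (u\<^sup>2 * deriv (deriv F) x - 2 * M * u * deriv F x + M * (M - 1) * F x) + (c - 2 * x) * (u * deriv F x - M * F x) - a * b * u * F x)
         - u * (x * u * deriv (deriv E) x + (c - 2 * x) * deriv E x - a * b * E x)"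
      unfolding N1_def N2_def u_def[symmetric] using u0 by (simp add: field_simps power2_eq_square)
    also have "\<dots> = 0" unfolding key using oE by (simp add: u_def)
    finally show "(x - 0) * (1 - x)\<^sup>2 * N2 x + (c - 2 * x) * (1 - x) * N1 x + - (a * b) * (1 - x) * (w x * F x - E x) = 0"
      by (simp add: u_def)
  next
    show "w 0 * F 0 - E 0 = 0" using hyp2F1_reg_0[OF ab, of c] hyp2F1_reg_0[OF abm, of c] by (simp add: F_def E_def w_def)
    have c: "of_nat n + c \<noteq> 0" for n unfolding c_def using of_nat_neq_0[of "n + m", where 'a = complex] by (simp add: add_ac)
    show "N1 0 = 0 \<or> (c - 2 * 0) * (1 - 0) \<noteq> 0" using c[of 0] by simp
    show "of_nat n * (1 - 0)\<^sup>2 + (c - 2 * 0) * (1 - 0) \<noteq> 0" if "n > 0" for n :: nat using c[of n] by simp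
  qed (auto intro!: holomorphic_intros open_slit_plane connected_slit_plane zero_in_slit_plane x)
  then show ?thesis by (simp add: F_def E_def w_def)
qed

text \<open>When \<open>c = 1 - m\<close> the first \<open>m\<close> coefficients vanish because of the factor \<open>rGamma (c + n)\<close>.\<close>

lemma hyp2F1_reg_degenerate:
  assumes ab: "Re a > 0 \<or> Re b > 0" and sum: "a + b = 1" and x: "x \<in> slit_plane"
  shows "hyp2F1_reg a b (1 - of_nat m) x =
    pochhammer a m * pochhammer b m * (x / (1 - x)) ^ m * hyp2F1_reg a b (1 + of_nat m) x"
proof -
  define K where "K = pochhammer a m * pochhammer b m"
  define F where "F = hyp2F1_reg (a + of_nat m) (b + of_nat m) (1 + of_nat m)"
  have abm: "Re (a + of_nat m) > 0 \<or> Re (b + of_nat m) > 0" using ab by auto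
  have "hyp2F1_reg a b (1 - of_nat m) x = K * x ^ m * F x"
  proof (rule hyp2F1_reg_eq[OF _ _ x])
    show "(\<lambda>x. K * x ^ m * F x) holomorphic_on slit_plane"
      unfolding F_def by (intro holomorphic_intros hyp2F1_reg_holomorphic_slit_plane abm)
    fix x :: complex assume "x \<in> ball 0 1"
    then have "(\<lambda>n. hyp_coeff (a + of_nat m) (b + of_nat m) (1 + of_nat m) n * x ^ n) sums F x"
      unfolding F_def by (intro hyp2F1_reg_sums abm)
    then have "(\<lambda>n. K * x ^ m * (hyp_coeff (a + of_nat m) (b + of_nat m) (1 + of_nat m) n * x ^ n)) sums (K * x ^ m * F x)"
      by (rule sums_mult)
    also have "(\<lambda>n. K * x ^ m * (hyp_coeff (a + of_nat m) (b + of_nat m) (1 + of_nat m) n * x ^ n))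
       = (\<lambda>n. hyp_coeff a b (1 - of_nat m) (n + m) * x ^ (n + m))"
    proof
      fix n
      have r1: "rGamma (1 - of_nat m + of_nat (n + m)) = (1 / fact n :: complex)"
        using Gamma_fact[of n, where 'a = complex] by (simp add: rGamma_inverse_Gamma add_ac field_simps)
      have r2: "rGamma (1 + of_nat m + of_nat n) = (1 / fact (n + m) :: complex)"
        using Gamma_fact[of "n + m", where 'a = complex] by (simp add: rGamma_inverse_Gamma add_ac field_simps)
      show "K * x ^ m * (hyp_coeff (a + of_nat m) (b + of_nat m) (1 + of_nat m) n * x ^ n) =
        hyp_coeff a b (1 - of_nat m) (n + m) * x ^ (n + m)"
        unfolding hyp_coeff_def K_def r1 r2
        using pochhammer_product'[of a m n] pochhammer_product'[of b m n] by (simp add: power_add add.commute mult_ac)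
    qed
    also have "\<dots> sums (K * x ^ m * F x) \<longleftrightarrow> (\<lambda>n. hyp_coeff a b (1 - of_nat m) n * x ^ n) sums (K * x ^ m * F x)"
    proof (rule sums_zero_iff_shift)
      fix i assume i: "i < m"
      have "(1 - of_nat m + of_nat i :: complex) = - of_nat (m - 1 - i)" using i by (simp add: of_nat_diff)
      then have "rGamma (1 - of_nat m + of_nat i :: complex) = 0" by (simp only: rGamma_eq_zero_iff) simp
      then show "hyp_coeff a b (1 - of_nat m) i * x ^ i = 0" by (simp add: hyp_coeff_def)
    qed
    finally show "(\<lambda>n. hyp_coeff a b (1 - of_nat m) n * x ^ n) sums (K * x ^ m * F x)" .
  qed
  \<comment> \<open>Dropping the vanishing coefficients has shifted \<open>a\<close> and
    \<open>b\<close> by \<open>m\<close>; Euler's transformation shifts them back.\<close>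
  also have "F x = hyp2F1_reg a b (1 + of_nat m) x / (1 - x) ^ m"
  proof -
    have "1 - x \<noteq> 0" using x by (auto simp: mem_slit_plane_iff)
    then show ?thesis
      using hyp2F1_reg_euler_transformation[OF ab sum x, of m] by (simp add: F_def field_simps)
  qed
  finally show ?thesis by (simp add: K_def power_divide)
qed

section \<open>Legendre functions in the variable of Whipple's formula\<close>

lemma csqrt_eqI: "w\<^sup>2 = z \<Longrightarrow> Re w > 0 \<Longrightarrow> csqrt z = w"
  by (rule csqrt_unique) auto

lemma obtain_csqrt:
  obtains w where "csqrt z = w" "w\<^sup>2 = z" "Re w \<ge> 0"
proof (rule that[of "csqrt z"])
  show "Re (csqrt z) \<ge> 0" using csqrt_principal[of z] by linarith
qed (simp_all only: power2_csqrt)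

lemma Re_csqrt_pos:
  assumes "z \<notin> \<real>\<^sub>\<le>\<^sub>0" shows "Re (csqrt z) > 0"
proof -
  obtain w where w: "csqrt z = w" "w\<^sup>2 = z" "Re w \<ge> 0" by (rule obtain_csqrt)
  have "Re w \<noteq> 0"
  proof
    assume "Re w = 0"
    then have "Re (w\<^sup>2) \<le> 0" "Im (w\<^sup>2) = 0" by (auto simp: power2_eq_square)
    then show False using assms w by (simp add: complex_nonpos_Reals_iff)
  qed
  then show ?thesis using w by simp
qed

lemma Re_csqrt_gt_Im:
  assumes "Re z > 0" shows "\<bar>Im (csqrt z)\<bar> < Re (csqrt z)"
proof -
  obtain w where w: "csqrt z = w" "w\<^sup>2 = z" "Re w \<ge> 0" by (rule obtain_csqrt)
  have "(Im w)\<^sup>2 < (Re w)\<^sup>2" using assms w(2) by (auto simp: power2_eq_square)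
  then have "\<not> \<bar>Re w\<bar> \<le> \<bar>Im w\<bar>" by (simp add: abs_le_square_iff)
  then show ?thesis using w by simp
qed

lemma power_is_one:
  assumes "i * s = (1::complex)" shows "s\<^sup>2 * i\<^sup>2 = 1"
proof -
  have "s\<^sup>2 * i\<^sup>2 = (i * s)\<^sup>2" by (simp only: power_mult_distrib mult.commute)
  then show ?thesis using assms by simp
qed

text \<open>Square roots of points in the right half-plane lie in the sector
  \<open>abs (Im w) < Re w\<close>, and the product of two points of this sector has positive real
  part.\<close>

lemma Re_csqrt_mult_pos:
  assumes "Re a > 0" "Re b > 0" shows "Re (csqrt a * csqrt b) > 0"
proof -
  have "x * y < u * v \<Longrightarrow> \<bar>p\<bar> = x \<Longrightarrow> \<bar>q\<bar> = y \<Longrightarrow> p * q < u * v" for p q x y u v :: real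
    using abs_ge_self[of "p * q"] by (simp add: abs_mult)
  from this[OF mult_strict_mono'[OF Re_csqrt_gt_Im[OF assms(1)] Re_csqrt_gt_Im[OF assms(2)]] refl refl]
  show ?thesis unfolding times_complex.sel by simp
qed

lemma Re_inverse_pos: "Re z > 0 \<Longrightarrow> Re (inverse z) > 0" for z :: complex
  by (auto simp: sum_power2_gt_zero_iff intro!: divide_pos_pos)

lemma Re_one_div_pos: "Re z > 0 \<Longrightarrow> Re (1 / z) > 0" for z :: complex
  using Re_inverse_pos[of z] by (simp only: inverse_eq_divide)

lemma Re_pos_not_nonpos: "Re z > 0 \<Longrightarrow> z \<notin> \<real>\<^sub>\<le>\<^sub>0" "Re z > 0 \<Longrightarrow> z \<noteq> 0" for z :: complex
  by (auto simp: complex_nonpos_Reals_iff)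

lemma islimpt_of_real_image:
  assumes "x islimpt A" shows "complex_of_real x islimpt of_real ` A"
proof (rule islimpt_isCont_image[OF assms])
  show "eventually (\<lambda>y. complex_of_real y \<noteq> of_real x) (at x)"
    unfolding of_real_eq_iff by (simp add: eventually_at_filter)
qed simp

lemma powr_mult_Re_pos:
  fixes a b c :: complex
  assumes "Re a > 0" "Re b > 0"
  shows "(a * b) powr c = a powr c * b powr c"
proof -
  have nz: "a \<noteq> 0" "b \<noteq> 0" using assms by auto
  then have "\<bar>Im (Ln a)\<bar> < pi / 2" "\<bar>Im (Ln b)\<bar> < pi / 2" using assms by (intro Re_Ln_pos_lt[THEN iffD2]; simp)+
  then have "Ln (a * b) = Ln a + Ln b" using nz by (intro Ln_times_simple) auto
  then show ?thesis using nz by (simp add: powr_def exp_add distrib_left)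
qed

text \<open>For \<open>Re x > 1\<close> all of \<open>x\<close>, \<open>x - 1\<close>,
  \<open>x + 1\<close>, \<open>1 - 1 / x\<close> and \<open>1 + 1 / x\<close> lie in the right
  half-plane, so their roots multiply without a change of branch. The last form separates the growth
  at infinity from a factor analytic in \<open>1 / x\<^sup>2\<close>.\<close>

lemma sqrt_sq_minus_1_properties:
  assumes "Re x > 1"
  shows "Re (sqrt_sq_minus_1 x) > 0"
    and "(sqrt_sq_minus_1 has_field_derivative x / sqrt_sq_minus_1 x) (at x)"
    and "sqrt_sq_minus_1 x = x * csqrt (1 - 1 / x\<^sup>2)"
proof -
  show p: "Re (sqrt_sq_minus_1 x) > 0"
    unfolding sqrt_sq_minus_1_def by (rule Re_csqrt_mult_pos) (use assms in auto)
  then have nz: "sqrt_sq_minus_1 x \<noteq> 0" by auto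
  then have nz': "csqrt (x - 1) \<noteq> 0" "csqrt (x + 1) \<noteq> 0" by (auto simp: sqrt_sq_minus_1_def)
  have nr: "x - 1 \<notin> \<real>\<^sub>\<le>\<^sub>0" "x + 1 \<notin> \<real>\<^sub>\<le>\<^sub>0" using assms by (auto simp: complex_nonpos_Reals_iff)
  have d: "(csqrt has_field_derivative inverse (2 * csqrt (x - 1))) (at (x - 1))"
      "(csqrt has_field_derivative inverse (2 * csqrt (x + 1))) (at (x + 1))"
    by (rule has_field_derivative_csqrt[OF nr(1)], rule has_field_derivative_csqrt[OF nr(2)])
  have sh: "((\<lambda>x. x - 1) has_field_derivative 1) (at x)" "((\<lambda>x. x + 1) has_field_derivative 1) (at x)"
    by (auto intro!: derivative_eq_intros)
  have alg: "inverse (2 * p) * 1 * q + inverse (2 * q) * 1 * p = (q\<^sup>2 + p\<^sup>2) / (2 * (p * q))"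
    if "p \<noteq> 0" "q \<noteq> 0" for p q :: complex
    using that by (simp add: field_simps power2_eq_square)
  have "(sqrt_sq_minus_1 has_field_derivative
      ((csqrt (x + 1))\<^sup>2 + (csqrt (x - 1))\<^sup>2) / (2 * (csqrt (x - 1) * csqrt (x + 1)))) (at x)"
    unfolding sqrt_sq_minus_1_def[abs_def]
    by (rule DERIV_cong[OF DERIV_mult[OF DERIV_chain2[OF d(1) sh(1)] DERIV_chain2[OF d(2) sh(2)]] alg[OF nz']])
  also have "((csqrt (x + 1))\<^sup>2 + (csqrt (x - 1))\<^sup>2) / (2 * (csqrt (x - 1) * csqrt (x + 1))) = x / sqrt_sq_minus_1 x"
    by (simp add: sqrt_sq_minus_1_def power2_csqrt)
  finally show "(sqrt_sq_minus_1 has_field_derivative x / sqrt_sq_minus_1 x) (at x)" .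
  have x0: "x \<noteq> 0" "Re x > 0" using assms by auto
  have c1: "cmod x > 1" using assms abs_Re_le_cmod[of x] by linarith
  have "cmod (1 / x) < 1" using c1 by (simp add: norm_divide divide_less_eq)
  then have "\<bar>Re (1 / x)\<bar> < 1" using abs_Re_le_cmod[of "1 / x"] by linarith
  then have ip: "Re (1 - 1 / x) > 0" "Re (1 + 1 / x) > 0" by auto
  have q: "x * (1 - 1 / x) = x - 1" "x * (1 + 1 / x) = x + 1" "(1 - 1 / x) * (1 + 1 / x) = 1 - 1 / x\<^sup>2"
    using x0 by (auto simp: field_simps power2_eq_square)
  have 1: "csqrt (x - 1) = csqrt x * csqrt (1 - 1 / x)"
    by (rule csqrt_eqI[OF _ Re_csqrt_mult_pos[OF x0(2) ip(1)]]) (simp only: power_mult_distrib power2_csqrt q)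
  have 2: "csqrt (x + 1) = csqrt x * csqrt (1 + 1 / x)"
    by (rule csqrt_eqI[OF _ Re_csqrt_mult_pos[OF x0(2) ip(2)]]) (simp only: power_mult_distrib power2_csqrt q)
  have 3: "csqrt (1 - 1 / x\<^sup>2) = csqrt (1 - 1 / x) * csqrt (1 + 1 / x)"
    by (rule csqrt_eqI[OF _ Re_csqrt_mult_pos[OF ip]]) (simp only: power_mult_distrib power2_csqrt q)
  have "sqrt_sq_minus_1 x = (csqrt x)\<^sup>2 * (csqrt (1 - 1 / x) * csqrt (1 + 1 / x))"
    unfolding sqrt_sq_minus_1_def 1 2 by (simp add: power2_eq_square mult_ac del: power2_csqrt)
  then show "sqrt_sq_minus_1 x = x * csqrt (1 - 1 / x\<^sup>2)" unfolding 3 by simp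
qed

lemma Re_sigma_pos:
  assumes "y \<in> slit_plane" shows "Re (csqrt (1 - y)) > 0"
  using assms by (intro Re_csqrt_pos) (simp add: mem_slit_plane_iff)

lemma half_plane_in_slit_plane:
  assumes "Re z > 0" shows "(1 - z) / 2 \<in> slit_plane"
  using assms by (simp add: mem_slit_plane_iff complex_nonpos_Reals_iff field_simps)

lemma inverse_square_in_ball:
  assumes "Re x > 1" shows "1 / x\<^sup>2 \<in> ball 0 1"
proof -
  have "cmod x > 1" using assms abs_Re_le_cmod[of x] by linarith
  then have "cmod x ^ 2 > 1" by (simp add: one_less_power)
  then show ?thesis by (simp add: norm_divide norm_power divide_less_eq)
qed

text \<open>The differential equation of \<open>G\<close> stripped of analysis: \<open>s\<close>
  stands for \<open>sqrt (x\<^sup>2 - 1)\<close>, \<open>i\<close> for its inverse, \<open>n\<close>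
  and \<open>m\<close> for \<nu> and \<mu>, and \<open>f\<close>, \<open>g\<close>, \<open>h\<close>
  for the hypergeometric function and its first two derivatives. \<open>L\<close> is the logarithmic
  derivative of the prefactor \<open>W\<close>, \<open>A\<close> the quotient \<open>G1 / W\<close>,
  and the assumption on \<open>h\<close> is the hypergeometric equation.\<close>

lemma whipple_algebra:
  fixes s i x n m f g h :: complex
  assumes iis: "i * s = 1" and x: "x\<^sup>2 = s\<^sup>2 + 1"
    and h: "h = 4 * s\<^sup>2 * ((m + x * i) * g + n * (n + 1) * f)"
  defines "L \<equiv> n * x * i\<^sup>2 - m * i"
  defines "A \<equiv> L * f + g * i ^ 3 / 2"
  shows "s\<^sup>2 * (L * A + ((n * i\<^sup>2 - 2 * n * x\<^sup>2 * i ^ 4 + m * x * i ^ 3) * f + L * (g * i ^ 3 / 2) + h * i ^ 6 / 4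
      - 3 * x * g * i ^ 5 / 2)) + (1 - 2 * n) * x * A - (m + n) * (m - n) * f = 0"
proof -
  have si: "s\<^sup>2 * i\<^sup>2 = 1" using iis by (rule power_is_one)
  define P where "P = x * i"
  define U where "U = n * P - m"
  have P2: "P\<^sup>2 = 1 + i\<^sup>2" using x si by (simp add: P_def power_mult_distrib distrib_right)
  have hi: "h * i\<^sup>2 / 4 = (m + P) * g + n * (n + 1) * f"
  proof -
    have "h * i\<^sup>2 / 4 = (s\<^sup>2 * i\<^sup>2) * ((m + P) * g + n * (n + 1) * f)" unfolding h P_def by simp
    then show ?thesis unfolding si by simp
  qed
  have p: "i ^ 3 = i\<^sup>2 * i" "i ^ 4 = i\<^sup>2 * i\<^sup>2" "i ^ 5 = i\<^sup>2 * (i\<^sup>2 * i)" "i ^ 6 = i\<^sup>2 * (i\<^sup>2 * i\<^sup>2)"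
    by (simp_all add: eval_nat_numeral)
  have L: "L = i * U" by (simp add: L_def U_def P_def power2_eq_square algebra_simps)
  have A: "A = i * (U * f + i\<^sup>2 * g / 2)" unfolding A_def L p by (simp add: algebra_simps)
  have 1: "L * A = i\<^sup>2 * (U * (U * f + i\<^sup>2 * g / 2))" unfolding L A by (simp add: power2_eq_square)
  have 2: "n * i\<^sup>2 - 2 * n * x\<^sup>2 * i ^ 4 + m * x * i ^ 3 = i\<^sup>2 * (n - 2 * n * P\<^sup>2 + m * P)"
    unfolding p P_def by (simp add: power_mult_distrib algebra_simps)
  have 3: "L * (g * i ^ 3 / 2) = i\<^sup>2 * (U * i\<^sup>2 * g / 2)" unfolding L p by (simp add: power2_eq_square)
  have 4: "h * i ^ 6 / 4 = i\<^sup>2 * (i\<^sup>2 * ((m + P) * g + n * (n + 1) * f))" unfolding p hi[symmetric] by simp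
  have 5: "3 * x * g * i ^ 5 / 2 = i\<^sup>2 * (3 * P * i\<^sup>2 * g / 2)" unfolding p P_def by (simp add: mult_ac)
  have 6: "x * A = P * (U * f + i\<^sup>2 * g / 2)" unfolding A P_def by (simp add: mult_ac)
  define E where "E = U * (U * f + i\<^sup>2 * g / 2) + ((n - 2 * n * P\<^sup>2 + m * P) * f + U * i\<^sup>2 * g / 2
      + i\<^sup>2 * ((m + P) * g + n * (n + 1) * f) - 3 * P * i\<^sup>2 * g / 2)"
  have "L * A + ((n * i\<^sup>2 - 2 * n * x\<^sup>2 * i ^ 4 + m * x * i ^ 3) * f + L * (g * i ^ 3 / 2) + h * i ^ 6 / 4
      - 3 * x * g * i ^ 5 / 2) = i\<^sup>2 * E"
    unfolding 1 2 3 4 5 E_def by (simp only: algebra_simps)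
  then have "s\<^sup>2 * (L * A + ((n * i\<^sup>2 - 2 * n * x\<^sup>2 * i ^ 4 + m * x * i ^ 3) * f + L * (g * i ^ 3 / 2) + h * i ^ 6 / 4
      - 3 * x * g * i ^ 5 / 2)) = E"
    using si by (simp only: mult.assoc[symmetric] mult_1_left)
  moreover have "E + (1 - 2 * n) * (x * A) - (m + n) * (m - n) * f = 0"
    unfolding 6 E_def P2 U_def
  proof -
    have "(n * P - m) * ((n * P - m) * f + i\<^sup>2 * g / 2) +
      ((n - 2 * n * (1 + i\<^sup>2) + m * P) * f + (n * P - m) * i\<^sup>2 * g / 2 + i\<^sup>2 * ((m + P) * g + n * (n + 1) * f) - 3 * P * i\<^sup>2 * g / 2) +
      (1 - 2 * n) * (P * ((n * P - m) * f + i\<^sup>2 * g / 2)) - (m + n) * (m - n) * f = (n - n\<^sup>2) * (P\<^sup>2 - (1 + i\<^sup>2)) * f"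
      by (simp add: power2_eq_square field_simps)
    then show "(n * P - m) * ((n * P - m) * f + i\<^sup>2 * g / 2) +
      ((n - 2 * n * (1 + i\<^sup>2) + m * P) * f + (n * P - m) * i\<^sup>2 * g / 2 + i\<^sup>2 * ((m + P) * g + n * (n + 1) * f) - 3 * P * i\<^sup>2 * g / 2) +
      (1 - 2 * n) * (P * ((n * P - m) * f + i\<^sup>2 * g / 2)) - (m + n) * (m - n) * f = 0"
      by (simp add: P2)
  qed
  ultimately show ?thesis by (simp add: mult.assoc)
qed

locale whipple =
  fixes \<nu> \<mu> :: complex
begin

lemma params: "Re (-\<nu>) > 0 \<or> Re (\<nu> + 1) > 0" by auto

definition f :: "complex \<Rightarrow> complex" where "f = hyp2F1_reg (-\<nu>) (\<nu> + 1) (1 + \<mu>)"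

text \<open>The exponents of the equation of \<open>G\<close> at infinity are
  \<open>\<nu> - \<mu>\<close> and \<open>\<nu> + \<mu>\<close>; \<open>G\<close> belongs to the
  first, that is to \<open>-\<alpha>\<close>.\<close>

definition \<alpha> :: complex where "\<alpha> = \<mu> - \<nu>"

lemma f_holomorphic: "f holomorphic_on slit_plane"
  unfolding f_def by (rule hyp2F1_reg_holomorphic_slit_plane[OF params])

lemma f_0: "f 0 = rGamma (1 + \<mu>)"
  unfolding f_def by (rule hyp2F1_reg_0[OF params])

lemma f_derivs:
  assumes "x \<in> slit_plane"
  shows "(f has_field_derivative deriv f x) (at x)" "(deriv f has_field_derivative deriv (deriv f) x) (at x)"
  unfolding f_def by (rule hyp2F1_reg_has_derivs[OF params assms])+

lemma f_ode:
  assumes "x \<in> slit_plane"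
  shows "x * (1 - x) * deriv (deriv f) x + (1 + \<mu> - 2 * x) * deriv f x + \<nu> * (\<nu> + 1) * f x = 0"
  using hyp2F1_reg_ode[OF params assms, of "1 + \<mu>"] by (simp add: f_def)

text \<open>
  Since \<open>(z + 1) / (z - 1) = (x + S)\<^sup>2\<close> for \<open>z = x / S\<close> and \<open>S\<^sup>2 = x\<^sup>2 - 1\<close>, the function \<open>G\<close> below is
  \<open>S powr \<nu> * Legendre_P \<nu> (-\<mu>) (x / S)\<close>, and \<open>g\<close> is its analytic factor at infinity, in \<open>y = 1 / x\<^sup>2\<close>.
  \<open>G1\<close> and \<open>G2\<close> are the first two derivatives of \<open>G\<close>.
\<close>

definition W :: "complex \<Rightarrow> complex" where
  "W x = sqrt_sq_minus_1 x powr \<nu> * (x + sqrt_sq_minus_1 x) powr (-\<mu>)"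

definition \<zeta> :: "complex \<Rightarrow> complex" where
  "\<zeta> x = (1 - x / sqrt_sq_minus_1 x) / 2"

definition G :: "complex \<Rightarrow> complex" where "G x = W x * f (\<zeta> x)"

definition G1 :: "complex \<Rightarrow> complex" where
  "G1 x = (let i = inverse (sqrt_sq_minus_1 x) in
     W x * ((\<nu> * x * i\<^sup>2 - \<mu> * i) * f (\<zeta> x) + deriv f (\<zeta> x) * i ^ 3 / 2))"

definition G2 :: "complex \<Rightarrow> complex" where
  "G2 x = ((\<mu> + \<nu>) * (\<mu> - \<nu>) * G x - (1 - 2 * \<nu>) * x * G1 x) / (x\<^sup>2 - 1)"

definition g :: "complex \<Rightarrow> complex" where
  "g y = csqrt (1 - y) powr \<nu> * (1 + csqrt (1 - y)) powr (-\<mu>) * f ((1 - 1 / csqrt (1 - y)) / 2)"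

lemma zeta_slit:
  assumes "Re x > 1" shows "\<zeta> x \<in> slit_plane"
proof -
  have "1 / x\<^sup>2 \<in> slit_plane" using inverse_square_in_ball[OF assms] unit_ball_subset_slit_plane by blast
  then have s: "Re (csqrt (1 - 1 / x\<^sup>2)) > 0" by (rule Re_sigma_pos)
  have "x \<noteq> 0" using assms by auto
  then have "x / sqrt_sq_minus_1 x = inverse (csqrt (1 - 1 / x\<^sup>2))"
    unfolding sqrt_sq_minus_1_properties(3)[OF assms] by (simp add: field_simps)
  then show ?thesis unfolding \<zeta>_def using Re_inverse_pos[OF s] by (intro half_plane_in_slit_plane) simp
qed

lemma G_derivs:
  assumes x: "Re x > 1"
  shows "(G has_field_derivative G1 x) (at x)" "(G1 has_field_derivative G2 x) (at x)"
proof -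
  define S where "S = sqrt_sq_minus_1"
  define i where "i = (\<lambda>x. inverse (S x))"
  have Sp: "Re (S x) > 0" unfolding S_def by (rule sqrt_sq_minus_1_properties(1)[OF x])
  have S': "(S has_field_derivative x * i x) (at x)"
    unfolding S_def i_def using sqrt_sq_minus_1_properties(2)[OF x] by (simp only: divide_inverse)
  have S0: "S x \<noteq> 0" using Sp by auto
  have S2: "x\<^sup>2 = (S x)\<^sup>2 + 1" by (simp add: S_def sqrt_sq_minus_1_power2)
  have iS: "i x * S x = 1" using S0 by (simp add: i_def)
  have xS: "Re (x + S x) > 0" using Sp x by simp
  have xS0: "x + S x \<noteq> 0" using xS by (rule Re_pos_not_nonpos)
  have i': "(i has_field_derivative - x * i x ^ 3) (at x)"
  proof -
    have "inverse (S x ^ Suc (Suc 0)) = i x * i x" by (simp add: i_def)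
    then have e: "- ((x * i x) * inverse (S x ^ Suc (Suc 0))) = - x * i x ^ 3" by (simp add: power3_eq_cube)
    have "((\<lambda>x. inverse (S x)) has_field_derivative - x * i x ^ 3) (at x)"
      by (rule DERIV_cong[OF DERIV_inverse_fun[OF S' S0] e])
    then show ?thesis by (simp only: i_def)
  qed
  have SP: "S x \<notin> \<real>\<^sub>\<le>\<^sub>0" "x + S x \<notin> \<real>\<^sub>\<le>\<^sub>0" using Sp xS by (auto simp: complex_nonpos_Reals_iff)
  have dp1: "((\<lambda>x. S x powr \<nu>) has_field_derivative \<nu> * x * (i x)\<^sup>2 * S x powr \<nu>) (at x)"
  proof -
    have "((\<lambda>x. S x powr \<nu>) has_field_derivative (\<nu> * S x powr (\<nu> - 1)) * (x * i x)) (at x)"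
      by (rule DERIV_chain2[OF has_field_derivative_powr[OF SP(1)] S'])
    moreover have "S x powr (\<nu> - 1) = S x powr \<nu> * i x" using S0 by (simp add: powr_diff i_def divide_inverse)
    ultimately show ?thesis by (simp only: power2_eq_square mult_ac)
  qed
  have dp2: "((\<lambda>x. (x + S x) powr (-\<mu>)) has_field_derivative - \<mu> * i x * (x + S x) powr (-\<mu>)) (at x)"
  proof -
    have "((\<lambda>x. x + S x) has_field_derivative 1 + x * i x) (at x)" by (intro derivative_intros S')
    then have "((\<lambda>x. (x + S x) powr (-\<mu>)) has_field_derivative (-\<mu> * (x + S x) powr (-\<mu> - 1)) * (1 + x * i x)) (at x)"
      by (rule DERIV_chain2[where g = "\<lambda>x. x + S x" and f = "\<lambda>z. z powr (-\<mu>)", OF has_field_derivative_powr[OF SP(2)]])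
    also have "1 + x * i x = (x + S x) * i x" using iS by (simp add: algebra_simps)
    also have "(-\<mu> * (x + S x) powr (-\<mu> - 1)) * ((x + S x) * i x) = - \<mu> * i x * (x + S x) powr (-\<mu>)"
      using xS0 by (simp add: powr_diff)
    finally show ?thesis .
  qed
  define L where "L = (\<lambda>x. \<nu> * x * (i x)\<^sup>2 - \<mu> * i x)"
  have W': "(W has_field_derivative W x * L x) (at x)"
  proof -
    have Wx: "W = (\<lambda>x. S x powr \<nu> * (x + S x) powr (-\<mu>))" by (rule ext) (simp only: W_def S_def)
    show ?thesis unfolding Wx by (rule DERIV_cong[OF DERIV_mult[OF dp1 dp2]]) (simp add: L_def algebra_simps)
  qed
  have z: "\<zeta> = (\<lambda>x. (1 - x * i x) / 2)" by (rule ext) (simp only: \<zeta>_def S_def i_def divide_inverse)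
  have z': "(\<zeta> has_field_derivative i x ^ 3 / 2) (at x)"
  proof -
    have e: "(0 - (1 * i x + - x * i x ^ 3 * x)) / 2 = (x\<^sup>2 * (i x)\<^sup>2 - 1) * i x / 2"
      by (simp add: eval_nat_numeral algebra_simps)
    have "(\<zeta> has_field_derivative (x\<^sup>2 * (i x)\<^sup>2 - 1) * i x / 2) (at x)"
      unfolding z by (rule DERIV_cong[OF DERIV_cdivide[OF DERIV_diff[OF DERIV_const DERIV_mult[OF DERIV_ident i']]] e])
    also have "x\<^sup>2 * (i x)\<^sup>2 - 1 = (i x)\<^sup>2" unfolding S2 using power_is_one[OF iS] by (simp add: distrib_right)
    finally show ?thesis by (simp add: eval_nat_numeral mult.assoc)
  qed
  note zs = zeta_slit[OF x]
  have f': "((\<lambda>x. f (\<zeta> x)) has_field_derivative deriv f (\<zeta> x) * (i x ^ 3 / 2)) (at x)"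
    by (rule DERIV_chain2[OF f_derivs(1)[OF zs] z'])
  have f'': "((\<lambda>x. deriv f (\<zeta> x)) has_field_derivative deriv (deriv f) (\<zeta> x) * (i x ^ 3 / 2)) (at x)"
    by (rule DERIV_chain2[OF f_derivs(2)[OF zs] z'])
  have G1: "G1 = (\<lambda>x. W x * (L x * f (\<zeta> x) + deriv f (\<zeta> x) * i x ^ 3 / 2))"
    by (simp add: G1_def L_def S_def i_def Let_def fun_eq_iff)
  show "(G has_field_derivative G1 x) (at x)"
    unfolding G_def[abs_def] by (rule DERIV_cong[OF DERIV_mult[OF W' f']]) (simp add: G1 algebra_simps)
  define A where "A = (\<lambda>x. L x * f (\<zeta> x) + deriv f (\<zeta> x) * i x ^ 3 / 2)"
  define h where "h = deriv (deriv f) (\<zeta> x)"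
  have i2': "((\<lambda>x. (i x)\<^sup>2) has_field_derivative - 2 * x * i x ^ 4) (at x)"
    unfolding power2_eq_square by (rule DERIV_cong[OF DERIV_mult[OF i' i']]) (simp add: eval_nat_numeral)
  have i3': "((\<lambda>x. i x ^ 3 / 2) has_field_derivative - 3 * x * i x ^ 5 / 2) (at x)"
  proof -
    have "((\<lambda>x. (i x)\<^sup>2 * i x / 2) has_field_derivative - 3 * x * i x ^ 5 / 2) (at x)"
      by (rule DERIV_cong[OF DERIV_cdivide[OF DERIV_mult[OF i2' i']]]) (simp add: eval_nat_numeral)
    then show ?thesis by (simp add: power3_eq_cube power2_eq_square)
  qed
  have L': "(L has_field_derivative \<nu> * (i x)\<^sup>2 - 2 * \<nu> * x\<^sup>2 * i x ^ 4 + \<mu> * x * i x ^ 3) (at x)"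
    unfolding L_def
    by (rule DERIV_cong[OF DERIV_diff[OF DERIV_mult[OF DERIV_cmult_Id i2'] DERIV_cmult[OF i']]])
       (simp add: power2_eq_square)
  have A': "(A has_field_derivative (\<nu> * (i x)\<^sup>2 - 2 * \<nu> * x\<^sup>2 * i x ^ 4 + \<mu> * x * i x ^ 3) * f (\<zeta> x)
      + L x * (deriv f (\<zeta> x) * i x ^ 3 / 2) + h * i x ^ 6 / 4 - 3 * x * deriv f (\<zeta> x) * i x ^ 5 / 2) (at x)"
  proof -
    have "((\<lambda>x. L x * f (\<zeta> x) + deriv f (\<zeta> x) * (i x ^ 3 / 2)) has_field_derivative
       (\<nu> * (i x)\<^sup>2 - 2 * \<nu> * x\<^sup>2 * i x ^ 4 + \<mu> * x * i x ^ 3) * f (\<zeta> x)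
      + L x * (deriv f (\<zeta> x) * i x ^ 3 / 2) + h * i x ^ 6 / 4 - 3 * x * deriv f (\<zeta> x) * i x ^ 5 / 2) (at x)"
      by (rule DERIV_cong[OF DERIV_add[OF DERIV_mult[OF L' f'] DERIV_mult[OF f'' i3']]])
         (simp add: h_def eval_nat_numeral algebra_simps)
    then show ?thesis by (simp add: A_def)
  qed
  \<comment> \<open>The substitution turns the leading coefficient of the hypergeometric equation
    into a pure power of \<open>i\<close>, so that the equation can be solved for the second
    derivative.\<close>
  have "\<zeta> x * (1 - \<zeta> x) = - (x\<^sup>2 * (i x)\<^sup>2 - 1) / 4" unfolding z by (simp add: power2_eq_square field_simps)
  also have "x\<^sup>2 * (i x)\<^sup>2 - 1 = (i x)\<^sup>2" unfolding S2 using power_is_one[OF iS] by (simp add: distrib_right)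
  finally have zz: "\<zeta> x * (1 - \<zeta> x) = - (i x)\<^sup>2 / 4" .
  have "- (i x)\<^sup>2 / 4 * h + (\<mu> + x * i x) * deriv f (\<zeta> x) + \<nu> * (\<nu> + 1) * f (\<zeta> x) = 0"
  proof -
    have "1 + \<mu> - 2 * \<zeta> x = \<mu> + x * i x" by (simp add: z field_simps)
    then show ?thesis using f_ode[OF zs] unfolding zz h_def by (simp only:)
  qed
  then have e: "(i x)\<^sup>2 * h = 4 * ((\<mu> + x * i x) * deriv f (\<zeta> x) + \<nu> * (\<nu> + 1) * f (\<zeta> x))"
    by (simp add: field_simps)
  have si: "(S x)\<^sup>2 * (i x)\<^sup>2 = 1" using iS by (rule power_is_one)
  have h: "h = 4 * (S x)\<^sup>2 * ((\<mu> + x * i x) * deriv f (\<zeta> x) + \<nu> * (\<nu> + 1) * f (\<zeta> x))"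
  proof -
    have "h = ((S x)\<^sup>2 * (i x)\<^sup>2) * h" unfolding si by simp
    also have "\<dots> = (S x)\<^sup>2 * ((i x)\<^sup>2 * h)" by (simp only: mult.assoc)
    finally show ?thesis unfolding e by (simp only: mult_ac)
  qed
  define A1 where "A1 = (\<nu> * (i x)\<^sup>2 - 2 * \<nu> * x\<^sup>2 * i x ^ 4 + \<mu> * x * i x ^ 3) * f (\<zeta> x)
      + L x * (deriv f (\<zeta> x) * i x ^ 3 / 2) + h * i x ^ 6 / 4 - 3 * x * deriv f (\<zeta> x) * i x ^ 5 / 2"
  have alg: "(S x)\<^sup>2 * (L x * A x + A1) + (1 - 2 * \<nu>) * x * A x - (\<mu> + \<nu>) * (\<mu> - \<nu>) * f (\<zeta> x) = 0"
    using whipple_algebra[OF iS S2 h] by (simp only: A1_def A_def L_def)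
  have G1A: "G1 = (\<lambda>x. W x * A x)" by (simp only: G1 A_def)
  have "(G1 has_field_derivative W x * L x * A x + W x * A1) (at x)"
    unfolding G1A A1_def by (rule DERIV_cong[OF DERIV_mult[OF W' A']]) (simp add: algebra_simps)
  also have "W x * L x * A x + W x * A1 = G2 x"
  proof -
    have "(S x)\<^sup>2 * (W x * L x * A x + W x * A1) = W x * ((S x)\<^sup>2 * (L x * A x + A1))" by (simp add: algebra_simps)
    also have "(S x)\<^sup>2 * (L x * A x + A1) = (\<mu> + \<nu>) * (\<mu> - \<nu>) * f (\<zeta> x) - (1 - 2 * \<nu>) * x * A x" using alg by algebra
    also have "W x * \<dots> = (\<mu> + \<nu>) * (\<mu> - \<nu>) * G x - (1 - 2 * \<nu>) * x * G1 x"
      unfolding G_def G1A by (simp only: algebra_simps)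
    also have "\<dots> = (S x)\<^sup>2 * G2 x" using S0 S2 by (simp add: G2_def)
    finally show ?thesis using S0 by simp
  qed
  finally show "(G1 has_field_derivative G2 x) (at x)" .
qed

lemma G_ode:
  assumes "Re x > 1"
  shows "(x\<^sup>2 - 1) * G2 x + (1 - 2 * \<nu>) * x * G1 x - (\<mu> + \<nu>) * (\<mu> - \<nu>) * G x = 0"
proof -
  have "sqrt_sq_minus_1 x \<noteq> 0" using sqrt_sq_minus_1_properties(1)[OF assms] by auto
  then have "x\<^sup>2 - 1 \<noteq> 0" using sqrt_sq_minus_1_power2[of x] by auto
  then show ?thesis by (simp add: G2_def)
qed

lemma g_holomorphic: "g holomorphic_on slit_plane"
proof -
  have s: "(\<lambda>y. csqrt (1 - y)) holomorphic_on slit_plane"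
    by (intro holomorphic_intros) (simp add: mem_slit_plane_iff)
  have "csqrt (1 - y) \<notin> \<real>\<^sub>\<le>\<^sub>0" "1 + csqrt (1 - y) \<notin> \<real>\<^sub>\<le>\<^sub>0" "csqrt (1 - y) \<noteq> 0" if "y \<in> slit_plane" for y
  proof -
    have "Re (1 + csqrt (1 - y)) > 0" using Re_sigma_pos[OF that] by (simp del: csqrt.simps)
    then show "1 + csqrt (1 - y) \<notin> \<real>\<^sub>\<le>\<^sub>0" by (rule Re_pos_not_nonpos)
    show "csqrt (1 - y) \<notin> \<real>\<^sub>\<le>\<^sub>0" "csqrt (1 - y) \<noteq> 0"
      by (rule Re_pos_not_nonpos[OF Re_sigma_pos[OF that]])+
  qed
  moreover have "(1 - 1 / csqrt (1 - y)) / 2 \<in> slit_plane" if "y \<in> slit_plane" for y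
    by (rule half_plane_in_slit_plane[OF Re_one_div_pos[OF Re_sigma_pos[OF that]]])
  then have "(\<lambda>y. f ((1 - 1 / csqrt (1 - y)) / 2)) holomorphic_on slit_plane"
    using calculation by (intro holomorphic_on_compose_gen[unfolded o_def, OF _ f_holomorphic] holomorphic_intros s) auto
  ultimately show ?thesis
    unfolding g_def[abs_def] by (intro holomorphic_on_mult holomorphic_on_powr holomorphic_intros s) auto
qed

lemma g_0: "g 0 = 2 powr (-\<mu>) * rGamma (1 + \<mu>)"
  by (simp add: g_def f_0)

lemma G_eq_g:
  assumes x: "Re x > 1"
  shows "G x = x powr (-\<alpha>) * g (1 / x\<^sup>2)"
proof -
  define s where "s = csqrt (1 - 1 / x\<^sup>2)"
  have "1 / x\<^sup>2 \<in> slit_plane" using inverse_square_in_ball[OF x] unit_ball_subset_slit_plane by blast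
  then have s: "Re s > 0" unfolding s_def by (rule Re_sigma_pos)
  have x0: "Re x > 0" "x \<noteq> 0" using x by auto
  have S: "sqrt_sq_minus_1 x = x * s" unfolding s_def by (rule sqrt_sq_minus_1_properties(3)[OF x])
  have "W x = (x * s) powr \<nu> * (x * (1 + s)) powr (-\<mu>)" unfolding W_def S by (simp only: distrib_left mult_1_right)
  also have "\<dots> = x powr \<nu> * s powr \<nu> * (x powr (-\<mu>) * (1 + s) powr (-\<mu>))"
    using powr_mult_Re_pos[OF x0(1) s] powr_mult_Re_pos[of x "1 + s"] x0(1) s by simp
  also have "\<dots> = x powr (-\<alpha>) * (s powr \<nu> * (1 + s) powr (-\<mu>))"
  proof -
    have "x powr \<nu> * x powr (-\<mu>) = x powr (-\<alpha>)" by (simp add: \<alpha>_def flip: powr_add)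
    moreover have "x powr \<nu> * s powr \<nu> * (x powr (-\<mu>) * (1 + s) powr (-\<mu>)) = (x powr \<nu> * x powr (-\<mu>)) * (s powr \<nu> * (1 + s) powr (-\<mu>))"
      by (simp only: mult_ac)
    ultimately show ?thesis by (simp only:)
  qed
  finally have "W x = x powr (-\<alpha>) * (s powr \<nu> * (1 + s) powr (-\<mu>))" .
  moreover have "\<zeta> x = (1 - 1 / s) / 2" using x0 by (simp add: \<zeta>_def S)
  ultimately show ?thesis unfolding G_def g_def s_def[symmetric] by (simp only: mult_ac)
qed

text \<open>The analytic factor at infinity of \<open>G1\<close>, whose power there is
  \<open>x powr (-\<alpha> - 1)\<close>. It controls the boundary term at infinity when a total
  derivative in \<open>t\<close> is integrated.\<close>

definition g1 :: "complex \<Rightarrow> complex" where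
  "g1 y = - \<alpha> * g y - 2 * y * deriv g y"

lemma g1_holomorphic: "g1 holomorphic_on slit_plane"
  unfolding g1_def[abs_def] by (intro holomorphic_intros holomorphic_deriv g_holomorphic open_slit_plane)

text \<open>
  In terms of \<open>y = 1 / x\<^sup>2\<close> the differential equation of \<open>G\<close> becomes a hypergeometric one, whose
  solutions regular at \<open>y = 0\<close> are unique up to a factor.
\<close>

lemma power_form_derivs:
  assumes M: "M holomorphic_on ball 0 1" and x: "Re x > 1"
  defines "y \<equiv> 1 / x\<^sup>2"
  shows "((\<lambda>x. x powr (-\<alpha>) * M (1 / x\<^sup>2)) has_field_derivative
            x powr (-\<alpha>) * (- \<alpha> * M y - 2 * y * deriv M y) / x) (at x)" (is ?A)
    and "((\<lambda>x. x powr (-\<alpha>) * (- \<alpha> * M (1 / x\<^sup>2) - 2 * (1 / x\<^sup>2) * deriv M (1 / x\<^sup>2)) / x) has_field_derivative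
            x powr (-\<alpha>) * (\<alpha> * (\<alpha> + 1) * M y + (4 * \<alpha> + 6) * y * deriv M y + 4 * y\<^sup>2 * deriv (deriv M) y) / x\<^sup>2) (at x)" (is ?B)
proof -
  have x0: "x \<noteq> 0" "x \<notin> \<real>\<^sub>\<le>\<^sub>0" using x by (auto simp: complex_nonpos_Reals_iff)
  have yb: "y \<in> ball 0 1" unfolding y_def by (rule inverse_square_in_ball[OF x])
  have dy: "((\<lambda>x. 1 / x\<^sup>2) has_field_derivative - 2 * y / x) (at x)"
    using x0 unfolding y_def by (auto intro!: derivative_eq_intros simp: field_simps eval_nat_numeral)
  have dp: "((\<lambda>x. x powr (-\<alpha>)) has_field_derivative - \<alpha> * x powr (-\<alpha>) / x) (at x)"
    using has_field_derivative_powr[OF x0(2), of "-\<alpha>"] x0 by (simp add: powr_diff)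
  have dM: "((\<lambda>x. M (1 / x\<^sup>2)) has_field_derivative deriv M y * (- 2 * y / x)) (at x)"
    by (rule DERIV_chain2[OF _ dy]) (use holomorphic_derivI[OF M open_ball yb] in \<open>simp add: y_def\<close>)
  have dM': "((\<lambda>x. deriv M (1 / x\<^sup>2)) has_field_derivative deriv (deriv M) y * (- 2 * y / x)) (at x)"
    by (rule DERIV_chain2[OF _ dy]) (use holomorphic_derivI[OF holomorphic_deriv[OF M open_ball] open_ball yb] in \<open>simp add: y_def\<close>)
  show ?A by (rule DERIV_cong[OF DERIV_mult[OF dp dM]], unfold y_def[symmetric], unfold divide_inverse) (simp add: algebra_simps)
  have dN: "((\<lambda>x. - \<alpha> * M (1 / x\<^sup>2) - 2 * (1 / x\<^sup>2) * deriv M (1 / x\<^sup>2)) has_field_derivative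
     - \<alpha> * (deriv M y * (- 2 * y / x)) - (2 * (- 2 * y / x) * deriv M y + 2 * y * (deriv (deriv M) y * (- 2 * y / x)))) (at x)"
    by (rule DERIV_cong[OF DERIV_diff[OF DERIV_cmult[OF dM] DERIV_mult[OF DERIV_cmult[OF dy] dM']]], unfold y_def[symmetric])
       (simp only: algebra_simps)
  have di: "(inverse has_field_derivative - (inverse x * inverse x)) (at x)"
    using DERIV_inverse[OF x0(1)] by (simp add: eval_nat_numeral)
  show ?B
    unfolding divide_inverse[where a = "_ * _"]
    by (rule DERIV_cong[OF DERIV_mult[OF DERIV_mult[OF dp dN] di]], unfold y_def[symmetric], unfold divide_inverse power2_eq_square inverse_mult_distrib)
      (simp add: algebra_simps)
qed

lemma G1_eq_g1:
  assumes x: "Re x > 1"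
  shows "G1 x = x powr (-\<alpha>) * g1 (1 / x\<^sup>2) / x"
proof -
  have gb: "g holomorphic_on ball 0 1"
    using g_holomorphic unit_ball_subset_slit_plane by (rule holomorphic_on_subset)
  have "eventually (\<lambda>x. x \<in> {x. Re x > 1}) (nhds x)"
    by (rule eventually_nhds_in_open[OF open_halfplane_Re]) (use x in simp)
  then have ev: "eventually (\<lambda>x. x powr (-\<alpha>) * g (1 / x\<^sup>2) = G x) (nhds x)"
    by eventually_elim (simp add: G_eq_g)
  have "(G has_field_derivative x powr (-\<alpha>) * g1 (1 / x\<^sup>2) / x) (at x)"
    using power_form_derivs(1)[OF gb x] DERIV_cong_ev[OF refl ev refl] by (simp add: g1_def)
  then show ?thesis using G_derivs(1)[OF x] DERIV_unique by blast
qed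

text \<open>In \<open>y\<close> the exponents at 0 are 0 and \<open>-\<mu>\<close>. The assumption
  on \<mu> keeps the second one from being a positive integer, where a second power series solution
  could enter; under it the constant term determines \<open>M\<close>.\<close>

lemma power_form_unique:
  assumes M: "M holomorphic_on ball 0 1" and M0: "M 0 = 0" and \<mu>: "\<And>n::nat. \<mu> \<noteq> - of_nat (Suc n)"
    and d1: "\<And>x. Re x > 1 \<Longrightarrow> ((\<lambda>x. x powr (-\<alpha>) * M (1 / x\<^sup>2)) has_field_derivative N1 x) (at x)"
    and d2: "\<And>x. Re x > 1 \<Longrightarrow> (N1 has_field_derivative N2 x) (at x)"
    and ode: "\<And>x. Re x > 1 \<Longrightarrow> (x\<^sup>2 - 1) * N2 x + (1 - 2 * \<nu>) * x * N1 x - (\<mu> + \<nu>) * (\<mu> - \<nu>) * (x powr (-\<alpha>) * M (1 / x\<^sup>2)) = 0"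
    and y: "y \<in> ball 0 1"
  shows "M y = 0"
proof -
  define D where "D = (\<lambda>y. y * (4 * (1 - y)) * deriv (deriv M) y + (4 * (1 + \<mu>) - (4 * \<alpha> + 6) * y) * deriv M y - \<alpha> * (\<alpha> + 1) * M y)"
  have Dhol: "D holomorphic_on ball 0 1"
    unfolding D_def by (intro holomorphic_intros holomorphic_deriv M open_ball)
  have D0: "D (1 / x\<^sup>2) = 0" if x: "Re x > 1" for x
  proof -
    define y where "y = 1 / x\<^sup>2"
    have x0: "x \<noteq> 0" "x powr (-\<alpha>) \<noteq> 0" using x by auto
    then have y0: "y \<noteq> 0" by (simp add: y_def)
    note pf = power_form_derivs[OF M, folded y_def]
    have n1: "N1 x = x powr (-\<alpha>) * (- \<alpha> * M (1 / x\<^sup>2) - 2 * (1 / x\<^sup>2) * deriv M (1 / x\<^sup>2)) / x" if "Re x > 1" for x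
      using DERIV_unique[OF d1[OF that] power_form_derivs(1)[OF M that]] .
    have "eventually (\<lambda>x. x \<in> {x. Re x > 1}) (nhds x)"
      by (rule eventually_nhds_in_open[OF open_halfplane_Re]) (use x in simp)
    then have ev: "eventually (\<lambda>x. N1 x = x powr (-\<alpha>) * (- \<alpha> * M (1 / x\<^sup>2) - 2 * (1 / x\<^sup>2) * deriv M (1 / x\<^sup>2)) / x) (nhds x)"
      by eventually_elim (simp add: n1)
    have "(N1 has_field_derivative x powr (-\<alpha>) * (\<alpha> * (\<alpha> + 1) * M y + (4 * \<alpha> + 6) * y * deriv M y + 4 * y\<^sup>2 * deriv (deriv M) y) / x\<^sup>2) (at x)"
      using power_form_derivs(2)[OF M x] DERIV_cong_ev[OF refl ev refl] by (simp add: y_def)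
    then have n2: "N2 x = x powr (-\<alpha>) * (\<alpha> * (\<alpha> + 1) * M y + (4 * \<alpha> + 6) * y * deriv M y + 4 * y\<^sup>2 * deriv (deriv M) y) / x\<^sup>2"
      using DERIV_unique[OF d2[OF x]] by blast
    define A where "A = \<alpha> * (\<alpha> + 1) * M y + (4 * \<alpha> + 6) * y * deriv M y + 4 * y\<^sup>2 * deriv (deriv M) y"
    define B where "B = - \<alpha> * M y - 2 * y * deriv M y"
    have "(x\<^sup>2 - 1) * (c / x\<^sup>2) = (1 - y) * c" for c using x0 by (simp add: y_def field_simps)
    then have e1: "(x\<^sup>2 - 1) * N2 x = (1 - y) * (x powr (-\<alpha>) * A)" using n2 by (simp only: A_def)
    have "N1 x = x powr (-\<alpha>) * B / x" using n1[OF x] by (simp only: B_def y_def)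
    then have e2: "(1 - 2 * \<nu>) * x * N1 x = (1 - 2 * \<nu>) * (x powr (-\<alpha>) * B)" using x0 by simp
    have "(x\<^sup>2 - 1) * N2 x + (1 - 2 * \<nu>) * x * N1 x - (\<mu> + \<nu>) * (\<mu> - \<nu>) * (x powr (-\<alpha>) * M y)
       = (1 - y) * (x powr (-\<alpha>) * A) + (1 - 2 * \<nu>) * (x powr (-\<alpha>) * B) - (\<mu> + \<nu>) * (\<mu> - \<nu>) * (x powr (-\<alpha>) * M y)"
      by (simp only: e1 e2)
    also have "\<dots> = x powr (-\<alpha>) * (y * D y)"
      unfolding D_def A_def B_def \<alpha>_def by (simp add: power2_eq_square algebra_simps)
    finally have "x powr (-\<alpha>) * (y * D y) = 0" using ode[OF x] by (simp add: y_def)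
    then show ?thesis using x0 y0 by (simp add: y_def)
  qed
  \<comment> \<open>The equation is known at the points \<open>1 / x\<^sup>2\<close> with
    \<open>Re x > 1\<close>; the real ones below 1/2 already form a set of uniqueness in the
    disc.\<close>
  have Dz: "D y = 0" if "y \<in> ball 0 1" for y
  proof (rule analytic_continuation[OF Dhol open_ball connected_ball, where U = "(\<lambda>t. of_real t) ` {0<..<1/2::real}" and \<xi> = "of_real (1/4)"])
    show "complex_of_real (1/4) islimpt (\<lambda>t. of_real t) ` {0<..<1/2::real}"
    proof -
      have "(1/4::real) islimpt {0<..<1/2}" by (simp add: open_imp_islimpt interior_limit_point)
      then show ?thesis by (rule islimpt_of_real_image)
    qed
    show "D z = 0" if z: "z \<in> (\<lambda>t. of_real t) ` {0<..<1/2::real}" for z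
    proof -
      obtain t where t: "z = of_real t" "0 < t" "t < 1/2" using z by auto
      have "Re (of_real (1 / sqrt t)) > 1" using t by (simp add: real_sqrt_lt_1_iff)
      from D0[OF this] show ?thesis using t by (simp add: power_divide flip: of_real_power)
    qed
  qed (use that in \<open>auto simp: dist_norm\<close>)
  show ?thesis
  proof (rule ode_unique[where A = "ball 0 1" and ?x0.0 = 0 and N = M and ?N1.0 = "deriv M" and ?N2.0 = "deriv (deriv M)"
      and p = "\<lambda>y. 4 * (1 - y)" and q = "\<lambda>y. 4 * (1 + \<mu>) - (4 * \<alpha> + 6) * y" and r = "\<lambda>_. - (\<alpha> * (\<alpha> + 1))"])
    have nz: "of_nat n + (1 + \<mu>) \<noteq> 0" for n using \<mu>[of n] by (auto simp: add_eq_0_iff algebra_simps)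
    have "4 * (1 + \<mu>) \<noteq> 0" using nz[of 0] unfolding mult_eq_0_iff by simp
    then show "deriv M 0 = 0 \<or> 4 * (1 + \<mu>) - (4 * \<alpha> + 6) * 0 \<noteq> 0" by simp
    have e: "of_nat n * (4 * (1 - 0)) + (4 * (1 + \<mu>) - (4 * \<alpha> + 6) * 0) = 4 * (of_nat n + (1 + \<mu>))" for n
      by (simp add: algebra_simps)
    show "of_nat n * (4 * (1 - 0)) + (4 * (1 + \<mu>) - (4 * \<alpha> + 6) * 0) \<noteq> 0" for n
      unfolding e mult_eq_0_iff using nz[of n] by simp
    show "(y - 0) * (4 * (1 - y)) * deriv (deriv M) y + (4 * (1 + \<mu>) - (4 * \<alpha> + 6) * y) * deriv M y + - (\<alpha> * (\<alpha> + 1)) * M y = 0"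
      if "y \<in> ball 0 1" for y
      using Dz[OF that] by (simp add: D_def)
  qed (use M M0 y in \<open>auto intro!: holomorphic_intros holomorphic_derivI[OF _ open_ball] holomorphic_deriv[OF _ open_ball]\<close>)
qed

end

section \<open>The product formula for real arguments\<close>

lemma beta_dominated_cong:
  assumes "\<And>s t. s \<in> S \<Longrightarrow> t \<in> {0<..<1} \<Longrightarrow> f s t = h s t" "beta_dominated S f"
  shows "beta_dominated S h"
  unfolding beta_dominated_def
proof (intro conjI ballI)
  fix s assume s: "s \<in> S"
  have "f s \<in> borel_measurable (lebesgue_on {0<..<1}) \<longleftrightarrow> h s \<in> borel_measurable (lebesgue_on {0<..<1})"
    by (rule measurable_cong) (use assms(1)[OF s] in auto)
  then show "h s \<in> borel_measurable (lebesgue_on {0<..<1})"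
    using beta_dominated_measurable[OF assms(2) s] by simp
  have "\<exists>e>0. \<exists>M. \<exists>a>0. \<exists>b>0. \<forall>s'\<in>S \<inter> ball s e. \<forall>t\<in>{0<..<1}.
      norm (f s' t) \<le> M * (t powr (a - 1) * (1 - t) powr (b - 1))"
    using assms(2) s unfolding beta_dominated_def by blast
  then obtain e M a b where "e > 0" "a > 0" "b > 0" and *: "\<forall>s'\<in>S \<inter> ball s e. \<forall>t\<in>{0<..<1}.
      norm (f s' t) \<le> M * (t powr (a - 1) * (1 - t) powr (b - 1))" by blast
  moreover have "\<forall>s'\<in>S \<inter> ball s e. \<forall>t\<in>{0<..<1}. norm (h s' t) \<le> M * (t powr (a - 1) * (1 - t) powr (b - 1))"
    using * assms(1) by simp
  ultimately show "\<exists>e>0. \<exists>M. \<exists>a>0. \<exists>b>0. \<forall>s'\<in>S \<inter> ball s e. \<forall>t\<in>{0<..<1}.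
      norm (h s' t) \<le> M * (t powr (a - 1) * (1 - t) powr (b - 1))" by blast
qed

text \<open>
  The operator of \<open>G\<close>'s differential equation, applied in \<open>x\<close> to \<open>G (x b + S r t)\<close> with
  \<open>S\<^sup>2 = x\<^sup>2 - 1\<close> and \<open>r\<^sup>2 = b\<^sup>2 - 1\<close>, leaves an expression that is a total derivative in \<open>t\<close>.
\<close>

lemma total_derivative_algebra:
  fixes S i x b r t \<nu> \<kappa> g0 g1 g2 :: complex
  assumes iS: "i * S = 1" and S2: "S\<^sup>2 = x\<^sup>2 - 1" and r2: "r\<^sup>2 = b\<^sup>2 - 1"
  defines "X \<equiv> x * b + S * r * t" and "X1 \<equiv> b + x * i * r * t" and "X2 \<equiv> - r * t * i ^ 3"
  assumes ode: "(X\<^sup>2 - 1) * g2 + (1 - 2 * \<nu>) * X * g1 - \<kappa> * g0 = 0"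
  shows "(x\<^sup>2 - 1) * (g2 * X1\<^sup>2 + g1 * X2) + (1 - 2 * \<nu>) * x * (g1 * X1) - \<kappa> * g0
     = - 2 * \<nu> * r * i * t * g1 + r\<^sup>2 * (t\<^sup>2 - 1) * g2"
proof -
  have SX1: "S * X1 = S * b + x * r * t"
  proof -
    have "S * X1 = S * b + (i * S) * (x * r * t)" unfolding X1_def by (simp add: algebra_simps)
    then show ?thesis unfolding iS by simp
  qed
  have x2: "x\<^sup>2 = S\<^sup>2 + 1" using S2 by simp
  have b2: "b\<^sup>2 = r\<^sup>2 + 1" using r2 by simp
  have 1: "S\<^sup>2 * X1\<^sup>2 = (X\<^sup>2 - 1) + r\<^sup>2 * (t\<^sup>2 - 1)"
  proof -
    have "S\<^sup>2 * X1\<^sup>2 = (S * b + x * r * t)\<^sup>2" unfolding SX1[symmetric] by (simp add: power_mult_distrib)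
    also have "\<dots> = S\<^sup>2 * b\<^sup>2 + 2 * S * b * x * r * t + x\<^sup>2 * r\<^sup>2 * t\<^sup>2" by (simp add: power2_eq_square algebra_simps)
    also have "\<dots> = (x\<^sup>2 * b\<^sup>2 + 2 * S * b * x * r * t + S\<^sup>2 * r\<^sup>2 * t\<^sup>2 - 1) + r\<^sup>2 * (t\<^sup>2 - 1)"
      unfolding x2 b2 by (simp add: algebra_simps)
    also have "x\<^sup>2 * b\<^sup>2 + 2 * S * b * x * r * t + S\<^sup>2 * r\<^sup>2 * t\<^sup>2 = X\<^sup>2"
      unfolding X_def by (simp add: power2_eq_square algebra_simps)
    finally show ?thesis .
  qed
  have 2: "S\<^sup>2 * X2 = - r * t * i"
  proof -
    have "S\<^sup>2 * X2 = (i * S)\<^sup>2 * (- r * t * i)" unfolding X2_def by (simp add: power_mult_distrib eval_nat_numeral)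
    then show ?thesis unfolding iS by simp
  qed
  have 3: "x * X1 = X + r * t * i"
  proof -
    have "S = (i * S) * S" unfolding iS by simp
    also have "\<dots> = i * S\<^sup>2" by (simp add: power2_eq_square)
    finally have S: "S = i * (x\<^sup>2 - 1)" unfolding S2 .
    have "x * X1 = x * b + x\<^sup>2 * i * r * t" unfolding X1_def by (simp add: power2_eq_square algebra_simps)
    also have "\<dots> = x * b + (i * (x\<^sup>2 - 1)) * r * t + r * t * i" by (simp add: algebra_simps)
    finally show ?thesis unfolding X_def S[symmetric] .
  qed
  have "(x\<^sup>2 - 1) * (g2 * X1\<^sup>2 + g1 * X2) + (1 - 2 * \<nu>) * x * (g1 * X1) - \<kappa> * g0
     = (S\<^sup>2 * X1\<^sup>2) * g2 + (S\<^sup>2 * X2) * g1 + (1 - 2 * \<nu>) * (x * X1) * g1 - \<kappa> * g0"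
    unfolding S2[symmetric] by (simp add: algebra_simps)
  also have "\<dots> = ((X\<^sup>2 - 1) * g2 + (1 - 2 * \<nu>) * X * g1 - \<kappa> * g0) + (- 2 * \<nu> * r * i * t * g1 + r\<^sup>2 * (t\<^sup>2 - 1) * g2)"
    unfolding 1 2 3 by (simp add: algebra_simps)
  finally show ?thesis unfolding ode by simp
qed

text \<open>The base may reach 0: a positive real part of the exponent makes the power tend to
  \<open>0 powr a = 0\<close> there. This is what removes the boundary terms later.\<close>

lemma continuous_on_of_real_powr:
  fixes a :: complex
  assumes "Re a > 0" "continuous_on S h" "\<And>v. v \<in> S \<Longrightarrow> h v \<ge> (0::real)"
  shows "continuous_on S (\<lambda>v. of_real (h v) powr a)"
proof (rule continuous_on_powr_complex)
  show "S \<subseteq> {z. 0 \<le> Re (complex_of_real (h z)) \<or> Im (complex_of_real (h z)) \<noteq> 0}" using assms by auto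
qed (use assms in \<open>auto intro!: continuous_intros\<close>)

lemma of_real_powr_has_vector_derivative:
  fixes a :: complex
  assumes "v > 0"
  shows "((\<lambda>v. of_real v powr a) has_vector_derivative a * of_real v powr a / of_real v) (at v)"
proof -
  have "((\<lambda>z. z powr a) has_field_derivative a * of_real v powr (a - 1)) (at (of_real v))"
    by (rule has_field_derivative_powr) (use assms in \<open>auto simp: complex_nonpos_Reals_iff\<close>)
  then have "((\<lambda>v. of_real v powr a) has_vector_derivative a * of_real v powr (a - 1)) (at v)"
    by (rule has_vector_derivative_real_field)
  then show ?thesis using assms by (simp add: powr_diff)
qed

lemma of_real_one_minus_powr_has_vector_derivative:
  fixes a :: complex
  assumes "v < 1"
  shows "((\<lambda>v. of_real (1 - v) powr a) has_vector_derivative - a * of_real (1 - v) powr a / of_real (1 - v)) (at v)"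
proof -
  have "((\<lambda>w. of_real w powr a) \<circ> (\<lambda>v. 1 - v) has_vector_derivative (-1) *\<^sub>R (a * of_real (1 - v) powr a / of_real (1 - v))) (at v)"
  proof (rule vector_diff_chain_at)
    show "((\<lambda>v::real. 1 - v) has_vector_derivative - 1) (at v)" by (auto intro!: derivative_eq_intros)
    show "((\<lambda>w. of_real w powr a) has_vector_derivative a * of_real (1 - v) powr a / of_real (1 - v)) (at (1 - v))"
      by (rule of_real_powr_has_vector_derivative) (use assms in simp)
  qed
  then show ?thesis by (simp add: o_def)
qed

text \<open>The first two inequalities are absolute convergence at the upper and at the lower end
  point. The third condition makes the equation and the power form at infinity determine
  \<open>G\<close> up to a factor, and keeps the leading coefficient \<open>g 0\<close> different
  from 0.\<close>

locale convergent_whipple = whipple +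
  assumes nu: "Re \<nu> < 0" and k: "Re (\<nu> + \<mu>) > -1" and mu: "\<And>n::nat. \<mu> \<noteq> - of_nat (Suc n)"
begin

definition R :: "real \<Rightarrow> real" where "R b = sqrt (b\<^sup>2 - 1)"

definition X :: "real \<Rightarrow> complex \<Rightarrow> real \<Rightarrow> complex" where
  "X b x v = x * of_real b + sqrt_sq_minus_1 x * of_real (R b) * of_real (2 / v - 1)"

text \<open>Up to a constant factor this is the weight
  \<open>(t\<^sup>2 - 1) powr (-\<nu> - 1) dt\<close> after the substitution
  \<open>t = 2 / v - 1\<close>.\<close>

definition \<omega> :: "real \<Rightarrow> complex" where
  "\<omega> v = of_real v powr (2 * \<nu>) * of_real (1 - v) powr (- \<nu> - 1)"

text \<open>
  The variable \<open>t > 1\<close> is \<open>2 / v - 1\<close>. As \<open>sqrt (x\<^sup>2 - 1) = x sqrt (1 - y)\<close> with \<open>y = 1 / x\<^sup>2\<close>, one has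
  \<open>X b x v = (b x / v) dd b y v\<close> and \<open>1 / (X b x v)\<^sup>2 = yy b y v\<close>, which exhibits the integral \<open>I0\<close> as
  \<open>x powr (-\<alpha>)\<close> times a function \<open>\<Psi>\<close> holomorphic at \<open>y = 0\<close>.
\<close>

definition dd :: "real \<Rightarrow> complex \<Rightarrow> real \<Rightarrow> complex" where
  "dd b y v = of_real v + csqrt (1 - y) * of_real (R b / b * (2 - v))"

definition yy :: "real \<Rightarrow> complex \<Rightarrow> real \<Rightarrow> complex" where
  "yy b y v = y * (of_real (v / b) / dd b y v)\<^sup>2"

definition ph :: "real \<Rightarrow> complex \<Rightarrow> real \<Rightarrow> complex" where
  "ph b y v = of_real b powr (-\<alpha>) * dd b y v powr (-\<alpha>) * g (yy b y v)"

definition \<psi> :: "real \<Rightarrow> complex \<Rightarrow> real \<Rightarrow> complex" where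
  "\<psi> b y v = of_real v powr (\<nu> + \<mu> + 1 - 1) * of_real (1 - v) powr (- \<nu> - 1) * ph b y v"

definition \<Psi> :: "real \<Rightarrow> complex \<Rightarrow> complex" where
  "\<Psi> b y = integral {0<..<1} (\<psi> b y)"

definition I0 :: "real \<Rightarrow> complex \<Rightarrow> complex" where
  "I0 b x = integral {0<..<1} (\<lambda>v. G (X b x v) * \<omega> v)"

lemma R_pos: "b > 1 \<Longrightarrow> R b > 0"
  by (simp add: R_def)

lemma R_squared: "b > 1 \<Longrightarrow> (R b)\<^sup>2 = b\<^sup>2 - 1"
  by (simp add: R_def)

lemma dd_Re:
  assumes b: "b > 1" and y: "y \<in> ball 0 1" and v: "v \<in> {0..1}"
  shows "Re (dd b y v) > 0" "v \<le> Re (dd b y v)"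
proof -
  have "Re (csqrt (1 - y)) > 0" using y unit_ball_subset_slit_plane by (intro Re_sigma_pos) blast
  moreover have "R b / b * (2 - v) > 0" using R_pos[OF b] b v by simp
  moreover have "Re (dd b y v) = v + Re (csqrt (1 - y)) * (R b / b * (2 - v))"
    unfolding dd_def by (simp only: plus_complex.sel times_complex.sel Re_complex_of_real Im_complex_of_real)
  ultimately have "Re (dd b y v) > v" by (metis less_add_same_cancel1 mult_pos_pos)
  then show "Re (dd b y v) > 0" "v \<le> Re (dd b y v)" using v by auto
qed

text \<open>Since \<open>v \<le> Re (dd b y v)\<close> and \<open>b > 1\<close>, the quotient whose
  square multiplies \<open>y\<close> has modulus at most 1. So the expansion of \<open>G\<close> at
  infinity is valid on the whole range of integration at once.\<close>

lemma yy_ball: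
  assumes b: "b > 1" and y: "y \<in> ball 0 1" and v: "v \<in> {0..1}"
  shows "yy b y v \<in> ball 0 1"
proof -
  have "v \<le> cmod (dd b y v)" using dd_Re(2)[OF assms] complex_Re_le_cmod order_trans by blast
  moreover have "cmod (dd b y v) > 0" using dd_Re(1)[OF assms] by auto
  moreover have "v / b \<le> v" using b v by (simp add: divide_le_eq mult_le_cancel_left1)
  moreover have "cmod (of_real (v / b) / dd b y v) = (v / b) / cmod (dd b y v)"
    using b v by (simp add: norm_divide norm_mult)
  ultimately have "cmod (of_real (v / b) / dd b y v) \<le> 1"
    by (simp only: divide_le_eq_1_pos)
  then have "cmod (of_real (v / b) / dd b y v) ^ 2 \<le> 1" by (simp add: power_le_one)
  then have "cmod y * cmod (of_real (v / b) / dd b y v) ^ 2 \<le> cmod y" by (simp add: mult_left_le)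
  then show ?thesis using y by (simp add: yy_def norm_mult norm_power del: of_real_divide)
qed

lemma X_eq:
  assumes b: "b > 1" and x: "Re x > 1" and v: "v > 0"
  shows "X b x v = of_real (b / v) * (x * dd b (1 / x\<^sup>2) v)"
proof -
  have S: "sqrt_sq_minus_1 x = x * csqrt (1 - 1 / x\<^sup>2)" by (rule sqrt_sq_minus_1_properties(3)[OF x])
  have e: "R b * (2 / v - 1) = b / v * (R b / b * (2 - v))" using b v by (simp add: field_simps)
  have "X b x v = x * of_real b + x * (csqrt (1 - 1 / x\<^sup>2) * of_real (R b * (2 / v - 1)))"
    unfolding X_def S by (simp only: of_real_mult mult.assoc)
  also have "\<dots> = of_real (b / v) * (x * (of_real v + csqrt (1 - 1 / x\<^sup>2) * of_real (R b / b * (2 - v))))"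
  proof -
    have "b = b / v * v" using v by simp
    then have "complex_of_real b = of_real (b / v) * of_real v" by (metis of_real_mult)
    then show ?thesis unfolding e of_real_mult[of "b / v"] by (simp only: distrib_left mult_ac)
  qed
  finally show ?thesis by (simp only: dd_def)
qed

lemma X_Re:
  assumes b: "b > 1" and x: "Re x > 1" and v: "v \<in> {0<..1}"
  shows "Re (X b x v) > 1"
proof -
  have "Re (sqrt_sq_minus_1 x) * (R b * (2 / v - 1)) > 0"
    using sqrt_sq_minus_1_properties(1)[OF x] R_pos[OF b] v by (intro mult_pos_pos) (auto simp: field_simps)
  moreover have "Re x * b > 1" using x b by (simp add: less_1_mult)
  moreover have "X b x v = x * of_real b + sqrt_sq_minus_1 x * of_real (R b * (2 / v - 1))"
    unfolding X_def by (simp only: of_real_mult mult.assoc)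
  then have "Re (X b x v) = Re x * b + Re (sqrt_sq_minus_1 x) * (R b * (2 / v - 1))"
    by (simp only: plus_complex.sel times_complex.sel Re_complex_of_real Im_complex_of_real)
  ultimately show ?thesis by linarith
qed

lemma X_powr:
  assumes b: "b > 1" and x: "Re x > 1" and v: "v \<in> {0<..<1}"
  shows "X b x v powr (-\<alpha>) = x powr (-\<alpha>) * (of_real v powr \<alpha> * (of_real b powr (-\<alpha>) * dd b (1 / x\<^sup>2) v powr (-\<alpha>)))"
    and "1 / (X b x v)\<^sup>2 = yy b (1 / x\<^sup>2) v"
proof -
  have d: "Re (dd b (1 / x\<^sup>2) v) > 0" using dd_Re(1)[OF b inverse_square_in_ball[OF x]] v by simp
  have v0: "v > 0" using v by simp
  note X = X_eq[OF b x v0]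
  have "X b x v powr (-\<alpha>) = of_real (b / v) powr (-\<alpha>) * (x * dd b (1 / x\<^sup>2) v) powr (-\<alpha>)"
    unfolding X by (rule powr_times_real_left) (use b v in auto)
  also have "(x * dd b (1 / x\<^sup>2) v) powr (-\<alpha>) = x powr (-\<alpha>) * dd b (1 / x\<^sup>2) v powr (-\<alpha>)"
    by (rule powr_mult_Re_pos) (use x d in auto)
  also have "complex_of_real (b / v) powr (-\<alpha>) = of_real b powr (-\<alpha>) * of_real v powr \<alpha>"
  proof -
    have "complex_of_real (b / v) = of_real b * of_real (inverse v)" by (simp add: divide_inverse)
    then have "complex_of_real (b / v) powr (-\<alpha>) = of_real b powr (-\<alpha>) * of_real (inverse v) powr (-\<alpha>)"
      by (simp only:) (rule powr_times_real_left, use b in auto)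
    also have "complex_of_real (inverse v) powr (-\<alpha>) = of_real v powr \<alpha>"
      unfolding powr_def using v by (simp add: Ln_of_real ln_inverse del: of_real_inverse)
    finally show ?thesis .
  qed
  finally show "X b x v powr (-\<alpha>) = x powr (-\<alpha>) * (of_real v powr \<alpha> * (of_real b powr (-\<alpha>) * dd b (1 / x\<^sup>2) v powr (-\<alpha>)))"
    by (simp only: mult_ac)
  show "1 / (X b x v)\<^sup>2 = yy b (1 / x\<^sup>2) v"
    unfolding X yy_def using b v by (simp add: power_mult_distrib power_divide)
qed

lemma integrand_eq:
  assumes b: "b > 1" and x: "Re x > 1" and v: "v \<in> {0<..<1}"
  shows "G (X b x v) * \<omega> v = x powr (-\<alpha>) * \<psi> b (1 / x\<^sup>2) v"
proof -
  have "Re (X b x v) > 1" using X_Re[OF b x] v by simp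
  from G_eq_g[OF this] have "G (X b x v) * \<omega> v =
     x powr (-\<alpha>) * ((of_real v powr \<alpha> * of_real v powr (2 * \<nu>)) * of_real (1 - v) powr (- \<nu> - 1) * ph b (1 / x\<^sup>2) v)"
    unfolding X_powr[OF assms] ph_def \<omega>_def by (simp only: mult_ac)
  \<comment> \<open>At \<open>v = 0\<close>, that is \<open>t = \<infinity>\<close>, the decay of
    \<open>G\<close> meets the weight: \<open>\<alpha> + 2 * \<nu> = \<nu> + \<mu>\<close>. The form
    \<open>+ 1 - 1\<close> is that of a beta kernel.\<close>
  also have "of_real v powr \<alpha> * of_real v powr (2 * \<nu>) = complex_of_real v powr (\<nu> + \<mu> + 1 - 1)"
    by (simp add: \<alpha>_def flip: powr_add)
  finally show ?thesis by (simp only: \<psi>_def)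
qed

lemma dd_continuous:
  assumes "continuous_on T h" "continuous_on T w" "\<And>s. s \<in> T \<Longrightarrow> h s \<in> ball 0 1"
  shows "continuous_on T (\<lambda>s. dd b (h s) (w s))"
proof -
  have "1 - h s \<notin> \<real>\<^sub>\<le>\<^sub>0" if "s \<in> T" for s
    using assms(3)[OF that] unit_ball_subset_slit_plane mem_slit_plane_iff by blast
  moreover have "csqrt holomorphic_on - \<real>\<^sub>\<le>\<^sub>0" by (intro holomorphic_intros) auto
  ultimately have "continuous_on T (\<lambda>s. csqrt (1 - h s))"
    by (intro continuous_on_compose2[OF holomorphic_on_imp_continuous_on, of csqrt "- \<real>\<^sub>\<le>\<^sub>0"] continuous_intros assms) auto
  then show ?thesis unfolding dd_def by (intro continuous_intros assms) 
qed

lemma yy_continuous: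
  assumes "continuous_on T h" "continuous_on T w" "\<And>s. s \<in> T \<Longrightarrow> h s \<in> ball 0 1" "\<And>s. s \<in> T \<Longrightarrow> w s \<in> {0..1}" "b > 1"
  shows "continuous_on T (\<lambda>s. yy b (h s) (w s))"
proof -
  have "dd b (h s) (w s) \<noteq> 0" if "s \<in> T" for s
    by (rule Re_pos_not_nonpos(2), rule dd_Re) (use assms that in auto)
  then show ?thesis unfolding yy_def by (intro continuous_intros assms dd_continuous) (use assms in auto)
qed

lemma composed_continuous:
  assumes c: "continuous_on T h" "continuous_on T w" "\<And>s. s \<in> T \<Longrightarrow> h s \<in> ball 0 1" "\<And>s. s \<in> T \<Longrightarrow> w s \<in> {0..1}" "b > 1"
    and p: "p holomorphic_on slit_plane"
  shows "continuous_on T (\<lambda>s. dd b (h s) (w s) powr (-\<alpha>))" "continuous_on T (\<lambda>s. p (yy b (h s) (w s)))"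
proof -
  have "dd b (h s) (w s) \<notin> \<real>\<^sub>\<le>\<^sub>0" if "s \<in> T" for s
    by (rule Re_pos_not_nonpos(1), rule dd_Re) (use c that in auto)
  then show "continuous_on T (\<lambda>s. dd b (h s) (w s) powr (-\<alpha>))"
    by (intro continuous_on_cpowr dd_continuous c continuous_intros) auto
  have "yy b (h s) (w s) \<in> slit_plane" if "s \<in> T" for s
    using yy_ball[of b "h s" "w s"] c that unit_ball_subset_slit_plane by blast
  then show "continuous_on T (\<lambda>s. p (yy b (h s) (w s)))"
    by (intro continuous_on_compose2[OF holomorphic_on_imp_continuous_on[OF p] yy_continuous] c) auto
qed

lemma ph_composed_continuous:
  assumes c: "continuous_on T h" "continuous_on T w" "\<And>s. s \<in> T \<Longrightarrow> h s \<in> ball 0 1" "\<And>s. s \<in> T \<Longrightarrow> w s \<in> {0..1}" "b > 1"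
  shows "continuous_on T (\<lambda>s. ph b (h s) (w s))"
  unfolding ph_def
  by (intro continuous_on_mult continuous_on_const composed_continuous[OF c g_holomorphic])

lemma ph_continuous:
  assumes "b > 1" shows "continuous_on (ball 0 1 \<times> {0..1}) (\<lambda>(y, v). ph b y v)"
  unfolding case_prod_unfold
  by (rule ph_composed_continuous) (use assms in \<open>auto intro: continuous_on_fst continuous_on_snd continuous_on_id\<close>)

lemma ph_holomorphic:
  assumes b: "b > 1" and v: "v \<in> {0..1}" shows "(\<lambda>y. ph b y v) holomorphic_on ball 0 1"
proof -
  have "1 - y \<notin> \<real>\<^sub>\<le>\<^sub>0" if "y \<in> ball 0 1" for y :: complex
    using that unit_ball_subset_slit_plane mem_slit_plane_iff by blast
  then have d: "(\<lambda>y. dd b y v) holomorphic_on ball 0 1" unfolding dd_def by (intro holomorphic_intros) auto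
  have d0: "dd b y v \<notin> \<real>\<^sub>\<le>\<^sub>0" "dd b y v \<noteq> 0" if "y \<in> ball 0 1" for y
    by (rule Re_pos_not_nonpos[OF dd_Re(1)[OF b that v]])+
  have "(\<lambda>y. yy b y v) holomorphic_on ball 0 1" unfolding yy_def by (intro holomorphic_intros d d0)
  then have "(\<lambda>y. g (yy b y v)) holomorphic_on ball 0 1"
    by (rule holomorphic_on_compose_gen[unfolded o_def, OF _ g_holomorphic])
      (use yy_ball[OF b _ v] unit_ball_subset_slit_plane in blast)
  then show ?thesis unfolding ph_def by (intro holomorphic_intros holomorphic_on_powr d d0)
qed

lemma psi_dominated:
  assumes "b > 1" shows "beta_dominated (ball 0 1) (\<psi> b)"
  unfolding \<psi>_def[abs_def]
  by (rule beta_dominatedI_compact[where A = "\<lambda>_. \<nu> + \<mu> + 1" and B = "\<lambda>_. - \<nu>"])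
     (use k nu ph_continuous[OF assms] in auto)

lemma Psi_holomorphic:
  assumes "b > 1" shows "\<Psi> b holomorphic_on ball 0 1"
  unfolding \<Psi>_def[abs_def]
  by (rule beta_dominated_holomorphic[OF psi_dominated[OF assms] open_ball], unfold \<psi>_def,
      intro holomorphic_intros ph_holomorphic) (use assms in auto)

lemma I0_eq:
  assumes "b > 1" "Re x > 1" shows "I0 b x = x powr (-\<alpha>) * \<Psi> b (1 / x\<^sup>2)"
proof -
  have "I0 b x = integral {0<..<1} (\<lambda>v. x powr (-\<alpha>) * \<psi> b (1 / x\<^sup>2) v)"
    unfolding I0_def by (rule integral_cong) (rule integrand_eq[OF assms])
  then show ?thesis by (simp add: \<Psi>_def)
qed

section \<open>The differential equation of the integral\<close>

abbreviation D1 :: "complex set" where "D1 \<equiv> {x. Re x > 1}"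

lemma F_dominated:
  assumes b: "b > 1" shows "beta_dominated D1 (\<lambda>x v. G (X b x v) * \<omega> v)"
proof (rule beta_dominated_cong)
  show "beta_dominated D1 (\<lambda>x v. of_real v powr (\<nu> + \<mu> + 1 - 1) * of_real (1 - v) powr (- \<nu> - 1) * (x powr (-\<alpha>) * ph b (1 / x\<^sup>2) v))"
  proof (rule beta_dominatedI_compact[where A = "\<lambda>_. \<nu> + \<mu> + 1" and B = "\<lambda>_. - \<nu>"])
    have "continuous_on (D1 \<times> {0..1::real}) (\<lambda>s. ph b (1 / (fst s)\<^sup>2) (snd s))"
    proof (rule ph_composed_continuous)
      show "continuous_on (D1 \<times> {0..1::real}) (\<lambda>s. 1 / (fst s)\<^sup>2)" by (intro continuous_intros) auto
      show "1 / (fst s)\<^sup>2 \<in> ball 0 1" if "s \<in> D1 \<times> {0..1::real}" for s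
        by (rule inverse_square_in_ball) (use that in auto)
    qed (use b in \<open>auto intro: continuous_on_snd continuous_on_id\<close>)
    moreover have "x \<notin> \<real>\<^sub>\<le>\<^sub>0" if "x \<in> D1" for x using that by (auto simp: complex_nonpos_Reals_iff)
    then have "continuous_on (D1 \<times> {0..1::real}) (\<lambda>s. fst s powr (-\<alpha>))"
      by (intro continuous_on_cpowr continuous_intros) auto
    ultimately show "continuous_on (D1 \<times> {0..1}) (\<lambda>(x, v). x powr (-\<alpha>) * ph b (1 / x\<^sup>2) v)"
      unfolding case_prod_unfold by (intro continuous_on_mult)
  qed (use k nu in auto)
  show "of_real v powr (\<nu> + \<mu> + 1 - 1) * of_real (1 - v) powr (- \<nu> - 1) * (x powr (-\<alpha>) * ph b (1 / x\<^sup>2) v) = G (X b x v) * \<omega> v"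
    if "x \<in> D1" "v \<in> {0<..<1}" for x v
    using integrand_eq[OF b _ that(2), of x] that(1) by (simp add: \<psi>_def mult_ac)
qed

definition X1 :: "real \<Rightarrow> complex \<Rightarrow> real \<Rightarrow> complex" where
  "X1 b x v = of_real b + x * inverse (sqrt_sq_minus_1 x) * of_real (R b) * of_real (2 / v - 1)"

definition X2 :: "real \<Rightarrow> complex \<Rightarrow> real \<Rightarrow> complex" where
  "X2 b x v = - of_real (R b) * of_real (2 / v - 1) * inverse (sqrt_sq_minus_1 x) ^ 3"

lemma X_derivs:
  assumes x: "Re x > 1"
  shows "((\<lambda>x. X b x v) has_field_derivative X1 b x v) (at x)" "((\<lambda>x. X1 b x v) has_field_derivative X2 b x v) (at x)"
proof -
  define i where "i = inverse (sqrt_sq_minus_1 x)"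
  have S': "(sqrt_sq_minus_1 has_field_derivative x * i) (at x)"
    using sqrt_sq_minus_1_properties(2)[OF x] by (simp only: divide_inverse i_def)
  have S0: "sqrt_sq_minus_1 x \<noteq> 0" using sqrt_sq_minus_1_properties(1)[OF x] by (rule Re_pos_not_nonpos)
  have si: "(sqrt_sq_minus_1 x)\<^sup>2 * i\<^sup>2 = 1" using S0 by (intro power_is_one) (simp add: i_def)
  have e: "- ((x * i) * inverse (sqrt_sq_minus_1 x ^ Suc (Suc 0))) = - x * i ^ 3" by (simp add: i_def power3_eq_cube)
  have i': "((\<lambda>x. inverse (sqrt_sq_minus_1 x)) has_field_derivative - x * i ^ 3) (at x)"
    by (rule DERIV_cong[OF DERIV_inverse_fun[OF S' S0] e])
  define c where "c = complex_of_real (R b) * of_real (2 / v - 1)"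
  have "((\<lambda>x. x * of_real b + sqrt_sq_minus_1 x * c) has_field_derivative of_real b + x * i * c) (at x)"
    by (rule DERIV_cong[OF DERIV_add[OF DERIV_cmult_right[OF DERIV_ident] DERIV_cmult_right[OF S']]]) simp
  then show "((\<lambda>x. X b x v) has_field_derivative X1 b x v) (at x)"
    by (simp only: X_def[abs_def] X1_def c_def i_def mult.assoc)
  have "((\<lambda>x. of_real b + x * inverse (sqrt_sq_minus_1 x) * c) has_field_derivative
      0 + (1 * inverse (sqrt_sq_minus_1 x) + - x * i ^ 3 * x) * c) (at x)"
    by (rule DERIV_add[OF DERIV_const DERIV_cmult_right[OF DERIV_mult[OF DERIV_ident i']]])
  also have "0 + (1 * inverse (sqrt_sq_minus_1 x) + - x * i ^ 3 * x) * c = - c * i ^ 3"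
  proof -
    have "i = (sqrt_sq_minus_1 x)\<^sup>2 * i\<^sup>2 * i" unfolding si by simp
    also have "\<dots> = (x\<^sup>2 - 1) * i ^ 3" unfolding sqrt_sq_minus_1_power2 by (simp add: eval_nat_numeral)
    finally have "i + - x * i ^ 3 * x = - (i ^ 3)" by (simp add: power2_eq_square algebra_simps)
    then show ?thesis by (simp add: i_def[symmetric])
  qed
  finally show "((\<lambda>x. X1 b x v) has_field_derivative X2 b x v) (at x)"
    by (simp only: X1_def[abs_def] X2_def c_def i_def mult.assoc mult_minus_left)
qed

definition F1 :: "real \<Rightarrow> complex \<Rightarrow> real \<Rightarrow> complex" where
  "F1 b x v = G1 (X b x v) * X1 b x v * \<omega> v"

definition F2 :: "real \<Rightarrow> complex \<Rightarrow> real \<Rightarrow> complex" where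
  "F2 b x v = (G2 (X b x v) * (X1 b x v)\<^sup>2 + G1 (X b x v) * X2 b x v) * \<omega> v"

lemma F_derivs:
  assumes b: "b > 1" and x: "x \<in> D1" and v: "v \<in> {0<..<1}"
  shows "((\<lambda>x. G (X b x v) * \<omega> v) has_field_derivative F1 b x v) (at x)"
    "((\<lambda>x. F1 b x v) has_field_derivative F2 b x v) (at x)"
proof -
  have x': "Re x > 1" using x by simp
  have XR: "Re (X b x v) > 1" using X_Re[OF b x'] v by simp
  note dX = X_derivs[OF x', of b v]
  note d1 = DERIV_chain2[OF G_derivs(1)[OF XR] dX(1)]
  note d2 = DERIV_chain2[OF G_derivs(2)[OF XR] dX(1)]
  show "((\<lambda>x. G (X b x v) * \<omega> v) has_field_derivative F1 b x v) (at x)"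
    unfolding F1_def by (rule DERIV_cmult_right[OF d1])
  show "((\<lambda>x. F1 b x v) has_field_derivative F2 b x v) (at x)"
    unfolding F1_def[abs_def] F2_def
    by (rule DERIV_cong[OF DERIV_cmult_right[OF DERIV_mult[OF d2 dX(2)]]]) (simp add: power2_eq_square algebra_simps)
qed

lemma F1_dominated:
  assumes b: "b > 1" shows "beta_dominated D1 (F1 b)"
    and "x \<in> D1 \<Longrightarrow> (I0 b has_field_derivative integral {0<..<1} (F1 b x)) (at x)"
proof -
  have hol: "(\<lambda>x. G (X b x v) * \<omega> v) holomorphic_on D1" if "v \<in> {0<..<1}" for v
    using F_derivs(1)[OF b _ that] by (auto simp: holomorphic_on_open[OF open_halfplane_Re])
  have d: "deriv (\<lambda>x. G (X b x v) * \<omega> v) x = F1 b x v" if "x \<in> D1" "v \<in> {0<..<1}" for x v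
    by (rule DERIV_imp_deriv[OF F_derivs(1)[OF b that]])
  show "beta_dominated D1 (F1 b)"
    by (rule beta_dominated_cong[OF d beta_dominated_deriv[OF F_dominated[OF b] open_halfplane_Re hol]])
  assume x: "x \<in> D1"
  have "(I0 b has_field_derivative integral {0<..<1} (\<lambda>v. deriv (\<lambda>x. G (X b x v) * \<omega> v) x)) (at x)"
    unfolding I0_def[abs_def] by (rule beta_dominated_has_field_derivative[OF F_dominated[OF b] open_halfplane_Re hol x])
  also have "integral {0<..<1} (\<lambda>v. deriv (\<lambda>x. G (X b x v) * \<omega> v) x) = integral {0<..<1} (F1 b x)"
    by (rule integral_cong) (rule d[OF x])
  finally show "(I0 b has_field_derivative integral {0<..<1} (F1 b x)) (at x)" .
qed

lemma F2_integral:
  assumes b: "b > 1" and x: "x \<in> D1" shows "F2 b x integrable_on {0<..<1}"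
    and "((\<lambda>x. integral {0<..<1} (F1 b x)) has_field_derivative integral {0<..<1} (F2 b x)) (at x)"
proof -
  have hol: "(\<lambda>x. F1 b x v) holomorphic_on D1" if "v \<in> {0<..<1}" for v
    using F_derivs(2)[OF b _ that] by (auto simp: holomorphic_on_open[OF open_halfplane_Re])
  have d: "deriv (\<lambda>x. F1 b x v) x = F2 b x v" if "x \<in> D1" "v \<in> {0<..<1}" for x v
    by (rule DERIV_imp_deriv[OF F_derivs(2)[OF b that]])
  have "beta_dominated D1 (F2 b)"
    by (rule beta_dominated_cong[OF d beta_dominated_deriv[OF F1_dominated(1)[OF b] open_halfplane_Re hol]])
  then show "F2 b x integrable_on {0<..<1}" using x by (rule beta_dominated_integrable)
  have "((\<lambda>x. integral {0<..<1} (F1 b x)) has_field_derivative integral {0<..<1} (\<lambda>v. deriv (\<lambda>x. F1 b x v) x)) (at x)"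
    by (rule beta_dominated_has_field_derivative[OF F1_dominated(1)[OF b] open_halfplane_Re hol x])
  also have "integral {0<..<1} (\<lambda>v. deriv (\<lambda>x. F1 b x v) x) = integral {0<..<1} (F2 b x)"
    by (rule integral_cong) (rule d[OF x])
  finally show "((\<lambda>x. integral {0<..<1} (F1 b x)) has_field_derivative integral {0<..<1} (F2 b x)) (at x)" .
qed

text \<open>In the variable \<open>t\<close> this is a multiple of
  \<open>(t\<^sup>2 - 1) powr (-\<nu>)\<close> times the derivative of \<open>G\<close>, the
  antiderivative behind the total derivative. It behaves like powers with exponents
  \<open>-\<nu>\<close> at \<open>v = 1\<close> and \<open>\<nu> + \<mu> + 1\<close> at
  \<open>v = 0\<close>, both of positive real part.\<close>

definition flux :: "real \<Rightarrow> complex \<Rightarrow> real \<Rightarrow> complex" where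
  "flux b x v = of_real (1 - v) powr (-\<nu>) * of_real v powr (2 * \<nu>) * G1 (X b x v)"

definition flux_deriv :: "real \<Rightarrow> complex \<Rightarrow> real \<Rightarrow> complex" where
  "flux_deriv b x v = \<omega> v * (\<nu> * of_real (2 / v - 1) * G1 (X b x v)
     - of_real (2 * R b * (1 - v) / v\<^sup>2) * sqrt_sq_minus_1 x * G2 (X b x v))"

lemma flux_has_derivative:
  assumes b: "b > 1" and x: "Re x > 1" and v: "v \<in> {0<..<1}"
  shows "(flux b x has_vector_derivative flux_deriv b x v) (at v)"
proof -
  have v0: "v > 0" "v < 1" using v by auto
  have XR: "Re (X b x v) > 1" using X_Re[OF b x] v by simp
  define S where "S = sqrt_sq_minus_1 x"
  have "((\<lambda>v. 2 / v - 1) has_real_derivative - 2 / v\<^sup>2) (at v)"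
    using v0 by (auto intro!: derivative_eq_intros simp: power2_eq_square)
  then have "((\<lambda>v. complex_of_real (2 / v - 1)) has_vector_derivative of_real (- 2 / v\<^sup>2)) (at v)"
    by (rule has_vector_derivative_of_real)
  then have "((\<lambda>v. S * of_real (R b) * complex_of_real (2 / v - 1)) has_vector_derivative S * of_real (R b) * of_real (- 2 / v\<^sup>2)) (at v)"
    by (rule has_vector_derivative_mult_right)
  then have dX: "(X b x has_vector_derivative S * of_real (R b) * of_real (- 2 / v\<^sup>2)) (at v)"
    unfolding X_def[abs_def] S_def[symmetric] using has_vector_derivative_add[OF has_vector_derivative_const] by fastforce
  have dG: "((\<lambda>v. G1 (X b x v)) has_vector_derivative S * of_real (R b) * of_real (- 2 / v\<^sup>2) * G2 (X b x v)) (at v)"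
    using field_vector_diff_chain_at[OF dX G_derivs(2)[OF XR]] by (simp add: o_def)
  define p where "p = complex_of_real (1 - v) powr (-\<nu>)"
  define q where "q = complex_of_real v powr (2 * \<nu>)"
  note d = has_vector_derivative_mult[OF has_vector_derivative_mult[OF
     of_real_one_minus_powr_has_vector_derivative[OF v0(2), of "-\<nu>"] of_real_powr_has_vector_derivative[OF v0(1), of "2 * \<nu>"]] dG]
  have om: "\<omega> v = p * q / of_real (1 - v)" using v0 unfolding \<omega>_def p_def q_def by (simp add: powr_diff mult_ac)
  have e1: "complex_of_real (2 / v - 1) = 1 + 2 * of_real (1 - v) / of_real v" using v0 by (simp add: field_simps)
  have n: "complex_of_real (1 - v) \<noteq> 0" "complex_of_real v \<noteq> 0" using v0 by auto
  have e2: "of_real (2 * R b * (1 - v) / v\<^sup>2) = - of_real (1 - v) * (complex_of_real (R b) * of_real (- 2 / v\<^sup>2))"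
  proof -
    have "2 * R b * (1 - v) / v\<^sup>2 = - (1 - v) * (R b * (- 2 / v\<^sup>2))" using v0 by (simp add: field_simps)
    then show ?thesis by (simp only: of_real_mult of_real_minus)
  qed
  have alg: "p * q / w * (\<nu> * e * A - (- w * (r * m)) * S * B) = p * q / w * (\<nu> * e * A + w * (S * r * m * B))"
    for w e A r m B by (simp add: mult_ac)
  have "flux_deriv b x v = p * q / of_real (1 - v) * (\<nu> * (1 + 2 * of_real (1 - v) / of_real v) * G1 (X b x v)
     + of_real (1 - v) * (S * of_real (R b) * of_real (- 2 / v\<^sup>2) * G2 (X b x v)))"
    unfolding flux_deriv_def om e1 e2 S_def[symmetric] by (rule alg)
  also have "\<dots> = p * q * (S * of_real (R b) * of_real (- 2 / v\<^sup>2) * G2 (X b x v)) +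
     (p * (2 * \<nu> * q / of_real v) + - (-\<nu>) * p / of_real (1 - v) * q) * G1 (X b x v)"
  proof -
    have "p * q / w * (\<nu> * (1 + 2 * w / u) * A + w * B) = p * q * B + (p * (2 * \<nu> * q / u) + - (-\<nu>) * p / w * q) * A"
      if "w \<noteq> 0" "u \<noteq> 0" for w u A B :: complex
      using that by (simp add: field_simps)
    from this[OF n] show ?thesis .
  qed
  finally show ?thesis unfolding flux_def[abs_def] using d by (simp only: p_def q_def)
qed

lemma flux_deriv_integral:
  assumes b: "b > 1" and x: "Re x > 1"
  shows "(flux_deriv b x has_integral 0) {0<..<1}"
proof -
  define \<rho> where "\<rho> = (\<lambda>v. x powr (-\<alpha>) * (of_real b powr (-\<alpha>) * dd b (1 / x\<^sup>2) v powr (-\<alpha>)) * g1 (yy b (1 / x\<^sup>2) v) /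
     (of_real b * (x * dd b (1 / x\<^sup>2) v)))"
  \<comment> \<open>\<open>X\<close> divides by \<open>v\<close>, so the formula for
    \<open>flux\<close> has no meaning at \<open>v = 0\<close>. \<open>H\<close> agrees with it
    inside the interval, is continuous up to both ends and vanishes there.\<close>
  define H where "H = (\<lambda>v. of_real (1 - v) powr (-\<nu>) * of_real v powr (\<nu> + \<mu> + 1) * \<rho> v)"
  have x0: "x \<noteq> 0" using x by auto
  have yb: "1 / x\<^sup>2 \<in> ball 0 1" by (rule inverse_square_in_ball[OF x])
  have d0: "dd b (1 / x\<^sup>2) v \<noteq> 0" if "v \<in> {0..1}" for v by (rule Re_pos_not_nonpos(2)[OF dd_Re(1)[OF b yb that]])
  have dc: "continuous_on {0..1} (dd b (1 / x\<^sup>2))"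
    using dd_continuous[of "{0..1}" "\<lambda>_. 1 / x\<^sup>2" "\<lambda>v. v" b] yb by simp
  note cc = composed_continuous[of "{0..1}" "\<lambda>_. 1 / x\<^sup>2" "\<lambda>v. v" b, OF continuous_on_const continuous_on_id yb _ b g1_holomorphic]
  have "continuous_on {0..1} \<rho>"
    unfolding \<rho>_def
    by (intro continuous_on_divide continuous_on_mult continuous_on_const cc dc) (use b x0 d0 in auto)
  then have Hc: "continuous_on {0..1} H"
    unfolding H_def by (intro continuous_on_mult continuous_on_of_real_powr continuous_intros) (use nu k in auto)
  have HE: "H v = flux b x v" if v: "v \<in> {0<..<1}" for v
  proof -
    have v0: "v > 0" using v by simp
    have XR: "Re (X b x v) > 1" using X_Re[OF b x] v by simp
    have alg: "p * q * (w * (r * (c * d)) * e / (of_real (b / v) * D)) =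
        p * (q * r * of_real v) * (w * (c * d) * e / (of_real b * D))" for p q r c d e D w :: complex
      using v0 by (simp add: field_simps)
    have "flux b x v = of_real (1 - v) powr (-\<nu>) * of_real v powr (2 * \<nu>) *
      (X b x v powr (-\<alpha>) * g1 (1 / (X b x v)\<^sup>2) / X b x v)"
      unfolding flux_def G1_eq_g1[OF XR] ..
    also have "\<dots> = of_real (1 - v) powr (-\<nu>) * (of_real v powr (2 * \<nu>) * of_real v powr \<alpha> * of_real v) * \<rho> v"
      unfolding \<rho>_def unfolding X_powr[OF b x v] unfolding X_eq[OF b x v0] by (rule alg)
    also have "of_real v powr (2 * \<nu>) * of_real v powr \<alpha> * of_real v = complex_of_real v powr (\<nu> + \<mu> + 1)"
    proof -
      have "\<nu> + \<mu> + 1 = 2 * \<nu> + \<alpha> + 1" by (simp add: \<alpha>_def)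
      then show ?thesis by (simp only: powr_add powr_to_1)
    qed
    finally show ?thesis by (simp add: H_def)
  qed
  have "(H has_vector_derivative flux_deriv b x v) (at v)" if v: "v \<in> {0<..<1}" for v
    by (rule has_vector_derivative_transform_within_open[OF flux_has_derivative[OF b x v], of "{0<..<1}"])
       (use v HE in auto)
  then have "(flux_deriv b x has_integral (H 1 - H 0)) {0..1}"
    by (intro fundamental_theorem_of_calculus_interior Hc) auto
  moreover have "H 1 = 0" "H 0 = 0" by (simp_all add: H_def)
  ultimately show ?thesis by (simp add: has_integral_Icc_iff_Ioo)
qed

text \<open>Under the integral sign the operator produces a multiple of \<open>flux_deriv\<close>,
  and the factor \<open>- 2 * R b / S\<close> does not depend on \<open>v\<close>, so the integral
  of the whole vanishes.\<close>

lemma I0_ode: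
  assumes b: "b > 1" and x: "Re x > 1"
  shows "(x\<^sup>2 - 1) * integral {0<..<1} (F2 b x) + (1 - 2 * \<nu>) * x * integral {0<..<1} (F1 b x) - (\<mu> + \<nu>) * (\<mu> - \<nu>) * I0 b x = 0"
proof -
  have xD: "x \<in> D1" using x by simp
  define S where "S = sqrt_sq_minus_1 x"
  have S0: "S \<noteq> 0" unfolding S_def by (rule Re_pos_not_nonpos(2)[OF sqrt_sq_minus_1_properties(1)[OF x]])
  have key: "(x\<^sup>2 - 1) * F2 b x v + (1 - 2 * \<nu>) * x * F1 b x v - (\<mu> + \<nu>) * (\<mu> - \<nu>) * (G (X b x v) * \<omega> v)
     = - 2 * of_real (R b) * inverse S * flux_deriv b x v" if v: "v \<in> {0<..<1}" for v
  proof -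
    have v0: "v \<noteq> 0" using v by simp
    define t where "t = complex_of_real (2 / v - 1)"
    define r where "r = complex_of_real (R b)"
    have XR: "Re (X b x v) > 1" using X_Re[OF b x] v by simp
    have iS: "inverse S * S = 1" using S0 by simp
    have r2: "r\<^sup>2 = (of_real b)\<^sup>2 - 1" unfolding r_def of_real_power[symmetric] R_squared[OF b] by simp
    have t2: "t\<^sup>2 - 1 = of_real (4 * (1 - v) / v\<^sup>2)"
    proof -
      have "(2 / v - 1)\<^sup>2 - 1 = 4 * (1 - v) / v\<^sup>2" using v0 by (simp add: field_simps power2_eq_square)
      then show ?thesis unfolding t_def by (metis of_real_1 of_real_diff of_real_power)
    qed
    have ode: "((x * of_real b + S * r * t)\<^sup>2 - 1) * G2 (X b x v) + (1 - 2 * \<nu>) * (x * of_real b + S * r * t) * G1 (X b x v)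
        - (\<mu> + \<nu>) * (\<mu> - \<nu>) * G (X b x v) = 0"
      using G_ode[OF XR] by (simp only: X_def S_def r_def t_def)
    have S2: "S\<^sup>2 = x\<^sup>2 - 1" by (simp add: S_def sqrt_sq_minus_1_power2)
    have "(x\<^sup>2 - 1) * F2 b x v + (1 - 2 * \<nu>) * x * F1 b x v - (\<mu> + \<nu>) * (\<mu> - \<nu>) * (G (X b x v) * \<omega> v)
       = ((x\<^sup>2 - 1) * (G2 (X b x v) * (X1 b x v)\<^sup>2 + G1 (X b x v) * X2 b x v) + (1 - 2 * \<nu>) * x * (G1 (X b x v) * X1 b x v)
         - (\<mu> + \<nu>) * (\<mu> - \<nu>) * G (X b x v)) * \<omega> v"
      unfolding F1_def F2_def by (simp only: algebra_simps)
    also have "(x\<^sup>2 - 1) * (G2 (X b x v) * (X1 b x v)\<^sup>2 + G1 (X b x v) * X2 b x v) + (1 - 2 * \<nu>) * x * (G1 (X b x v) * X1 b x v)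
         - (\<mu> + \<nu>) * (\<mu> - \<nu>) * G (X b x v)
       = - 2 * \<nu> * r * inverse S * t * G1 (X b x v) + r\<^sup>2 * (t\<^sup>2 - 1) * G2 (X b x v)"
      using total_derivative_algebra[OF iS S2 r2 ode] by (simp only: X1_def X2_def S_def r_def t_def)
    also have "(- 2 * \<nu> * r * inverse S * t * G1 (X b x v) + r\<^sup>2 * (t\<^sup>2 - 1) * G2 (X b x v)) * \<omega> v
       = - 2 * r * inverse S * flux_deriv b x v"
    proof -
      have "flux_deriv b x v = \<omega> v * (\<nu> * t * G1 (X b x v) - r * (t\<^sup>2 - 1) / 2 * S * G2 (X b x v))"
      proof -
        have tt: "of_real (2 * R b * (1 - v) / v\<^sup>2) = r * (t\<^sup>2 - 1) / 2" unfolding t2 r_def using v0 by (simp add: field_simps)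
        show ?thesis unfolding flux_deriv_def t_def[symmetric] S_def[symmetric] tt ..
      qed
      moreover have "- 2 * r * inverse S * (w * (\<nu> * t * A - r * u / 2 * S * B)) =
         (- 2 * \<nu> * r * inverse S * t * A + r\<^sup>2 * u * B) * w" for w A u B
      proof -
        have "- 2 * r * inverse S * (w * (\<nu> * t * A - r * u / 2 * S * B)) =
          (- 2 * \<nu> * r * inverse S * t * A + (inverse S * S) * (r\<^sup>2 * u * B)) * w"
          by (simp add: algebra_simps power2_eq_square)
        then show ?thesis unfolding iS by simp
      qed
      ultimately show ?thesis by (simp only:)
    qed
    finally show ?thesis by (simp only: r_def)
  qed
  have int: "F2 b x integrable_on {0<..<1}" "F1 b x integrable_on {0<..<1}" "(\<lambda>v. G (X b x v) * \<omega> v) integrable_on {0<..<1}"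
    using F2_integral(1)[OF b xD] beta_dominated_integrable[OF F1_dominated(1)[OF b] xD] beta_dominated_integrable[OF F_dominated[OF b] xD] by auto
  have A: "((\<lambda>v. (x\<^sup>2 - 1) * F2 b x v + (1 - 2 * \<nu>) * x * F1 b x v - (\<mu> + \<nu>) * (\<mu> - \<nu>) * (G (X b x v) * \<omega> v)) has_integral
     (x\<^sup>2 - 1) * integral {0<..<1} (F2 b x) + (1 - 2 * \<nu>) * x * integral {0<..<1} (F1 b x) - (\<mu> + \<nu>) * (\<mu> - \<nu>) * I0 b x) {0<..<1}"
    unfolding I0_def by (intro has_integral_diff has_integral_add has_integral_mult_right integrable_integral int)
  have "((\<lambda>v. - 2 * of_real (R b) * inverse S * flux_deriv b x v) has_integral - 2 * of_real (R b) * inverse S * 0) {0<..<1}"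
    by (intro has_integral_mult_right flux_deriv_integral b x)
  then have B: "((\<lambda>v. (x\<^sup>2 - 1) * F2 b x v + (1 - 2 * \<nu>) * x * F1 b x v - (\<mu> + \<nu>) * (\<mu> - \<nu>) * (G (X b x v) * \<omega> v)) has_integral
     - 2 * of_real (R b) * inverse S * 0) {0<..<1}"
    by (rule has_integral_eq[rotated]) (use key in simp)
  from has_integral_unique[OF A B] show ?thesis by simp
qed

section \<open>Proportionality to \<open>G\<close> and the constant\<close>

lemma g_0_nonzero: "g 0 \<noteq> 0"
proof -
  have "1 + \<mu> \<noteq> - of_nat n" for n
  proof
    assume *: "1 + \<mu> = - of_nat n"
    have "\<mu> = (1 + \<mu>) - 1" by simp
    also have "\<dots> = - of_nat (Suc n)" unfolding * by simp
    finally show False using mu by blast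
  qed
  then have "1 + \<mu> \<notin> \<int>\<^sub>\<le>\<^sub>0" by (auto elim!: nonpos_Ints_cases')
  then show ?thesis by (simp add: g_0 rGamma_eq_zero_iff)
qed

text \<open>\<open>I0 b\<close> and \<open>G\<close> are \<open>x powr (-\<alpha>)\<close> times
  power series in \<open>y\<close> and solve the same equation. The cross-multiplied combination
  \<open>M\<close> has constant term 0, hence vanishes.\<close>

lemma Psi_factor:
  fixes b :: real
  assumes b: "b > 1" and y: "y \<in> ball 0 1"
  shows "\<Psi> b y * g 0 = \<Psi> b 0 * g y"
proof -
  have gb: "g holomorphic_on ball 0 1"
    using g_holomorphic unit_ball_subset_slit_plane by (rule holomorphic_on_subset)
  define M where "M = (\<lambda>y. \<Psi> b y * g 0 - \<Psi> b 0 * g y)"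
  define N1 where "N1 = (\<lambda>x. integral {0<..<1} (F1 b x) * g 0 - \<Psi> b 0 * G1 x)"
  define N2 where "N2 = (\<lambda>x. integral {0<..<1} (F2 b x) * g 0 - \<Psi> b 0 * G2 x)"
  have e: "x powr (-\<alpha>) * M (1 / x\<^sup>2) = I0 b x * g 0 - \<Psi> b 0 * G x" if "Re x > 1" for x
    unfolding M_def I0_eq[OF b that] G_eq_g[OF that] by (simp only: algebra_simps)
  have "M y = 0"
  proof (rule power_form_unique[where M = M and ?N1.0 = N1 and ?N2.0 = N2])
    show "M holomorphic_on ball 0 1" unfolding M_def by (intro holomorphic_intros Psi_holomorphic b gb)
    fix x assume x: "Re x > 1"
    have "eventually (\<lambda>x. x \<in> D1) (nhds x)"
      by (rule eventually_nhds_in_open[OF open_halfplane_Re]) (use x in simp)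
    then have ev: "eventually (\<lambda>x. x powr (-\<alpha>) * M (1 / x\<^sup>2) = I0 b x * g 0 - \<Psi> b 0 * G x) (nhds x)"
      by eventually_elim (use e in simp)
    have "((\<lambda>x. I0 b x * g 0 - \<Psi> b 0 * G x) has_field_derivative N1 x) (at x)"
      unfolding N1_def by (intro DERIV_diff DERIV_cmult DERIV_cmult_right F1_dominated(2) G_derivs b) (use x in auto)
    then show "((\<lambda>x. x powr (-\<alpha>) * M (1 / x\<^sup>2)) has_field_derivative N1 x) (at x)"
      using DERIV_cong_ev[OF refl ev refl] by blast
    show "(N1 has_field_derivative N2 x) (at x)"
      unfolding N1_def N2_def by (intro DERIV_diff DERIV_cmult DERIV_cmult_right F2_integral(2) G_derivs b) (use x in auto)
    have "(x\<^sup>2 - 1) * N2 x + (1 - 2 * \<nu>) * x * N1 x - (\<mu> + \<nu>) * (\<mu> - \<nu>) * (I0 b x * g 0 - \<Psi> b 0 * G x)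
      = ((x\<^sup>2 - 1) * integral {0<..<1} (F2 b x) + (1 - 2 * \<nu>) * x * integral {0<..<1} (F1 b x) - (\<mu> + \<nu>) * (\<mu> - \<nu>) * I0 b x) * g 0
       - \<Psi> b 0 * ((x\<^sup>2 - 1) * G2 x + (1 - 2 * \<nu>) * x * G1 x - (\<mu> + \<nu>) * (\<mu> - \<nu>) * G x)"
      unfolding N1_def N2_def by (simp only: algebra_simps)
    also have "\<dots> = 0" unfolding I0_ode[OF b x] G_ode[OF x] by simp
    finally show "(x\<^sup>2 - 1) * N2 x + (1 - 2 * \<nu>) * x * N1 x - (\<mu> + \<nu>) * (\<mu> - \<nu>) * (x powr (-\<alpha>) * M (1 / x\<^sup>2)) = 0"
      unfolding e[OF x] .
  qed (use y mu in \<open>auto simp: M_def simp del: of_nat_Suc\<close>)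
  then show ?thesis by (simp add: M_def)
qed

text \<open>\<open>\<Psi> b 0\<close> without its elementary factors, as a function of
  \<open>q = R b / b\<close>. As \<open>b\<close> grows, \<open>q\<close> tends to 1, where
  \<open>v + q * (2 - v)\<close> is the constant 2 and the integral is a Beta integral.\<close>

definition Q :: "real \<Rightarrow> complex" where
  "Q q = integral {0<..<1} (\<lambda>v. of_real v powr (\<nu> + \<mu> + 1 - 1) * of_real (1 - v) powr (- \<nu> - 1) *
     of_real (v + q * (2 - v)) powr (-\<alpha>))"

lemma Q_continuous: "continuous_on {0<..1} Q"
  unfolding Q_def
proof (rule beta_dominated_continuous)
  have pos: "v + q * (2 - v) > 0" if "q \<in> {0<..1}" "v \<in> {0..1}" for q v :: real
    using that by (intro add_nonneg_pos mult_pos_pos) auto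
  show "beta_dominated {0<..1} (\<lambda>q v. of_real v powr (\<nu> + \<mu> + 1 - 1) * of_real (1 - v) powr (- \<nu> - 1) *
     of_real (v + q * (2 - v)) powr (-\<alpha>))"
  proof (rule beta_dominatedI_compact[where A = "\<lambda>_. \<nu> + \<mu> + 1" and B = "\<lambda>_. - \<nu>"])
    show "continuous_on ({0<..1} \<times> {0..1}) (\<lambda>(q, v). complex_of_real (v + q * (2 - v)) powr (-\<alpha>))"
      unfolding case_prod_unfold
    proof (rule continuous_on_cpowr)
      show "complex_of_real (snd s + fst s * (2 - snd s)) \<notin> \<real>\<^sub>\<le>\<^sub>0" if "s \<in> {0<..1} \<times> {0..1}" for s :: "real \<times> real"
        using pos[of "fst s" "snd s"] that by (intro Re_pos_not_nonpos) auto
    qed (intro continuous_intros)+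
  qed (use k nu in auto)
  fix v :: real assume v: "v \<in> {0<..<1}"
  show "continuous_on {0<..1} (\<lambda>q. complex_of_real v powr (\<nu> + \<mu> + 1 - 1) * of_real (1 - v) powr (- \<nu> - 1) *
     of_real (v + q * (2 - v)) powr (-\<alpha>))"
  proof -
    have "complex_of_real (v + q * (2 - v)) \<notin> \<real>\<^sub>\<le>\<^sub>0" if "q \<in> {0<..1}" for q
      using pos[of q v] that v by (intro Re_pos_not_nonpos) auto
    moreover have "continuous_on {0<..1} (\<lambda>q. complex_of_real (v + q * (2 - v)))" by (intro continuous_intros)
    ultimately have "continuous_on {0<..1} (\<lambda>q. complex_of_real (v + q * (2 - v)) powr (-\<alpha>))"
      by (intro continuous_on_cpowr continuous_on_const)
    then show ?thesis by (intro continuous_on_mult continuous_on_const)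
  qed
qed

lemma Q_1: "Q 1 = 2 powr (-\<alpha>) * (Gamma (\<nu> + \<mu> + 1) * Gamma (-\<nu>) * rGamma (\<mu> + 1))"
proof -
  have "((\<lambda>v. of_real v powr (\<nu> + \<mu> + 1 - 1) * of_real (1 - v) powr (- \<nu> - 1)) has_integral
      Gamma (\<nu> + \<mu> + 1) * Gamma (-\<nu>) * rGamma (\<nu> + \<mu> + 1 + - \<nu>)) {0<..<1}"
    by (rule complex_Beta_integral) (use nu k in auto)
  then have "((\<lambda>v. of_real v powr (\<nu> + \<mu> + 1 - 1) * of_real (1 - v) powr (- \<nu> - 1) * 2 powr (-\<alpha>)) has_integral
      Gamma (\<nu> + \<mu> + 1) * Gamma (-\<nu>) * rGamma (\<nu> + \<mu> + 1 + - \<nu>) * 2 powr (-\<alpha>)) {0<..<1}"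
    by (rule has_integral_mult_left)
  then have "Q 1 = Gamma (\<nu> + \<mu> + 1) * Gamma (-\<nu>) * rGamma (\<nu> + \<mu> + 1 + - \<nu>) * 2 powr (-\<alpha>)"
    unfolding Q_def by (intro integral_unique) simp
  then show ?thesis by (simp add: mult_ac)
qed

lemma R_quotient: "b > 1 \<Longrightarrow> R b / b \<in> {0<..<1}"
  using R_pos[of b] by (simp add: R_def real_less_lsqrt)

lemma Psi_0:
  assumes b: "b > 1" shows "\<Psi> b 0 = of_real b powr (-\<alpha>) * g 0 * Q (R b / b)"
proof -
  have *: "\<psi> b 0 v = of_real b powr (-\<alpha>) * g 0 * (of_real v powr (\<nu> + \<mu> + 1 - 1) * of_real (1 - v) powr (- \<nu> - 1) *
     of_real (v + R b / b * (2 - v)) powr (-\<alpha>))" for v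
    unfolding \<psi>_def ph_def yy_def dd_def by (simp add: mult_ac)
  show ?thesis unfolding \<Psi>_def Q_def ext[of "\<psi> b 0", OF *] by (rule integral_mult_right)
qed

lemma sqrt_sq_minus_1_of_real:
  assumes "a > 1" shows "sqrt_sq_minus_1 (of_real a) = of_real (R a)"
proof -
  have "csqrt (of_real (a - 1)) = of_real (sqrt (a - 1))" "csqrt (of_real (a + 1)) = of_real (sqrt (a + 1))"
    using assms by (intro csqrt_of_real; simp)+
  moreover have "sqrt (a - 1) * sqrt (a + 1) = R a"
    unfolding R_def real_sqrt_mult[symmetric] by (simp add: power2_eq_square algebra_simps)
  ultimately show ?thesis unfolding sqrt_sq_minus_1_def by (metis of_real_1 of_real_add of_real_diff of_real_mult)
qed

lemma I0_sym:
  assumes "a > 1" "b > 1" shows "I0 b (of_real a) = I0 a (of_real b)"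
proof -
  have "X b (of_real a) v = X a (of_real b) v" for v
    unfolding X_def sqrt_sq_minus_1_of_real[OF assms(1)] sqrt_sq_minus_1_of_real[OF assms(2)] by (simp only: mult_ac)
  then show ?thesis by (simp only: I0_def)
qed

lemma I0_factor:
  assumes b: "b > 1" and x: "Re x > 1" shows "I0 b x * g 0 = \<Psi> b 0 * G x"
proof -
  have "I0 b x * g 0 = x powr (-\<alpha>) * (\<Psi> b (1 / x\<^sup>2) * g 0)" unfolding I0_eq[OF assms] by (simp only: mult_ac)
  then show ?thesis unfolding Psi_factor[OF b inverse_square_in_ball[OF x]] G_eq_g[OF x] by (simp only: mult_ac)
qed

text \<open>By symmetry of \<open>I0\<close>, \<open>\<Psi> b 0 * G a = \<Psi> a 0 * G b\<close>.
  Divided by \<open>a powr (-\<alpha>) * g 0\<close>, both sides have limits as \<open>a\<close>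
  tends to infinity, and this identifies the factor \<open>\<Psi> b 0\<close> as a constant multiple
  of \<open>G b\<close>.\<close>

lemma Q_G:
  assumes b: "b > 1"
  shows "of_real b powr (-\<alpha>) * Q (R b / b) * g 0 = Q 1 * G (of_real b)"
proof -
  define a where "a = (\<lambda>n::nat. real n + 2)"
  have a: "a n > 1" for n by (simp add: a_def)
  have eq: "of_real b powr (-\<alpha>) * Q (R b / b) * g (1 / (of_real (a n))\<^sup>2) = Q (R (a n) / a n) * G (of_real b)" for n
  proof -
    have nz: "complex_of_real (a n) powr (-\<alpha>) * g 0 \<noteq> 0" using a[of n] g_0_nonzero by auto
    have "\<Psi> b 0 * G (of_real (a n)) = \<Psi> (a n) 0 * G (of_real b)"
      using I0_factor[OF b, of "of_real (a n)"] I0_factor[OF a[of n], of "of_real b"] I0_sym[OF a[of n] b] a[of n] b by simp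
    moreover have "G (of_real (a n)) = of_real (a n) powr (-\<alpha>) * g (1 / (of_real (a n))\<^sup>2)"
      by (rule G_eq_g) (use a[of n] in simp)
    ultimately have E: "(of_real (a n) powr (-\<alpha>) * g 0) * (of_real b powr (-\<alpha>) * Q (R b / b) * g (1 / (of_real (a n))\<^sup>2))
       = (of_real (a n) powr (-\<alpha>) * g 0) * (Q (R (a n) / a n) * G (of_real b))"
      unfolding Psi_0[OF b] Psi_0[OF a] by (simp only: mult_ac)
    show ?thesis by (rule mult_left_cancel[OF nz, THEN iffD1, OF E])
  qed
  have "(\<lambda>n. 1 / (a n)\<^sup>2) \<longlonglongrightarrow> 0" unfolding a_def by real_asymp
  then have "(\<lambda>n. complex_of_real (1 / (a n)\<^sup>2)) \<longlonglongrightarrow> of_real 0" by (rule tendsto_of_real)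
  then have l1: "(\<lambda>n. 1 / (complex_of_real (a n))\<^sup>2) \<longlonglongrightarrow> 0" by simp
  have "isCont g 0" using holomorphic_on_imp_continuous_on[OF g_holomorphic] open_slit_plane zero_in_slit_plane
    by (simp add: continuous_on_eq_continuous_at)
  then have "(\<lambda>n. g (1 / (complex_of_real (a n))\<^sup>2)) \<longlonglongrightarrow> g 0" using l1 by (rule isCont_tendsto_compose)
  then have L: "(\<lambda>n. of_real b powr (-\<alpha>) * Q (R b / b) * g (1 / (of_real (a n))\<^sup>2)) \<longlonglongrightarrow> of_real b powr (-\<alpha>) * Q (R b / b) * g 0"
    by (rule tendsto_mult_left)
  have "(\<lambda>n. R (a n) / a n) \<longlonglongrightarrow> 1" unfolding R_def a_def by real_asymp
  moreover have "R (a n) / a n \<in> {0<..1}" for n using R_quotient[OF a[of n]] by simp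
  ultimately have "(\<lambda>n. Q (R (a n) / a n)) \<longlonglongrightarrow> Q 1"
    using Q_continuous unfolding continuous_on_sequentially o_def by force
  then have "(\<lambda>n. Q (R (a n) / a n) * G (of_real b)) \<longlonglongrightarrow> Q 1 * G (of_real b)" by (rule tendsto_mult_right)
  with L show ?thesis unfolding eq using LIMSEQ_unique by blast
qed

lemma product_I0:
  assumes a: "a > 1" and b: "b > 1"
  shows "I0 b (of_real a) = 2 powr \<nu> * Gamma (\<nu> + \<mu> + 1) * Gamma (-\<nu>) * G (of_real a) * G (of_real b)"
proof -
  have "I0 b (of_real a) * g 0 = \<Psi> b 0 * G (of_real a)" by (rule I0_factor[OF b]) (use a in simp)
  also have "\<dots> = (of_real b powr (-\<alpha>) * Q (R b / b) * g 0) * G (of_real a)" unfolding Psi_0[OF b] by (simp only: mult_ac)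
  finally have "I0 b (of_real a) * g 0 = Q 1 * G (of_real b) * G (of_real a)" unfolding Q_G[OF b] .
  moreover have "Q 1 = 2 powr \<nu> * Gamma (\<nu> + \<mu> + 1) * Gamma (-\<nu>) * g 0"
  proof -
    have "(2::complex) powr (-\<alpha>) = 2 powr \<nu> * 2 powr (-\<mu>)" by (simp add: \<alpha>_def flip: powr_add)
    then show ?thesis unfolding Q_1 g_0 by (simp add: add.commute mult_ac)
  qed
  ultimately have "I0 b (of_real a) * g 0 = (2 powr \<nu> * Gamma (\<nu> + \<mu> + 1) * Gamma (-\<nu>) * G (of_real a) * G (of_real b)) * g 0"
    by (simp only: mult_ac)
  then show ?thesis using g_0_nonzero by simp
qed

end

text \<open>Whipple's involution of the half-line above 1, the passage from \<open>cosh s\<close> to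
  \<open>coth s\<close>: decreasing and its own inverse.\<close>

definition coroot :: "real \<Rightarrow> real" where "coroot x = x / sqrt (x\<^sup>2 - 1)"

lemma coroot_properties:
  assumes x: "x > 1"
  shows "coroot x > 1" "sqrt ((coroot x)\<^sup>2 - 1) = 1 / sqrt (x\<^sup>2 - 1)" "coroot (coroot x) = x"
    "(coroot has_real_derivative - 1 / sqrt (x\<^sup>2 - 1) ^ 3) (at x)"
proof -
  define r where "r = sqrt (x\<^sup>2 - 1)"
  have x2: "x\<^sup>2 > 1" using x by (simp add: one_less_power)
  then have r: "r > 0" "r\<^sup>2 = x\<^sup>2 - 1" by (auto simp: r_def)
  have "r < x" using r(2) x by (intro power2_less_imp_less[of r x]) auto
  then show "coroot x > 1" using r by (simp add: coroot_def r_def[symmetric])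
  have "(coroot x)\<^sup>2 - 1 = (1 / r)\<^sup>2"
    using r by (simp add: coroot_def r_def[symmetric] power_divide field_simps)
  then show 1: "sqrt ((coroot x)\<^sup>2 - 1) = 1 / sqrt (x\<^sup>2 - 1)"
    using r(1) by (simp add: r_def[symmetric] real_sqrt_unique)
  show "coroot (coroot x) = x"
    unfolding coroot_def[of "coroot x"] 1 using r by (simp add: coroot_def r_def[symmetric])
  have "((\<lambda>x. sqrt (x\<^sup>2 - 1)) has_real_derivative (2 * x) * (inverse r / 2)) (at x)"
  proof -
    have "((\<lambda>x::real. x\<^sup>2 - 1) has_real_derivative 2 * x) (at x)" by (auto intro!: derivative_eq_intros)
    from DERIV_chain2[OF DERIV_real_sqrt this] show ?thesis using x2 by (simp add: r_def mult.commute)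
  qed
  then have "(coroot has_real_derivative (1 * r - x * ((2 * x) * (inverse r / 2))) / (r * r)) (at x)"
    unfolding coroot_def[abs_def] r_def by (intro DERIV_divide DERIV_ident) (use x2 in auto)
  also have "(1 * r - x * ((2 * x) * (inverse r / 2))) / (r * r) = (r\<^sup>2 - x\<^sup>2) / r ^ 3"
    using r by (simp add: field_simps power2_eq_square power3_eq_cube)
  also have "\<dots> = - 1 / sqrt (x\<^sup>2 - 1) ^ 3" unfolding r(2) by (simp add: r_def)
  finally show "(coroot has_real_derivative - 1 / sqrt (x\<^sup>2 - 1) ^ 3) (at x)" .
qed

lemma coroot_less:
  assumes "1 < x" "x < y" shows "coroot y < coroot x"
proof -
  have p: "sqrt (x\<^sup>2 - 1) > 0" "sqrt (y\<^sup>2 - 1) > 0" "x\<^sup>2 < y\<^sup>2" "x\<^sup>2 > 1" "y\<^sup>2 > 1"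
    using assms by (auto simp: one_less_power power_strict_mono)
  have "(y * sqrt (x\<^sup>2 - 1))\<^sup>2 < (x * sqrt (y\<^sup>2 - 1))\<^sup>2"
    using p by (simp add: power_mult_distrib algebra_simps)
  then have "y * sqrt (x\<^sup>2 - 1) < x * sqrt (y\<^sup>2 - 1)"
    by (rule power2_less_imp_less) (use assms p in auto)
  then show ?thesis using p by (simp add: coroot_def field_simps)
qed

lemma of_real_powr_mult: "x > 0 \<Longrightarrow> y > 0 \<Longrightarrow> complex_of_real (x * y) powr c = of_real x powr c * of_real y powr c"
  unfolding of_real_mult by (rule powr_times_real_left) auto

lemma of_real_powr_exp: "x > 0 \<Longrightarrow> complex_of_real x powr c = exp (c * of_real (ln x))"
  by (simp add: powr_def Ln_of_real)

lemma of_real_exp_ln: "x > 0 \<Longrightarrow> complex_of_real x = exp (of_real (ln x))"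
  by (simp add: exp_of_real)

section \<open>The segment integral for real arguments\<close>

context convergent_whipple
begin

lemma R_coroot: "a > 1 \<Longrightarrow> R (coroot a) = 1 / R a"
  unfolding R_def by (rule coroot_properties(2))

lemma coroot_R: "coroot a = a / R a"
  by (simp add: coroot_def R_def)

lemma Legendre_P_coroot:
  assumes a: "a > 1"
  shows "Legendre_P \<nu> (-\<mu>) (of_real (coroot a)) = of_real (R a) powr (-\<nu>) * G (of_real a)"
proof -
  have r: "R a > 0" "(R a)\<^sup>2 = a\<^sup>2 - 1" using R_pos[OF a] R_squared[OF a] by auto
  have sa: "sqrt_sq_minus_1 (of_real a) = of_real (R a)" by (rule sqrt_sq_minus_1_of_real[OF a])
  have l: "R a < a" using r(2) a by (intro power2_less_imp_less[of "R a" a]) auto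
  have m: "(a + R a) * (a - R a) = 1" using r(2) by (simp add: power2_eq_square algebra_simps)
  have "(coroot a + 1) / (coroot a - 1) = (a + R a) / (a - R a)"
    using r l by (simp add: coroot_R field_simps)
  also have "\<dots> = (a + R a) * ((a + R a) * (a - R a)) / (a - R a)" unfolding m by simp
  also have "\<dots> = (a + R a)\<^sup>2" using l by (simp add: power2_eq_square)
  finally have q: "(coroot a + 1) / (coroot a - 1) = (a + R a)\<^sup>2" .
  have "((of_real (coroot a) + 1) / (of_real (coroot a) - 1)) powr (-\<mu> / 2) = complex_of_real ((coroot a + 1) / (coroot a - 1)) powr (-\<mu> / 2)"
    by simp
  also have "\<dots> = (of_real (a + R a)) powr (-\<mu>)"
    unfolding q using r a by (simp add: of_real_powr_exp ln_realpow del: of_real_add of_real_power)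
  finally have p: "((of_real (coroot a) + 1) / (of_real (coroot a) - 1)) powr (-\<mu> / 2) = complex_of_real (a + R a) powr (-\<mu>)" .
  have z: "\<zeta> (of_real a) = (1 - of_real (coroot a)) / 2" by (simp add: \<zeta>_def sa coroot_R)
  have "of_real (R a) powr (-\<nu>) * complex_of_real (R a) powr \<nu> = 1"
    using r by (simp flip: powr_add)
  then have "of_real (R a) powr (-\<nu>) * G (of_real a) = complex_of_real (a + R a) powr (-\<mu>) * f (\<zeta> (of_real a))"
    unfolding G_def W_def sa by (simp add: mult.assoc[symmetric])
  then show ?thesis unfolding Legendre_P_def p z f_def by simp
qed

text \<open>In Whipple's variables \<open>C\<close> loses its square roots, and with
  \<open>x = a b + R a R b t\<close> the numerator of \<open>C - 1\<close> is
  \<open>(R a * R b)\<^sup>2 * (t\<^sup>2 - 1)\<close>. This is the origin of the variable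
  \<open>t\<close> and of its weight.\<close>

lemma kernel_C_coroot:
  assumes a: "a > 1" and b: "b > 1" and x: "x > 1"
  shows "kernel_C (of_real (coroot a)) (of_real (coroot b)) (of_real (coroot x)) - 1 =
    of_real (((x - a * b)\<^sup>2 - (R a * R b)\<^sup>2) / (2 * R a * R b * R x * coroot a * coroot b * coroot x))"
proof -
  have s: "sqrt_sq_minus_1 (of_real (coroot c)) = of_real (1 / R c)" if "c > 1" for c
    using sqrt_sq_minus_1_of_real[OF coroot_properties(1)[OF that]] R_coroot[OF that] by simp
  define p where "p = R a" define q where "q = R b" define r where "r = R x"
  have pos: "p > 0" "q > 0" "r > 0" using R_pos a b x by (auto simp: p_def q_def r_def)
  have sq: "a\<^sup>2 = p\<^sup>2 + 1" "b\<^sup>2 = q\<^sup>2 + 1" "x\<^sup>2 = r\<^sup>2 + 1"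
    using R_squared[OF a] R_squared[OF b] R_squared[OF x] by (auto simp: p_def q_def r_def)
  have "kernel_C (of_real (coroot a)) (of_real (coroot b)) (of_real (coroot x)) = of_real
     ((1 - (a / p)\<^sup>2 * (b / q)\<^sup>2 - (a / p)\<^sup>2 * (x / r)\<^sup>2 - (b / q)\<^sup>2 * (x / r)\<^sup>2 + 2 * (a / p)\<^sup>2 * (b / q)\<^sup>2 * (x / r)\<^sup>2) /
      (2 * (a / p) * (b / q) * (x / r) * (1 / p * (1 / q) * (1 / r))))"
    unfolding kernel_C_def s[OF a] s[OF b] s[OF x] by (simp add: coroot_R p_def q_def r_def)
  also have "(1 - (a / p)\<^sup>2 * (b / q)\<^sup>2 - (a / p)\<^sup>2 * (x / r)\<^sup>2 - (b / q)\<^sup>2 * (x / r)\<^sup>2 + 2 * (a / p)\<^sup>2 * (b / q)\<^sup>2 * (x / r)\<^sup>2) /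
      (2 * (a / p) * (b / q) * (x / r) * (1 / p * (1 / q) * (1 / r))) =
      (p\<^sup>2 * q\<^sup>2 * r\<^sup>2 - a\<^sup>2 * b\<^sup>2 * r\<^sup>2 - a\<^sup>2 * x\<^sup>2 * q\<^sup>2 - b\<^sup>2 * x\<^sup>2 * p\<^sup>2 + 2 * a\<^sup>2 * b\<^sup>2 * x\<^sup>2) / (2 * a * b * x)"
    using pos a b x by (simp add: field_simps power2_eq_square)
  also have "p\<^sup>2 * q\<^sup>2 * r\<^sup>2 - a\<^sup>2 * b\<^sup>2 * r\<^sup>2 - a\<^sup>2 * x\<^sup>2 * q\<^sup>2 - b\<^sup>2 * x\<^sup>2 * p\<^sup>2 + 2 * a\<^sup>2 * b\<^sup>2 * x\<^sup>2 = x\<^sup>2 + a\<^sup>2 * b\<^sup>2 - p\<^sup>2 * q\<^sup>2"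
    unfolding sq by (simp add: algebra_simps)
  finally have "kernel_C (of_real (coroot a)) (of_real (coroot b)) (of_real (coroot x)) - 1 =
     of_real ((x\<^sup>2 + a\<^sup>2 * b\<^sup>2 - p\<^sup>2 * q\<^sup>2) / (2 * a * b * x) - 1)" by simp
  also have "(x\<^sup>2 + a\<^sup>2 * b\<^sup>2 - p\<^sup>2 * q\<^sup>2) / (2 * a * b * x) - 1 =
     ((x - a * b)\<^sup>2 - (R a * R b)\<^sup>2) / (2 * R a * R b * R x * coroot a * coroot b * coroot x)"
    unfolding coroot_R using pos a b x by (simp add: p_def[symmetric] q_def[symmetric] r_def[symmetric] field_simps power2_eq_square)
  finally show ?thesis .
qed

text \<open>The addition theorem of \<open>coth\<close>: if \<open>a\<close> and \<open>b\<close>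
  are hyperbolic cosines, \<open>a * b + R a * R b\<close> is the hyperbolic cosine of the sum. So
  the upper limit corresponds to \<open>t = 1\<close> and the lower limit 1 to
  \<open>t = \<infinity>\<close>.\<close>

lemma upper_limit_coroot:
  assumes a: "a > 1" and b: "b > 1"
  shows "upper_limit (of_real (coroot a)) (of_real (coroot b)) = of_real (coroot (a * b + R a * R b))"
proof -
  have r: "R a > 0" "(R a)\<^sup>2 = a\<^sup>2 - 1" "R b > 0" "(R b)\<^sup>2 = b\<^sup>2 - 1" using R_pos R_squared a b by auto
  have "(a * b + R a * R b)\<^sup>2 - 1 = a\<^sup>2 * b\<^sup>2 + 2 * a * b * R a * R b + (R a)\<^sup>2 * (R b)\<^sup>2 - 1"
    by (simp add: power2_eq_square algebra_simps)
  also have "\<dots> = a\<^sup>2 * (R b)\<^sup>2 + 2 * a * b * R a * R b + b\<^sup>2 * (R a)\<^sup>2" unfolding r by (simp add: algebra_simps)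
  also have "\<dots> = (a * R b + b * R a)\<^sup>2" by (simp add: power2_eq_square algebra_simps)
  finally have RX: "R (a * b + R a * R b) = a * R b + b * R a"
    unfolding R_def[of "a * b + R a * R b"] using r a b by (simp add: real_sqrt_unique)
  have "coroot (a * b + R a * R b) = (1 + coroot a * coroot b) / (coroot a + coroot b)"
  proof -
    have "1 + a / R a * (b / R b) = (a * b + R a * R b) / (R a * R b)" "a / R a + b / R b = (a * R b + b * R a) / (R a * R b)"
      using r by (simp_all add: field_simps)
    then show ?thesis unfolding coroot_R RX using r by simp
  qed
  then show ?thesis by (simp add: upper_limit_def)
qed

text \<open>The substitution \<open>z3 = coroot x\<close> followed by the passage from
  \<open>x\<close> to \<open>v\<close>. Both reverse the orientation, so together they preserve it;
  the minus sign comes from \<open>1 - z3\<^sup>2 < 0\<close>.\<close>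

lemma real_segment_integral:
  assumes a: "a > 1" and b: "b > 1"
  defines "z1 \<equiv> complex_of_real (coroot a)" and "z2 \<equiv> complex_of_real (coroot b)"
  shows "(product_integrand \<nu> \<mu> z1 z2 has_contour_integral
     - (z1 powr (\<nu> + 1) * z2 powr (\<nu> + 1)) * of_real (2 * R a * R b) powr (-\<nu>) * I0 b (of_real a)) (linepath 1 (upper_limit z1 z2))"
proof -
  define d where "d = R a * R b"
  have d: "d > 0" using R_pos a b by (simp add: d_def)
  define X0 where "X0 = a * b + d"
  have ab: "a * b > 1" using a b by (simp add: less_1_mult)
  then have X0: "X0 > 1" using d by (simp add: X0_def)
  define u where "u = coroot X0"
  have u: "u > 1" unfolding u_def by (rule coroot_properties(1)[OF X0])
  have uu: "upper_limit z1 z2 = of_real u" unfolding z1_def z2_def u_def X0_def d_def by (rule upper_limit_coroot[OF a b])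
  define x where "x = (\<lambda>v. a * b + d * (2 / v - 1))"
  \<comment> \<open>The position on the segment as a function of \<open>v\<close>: it increases from
    0, the end point 1, to 1, the upper limit.\<close>
  define h where "h = (\<lambda>v. (coroot (x v) - 1) / (u - 1))"
  define h' where "h' = (\<lambda>v. 2 * d / (v\<^sup>2 * R (x v) ^ 3 * (u - 1)))"
  have xX: "X b (of_real a) v = of_real (x v)" for v
    unfolding X_def sqrt_sq_minus_1_of_real[OF a] x_def d_def by simp
  have xv: "x v > X0" "x v > 1" if "v \<in> {0<..<1}" for v
  proof -
    have "2 / v - 1 > 1" using that by (simp add: field_simps)
    then have "d * (2 / v - 1) > d * 1" using d by (intro mult_strict_left_mono) auto
    then show "x v > X0" by (simp add: x_def X0_def)
    then show "x v > 1" using X0 by simp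
  qed
  have hd: "(h has_real_derivative h' v) (at v)" if v: "v \<in> {0<..<1}" for v
  proof -
    have "(x has_real_derivative d * (- 2 / v\<^sup>2)) (at v)"
      unfolding x_def using v by (auto intro!: derivative_eq_intros simp: power2_eq_square)
    from DERIV_chain2[OF coroot_properties(4)[OF xv(2)[OF v]] this]
    have "((\<lambda>v. coroot (x v)) has_real_derivative - 1 / sqrt ((x v)\<^sup>2 - 1) ^ 3 * (d * (- 2 / v\<^sup>2))) (at v)" .
    then have "(h has_real_derivative (- 1 / sqrt ((x v)\<^sup>2 - 1) ^ 3 * (d * (- 2 / v\<^sup>2)) - 0) / (u - 1)) (at v)"
      unfolding h_def by (intro DERIV_cdivide DERIV_diff DERIV_const)
    then show ?thesis by (simp add: h'_def R_def mult_ac)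
  qed
  have inj: "inj_on h {0<..<1}"
  proof (rule inj_onI)
    fix v w assume vw: "v \<in> {0<..<1}" "w \<in> {0<..<1}" "h v = h w"
    then have "coroot (x v) = coroot (x w)" using u by (simp add: h_def)
    then have "x v = x w" using coroot_properties(3) xv(2) vw by metis
    then show "v = w" using d vw by (simp add: x_def field_simps)
  qed
  have img: "h ` {0<..<1} = {0<..<1}"
  proof (intro equalityI subsetI)
    fix s assume "s \<in> h ` {0<..<1}"
    then obtain v where v: "v \<in> {0<..<1}" "s = h v" by blast
    have "coroot (x v) < u" unfolding u_def by (rule coroot_less[OF X0 xv(1)[OF v(1)]])
    then show "s \<in> {0<..<1}" using coroot_properties(1)[OF xv(2)[OF v(1)]] u by (simp add: v(2) h_def)
  next
    fix s :: real assume s: "s \<in> {0<..<1}"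
    define z where "z = 1 + s * (u - 1)"
    have z: "z > 1" "z < u"
    proof -
      show "z > 1" using s u by (simp add: z_def)
      have "s * (u - 1) < 1 * (u - 1)" using s u by (intro mult_strict_right_mono) auto
      then show "z < u" by (simp add: z_def)
    qed
    have cz: "coroot z > X0" using coroot_less[OF z] coroot_properties(3)[OF X0] by (simp add: u_def)
    define t where "t = (coroot z - a * b) / d"
    have t: "t > 1" using cz d by (simp add: t_def X0_def field_simps)
    have "2 / (2 / (t + 1)) - 1 = t" using t by (simp add: field_simps)
    then have xt: "x (2 / (t + 1)) = coroot z" unfolding x_def using d by (simp add: t_def)
    have "h (2 / (t + 1)) = s"
      unfolding h_def xt coroot_properties(3)[OF z(1)] using u by (simp add: z_def)
    moreover have "2 / (t + 1) \<in> {0<..<1}" using t by simp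
    ultimately show "s \<in> h ` {0<..<1}" by (metis image_eqI)
  qed
  define K where "K = - (z1 powr (\<nu> + 1) * z2 powr (\<nu> + 1)) * of_real (2 * R a * R b) powr (-\<nu>)"
  define J where "J = (\<lambda>s. product_integrand \<nu> \<mu> z1 z2 (1 + of_real s * (of_real u - 1)) * (of_real u - 1))"
  have key: "\<bar>h' v\<bar> *\<^sub>R J (h v) = K * (G (X b (of_real a) v) * \<omega> v)" if v: "v \<in> {0<..<1}" for v
  proof -
    define Y where "Y = R (x v)"
    define Z where "Z = coroot (x v)"
    have Y: "Y > 0" unfolding Y_def by (rule R_pos[OF xv(2)[OF v]])
    have Z: "Z > 1" unfolding Z_def by (rule coroot_properties(1)[OF xv(2)[OF v]])
    have c: "coroot a > 1" "coroot b > 1" using coroot_properties(1) a b by auto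
    have v0: "v > 0" "1 - v > 0" using v by auto
    have arg: "1 + of_real (h v) * (of_real u - 1) = complex_of_real Z"
      using u by (simp add: h_def Z_def)
    have x2: "(x v - a * b)\<^sup>2 - (R a * R b)\<^sup>2 = d\<^sup>2 * (4 * (1 - v) / v\<^sup>2)"
      using v0 by (simp add: x_def d_def[symmetric] power_mult_distrib power2_eq_square field_simps)
    define Q where "Q = 2 * d * (1 - v) / (v * v * Y * coroot a * coroot b * Z)"
    have kC: "kernel_C z1 z2 (of_real Z) - 1 = of_real Q"
    proof -
      have "d\<^sup>2 * (4 * (1 - v) / v\<^sup>2) / (2 * R a * R b * R (x v) * coroot a * coroot b * coroot (x v)) = Q"
        unfolding Q_def Y_def[symmetric] Z_def[symmetric] mult.assoc[of 2 "R a" "R b"] d_def[symmetric]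
        using d v0 Y Z c by (simp add: field_simps power2_eq_square)
      then show ?thesis using kernel_C_coroot[OF a b xv(2)[OF v]] unfolding x2 z1_def z2_def Z_def by simp
    qed
    have Q: "Q > 0" using d v0 Y Z c by (simp add: Q_def)
    have "Y\<^sup>2 = (x v)\<^sup>2 - 1" unfolding Y_def by (rule R_squared[OF xv(2)[OF v]])
    then have YZ: "Y\<^sup>2 - (x v)\<^sup>2 = - 1" by simp
    have "1 - Z\<^sup>2 = (Y\<^sup>2 - (x v)\<^sup>2) / Y\<^sup>2"
      using Y unfolding Z_def coroot_R Y_def[symmetric] by (simp add: power_divide diff_divide_distrib)
    then have Z2: "1 - Z\<^sup>2 = - 1 / (Y * Y)" unfolding YZ by (simp add: power2_eq_square)
    have "1 - (complex_of_real Z)\<^sup>2 = of_real (1 - Z\<^sup>2)" by simp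
    then have Z2c: "1 - (complex_of_real Z)\<^sup>2 = - 1 / of_real (Y * Y)" unfolding Z2 by simp
    have L: "Legendre_P \<nu> (-\<mu>) (of_real Z) = of_real Y powr (-\<nu>) * G (of_real (x v))"
      unfolding Z_def Y_def by (rule Legendre_P_coroot[OF xv(2)[OF v]])
    have h'u: "complex_of_real \<bar>h' v\<bar> * (of_real u - 1) = of_real (2 * d / (v * v * (Y * Y * Y)))"
    proof -
      have "h' v > 0" using d v0 Y u by (simp add: h'_def Y_def[symmetric])
      moreover have "h' v * (u - 1) = 2 * d / (v * v * (Y * Y * Y))"
        using u by (simp add: h'_def Y_def[symmetric] power2_eq_square power3_eq_cube)
      ultimately show ?thesis by (metis abs_of_pos of_real_1 of_real_diff of_real_mult)
    qed
    \<comment> \<open>All bases are positive reals. Written as exponentials of real logarithms, the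
      powers are compared by linear algebra in their exponents.\<close>
    define l2 where "l2 = complex_of_real (ln (2 * d))"
    define lw where "lw = complex_of_real (ln (1 - v))"
    define lv where "lv = complex_of_real (ln v)"
    define lY where "lY = complex_of_real (ln Y)"
    define la where "la = complex_of_real (ln (coroot a))"
    define lb where "lb = complex_of_real (ln (coroot b))"
    define lZ where "lZ = complex_of_real (ln Z)"
    have lnQ: "of_real (ln Q) = l2 + lw - (lv + lv + lY + la + lb + lZ)"
    proof -
      have "ln Q = ln (2 * d) + ln (1 - v) - (ln v + ln v + ln Y + ln (coroot a) + ln (coroot b) + ln Z)"
        using d v0 Y Z c by (simp add: Q_def ln_div ln_mult)
      then show ?thesis unfolding l2_def lw_def lv_def lY_def la_def lb_def lZ_def by (simp only: of_real_add of_real_diff)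
    qed
    have e1: "complex_of_real (2 * d / (v * v * (Y * Y * Y))) = exp (l2 - (lv + lv + (lY + lY + lY)))"
    proof -
      have "ln (2 * d / (v * v * (Y * Y * Y))) = ln (2 * d) - (ln v + ln v + (ln Y + ln Y + ln Y))"
        using d v0 Y by (simp add: ln_div ln_mult)
      moreover have "2 * d / (v * v * (Y * Y * Y)) > 0" using d v0 Y by simp
      ultimately show ?thesis by (subst of_real_exp_ln) (simp_all add: l2_def lv_def lY_def)
    qed
    have e2: "1 / (- 1 / complex_of_real (Y * Y)) = - exp (lY + lY)"
    proof -
      have e: "complex_of_real Y = exp lY" unfolding lY_def by (rule of_real_exp_ln[OF Y])
      show ?thesis unfolding of_real_mult e exp_add by simp
    qed
    have "\<bar>h' v\<bar> *\<^sub>R J (h v) = (of_real \<bar>h' v\<bar> * (of_real u - 1)) * product_integrand \<nu> \<mu> z1 z2 (of_real Z)"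
      unfolding J_def arg by (simp add: scaleR_conv_of_real mult_ac)
    also have "\<dots> = exp (l2 - (lv + lv + (lY + lY + lY))) * (exp (-\<nu> * lY) * G (of_real (x v)) *
        (exp ((-\<nu> - 1) * (l2 + lw - (lv + lv + lY + la + lb + lZ))) * (1 / exp ((\<nu> + 1) * lZ)) * (1 / (- 1 / of_real (Y * Y)))))"
      unfolding h'u e1 product_integrand_def L kC Z2c
      using Q Y Z by (simp add: of_real_powr_exp lnQ lY_def[symmetric] lZ_def[symmetric])
    also have "\<dots> = - (exp (l2 - (lv + lv + (lY + lY + lY))) * exp (-\<nu> * lY) * exp ((-\<nu> - 1) * (l2 + lw - (lv + lv + lY + la + lb + lZ))) *
        exp (- ((\<nu> + 1) * lZ)) * exp (lY + lY)) * G (of_real (x v))"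
      unfolding e2 exp_minus by (simp add: divide_inverse mult_ac)
    also have "exp (l2 - (lv + lv + (lY + lY + lY))) * exp (-\<nu> * lY) * exp ((-\<nu> - 1) * (l2 + lw - (lv + lv + lY + la + lb + lZ))) *
        exp (- ((\<nu> + 1) * lZ)) * exp (lY + lY) = exp ((\<nu> + 1) * la) * exp ((\<nu> + 1) * lb) * exp (-\<nu> * l2) * exp (2 * \<nu> * lv) * exp ((-\<nu> - 1) * lw)"
      unfolding mult_exp_exp by (rule arg_cong[where f = exp]) (simp add: algebra_simps)
    also have "- \<dots> * G (of_real (x v)) = K * (G (X b (of_real a) v) * \<omega> v)"
    proof -
      have "2 * R a * R b = 2 * d" by (simp add: d_def)
      show ?thesis
        unfolding xX K_def \<omega>_def z1_def z2_def \<open>2 * R a * R b = 2 * d\<close>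
        using c d v0 by (simp add: of_real_powr_exp la_def lb_def l2_def lv_def lw_def del: of_real_mult of_real_diff)
    qed
    finally show ?thesis .
  qed
  have int: "(\<lambda>v. G (X b (of_real a) v) * \<omega> v) absolutely_integrable_on {0<..<1}"
    by (rule beta_dominated_absolutely_integrable[OF F_dominated[OF b]]) (use a in simp)
  have KI: "(\<lambda>v. K * (G (X b (of_real a) v) * \<omega> v)) absolutely_integrable_on {0<..<1}"
    by (rule set_integrable_mult_right) (rule int)
  have B: "(\<lambda>v. \<bar>h' v\<bar> *\<^sub>R J (h v)) absolutely_integrable_on {0<..<1}"
    using KI by (subst set_integrable_cong[OF refl refl key])
  have "integral {0<..<1} (\<lambda>v. \<bar>h' v\<bar> *\<^sub>R J (h v)) = K * I0 b (of_real a)"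
  proof -
    have "integral {0<..<1} (\<lambda>v. \<bar>h' v\<bar> *\<^sub>R J (h v)) = integral {0<..<1} (\<lambda>v. K * (G (X b (of_real a) v) * \<omega> v))"
      by (rule integral_cong) (rule key)
    then show ?thesis by (simp add: I0_def)
  qed
  with B have "J absolutely_integrable_on h ` {0<..<1} \<and> integral (h ` {0<..<1}) J = K * I0 b (of_real a)"
    by (subst has_absolute_integral_change_of_variables_real[symmetric, where h = h'])
      (use hd inj in \<open>auto intro: has_field_derivative_at_within\<close>)
  then have JI: "J absolutely_integrable_on {0<..<1}" and "integral {0<..<1} J = K * I0 b (of_real a)"
    unfolding img by auto
  then have "(J has_integral K * I0 b (of_real a)) {0<..<1}"
    using set_lebesgue_integral_eq_integral(1)[OF JI] by (simp add: has_integral_iff)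
  then have "(J has_integral K * I0 b (of_real a)) {0..1}" by (simp add: has_integral_Icc_iff_Ioo)
  moreover have "J = (\<lambda>s. product_integrand \<nu> \<mu> z1 z2 (linepath 1 (of_real u) s) * (of_real u - 1))"
    unfolding J_def by (intro ext arg_cong[where f = "\<lambda>w. product_integrand \<nu> \<mu> z1 z2 w * (of_real u - 1)"])
      (simp add: linepath_def scaleR_conv_of_real algebra_simps)
  ultimately show ?thesis unfolding uu K_def[symmetric] has_contour_integral_linepath by simp
qed

theorem real_product_formula:
  assumes x: "x > 1" and y: "y > 1"
  defines "z1 \<equiv> complex_of_real x" and "z2 \<equiv> complex_of_real y"
  shows "(product_integrand \<nu> \<mu> z1 z2 has_contour_integral
     - (z1 powr (\<nu> + 1) * z2 powr (\<nu> + 1)) * Gamma (\<nu> + \<mu> + 1) * Gamma (-\<nu>) * (Legendre_P \<nu> (-\<mu>) z1 * Legendre_P \<nu> (-\<mu>) z2))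
     (linepath 1 (upper_limit z1 z2))"
proof -
  define a where "a = coroot x" define b where "b = coroot y"
  have a: "a > 1" "coroot a = x" and b: "b > 1" "coroot b = y"
    using coroot_properties[OF x] coroot_properties[OF y] by (auto simp: a_def b_def)
  have r: "R a > 0" "R b > 0" using R_pos a b by auto
  have c: "of_real (2 * R a * R b) powr (-\<nu>) * 2 powr \<nu> = of_real (R a) powr (-\<nu>) * complex_of_real (R b) powr (-\<nu>)"
  proof -
    have "complex_of_real (2 * R a * R b) powr (-\<nu>) = 2 powr (-\<nu>) * of_real (R a) powr (-\<nu>) * of_real (R b) powr (-\<nu>)"
      using of_real_powr_mult[of "2 * R a" "R b" "-\<nu>"] of_real_powr_mult[of 2 "R a" "-\<nu>"] r by simp
    moreover have "(2::complex) powr (-\<nu>) * 2 powr \<nu> = 1" by (simp flip: powr_add)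
    ultimately show ?thesis by (simp add: mult_ac)
  qed
  have "- (z1 powr (\<nu> + 1) * z2 powr (\<nu> + 1)) * of_real (2 * R a * R b) powr (-\<nu>) * I0 b (of_real a)
     = - (z1 powr (\<nu> + 1) * z2 powr (\<nu> + 1)) * Gamma (\<nu> + \<mu> + 1) * Gamma (-\<nu>) *
       ((of_real (2 * R a * R b) powr (-\<nu>) * 2 powr \<nu>) * G (of_real a) * G (of_real b))"
    unfolding product_I0[OF a(1) b(1)] by (simp only: mult_ac mult_minus_left)
  also have "(of_real (2 * R a * R b) powr (-\<nu>) * 2 powr \<nu>) * G (of_real a) * G (of_real b)
     = Legendre_P \<nu> (-\<mu>) z1 * Legendre_P \<nu> (-\<mu>) z2"
    unfolding c z1_def z2_def using Legendre_P_coroot[OF a(1)] Legendre_P_coroot[OF b(1)] a(2) b(2) by (simp add: mult_ac)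
  finally have E: "- (z1 powr (\<nu> + 1) * z2 powr (\<nu> + 1)) * of_real (2 * R a * R b) powr (-\<nu>) * I0 b (of_real a)
     = - (z1 powr (\<nu> + 1) * z2 powr (\<nu> + 1)) * Gamma (\<nu> + \<mu> + 1) * Gamma (-\<nu>) *
       (Legendre_P \<nu> (-\<mu>) z1 * Legendre_P \<nu> (-\<mu>) z2)" .
  show ?thesis using real_segment_integral[OF a(1) b(1)] unfolding a(2) b(2) z1_def[symmetric] z2_def[symmetric] E .
qed

end

section \<open>The integrand on the principal region\<close>

text \<open>Branch conditions along a segment starting at 1 reduce to this: the points in question
  are combinations, with nonnegative coefficients, of 1 and a number off the negative axis.\<close>

lemma nonpos_affine:
  fixes w :: complex
  assumes "w \<notin> \<real>\<^sub>\<le>\<^sub>0" "c > 0" "t \<ge> 0"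
  shows "of_real c + of_real t * w \<notin> \<real>\<^sub>\<le>\<^sub>0" "of_real t + of_real c * w \<notin> \<real>\<^sub>\<le>\<^sub>0"
proof -
  show "of_real c + of_real t * w \<notin> \<real>\<^sub>\<le>\<^sub>0"
  proof
    assume "of_real c + of_real t * w \<in> \<real>\<^sub>\<le>\<^sub>0"
    then have *: "c + t * Re w \<le> 0" "t * Im w = 0" by (auto simp: complex_nonpos_Reals_iff)
    then have t: "t > 0" using assms by (cases "t = 0") auto
    then have "Im w = 0" "t * Re w < t * 0" using * assms by auto
    then have "Im w = 0" "Re w < 0" using t by (auto simp only: mult_less_cancel_left_pos)
    then show False using assms by (simp add: complex_nonpos_Reals_iff)
  qed
  show "of_real t + of_real c * w \<notin> \<real>\<^sub>\<le>\<^sub>0"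
  proof
    assume "of_real t + of_real c * w \<in> \<real>\<^sub>\<le>\<^sub>0"
    then have *: "t + c * Re w \<le> 0" "c * Im w = 0" by (auto simp: complex_nonpos_Reals_iff)
    then have "Im w = 0" "c * Re w \<le> c * 0" using assms by auto
    then have "Im w = 0" "Re w \<le> 0" using assms by (auto simp only: mult_le_cancel_left_pos)
    then show False using assms by (simp add: complex_nonpos_Reals_iff)
  qed
qed

lemma cut_plane_nonzero:
  assumes "z \<in> cut_plane" shows "z \<noteq> 0" "z \<noteq> 1" "z \<noteq> -1" "sqrt_sq_minus_1 z \<noteq> 0"
proof -
  show z: "z \<noteq> 0" "z \<noteq> 1" "z \<noteq> -1" using assms by (auto simp: in_cut_plane_iff complex_nonpos_Reals_iff)
  have "(sqrt_sq_minus_1 z)\<^sup>2 = (z - 1) * (z + 1)" unfolding sqrt_sq_minus_1_power2 by (simp add: power2_eq_square algebra_simps)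
  moreover have "z + 1 \<noteq> 0" using z(3) by (metis add_eq_0_iff2)
  ultimately show "sqrt_sq_minus_1 z \<noteq> 0" using z by auto
qed

lemma csqrt_continuous_compose:
  fixes h :: "'a::topological_space \<Rightarrow> complex"
  assumes "continuous_on T h" "\<And>s. s \<in> T \<Longrightarrow> h s \<notin> \<real>\<^sub>\<le>\<^sub>0"
  shows "continuous_on T (\<lambda>s. csqrt (h s))"
proof -
  have "csqrt holomorphic_on - \<real>\<^sub>\<le>\<^sub>0" by (intro holomorphic_intros) auto
  then show ?thesis using assms
    by (intro continuous_on_compose2[OF holomorphic_on_imp_continuous_on, of csqrt "- \<real>\<^sub>\<le>\<^sub>0"]) auto
qed

text \<open>
  The conditions under which no factor of the integrand degenerates on the closed segment. The last
  one excludes the wrong sign of \<open>sqrt (u\<^sup>2 - 1)\<close>, for which \<open>C - 1\<close> would not vanish at the upper limit \<open>u\<close>.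
\<close>

definition regular_pairs :: "(complex \<times> complex) set" where
  "regular_pairs = {p. p \<in> cut_free_pairs \<and> (fst p + snd p) * segment_root p 1 = root_product p}"

text \<open>The numerator of \<open>C - 1\<close> is a product of two differences. The one vanishing
  at the upper limit is rationalised by its conjugate \<open>seg_den\<close>, which exposes the
  factor \<open>1 - t\<close>; the other one is \<open>seg_num\<close>.\<close>

definition seg_num :: "(complex \<times> complex) \<Rightarrow> real \<Rightarrow> complex" where
  "seg_num p t = segment_point p t * root_product p - (fst p * snd p - 1) * of_real (sqrt t) * segment_root p t"

definition seg_den :: "(complex \<times> complex) \<Rightarrow> real \<Rightarrow> complex" where
  "seg_den p t = segment_point p t * root_product p + (fst p * snd p + 1) * of_real (sqrt t) * segment_root p t"

definition w_of :: "(complex \<times> complex) \<Rightarrow> complex" where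
  "w_of p = upper_limit (fst p) (snd p) - 1"

lemma segment_point_w: "segment_point p t = 1 + of_real t * w_of p"
  by (simp add: segment_point_def w_of_def)

lemma segment_root_w: "segment_root p t = csqrt (w_of p) * csqrt (2 + of_real t * w_of p)"
  by (simp add: segment_root_def segment_point_w w_of_def)

lemma kernel_normalised_eq:
  "kernel_normalised p t = (fst p + snd p)\<^sup>2 * w_of p * (2 + w_of p + of_real t * w_of p) * seg_num p t /
     (seg_den p t * (2 * fst p * snd p * segment_point p t * segment_root p t * root_product p))"
  by (simp add: kernel_normalised_def seg_num_def seg_den_def w_of_def segment_point_def algebra_simps)

lemma regular_pairs_D:
  assumes p: "p \<in> regular_pairs"
  shows "fst p \<in> cut_plane" "snd p \<in> cut_plane" "fst p + snd p \<noteq> 0" "w_of p \<notin> \<real>\<^sub>\<le>\<^sub>0" "w_of p \<noteq> 0"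
    "root_product p \<noteq> 0" "1 + fst p * snd p = (1 + w_of p) * (fst p + snd p)"
    "upper_limit (fst p) (snd p) \<in> cut_plane"
proof -
  show *: "fst p \<in> cut_plane" "snd p \<in> cut_plane" "fst p + snd p \<noteq> 0" "w_of p \<notin> \<real>\<^sub>\<le>\<^sub>0" "upper_limit (fst p) (snd p) \<in> cut_plane"
    using p by (auto simp: regular_pairs_def cut_free_pairs_def w_of_def in_cut_plane_iff)
  then show "w_of p \<noteq> 0" by auto
  show "root_product p \<noteq> 0" using cut_plane_nonzero(4) * by (simp add: root_product_def)
  show "1 + fst p * snd p = (1 + w_of p) * (fst p + snd p)" using * by (simp add: w_of_def upper_limit_def)
qed

text \<open>Everything follows from \<open>w_of p\<close> lying off the negative axis, that is from
  the upper limit lying in \<open>cut_plane\<close>: each quantity is built from positive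
  combinations of 1 and \<open>w_of p\<close> or its inverse, and from roots of such.\<close>

lemma seg_facts:
  assumes p: "p \<in> regular_pairs" and t: "t \<in> {0..1}"
  shows "segment_point p t \<notin> \<real>\<^sub>\<le>\<^sub>0" "2 + of_real t * w_of p \<notin> \<real>\<^sub>\<le>\<^sub>0" "2 + w_of p + of_real t * w_of p \<noteq> 0"
    "(segment_point p t + 1) / w_of p \<notin> \<real>\<^sub>\<le>\<^sub>0" "segment_root p t \<noteq> 0" "(1 - segment_point p t) / 2 \<in> slit_plane"
proof -
  note D = regular_pairs_D[OF p]
  show "segment_point p t \<notin> \<real>\<^sub>\<le>\<^sub>0"
    unfolding segment_point_w using nonpos_affine(1)[OF D(4), of 1 t] t by simp
  show two: "2 + of_real t * w_of p \<notin> \<real>\<^sub>\<le>\<^sub>0" using nonpos_affine(1)[OF D(4), of 2 t] t by simp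
  have "2 + of_real (1 + t) * w_of p \<notin> \<real>\<^sub>\<le>\<^sub>0" using nonpos_affine(1)[OF D(4), of 2 "1 + t"] t by simp
  then show "2 + w_of p + of_real t * w_of p \<noteq> 0" by (auto simp: algebra_simps)
  have i: "inverse (w_of p) \<notin> \<real>\<^sub>\<le>\<^sub>0" using D(4) by simp
  have "(segment_point p t + 1) / w_of p = of_real t + of_real 2 * inverse (w_of p)"
    unfolding segment_point_w using D(5) by (simp add: field_simps)
  then show "(segment_point p t + 1) / w_of p \<notin> \<real>\<^sub>\<le>\<^sub>0" using nonpos_affine(2)[OF i, of 2 t] t by simp
  have "2 + of_real t * w_of p \<noteq> 0" using two by auto
  then show "segment_root p t \<noteq> 0" unfolding segment_root_w using D(5) by simp
  have e: "1 - (1 - segment_point p t) / 2 = of_real 1 + of_real (t / 2) * w_of p"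
    unfolding segment_point_w by (simp add: field_simps)
  show "(1 - segment_point p t) / 2 \<in> slit_plane"
    unfolding mem_slit_plane_iff e using nonpos_affine(1)[OF D(4), of 1 "t / 2"] t by simp
qed

lemma segment_root_squared: "(of_real (sqrt t) * segment_root p t)\<^sup>2 = (segment_point p t)\<^sup>2 - 1" if "t \<ge> 0"
  using sqrt_seg[OF that, of p] sqrt_sq_minus_1_power2[of "segment_point p t"] by simp

lemma root_product_squared: "(root_product p)\<^sup>2 = ((fst p)\<^sup>2 - 1) * ((snd p)\<^sup>2 - 1)"
  by (simp add: root_product_def power_mult_distrib sqrt_sq_minus_1_power2)

text \<open>At \<open>t = 0\<close> only the root product survives; at \<open>t = 1\<close> the sign
  condition in \<open>regular_pairs\<close> gives both values explicitly. In between,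
  \<open>seg_den\<close> times its conjugate is \<open>(a + b)\<^sup>2 * (u - z) * (u + z)\<close>,
  which has no zero, and a zero of \<open>seg_num\<close> would mean \<open>C - 1 = 0\<close>, a
  point of the excluded cut.\<close>

lemma seg_num_den_nonzero:
  assumes p: "p \<in> regular_pairs" and t: "t \<in> {0..1}"
  shows "seg_den p t \<noteq> 0" "seg_num p t \<noteq> 0"
proof -
  note D = regular_pairs_D[OF p] and F = seg_facts[OF p t]
  consider "t = 0" | "t = 1" | "t \<in> {0<..<1}" using t by force
  then have "seg_den p t \<noteq> 0 \<and> seg_num p t \<noteq> 0"
  proof cases
    case 1
    then show ?thesis using D by (simp add: seg_den_def seg_num_def segment_point_w)
  next
    case 2
    have r: "(fst p + snd p) * segment_root p 1 = root_product p" using p by (simp add: regular_pairs_def)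
    have sp: "segment_point p 1 = 1 + w_of p" by (simp add: segment_point_w)
    have e: "segment_point p 1 * root_product p = (1 + fst p * snd p) * segment_root p 1"
      unfolding sp r[symmetric] D(7) by (simp add: mult_ac)
    have "seg_den p 1 = 2 * (1 + fst p * snd p) * segment_root p 1" "seg_num p 1 = 2 * segment_root p 1"
      unfolding seg_den_def seg_num_def e by (simp_all add: algebra_simps)
    moreover have "1 + fst p * snd p \<noteq> 0"
      unfolding D(7) using D(3) F(1) 2 sp by auto
    moreover have "2 * (1 + fst p * snd p) * segment_root p 1 \<noteq> 0"
      using calculation(3) F(5) 2 unfolding mult_eq_0_iff by simp
    ultimately show ?thesis using F(5) 2 by simp
  next
    case 3
    then have t0: "t \<ge> 0" "sqrt t \<noteq> 0" by auto
    define a b z s u r where defs: "a = fst p" "b = snd p" "z = segment_point p t"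
      "s = of_real (sqrt t) * segment_root p t" "u = upper_limit a b" "r = root_product p"
    have s2: "s\<^sup>2 = z\<^sup>2 - 1" unfolding defs by (rule segment_root_squared[OF t0(1)])
    have r2: "r\<^sup>2 = (a\<^sup>2 - 1) * (b\<^sup>2 - 1)" unfolding defs by (rule root_product_squared)
    have ub: "1 + a * b = u * (a + b)" using D(3) by (simp add: defs upper_limit_def)
    have uw: "u = 1 + w_of p" by (simp add: defs w_of_def)
    have "(z * r - (a * b + 1) * s) * (z * r + (a * b + 1) * s) = z\<^sup>2 * r\<^sup>2 - (1 + a * b)\<^sup>2 * s\<^sup>2"
      by algebra
    also have "\<dots> = (1 + a * b)\<^sup>2 - (a + b)\<^sup>2 * z\<^sup>2" unfolding r2 s2 by algebra
    also have "\<dots> = (a + b)\<^sup>2 * (u - z) * (u + z)" unfolding ub by algebra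
    finally have m: "(z * r - (a * b + 1) * s) * (z * r + (a * b + 1) * s) = (a + b)\<^sup>2 * (u - z) * (u + z)" .
    have "u - z = of_real (1 - t) * w_of p" by (simp add: uw defs segment_point_w algebra_simps)
    then have "u - z \<noteq> 0" using D(5) 3 by simp
    moreover have "u + z \<noteq> 0" using F(3) by (simp add: uw defs segment_point_w add_ac)
    ultimately have nz: "z * r + (a * b + 1) * s \<noteq> 0" using m D(3) by (auto simp: defs)
    then have den: "seg_den p t \<noteq> 0" by (simp add: seg_den_def defs mult.assoc)
    have z0: "z \<noteq> 0" using F(1) by (auto simp: defs)
    have s0: "s \<noteq> 0" using F(5) t0 by (simp add: defs)
    have st: "sqrt_sq_minus_1 z = s" unfolding defs by (rule sqrt_seg[OF t0(1)])
    have "kernel_C a b z - 1 = (a + b)\<^sup>2 * (u - z) * (u + z) * (z * r - (a * b - 1) * s) /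
       ((z * r + (a * b + 1) * s) * (2 * a * b * z * s * r))"
      using kernel_eq_aux[OF r2 s2 ub] cut_plane_nonzero D(1,2,6) z0 s0 nz
      unfolding kernel_C_def st by (simp add: defs root_product_def mult_ac)
    moreover have "kernel_C a b z - 1 \<notin> \<real>\<^sub>\<le>\<^sub>0"
    proof -
      have "z \<in> open_segment 1 u"
        unfolding in_segment using 3 D(5) uw by (intro conjI exI[of _ t]) (auto simp: defs segment_point_w scaleR_conv_of_real algebra_simps)
      then show ?thesis using p by (auto simp: regular_pairs_def cut_free_pairs_def defs split: prod.splits)
    qed
    ultimately have "z * r - (a * b - 1) * s \<noteq> 0" by auto
    then show ?thesis using den by (simp add: seg_num_def defs mult.assoc)
  qed
  then show "seg_den p t \<noteq> 0" "seg_num p t \<noteq> 0" by auto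
qed

lemma kernel_normalised_nonzero:
  assumes p: "p \<in> regular_pairs" and t: "t \<in> {0..1}"
  shows "kernel_normalised p t \<noteq> 0"
    "seg_den p t * (2 * fst p * snd p * segment_point p t * segment_root p t * root_product p) \<noteq> 0"
proof -
  note D = regular_pairs_D[OF p] and F = seg_facts[OF p t] and N = seg_num_den_nonzero[OF p t]
  have "segment_point p t \<noteq> 0" using F(1) by auto
  then show "seg_den p t * (2 * fst p * snd p * segment_point p t * segment_root p t * root_product p) \<noteq> 0"
    using cut_plane_nonzero(1) D N F by simp
  then show "kernel_normalised p t \<noteq> 0" unfolding kernel_normalised_eq using D N F by simp
qed

lemma kernel_normalised_not_nonpos:
  assumes p: "p \<in> regular_pairs" and t: "t \<in> {0<..<1}"
  shows "kernel_C (fst p) (snd p) (segment_point p t) - 1 = of_real ((1 - t) / sqrt t) * kernel_normalised p t"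
    "kernel_normalised p t \<notin> \<real>\<^sub>\<le>\<^sub>0"
proof -
  have t': "0 < t" "t < 1" "t \<in> {0..1}" using t by auto
  show e: "kernel_C (fst p) (snd p) (segment_point p t) - 1 = of_real ((1 - t) / sqrt t) * kernel_normalised p t"
    by (rule kernel_seg[OF t'(1,2) kernel_normalised_nonzero(1)[OF p t'(3)]])
  have "segment_point p t \<in> open_segment 1 (upper_limit (fst p) (snd p))"
    unfolding in_segment using t' regular_pairs_D(5)[OF p]
    by (intro conjI exI[of _ t]) (auto simp: w_of_def segment_point_def scaleR_conv_of_real algebra_simps)
  then have "kernel_C (fst p) (snd p) (segment_point p t) - 1 \<notin> \<real>\<^sub>\<le>\<^sub>0"
    using p by (auto simp: regular_pairs_def cut_free_pairs_def split: prod.splits)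
  then have *: "of_real ((1 - t) / sqrt t) * kernel_normalised p t \<notin> \<real>\<^sub>\<le>\<^sub>0" unfolding e .
  show "kernel_normalised p t \<notin> \<real>\<^sub>\<le>\<^sub>0"
  proof
    assume "kernel_normalised p t \<in> \<real>\<^sub>\<le>\<^sub>0"
    moreover have "(1 - t) / sqrt t > 0" using t' by simp
    moreover have "of_real c * w \<in> \<real>\<^sub>\<le>\<^sub>0" if "c > 0" "w \<in> \<real>\<^sub>\<le>\<^sub>0" for c and w :: complex
      using that by (auto simp: complex_nonpos_Reals_iff mult_nonneg_nonpos)
    ultimately have "of_real ((1 - t) / sqrt t) * kernel_normalised p t \<in> \<real>\<^sub>\<le>\<^sub>0" by blast
    with * show False by simp
  qed
qed

lemma pair_continuous:
  fixes P :: "'a::topological_space \<Rightarrow> complex \<times> complex" and T :: "'a \<Rightarrow> real"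
  assumes c: "continuous_on S P" "continuous_on S T"
    and S: "\<And>s. s \<in> S \<Longrightarrow> P s \<in> regular_pairs \<and> T s \<in> {0..1}"
  shows "continuous_on S (\<lambda>s. w_of (P s))" "continuous_on S (\<lambda>s. segment_point (P s) (T s))"
    "continuous_on S (\<lambda>s. segment_root (P s) (T s))" "continuous_on S (\<lambda>s. root_product (P s))"
    "continuous_on S (\<lambda>s. kernel_normalised (P s) (T s))"
proof -
  note D = regular_pairs_D
  have c': "continuous_on S (\<lambda>s. fst (P s))" "continuous_on S (\<lambda>s. snd (P s))"
    by (intro continuous_on_fst continuous_on_snd c)+
  show w: "continuous_on S (\<lambda>s. w_of (P s))"
    unfolding w_of_def upper_limit_def by (intro continuous_intros c') (use D(3) S in auto)
  show z: "continuous_on S (\<lambda>s. segment_point (P s) (T s))"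
    unfolding segment_point_w by (intro continuous_intros w c)
  have "w_of (P s) \<notin> \<real>\<^sub>\<le>\<^sub>0" "2 + of_real (T s) * w_of (P s) \<notin> \<real>\<^sub>\<le>\<^sub>0" if "s \<in> S" for s
    using D(4) seg_facts(2) S that by auto
  then show r: "continuous_on S (\<lambda>s. segment_root (P s) (T s))"
    unfolding segment_root_w
    by (intro continuous_on_mult csqrt_continuous_compose continuous_on_add continuous_on_const w continuous_on_of_real c) auto
  have "fst (P s) - 1 \<notin> \<real>\<^sub>\<le>\<^sub>0" "snd (P s) - 1 \<notin> \<real>\<^sub>\<le>\<^sub>0" if "s \<in> S" for s
    using D(1,2) S that by (auto simp: in_cut_plane_iff)
  moreover have "z + 1 \<notin> \<real>\<^sub>\<le>\<^sub>0" if "z - 1 \<notin> \<real>\<^sub>\<le>\<^sub>0" for z :: complex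
    using that by (auto simp: complex_nonpos_Reals_iff)
  ultimately show rp: "continuous_on S (\<lambda>s. root_product (P s))"
    unfolding root_product_def sqrt_sq_minus_1_def
    by (intro continuous_on_mult csqrt_continuous_compose continuous_on_add continuous_on_diff continuous_on_const c') auto
  have "continuous_on S (\<lambda>s. (fst (P s) + snd (P s))\<^sup>2 * w_of (P s) * (2 + w_of (P s) + of_real (T s) * w_of (P s)) * seg_num (P s) (T s) /
     (seg_den (P s) (T s) * (2 * fst (P s) * snd (P s) * segment_point (P s) (T s) * segment_root (P s) (T s) * root_product (P s))))"
  proof (rule continuous_on_divide)
    show "\<forall>s\<in>S. seg_den (P s) (T s) * (2 * fst (P s) * snd (P s) * segment_point (P s) (T s) * segment_root (P s) (T s) * root_product (P s)) \<noteq> 0"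
      using kernel_normalised_nonzero(2) S by blast
    have sq: "continuous_on S (\<lambda>s. complex_of_real (sqrt (T s)))" by (intro continuous_intros c)
    show "continuous_on S (\<lambda>s. (fst (P s) + snd (P s))\<^sup>2 * w_of (P s) * (2 + w_of (P s) + of_real (T s) * w_of (P s)) * seg_num (P s) (T s))"
      unfolding seg_num_def
      by (intro continuous_on_mult continuous_on_add continuous_on_diff continuous_on_power continuous_on_const continuous_on_of_real c c' w z r rp sq)
    show "continuous_on S (\<lambda>s. seg_den (P s) (T s) * (2 * fst (P s) * snd (P s) * segment_point (P s) (T s) * segment_root (P s) (T s) * root_product (P s)))"
      unfolding seg_den_def
      by (intro continuous_on_mult continuous_on_add continuous_on_const c' w z r rp sq)
  qed
  then show "continuous_on S (\<lambda>s. kernel_normalised (P s) (T s))" by (simp only: kernel_normalised_eq)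
qed

lemma pair_holomorphic:
  assumes h: "A holomorphic_on S" "B holomorphic_on S"
    and S: "\<And>s. s \<in> S \<Longrightarrow> (A s, B s) \<in> regular_pairs" and t: "t \<in> {0..1}"
  shows "(\<lambda>s. w_of (A s, B s)) holomorphic_on S" "(\<lambda>s. segment_point (A s, B s) t) holomorphic_on S"
    "(\<lambda>s. segment_root (A s, B s) t) holomorphic_on S" "(\<lambda>s. root_product (A s, B s)) holomorphic_on S"
    "(\<lambda>s. kernel_normalised (A s, B s) t) holomorphic_on S"
proof -
  note D = regular_pairs_D[OF S, unfolded fst_conv snd_conv]
  show w: "(\<lambda>s. w_of (A s, B s)) holomorphic_on S"
    unfolding w_of_def upper_limit_def fst_conv snd_conv by (intro holomorphic_intros h) (use D(3) in auto)
  show z: "(\<lambda>s. segment_point (A s, B s) t) holomorphic_on S"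
    unfolding segment_point_w by (intro holomorphic_intros w)
  show r: "(\<lambda>s. segment_root (A s, B s) t) holomorphic_on S"
    unfolding segment_root_w by (intro holomorphic_intros w) (use D(4) seg_facts(2)[OF S t] in auto)
  have "A s - 1 \<notin> \<real>\<^sub>\<le>\<^sub>0" "B s - 1 \<notin> \<real>\<^sub>\<le>\<^sub>0" if "s \<in> S" for s
    using D(1,2) that by (auto simp: in_cut_plane_iff)
  moreover have "z + 1 \<notin> \<real>\<^sub>\<le>\<^sub>0" if "z - 1 \<notin> \<real>\<^sub>\<le>\<^sub>0" for z :: complex
    using that by (auto simp: complex_nonpos_Reals_iff)
  ultimately show rp: "(\<lambda>s. root_product (A s, B s)) holomorphic_on S"
    unfolding root_product_def sqrt_sq_minus_1_def fst_conv snd_conv by (intro holomorphic_intros h) auto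
  show "(\<lambda>s. kernel_normalised (A s, B s) t) holomorphic_on S"
    unfolding kernel_normalised_eq
  proof (rule holomorphic_on_divide)
    show "seg_den (A s, B s) t * (2 * fst (A s, B s) * snd (A s, B s) * segment_point (A s, B s) t * segment_root (A s, B s) t * root_product (A s, B s)) \<noteq> 0"
      if "s \<in> S" for s
      by (rule kernel_normalised_nonzero(2)[OF S[OF that] t])
  qed (unfold seg_num_def seg_den_def fst_conv snd_conv, (intro holomorphic_intros h w z r rp)+)
qed

text \<open>Only the bound \<open>pi\<close> on the imaginary part of \<open>Ln\<close> enters, so
  the estimate also holds on the branch cut. That matters at the ends of the segment, where
  \<open>kernel_normalised\<close> may reach the negative axis.\<close>

lemma norm_powr_le:
  fixes w c :: complex
  assumes "w \<noteq> 0" shows "norm (w powr c) \<le> norm w powr Re c * exp (pi * \<bar>Im c\<bar>)"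
proof -
  have a: "Re (c * Ln w) = Re c * ln (norm w) - Im c * Im (Ln w)" using assms by simp
  have "\<bar>Im c * Im (Ln w)\<bar> \<le> \<bar>Im c\<bar> * pi"
    unfolding abs_mult using mpi_less_Im_Ln[OF assms] Im_Ln_le_pi[OF assms] by (intro mult_left_mono) auto
  then have "- (Im c * Im (Ln w)) \<le> pi * \<bar>Im c\<bar>" by (simp only: abs_le_iff mult.commute[of _ pi])
  then have "Re (c * Ln w) \<le> Re c * ln (norm w) + pi * \<bar>Im c\<bar>" unfolding a by linarith
  then have "exp (Re (c * Ln w)) \<le> exp (Re c * ln (norm w) + pi * \<bar>Im c\<bar>)" by simp
  then show ?thesis using assms by (simp add: powr_def exp_add)
qed

section \<open>Splitting off the powers at the end points\<close>

context whipple
begin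

text \<open>The factors that are continuous on the closed segment. Dividing \<open>z + 1\<close> by
  \<open>w_of p\<close> instead of \<open>z - 1\<close> takes the power of \<open>t\<close> out of
  the Legendre function. The power of \<open>kernel_normalised\<close> is kept apart, as its branch
  may jump at an end.\<close>

definition smooth_part :: "(complex \<times> complex) \<Rightarrow> real \<Rightarrow> complex" where
  "smooth_part p t = ((segment_point p t + 1) / w_of p) powr (-\<mu> / 2) * f ((1 - segment_point p t) / 2) *
     segment_point p t powr (- \<nu> - 1) * w_of p / (segment_root p t)\<^sup>2"

definition bounded_part :: "(complex \<times> complex) \<Rightarrow> real \<Rightarrow> complex" where
  "bounded_part p t = smooth_part p t * kernel_normalised p t powr (- \<nu> - 1)"

text \<open>At the lower end the Legendre function contributes the exponent
  \<open>\<mu> / 2\<close>, the power of \<open>C - 1\<close> another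
  \<open>(\<nu> + 1) / 2\<close>, and the factor \<open>1 / (1 - z3\<^sup>2)\<close> the exponent
  -1; their sum is \<open>A_exp - 1\<close>.\<close>

definition A_exp :: complex where "A_exp = (\<nu> + \<mu> + 1) / 2"

definition seg_integrand :: "(complex \<times> complex) \<Rightarrow> real \<Rightarrow> complex" where
  "seg_integrand p t = of_real t powr (A_exp - 1) * of_real (1 - t) powr (- \<nu> - 1) * bounded_part p t"

lemma product_integrand_eq:
  assumes p: "p \<in> regular_pairs" and t: "t \<in> {0<..<1}"
  shows "product_integrand \<nu> \<mu> (fst p) (snd p) (segment_point p t) * w_of p = - seg_integrand p t"
proof -
  have t': "t > 0" "1 - t > 0" "t \<in> {0..1}" using t by auto
  note D = regular_pairs_D[OF p] and F = seg_facts[OF p t'(3)] and K = kernel_normalised_not_nonpos[OF p t]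
  define z where "z = segment_point p t"
  define w where "w = w_of p"
  define q where "q = (z + 1) / w"
  define kn where "kn = kernel_normalised p t"
  define sg where "sg = segment_root p t"
  have sg0: "sg \<noteq> 0" using F(5) by (simp add: sg_def)
  have z1: "z - 1 = of_real t * w" by (simp add: z_def w_def segment_point_w)
  \<comment> \<open>On the segment \<open>1 - z\<^sup>2\<close> is \<open>- t\<close> times a factor
    without zeros: the source of the sign in the statement.\<close>
  have zz: "1 - z\<^sup>2 = - (of_real t * sg\<^sup>2)"
    using segment_root_squared[of t p] t' by (simp add: z_def sg_def power_mult_distrib flip: of_real_power)
  define l where "l = complex_of_real (ln t)"
  define l1 where "l1 = complex_of_real (ln (1 - t))"
  have et: "complex_of_real t = exp l" unfolding l_def by (rule of_real_exp_ln[OF t'(1)])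
  have "(z + 1) / (z - 1) = of_real (1 / t) * q" unfolding z1 q_def using t' by (simp add: field_simps)
  then have "((z + 1) / (z - 1)) powr (-\<mu> / 2) = of_real (1 / t) powr (-\<mu> / 2) * q powr (-\<mu> / 2)"
    using t' by (simp only:) (rule powr_times_real_left, auto)
  also have "complex_of_real (1 / t) powr (-\<mu> / 2) = exp (\<mu> / 2 * l)"
    using t' of_real_powr_exp[of "1 / t" "-\<mu> / 2"] by (simp add: ln_div l_def del: of_real_divide)
  finally have L: "Legendre_P \<nu> (-\<mu>) z = exp (\<mu> / 2 * l) * q powr (-\<mu> / 2) * f ((1 - z) / 2)"
    by (simp add: Legendre_P_def f_def)
  have c: "(1 - t) / sqrt t > 0" using t' by simp
  have "(kernel_C (fst p) (snd p) z - 1) powr (- \<nu> - 1) = of_real ((1 - t) / sqrt t) powr (- \<nu> - 1) * kn powr (- \<nu> - 1)"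
    unfolding z_def K(1) kn_def using c by (intro powr_times_real_left) auto
  also have "complex_of_real ((1 - t) / sqrt t) powr (- \<nu> - 1) = exp ((- \<nu> - 1) * (l1 - l / 2))"
  proof -
    have "ln ((1 - t) / sqrt t) = ln (1 - t) - ln t / 2" using t' by (simp add: ln_div ln_sqrt)
    then show ?thesis unfolding of_real_powr_exp[OF c] l_def l1_def by simp
  qed
  finally have C: "(kernel_C (fst p) (snd p) z - 1) powr (- \<nu> - 1) = exp ((- \<nu> - 1) * (l1 - l / 2)) * kn powr (- \<nu> - 1)" .
  have Zp: "1 / z powr (\<nu> + 1) = z powr (- \<nu> - 1)"
    using powr_minus[of z "\<nu> + 1"] by (simp add: divide_inverse)
  have "product_integrand \<nu> \<mu> (fst p) (snd p) z * w =
    exp (\<mu> / 2 * l) * q powr (-\<mu> / 2) * f ((1 - z) / 2) * (exp ((- \<nu> - 1) * (l1 - l / 2)) * kn powr (- \<nu> - 1)) *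
      (1 / z powr (\<nu> + 1)) * (- 1 / (exp l * sg\<^sup>2)) * w"
    unfolding product_integrand_def L C zz et by simp
  also have "\<dots> = - ((exp (\<mu> / 2 * l) * exp ((- \<nu> - 1) * (l1 - l / 2)) * exp (- l)) *
      (q powr (-\<mu> / 2) * f ((1 - z) / 2) * z powr (- \<nu> - 1) * w / sg\<^sup>2 * kn powr (- \<nu> - 1)))"
  proof -
    have "e1 * q' * F * (e2 * k) * Zm * (- 1 / (e3 * s)) * w = - ((e1 * e2 * inverse e3) * (q' * F * Zm * w / s * k))"
      for e1 q' F e2 k Zm e3 s :: complex
      by (simp add: divide_inverse)
    then show ?thesis unfolding Zp exp_minus[of l] .
  qed
  also have "exp (\<mu> / 2 * l) * exp ((- \<nu> - 1) * (l1 - l / 2)) * exp (- l) = exp ((A_exp - 1) * l) * exp ((- \<nu> - 1) * l1)"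
    unfolding mult_exp_exp by (rule arg_cong[where f = exp]) (simp add: A_exp_def field_simps)
  also have "exp ((A_exp - 1) * l) = of_real t powr (A_exp - 1)"
    unfolding l_def by (rule of_real_powr_exp[OF t'(1), symmetric])
  also have "exp ((- \<nu> - 1) * l1) = of_real (1 - t) powr (- \<nu> - 1)"
    unfolding l1_def by (rule of_real_powr_exp[OF t'(2), symmetric])
  finally show ?thesis
    unfolding seg_integrand_def bounded_part_def smooth_part_def
    by (simp only: z_def w_def q_def kn_def sg_def)
qed

lemma contour_integral_iff:
  assumes p: "p \<in> regular_pairs"
  shows "(product_integrand \<nu> \<mu> (fst p) (snd p) has_contour_integral i) (linepath 1 (upper_limit (fst p) (snd p)))
    \<longleftrightarrow> (seg_integrand p has_integral - i) {0<..<1}"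
proof -
  have lp: "linepath 1 (upper_limit (fst p) (snd p)) t = segment_point p t" for t
    by (simp add: linepath_def segment_point_def scaleR_conv_of_real algebra_simps)
  have "(product_integrand \<nu> \<mu> (fst p) (snd p) has_contour_integral i) (linepath 1 (upper_limit (fst p) (snd p)))
    \<longleftrightarrow> ((\<lambda>t. product_integrand \<nu> \<mu> (fst p) (snd p) (segment_point p t) * w_of p) has_integral i) {0<..<1}"
    unfolding has_contour_integral_linepath lp w_of_def has_integral_Icc_iff_Ioo ..
  also have "\<dots> \<longleftrightarrow> ((\<lambda>t. - seg_integrand p t) has_integral i) {0<..<1}"
    by (rule has_integral_cong) (rule product_integrand_eq[OF p])
  also have "\<dots> \<longleftrightarrow> (seg_integrand p has_integral - i) {0<..<1}"
    by (rule has_integral_neg_iff)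
  finally show ?thesis .
qed

lemma smooth_part_continuous:
  fixes P :: "'a::topological_space \<Rightarrow> complex \<times> complex" and T :: "'a \<Rightarrow> real"
  assumes c: "continuous_on S P" "continuous_on S T"
    and S: "\<And>s. s \<in> S \<Longrightarrow> P s \<in> regular_pairs \<and> T s \<in> {0..1}"
  shows "continuous_on S (\<lambda>s. smooth_part (P s) (T s))"
proof -
  note C = pair_continuous[OF c S]
  have F: "segment_point (P s) (T s) \<notin> \<real>\<^sub>\<le>\<^sub>0" "(segment_point (P s) (T s) + 1) / w_of (P s) \<notin> \<real>\<^sub>\<le>\<^sub>0"
      "segment_root (P s) (T s) \<noteq> 0" "(1 - segment_point (P s) (T s)) / 2 \<in> slit_plane" "w_of (P s) \<noteq> 0" if "s \<in> S" for s
    using seg_facts[of "P s" "T s"] regular_pairs_D(5) S that by auto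
  have q: "continuous_on S (\<lambda>s. (segment_point (P s) (T s) + 1) / w_of (P s))"
    by (intro continuous_on_divide continuous_on_add continuous_on_const C) (use F in auto)
  have "continuous_on S (\<lambda>s. f ((1 - segment_point (P s) (T s)) / 2))"
    by (intro continuous_on_compose2[OF holomorphic_on_imp_continuous_on[OF f_holomorphic]] continuous_intros C) (use F in auto)
  then show ?thesis
    unfolding smooth_part_def
    by (intro continuous_on_divide continuous_on_mult continuous_on_cpowr continuous_on_power continuous_on_const q C) (use F in auto)
qed

lemma bounded_part_locally_bounded:
  assumes p: "p \<in> regular_pairs"
  shows "\<exists>e>0. \<exists>M. \<forall>p'\<in>regular_pairs. dist p p' < e \<longrightarrow> (\<forall>t\<in>{0<..<1}. norm (bounded_part p' t) \<le> M)"
proof -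
  \<comment> \<open>A majorant of \<open>bounded_part\<close> that is continuous up to the ends,
    where \<open>bounded_part\<close> itself need not be.\<close>
  define B where "B = (\<lambda>s. norm (smooth_part (fst s) (snd s)) * (norm (kernel_normalised (fst s) (snd s)) powr Re (- \<nu> - 1) * exp (pi * \<bar>Im (- \<nu> - 1)\<bar>)))"
  have c: "continuous_on (regular_pairs \<times> {0..1::real}) fst" "continuous_on (regular_pairs \<times> {0..1::real}) snd"
    by (intro continuous_intros)+
  have S: "fst s \<in> regular_pairs \<and> snd s \<in> {0..1}" if "s \<in> regular_pairs \<times> {0..1::real}" for s using that by auto
  have "continuous_on (regular_pairs \<times> {0..1::real}) (\<lambda>s. norm (kernel_normalised (fst s) (snd s)))"
    by (intro continuous_on_norm pair_continuous(5) c S)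
  moreover have "norm (kernel_normalised (fst s) (snd s)) \<noteq> 0" if "s \<in> regular_pairs \<times> {0..1::real}" for s
    using kernel_normalised_nonzero(1)[of "fst s" "snd s"] S[OF that] by simp
  ultimately have k: "continuous_on (regular_pairs \<times> {0..1::real}) (\<lambda>s. norm (kernel_normalised (fst s) (snd s)) powr Re (- \<nu> - 1))"
    by (intro continuous_on_powr continuous_on_const) auto
  have "continuous_on (regular_pairs \<times> {0..1::real}) B"
    unfolding B_def by (intro continuous_on_mult continuous_on_norm smooth_part_continuous continuous_on_const k c S)
  from continuous_on_locally_bounded[OF this compact_Icc p]
  obtain e M where e: "e > 0" "\<forall>p'\<in>regular_pairs. dist p p' < e \<longrightarrow> (\<forall>t\<in>{0..1}. norm (B (p', t)) \<le> M)" by blast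
  have "norm (bounded_part p' t) \<le> M" if "p' \<in> regular_pairs" "dist p p' < e" "t \<in> {0<..<1}" for p' t
  proof -
    have t: "t \<in> {0..1}" using that by auto
    have "norm (bounded_part p' t) \<le> B (p', t)"
      unfolding bounded_part_def B_def norm_mult fst_conv snd_conv
      by (intro mult_left_mono norm_powr_le kernel_normalised_nonzero(1)[OF that(1) t]) auto
    also have "\<dots> \<le> M" using e(2) that t abs_ge_self[of "B (p', t)"] unfolding real_norm_def by fastforce
    finally show ?thesis .
  qed
  then show ?thesis using e(1) by blast
qed

lemma bounded_part_continuous:
  fixes P :: "'a::topological_space \<Rightarrow> complex \<times> complex" and T :: "'a \<Rightarrow> real"
  assumes c: "continuous_on S P" "continuous_on S T"
    and S: "\<And>s. s \<in> S \<Longrightarrow> P s \<in> regular_pairs \<and> T s \<in> {0<..<1}"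
  shows "continuous_on S (\<lambda>s. bounded_part (P s) (T s))"
proof -
  have S': "P s \<in> regular_pairs \<and> T s \<in> {0..1}" if "s \<in> S" for s using S[OF that] by auto
  show ?thesis
    unfolding bounded_part_def
    by (intro continuous_on_mult smooth_part_continuous continuous_on_cpowr pair_continuous(5) continuous_on_const c S')
      (use kernel_normalised_not_nonpos(2) S in auto)
qed

lemma bounded_part_holomorphic:
  assumes h: "A holomorphic_on S" "B holomorphic_on S"
    and S: "\<And>s. s \<in> S \<Longrightarrow> (A s, B s) \<in> regular_pairs" and t: "t \<in> {0<..<1}"
  shows "(\<lambda>s. bounded_part (A s, B s) t) holomorphic_on S"
proof -
  have t': "t \<in> {0..1}" using t by auto
  note H = pair_holomorphic[OF h S t']
  note F = seg_facts[OF S t'] regular_pairs_D(5)[OF S]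
  have "(\<lambda>s. f ((1 - segment_point (A s, B s) t) / 2)) holomorphic_on S"
    by (rule holomorphic_on_compose_gen[unfolded o_def, OF _ f_holomorphic]) (use F in \<open>auto intro!: holomorphic_intros H\<close>)
  then show ?thesis
    unfolding bounded_part_def smooth_part_def
    by (intro holomorphic_on_mult holomorphic_on_divide holomorphic_on_powr holomorphic_on_power holomorphic_on_add holomorphic_on_const H)
       (use F kernel_normalised_not_nonpos(2)[OF S t] in auto)
qed

end

section \<open>Continuation from real to complex arguments\<close>

lemma open_contains_polydisc:
  assumes "open C" "(a, b) \<in> C"
  obtains r where "r > 0" "ball a r \<times> ball b r \<subseteq> C"
proof -
  obtain A B where AB: "open A" "open B" "a \<in> A" "b \<in> B" "A \<times> B \<subseteq> C"
    using open_prod_elim[OF assms] by (metis mem_Sigma_iff)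
  obtain r1 where r1: "r1 > 0" "ball a r1 \<subseteq> A" using AB openE by blast
  obtain r2 where r2: "r2 > 0" "ball b r2 \<subseteq> B" using AB openE by blast
  have "ball a (min r1 r2) \<times> ball b (min r1 r2) \<subseteq> C" using r1 r2 AB(5) by force
  then show ?thesis using r1 r2 that[of "min r1 r2"] by simp
qed

text \<open>Holomorphy in each variable separately is enough, as the identity theorem is applied in
  one variable at a time.\<close>

lemma polydisc_identity:
  fixes E :: "complex \<times> complex \<Rightarrow> complex"
  assumes h1: "\<And>b. b \<in> V \<Longrightarrow> (\<lambda>a. E (a, b)) holomorphic_on U"
    and h2: "\<And>a. a \<in> U \<Longrightarrow> (\<lambda>b. E (a, b)) holomorphic_on V"
    and UV: "open U" "connected U" "open V" "connected V"
    and A: "A \<subseteq> U" "\<alpha> \<in> U" "\<alpha> islimpt A" and B: "B \<subseteq> V" "\<beta> \<in> V" "\<beta> islimpt B"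
    and zero: "\<And>a b. a \<in> A \<Longrightarrow> b \<in> B \<Longrightarrow> E (a, b) = 0"
    and ab: "a \<in> U" "b \<in> V"
  shows "E (a, b) = 0"
proof -
  have 1: "E (a, b) = 0" if "a \<in> U" "b \<in> B" for a b
  proof -
    have b: "b \<in> V" using that B(1) by blast
    have "(\<lambda>a. E (a, b)) a = 0"
      by (rule analytic_continuation[OF h1[OF b] UV(1,2) A]) (use zero that in auto)
    then show ?thesis .
  qed
  show ?thesis
  proof -
    have "(\<lambda>b. E (a, b)) b = 0"
      by (rule analytic_continuation[OF h2[OF ab(1)] UV(3,4) B]) (use 1 ab in auto)
    then show ?thesis .
  qed
qed

text \<open>The interior of the zero set is open and closed in \<open>C\<close>. Near a limit point
  in \<open>C\<close> a polydisc contains a smaller one on which \<open>E\<close> vanishes, and the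
  zeros spread from it. Nonemptiness comes from real intervals around the base point, which are sets
  of uniqueness in each variable.\<close>

lemma two_variable_identity:
  fixes E :: "complex \<times> complex \<Rightarrow> complex"
  assumes C: "open C" "connected C"
    and h1: "\<And>b S. open S \<Longrightarrow> (\<And>a. a \<in> S \<Longrightarrow> (a, b) \<in> C) \<Longrightarrow> (\<lambda>a. E (a, b)) holomorphic_on S"
    and h2: "\<And>a S. open S \<Longrightarrow> (\<And>b. b \<in> S \<Longrightarrow> (a, b) \<in> C) \<Longrightarrow> (\<lambda>b. E (a, b)) holomorphic_on S"
    and base: "(of_real x0, of_real y0) \<in> C" "x0 > 1" "y0 > 1"
    and real: "\<And>x y::real. x > 1 \<Longrightarrow> y > 1 \<Longrightarrow> (of_real x, of_real y) \<in> C \<Longrightarrow> E (of_real x, of_real y) = 0"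
    and p: "p \<in> C"
  shows "E p = 0"
proof -
  define W where "W = interior {q \<in> C. E q = 0}"
  have WZ: "W \<subseteq> {q \<in> C. E q = 0}" unfolding W_def by (rule interior_subset)
  have poly: "ball a r \<times> ball b r \<subseteq> W"
    if sub: "ball a r \<times> ball b r \<subseteq> C" and A: "A \<subseteq> ball a r" "\<alpha> \<in> ball a r" "\<alpha> islimpt A"
      and B: "B \<subseteq> ball b r" "\<beta> \<in> ball b r" "\<beta> islimpt B"
      and zero: "\<And>a b. a \<in> A \<Longrightarrow> b \<in> B \<Longrightarrow> E (a, b) = 0" for a b r A B \<alpha> \<beta>
  proof -
    have "E (s, t) = 0" if "s \<in> ball a r" "t \<in> ball b r" for s t
    proof (rule polydisc_identity[where U = "ball a r" and V = "ball b r" and A = A and \<alpha> = \<alpha> and B = B and \<beta> = \<beta>])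
      show "(\<lambda>a. E (a, t)) holomorphic_on ball a r" if "t \<in> ball b r" for t
        by (rule h1) (use that sub in auto)
      show "(\<lambda>b. E (s, b)) holomorphic_on ball b r" if "s \<in> ball a r" for s
        by (rule h2) (use that sub in auto)
    qed (use A B zero that in auto)
    then show ?thesis unfolding W_def by (intro interior_maximal open_Times) (use sub in auto)
  qed
  have "closedin (top_of_set C) W"
    unfolding closedin_limpt
  proof (intro conjI allI impI)
    show "W \<subseteq> C" using WZ by blast
    fix q assume "q islimpt W \<and> q \<in> C"
    then have q: "q islimpt W" "q \<in> C" by simp_all
    obtain a b where ab: "q = (a, b)" by (cases q)
    obtain r where r: "r > 0" "ball a r \<times> ball b r \<subseteq> C" using open_contains_polydisc[OF C(1)] q(2) ab by blast
    have oU: "open (ball a r \<times> ball b r)" by (intro open_Times) auto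
    have "q \<in> ball a r \<times> ball b r" using r ab by simp
    then obtain q' where q': "q' \<in> W" "q' \<in> ball a r \<times> ball b r"
      using q(1) oU unfolding islimpt_def by meson
    obtain a' b' where ab': "q' = (a', b')" by (cases q')
    have "open (W \<inter> (ball a r \<times> ball b r))" using oU by (intro open_Int) (auto simp: W_def)
    moreover have "(a', b') \<in> W \<inter> (ball a r \<times> ball b r)" using q' ab' by simp
    ultimately obtain r' where r': "r' > 0" "ball a' r' \<times> ball b' r' \<subseteq> W \<inter> (ball a r \<times> ball b r)"
      by (rule open_contains_polydisc)
    have in': "a' \<in> ball a' r'" "b' \<in> ball b' r'" using r' by auto
    have s1: "x \<in> ball a r" if "x \<in> ball a' r'" for x
    proof -
      have "(x, b') \<in> ball a' r' \<times> ball b' r'" using that in'(2) by (rule SigmaI)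
      from subsetD[OF r'(2) this] show ?thesis by simp
    qed
    have s2: "x \<in> ball b r" if "x \<in> ball b' r'" for x
    proof -
      have "(a', x) \<in> ball a' r' \<times> ball b' r'" using in'(1) that by (rule SigmaI)
      from subsetD[OF r'(2) this] show ?thesis by simp
    qed
    have s: "ball a' r' \<subseteq> ball a r" "ball b' r' \<subseteq> ball b r" using s1 s2 by (simp_all only: subsetI)
    have "ball a r \<times> ball b r \<subseteq> W"
    proof (rule poly[OF r(2), where A = "ball a' r'" and \<alpha> = a' and B = "ball b' r'" and \<beta> = b'])
      show "a' islimpt ball a' r'" "b' islimpt ball b' r'"
        using in' by (intro interior_limit_point; simp)+
      show "E (s, t) = 0" if "s \<in> ball a' r'" "t \<in> ball b' r'" for s t
      proof -
        have "(s, t) \<in> ball a' r' \<times> ball b' r'" using that by (rule SigmaI)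
        from subsetD[OF r'(2) this] have "(s, t) \<in> W" by simp
        from subsetD[OF WZ this] show ?thesis by simp
      qed
    qed (use s in' s1 s2 in \<open>simp_all only: subsetD\<close>)
    then show "q \<in> W" using r(1) ab by auto
  qed
  moreover have "openin (top_of_set C) W"
    unfolding openin_open using WZ by (intro exI[of _ W]) (auto simp: W_def)
  moreover have "W \<noteq> {}"
  proof -
    obtain r where r: "r > 0" "ball (of_real x0) r \<times> ball (of_real y0) r \<subseteq> C" using open_contains_polydisc[OF C(1) base(1)] by blast
    define d where "d = min r (min (x0 - 1) (y0 - 1))"
    have d: "d > 0" "d \<le> r" "d \<le> x0 - 1" "d \<le> y0 - 1" using r base by (auto simp: d_def)
    define I where "I = (\<lambda>c::real. complex_of_real ` {c - d<..<c + d})"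
    have Ib: "I c \<subseteq> ball (of_real c) r" for c
      unfolding I_def using d by (auto simp: dist_norm abs_less_iff simp flip: of_real_diff)
    have Il: "complex_of_real c islimpt I c" for c
      unfolding I_def by (intro islimpt_of_real_image interior_limit_point) (use d in simp)
    have "ball (of_real x0) r \<times> ball (of_real y0) r \<subseteq> W"
    proof (rule poly[OF r(2) Ib _ Il Ib _ Il])
      fix a b assume "a \<in> I x0" "b \<in> I y0"
      then obtain x y where xy: "a = of_real x" "b = of_real y" "x > 1" "y > 1" "a \<in> I x0" "b \<in> I y0"
        using d by (auto simp: I_def)
      have "(a, b) \<in> ball (of_real x0) r \<times> ball (of_real y0) r"
        using subsetD[OF Ib xy(5)] subsetD[OF Ib xy(6)] by (rule SigmaI)
      from subsetD[OF r(2) this] have "(of_real x, of_real y) \<in> C" unfolding xy(1,2) .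
      then show "E (a, b) = 0" using real xy by simp
    qed (use r in auto)
    then show ?thesis using r(1) by auto
  qed
  ultimately have "W = C"
    using C(2)[unfolded connected_clopen, rule_format, of W] by metis
  then show ?thesis using WZ p by blast
qed

lemma beta_dominated_compose:
  fixes h :: "'b::metric_space \<Rightarrow> 'a::metric_space"
  assumes f: "beta_dominated S f" and h: "continuous_on T h" "\<And>t. t \<in> T \<Longrightarrow> h t \<in> S"
  shows "beta_dominated T (\<lambda>t. f (h t))"
  unfolding beta_dominated_def
proof (intro conjI ballI)
  fix t assume t: "t \<in> T"
  show "f (h t) \<in> borel_measurable (lebesgue_on {0<..<1})"
    by (rule beta_dominated_measurable[OF f h(2)[OF t]])
  have "\<exists>e>0. \<exists>M. \<exists>a>0. \<exists>b>0. \<forall>s'\<in>S \<inter> ball (h t) e. \<forall>v\<in>{0<..<1}.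
      norm (f s' v) \<le> M * (v powr (a - 1) * (1 - v) powr (b - 1))"
    using f h(2)[OF t] unfolding beta_dominated_def by blast
  then obtain e M a b where e: "e > 0" "a > 0" "b > 0" and *: "\<forall>s'\<in>S \<inter> ball (h t) e. \<forall>v\<in>{0<..<1}.
      norm (f s' v) \<le> M * (v powr (a - 1) * (1 - v) powr (b - 1))" by blast
  obtain d where d: "d > 0" "\<forall>t'\<in>T. dist t' t < d \<longrightarrow> dist (h t') (h t) < e"
    using h(1) t e(1) unfolding continuous_on_iff by blast
  have "\<forall>t'\<in>T \<inter> ball t d. \<forall>v\<in>{0<..<1}. norm (f (h t') v) \<le> M * (v powr (a - 1) * (1 - v) powr (b - 1))"
    using * d(2) h(2) by (simp add: dist_commute)
  then show "\<exists>e>0. \<exists>M. \<exists>a>0. \<exists>b>0. \<forall>t'\<in>T \<inter> ball t e. \<forall>v\<in>{0<..<1}.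
      norm (f (h t') v) \<le> M * (v powr (a - 1) * (1 - v) powr (b - 1))"
    using d(1) e by blast
qed

text \<open>On the component the quotient of the two sides of the sign condition is continuous and
  squares to 1, hence constant; at the real base pair it is positive.\<close>

lemma principal_component_regular:
  fixes x0 y0 :: real
  assumes xy: "x0 > 1" "y0 > 1"
  defines "C \<equiv> connected_component_set (interior cut_free_pairs) (of_real x0, of_real y0)"
  shows "C \<subseteq> regular_pairs" "open C" "connected C"
proof -
  show oC: "open C" unfolding C_def by (intro open_connected_component open_interior)
  show cC: "connected C" unfolding C_def by (rule connected_connected_component)
  have sub: "C \<subseteq> cut_free_pairs"
    unfolding C_def using connected_component_subset interior_subset by blast
  define h where "h = (\<lambda>p. (fst p + snd p) * segment_root p 1 / root_product p)"
  have D: "fst p \<in> cut_plane" "snd p \<in> cut_plane" "fst p + snd p \<noteq> 0" "w_of p \<notin> \<real>\<^sub>\<le>\<^sub>0" "root_product p \<noteq> 0" if "p \<in> C" for p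
  proof -
    show "fst p \<in> cut_plane" "snd p \<in> cut_plane" "fst p + snd p \<noteq> 0" "w_of p \<notin> \<real>\<^sub>\<le>\<^sub>0"
      using sub that by (auto simp: cut_free_pairs_def w_of_def in_cut_plane_iff)
    then show "root_product p \<noteq> 0" using cut_plane_nonzero(4) by (simp add: root_product_def)
  qed
  have c1: "continuous_on C fst" "continuous_on C snd" by (intro continuous_intros)+
  have w: "continuous_on C w_of"
    unfolding w_of_def[abs_def] upper_limit_def by (intro continuous_intros c1) (use D(3) in auto)
  have two: "2 + w_of p \<notin> \<real>\<^sub>\<le>\<^sub>0" if "p \<in> C" for p using nonpos_affine(1)[OF D(4)[OF that], of 2 1] by simp
  have r: "continuous_on C (\<lambda>p. segment_root p 1)"
    unfolding segment_root_w
    by (intro continuous_on_mult csqrt_continuous_compose continuous_on_add continuous_on_const w) (use D(4) two in auto)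
  have "fst p - 1 \<notin> \<real>\<^sub>\<le>\<^sub>0" "snd p - 1 \<notin> \<real>\<^sub>\<le>\<^sub>0" if "p \<in> C" for p
    using D(1,2) that by (auto simp: in_cut_plane_iff)
  moreover have "z + 1 \<notin> \<real>\<^sub>\<le>\<^sub>0" if "z - 1 \<notin> \<real>\<^sub>\<le>\<^sub>0" for z :: complex
    using that by (auto simp: complex_nonpos_Reals_iff)
  ultimately have rp: "continuous_on C root_product"
    unfolding root_product_def[abs_def] sqrt_sq_minus_1_def
    by (intro continuous_on_mult csqrt_continuous_compose continuous_on_add continuous_on_diff continuous_on_const c1) auto
  have hc: "continuous_on C h"
    unfolding h_def by (intro continuous_on_divide continuous_on_mult continuous_on_add c1 r rp) (use D(5) in auto)
  have h2: "(h p)\<^sup>2 = 1" if "p \<in> C" for p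
  proof -
    have u: "1 + fst p * snd p = (1 + w_of p) * (fst p + snd p)" using D(3)[OF that] by (simp add: w_of_def upper_limit_def)
    have s: "(segment_root p 1)\<^sup>2 = (1 + w_of p)\<^sup>2 - 1" using segment_root_squared[of 1 p] by (simp add: segment_point_w)
    have "((fst p + snd p) * segment_root p 1)\<^sup>2 = ((1 + w_of p) * (fst p + snd p))\<^sup>2 - (fst p + snd p)\<^sup>2"
      unfolding power_mult_distrib s by (simp add: algebra_simps)
    also have "\<dots> = (root_product p)\<^sup>2" unfolding u[symmetric] root_product_squared by (simp add: power2_eq_square algebra_simps)
    finally show ?thesis using D(5)[OF that] by (simp add: h_def power_divide)
  qed
  define b where "b = (complex_of_real x0, complex_of_real y0)"
  have bC: "b \<in> C"
  proof -
    have "b \<in> principal_region" unfolding b_def by (rule of_real_in_principal_region[OF xy])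
    then have "b \<in> interior cut_free_pairs"
      unfolding principal_region_def using connected_component_in by blast
    then show ?thesis unfolding C_def b_def[symmetric] by (simp add: connected_component_refl)
  qed
  have hb: "Re (h b) > 0"
  proof -
    have s: "sqrt_sq_minus_1 (of_real v) = of_real (sqrt (v - 1) * sqrt (v + 1))" if "v > 1" for v :: real
    proof -
      have "csqrt (of_real (v - 1)) = of_real (sqrt (v - 1))" "csqrt (of_real (v + 1)) = of_real (sqrt (v + 1))"
        using that by (intro csqrt_of_real; simp)+
      then show ?thesis by (simp add: sqrt_sq_minus_1_def)
    qed
    define v where "v = (1 + x0 * y0) / (x0 + y0)"
    have "v - 1 = (x0 - 1) * (y0 - 1) / (x0 + y0)" using xy by (simp add: v_def field_simps)
    moreover have "(x0 - 1) * (y0 - 1) / (x0 + y0) > 0" using xy by simp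
    ultimately have v: "v > 1" by linarith
    have uv: "upper_limit (fst b) (snd b) = of_real v" by (simp add: b_def upper_limit_def v_def)
    have "segment_root b 1 = sqrt_sq_minus_1 (of_real v)"
      by (simp add: segment_root_def segment_point_def uv sqrt_sq_minus_1_def add.commute)
    then have "h b = of_real ((x0 + y0) * (sqrt (v - 1) * sqrt (v + 1)) /
       ((sqrt (x0 - 1) * sqrt (x0 + 1)) * (sqrt (y0 - 1) * sqrt (y0 + 1))))"
      unfolding h_def root_product_def s[OF v] by (simp add: b_def s xy)
    moreover have "(x0 + y0) * (sqrt (v - 1) * sqrt (v + 1)) /
       ((sqrt (x0 - 1) * sqrt (x0 + 1)) * (sqrt (y0 - 1) * sqrt (y0 + 1))) > 0"
      using xy v by (intro divide_pos_pos mult_pos_pos) auto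
    ultimately show ?thesis by simp
  qed
  have hpm: "h p = 1 \<or> h p = -1" if "p \<in> C" for p using h2[OF that] by (simp add: power2_eq_1_iff)
  then have "finite (h ` C)" by (intro finite_subset[of "h ` C" "{1, -1}"]) auto
  moreover have "connected (h ` C)" by (rule connected_continuous_image[OF hc cC])
  ultimately have "h ` C = {} \<or> (\<exists>c. h ` C = {c})" by (simp only: connected_finite_iff_sing)
  then obtain c where c: "h ` C = {c}" using bC by auto
  have "h p = c" if "p \<in> C" for p using imageI[OF that, of h] unfolding c by simp
  then have "h p = h b" if "p \<in> C" for p using that bC by simp
  moreover have "h b = 1" using hpm[OF bC] hb by auto
  ultimately have "(fst p + snd p) * segment_root p 1 = root_product p" if "p \<in> C" for p
    using that D(5)[OF that] by (simp add: h_def)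
  then show "C \<subseteq> regular_pairs" using sub by (auto simp: regular_pairs_def)
qed

lemma principal_region_regular: "principal_region \<subseteq> regular_pairs"
proof
  fix p assume "p \<in> principal_region"
  then obtain x1 x2 :: real where "x1 > 1" "x2 > 1" "p \<in> connected_component_set (interior cut_free_pairs) (of_real x1, of_real x2)"
    by (auto simp: principal_region_def)
  then show "p \<in> regular_pairs" using principal_component_regular(1) by blast
qed

context whipple
begin

lemma Legendre_P_holomorphic: "Legendre_P \<nu> (-\<mu>) holomorphic_on cut_plane"
proof -
  have c: "(z + 1) / (z - 1) \<notin> \<real>\<^sub>\<le>\<^sub>0" "(1 - z) / 2 \<in> slit_plane" "z - 1 \<noteq> 0" if "z \<in> cut_plane" for z
  proof -
    have z: "z - 1 \<notin> \<real>\<^sub>\<le>\<^sub>0" using that by (simp add: in_cut_plane_iff)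
    then show z0: "z - 1 \<noteq> 0" by auto
    have "(z + 1) / (z - 1) = of_real 1 + of_real 2 * inverse (z - 1)" using z0 by (simp add: field_simps)
    moreover have "inverse (z - 1) \<notin> \<real>\<^sub>\<le>\<^sub>0" using z by simp
    ultimately show "(z + 1) / (z - 1) \<notin> \<real>\<^sub>\<le>\<^sub>0" using nonpos_affine(1)[of "inverse (z - 1)" 1 2] by simp
    have e: "1 - (1 - z) / 2 = of_real 1 + of_real (1 / 2) * (z - 1)" by (simp add: field_simps)
    show "(1 - z) / 2 \<in> slit_plane" unfolding mem_slit_plane_iff e using nonpos_affine(1)[OF z, of 1 "1/2"] by simp
  qed
  have "(\<lambda>z. f ((1 - z) / 2)) holomorphic_on cut_plane"
    by (rule holomorphic_on_compose_gen[unfolded o_def, OF _ f_holomorphic]) (use c in \<open>auto intro!: holomorphic_intros\<close>)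
  then show ?thesis
    unfolding Legendre_P_def[abs_def] f_def[symmetric]
    by (simp add: f_def) (intro holomorphic_on_mult holomorphic_on_powr holomorphic_intros, use c in auto)
qed

end

section \<open>The formula on the principal region in the convergent range\<close>

context convergent_whipple
begin

lemma A_exp_pos: "Re A_exp > 0"
  using k by (simp add: A_exp_def)

lemma seg_integrand_dominated: "beta_dominated regular_pairs seg_integrand"
  unfolding seg_integrand_def[abs_def]
proof (rule beta_dominatedI[where A = "\<lambda>_. A_exp" and B = "\<lambda>_. - \<nu>"])
  show "continuous_on {0<..<1} (bounded_part p)" if "p \<in> regular_pairs" for p
    using bounded_part_continuous[of "{0<..<1}" "\<lambda>_. p" "\<lambda>t. t"] that by (simp add: continuous_on_id)
qed (use A_exp_pos nu bounded_part_locally_bounded in auto)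

lemma seg_integrand_integral_holomorphic:
  assumes h: "A holomorphic_on S" "B holomorphic_on S" "open S" and S: "\<And>s. s \<in> S \<Longrightarrow> (A s, B s) \<in> regular_pairs"
  shows "(\<lambda>s. integral {0<..<1} (seg_integrand (A s, B s))) holomorphic_on S"
proof (rule beta_dominated_holomorphic)
  show "beta_dominated S (\<lambda>s. seg_integrand (A s, B s))"
    by (rule beta_dominated_compose[OF seg_integrand_dominated])
      (use S in \<open>auto intro!: continuous_intros holomorphic_on_imp_continuous_on h\<close>)
  show "(\<lambda>s. seg_integrand (A s, B s) t) holomorphic_on S" if "t \<in> {0<..<1}" for t
    unfolding seg_integrand_def by (intro holomorphic_intros bounded_part_holomorphic h S that)
qed (rule h)

definition product_rhs :: "complex \<times> complex \<Rightarrow> complex" where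
  "product_rhs p = fst p powr (\<nu> + 1) * snd p powr (\<nu> + 1) * Gamma (\<nu> + \<mu> + 1) * Gamma (-\<nu>) *
     (Legendre_P \<nu> (-\<mu>) (fst p) * Legendre_P \<nu> (-\<mu>) (snd p))"

theorem product_formula_convergent:
  assumes p: "p \<in> principal_region"
  shows "(seg_integrand p has_integral product_rhs p) {0<..<1}"
proof -
  obtain x0 y0 :: real where xy: "x0 > 1" "y0 > 1"
    and pC: "p \<in> connected_component_set (interior cut_free_pairs) (of_real x0, of_real y0)"
    using p by (auto simp: principal_region_def)
  define C where "C = connected_component_set (interior cut_free_pairs) (complex_of_real x0, complex_of_real y0)"
  note C = principal_component_regular[OF xy, folded C_def]
  define E where "E = (\<lambda>p. integral {0<..<1} (seg_integrand p) - product_rhs p)"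
  have cut: "fst q \<in> cut_plane" "snd q \<in> cut_plane" if "q \<in> C" for q
    using regular_pairs_D(1)[OF subsetD[OF C(1) that]] regular_pairs_D(2)[OF subsetD[OF C(1) that]] by simp_all
  have pw: "(\<lambda>z. z powr (\<nu> + 1)) holomorphic_on cut_plane"
  proof -
    have "z \<notin> \<real>\<^sub>\<le>\<^sub>0" if "z \<in> cut_plane" for z using that by (auto simp: in_cut_plane_iff complex_nonpos_Reals_iff)
    then show ?thesis by (intro holomorphic_intros) auto
  qed
  have "E p = 0"
  proof (rule two_variable_identity[OF C(2,3)])
    show "(of_real x0, of_real y0) \<in> C"
    proof -
      have "(complex_of_real x0, complex_of_real y0) \<in> interior cut_free_pairs"
        using pC connected_component_in by (metis mem_Collect_eq)
      then show ?thesis unfolding C_def by (simp add: connected_component_refl)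
    qed
    show "p \<in> C" using pC by (simp add: C_def)
    show "(\<lambda>a. E (a, b)) holomorphic_on S" if S: "open S" "\<And>a. a \<in> S \<Longrightarrow> (a, b) \<in> C" for b S
    proof -
      have sub: "S \<subseteq> cut_plane" using cut(1) S(2) by fastforce
      show ?thesis unfolding E_def product_rhs_def fst_conv snd_conv
        by (intro holomorphic_intros seg_integrand_integral_holomorphic holomorphic_on_subset[OF pw sub]
            holomorphic_on_subset[OF Legendre_P_holomorphic sub] S(1)) (use S(2) C(1) in auto)
    qed
    show "(\<lambda>b. E (a, b)) holomorphic_on S" if S: "open S" "\<And>b. b \<in> S \<Longrightarrow> (a, b) \<in> C" for a S
    proof -
      have sub: "S \<subseteq> cut_plane" using cut(2) S(2) by fastforce
      show ?thesis unfolding E_def product_rhs_def fst_conv snd_conv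
        by (intro holomorphic_intros seg_integrand_integral_holomorphic holomorphic_on_subset[OF pw sub]
            holomorphic_on_subset[OF Legendre_P_holomorphic sub] S(1)) (use S(2) C(1) in auto)
    qed
    show "E (of_real x, of_real y) = 0" if "x > 1" "y > 1" "(of_real x, of_real y) \<in> C" for x y :: real
    proof -
      let ?q = "(complex_of_real x, complex_of_real y)"
      have q: "?q \<in> regular_pairs" using C(1) that by blast
      have "(seg_integrand ?q has_integral product_rhs ?q) {0<..<1}"
        using real_product_formula[OF that(1,2)] contour_integral_iff[OF q, of "- product_rhs ?q"]
        by (simp add: product_rhs_def mult.assoc)
      then show ?thesis by (simp add: E_def integral_unique)
    qed
  qed (rule xy)+
  then have "integral {0<..<1} (seg_integrand p) = product_rhs p" by (simp add: E_def)
  moreover have "seg_integrand p integrable_on {0<..<1}"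
    by (rule beta_dominated_integrable[OF seg_integrand_dominated]) (use p principal_region_regular in blast)
  ultimately show ?thesis by (simp add: has_integral_iff)
qed

end

section \<open>Consequences of convergence of the integral\<close>

text \<open>The gauge integral may converge conditionally and the power may oscillate, so norms
  cannot simply be compared. On a window \<open>[s, \<rho> * s]\<close> of fixed ratio, however, the
  integrand stays close to a constant of modulus \<open>s powr (Re \<alpha> - 1) * norm c\<close>,
  so the integral over it is at least of order \<open>s powr Re \<alpha>\<close>, while continuity
  of the indefinite integral makes it small.\<close>

lemma powr_integrable_imp_Re_pos:
  fixes \<phi> :: "real \<Rightarrow> complex"
  assumes int: "(\<lambda>t. of_real t powr (\<alpha> - 1) * \<phi> t) integrable_on {0<..<1}"
    and lim: "(\<phi> \<longlongrightarrow> c) (at_right 0)" and c: "c \<noteq> 0"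
  shows "Re \<alpha> > 0"
proof (rule ccontr)
  assume "\<not> Re \<alpha> > 0"
  then have \<alpha>: "Re \<alpha> \<le> 0" by simp
  define g where "g = (\<lambda>t. complex_of_real t powr (\<alpha> - 1) * \<phi> t)"
  have g: "g integrable_on {0..1}" using int unfolding g_def integrable_on_Icc_iff_Ioo .
  define G where "G = (\<lambda>x. integral {0..x} g)"
  have Gc: "continuous_on {0..1} G" unfolding G_def by (rule indefinite_integral_continuous_1[OF g])
  have "(G \<longlongrightarrow> G 0) (at_right 0)" by (rule continuous_on_Icc_at_rightD[OF Gc]) simp
  then have G0: "(G \<longlongrightarrow> 0) (at_right 0)" by (simp add: G_def)
  have "isCont (\<lambda>v. complex_of_real v powr (\<alpha> - 1)) 1"
    by (intro continuous_intros) auto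
  then have "((\<lambda>v. complex_of_real v powr (\<alpha> - 1)) \<longlongrightarrow> 1) (at 1)" by (simp add: isCont_def)
  then obtain d where d: "d > 0" "\<forall>v. v \<noteq> 1 \<and> dist v 1 < d \<longrightarrow> dist (complex_of_real v powr (\<alpha> - 1)) 1 < 1 / 4"
    unfolding tendsto_iff eventually_at by (metis UNIV_I zero_less_divide_1_iff zero_less_numeral)
  \<comment> \<open>The ratio depends on \<alpha> alone: on \<open>[1, \<rho>]\<close> the power
    \<open>v powr (\<alpha> - 1)\<close> differs from 1 by at most 1/4.\<close>
  define \<rho> where "\<rho> = 1 + min (d / 2) 1"
  have \<rho>: "\<rho> > 1" "\<rho> \<le> 2" "\<rho> < 1 + d" using d(1) by (auto simp: \<rho>_def min_def)
  have v: "norm (complex_of_real v powr (\<alpha> - 1) - 1) \<le> 1 / 4" if "v \<in> {1..\<rho>}" for v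
  proof (cases "v = 1")
    case False
    then have "v \<noteq> 1 \<and> dist v 1 < d" using that \<rho> by (auto simp: dist_real_def)
    from d(2)[rule_format, OF this] show ?thesis by (simp add: dist_norm)
  qed simp
  \<comment> \<open>With deviations of 1/4 in both factors the relative error is at most
    \<open>5/16 + 1/4 < 3/5\<close>, which leaves at least
    \<open>2/5 * norm c * (\<rho> - 1)\<close> for the window; \<open>2 * \<epsilon>\<close> is half
    of that.\<close>
  define \<epsilon> where "\<epsilon> = norm c * (\<rho> - 1) / 10"
  have \<epsilon>: "\<epsilon> > 0" using c \<rho> by (simp add: \<epsilon>_def)
  have "eventually (\<lambda>t. norm (\<phi> t - c) < norm c / 4) (at_right 0)"
    using lim[unfolded tendsto_iff dist_norm, rule_format, of "norm c / 4"] c by simp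
  then obtain b1 where b1: "b1 > 0" "\<And>t. 0 < t \<Longrightarrow> t < b1 \<Longrightarrow> norm (\<phi> t - c) < norm c / 4"
    unfolding eventually_at_right_field by auto
  have "eventually (\<lambda>t. norm (G t) < \<epsilon>) (at_right 0)"
    using G0 \<epsilon> unfolding tendsto_iff dist_norm by simp
  then obtain b2 where b2: "b2 > 0" "\<And>t. 0 < t \<Longrightarrow> t < b2 \<Longrightarrow> norm (G t) < \<epsilon>"
    unfolding eventually_at_right_field by auto
  define s where "s = min (min b1 b2) 1 / 4"
  have s: "s > 0" "2 * s < b1" "2 * s < b2" "2 * s < 1" using b1 b2 by (auto simp: s_def min_def)
  define r where "r = \<rho> * s"
  have rs: "r \<le> 2 * s" "s < r" using \<rho> s by (auto simp: r_def)
  define P where "P = complex_of_real s powr (\<alpha> - 1)"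
  have bound: "norm (g t - P * c) \<le> 3 / 5 * (norm P * norm c)" if t: "t \<in> {s..r}" for t
  proof -
    define V where "V = complex_of_real (t / s) powr (\<alpha> - 1)"
    have ts: "t / s \<in> {1..\<rho>}" using t s by (auto simp: r_def field_simps)
    have V: "norm (V - 1) \<le> 1 / 4" unfolding V_def by (rule v[OF ts])
    then have V': "norm V \<le> 5 / 4" using norm_triangle_ineq[of 1 "V - 1"] by simp
    have F: "norm (\<phi> t - c) \<le> norm c / 4" using b1(2)[of t] t s rs by simp
    have "complex_of_real t powr (\<alpha> - 1) = of_real (s * (t / s)) powr (\<alpha> - 1)" using s by simp
    also have "\<dots> = P * V" unfolding P_def V_def
      by (simp only: of_real_mult, rule powr_times_real_left) (use s t in auto)
    finally have "g t - P * c = P * (V * (\<phi> t - c) + (V - 1) * c)" by (simp add: g_def algebra_simps)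
    also have "norm \<dots> \<le> norm P * (5 / 4 * (norm c / 4) + 1 / 4 * norm c)"
    proof -
      have "norm (V * (\<phi> t - c)) \<le> 5 / 4 * (norm c / 4)"
        unfolding norm_mult by (rule mult_mono[OF V' F]) auto
      moreover have "norm ((V - 1) * c) \<le> 1 / 4 * norm c"
        unfolding norm_mult by (rule mult_right_mono[OF V]) simp
      ultimately have "norm (V * (\<phi> t - c) + (V - 1) * c) \<le> 5 / 4 * (norm c / 4) + 1 / 4 * norm c"
        by (rule norm_triangle_mono)
      then show ?thesis unfolding norm_mult[of P] by (intro mult_left_mono) auto
    qed
    also have "\<dots> \<le> 3 / 5 * (norm P * norm c)" by (simp add: field_simps)
    finally show ?thesis .
  qed
  have gI: "g integrable_on {0..r}" "g integrable_on {s..r}"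
    using s rs by (auto intro: integrable_on_subinterval[OF g])
  have comb: "integral {s..r} g = G r - G s"
    unfolding G_def using Henstock_Kurzweil_Integration.integral_combine[OF _ _ gI(1), of s] s rs by (simp add: eq_diff_eq add.commute)
  have "((\<lambda>t. g t - P * c) has_integral integral {s..r} g - (r - s) *\<^sub>R (P * c)) {s..r}"
    by (intro has_integral_diff integrable_integral gI(2)) (use has_integral_const_real[of "P * c" s "r"] rs in simp)
  then have "norm (integral {s..r} g - (r - s) *\<^sub>R (P * c)) \<le> 3 / 5 * (norm P * norm c) * measure lborel (cbox s r)"
    by (intro has_integral_bound[where f = "\<lambda>t. g t - P * c"]) (use bound in auto)
  then have 1: "norm (integral {s..r} g - (r - s) *\<^sub>R (P * c)) \<le> 3 / 5 * (norm P * norm c) * (r - s)"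
    using rs by simp
  have n: "norm ((r - s) *\<^sub>R (P * c)) = (norm P * norm c) * (r - s)"
    using rs by (simp add: norm_mult)
  have "norm ((r - s) *\<^sub>R (P * c)) \<le> norm (integral {s..r} g) + norm (integral {s..r} g - (r - s) *\<^sub>R (P * c))"
    by (metis norm_minus_commute norm_triangle_sub add.commute)
  moreover have "norm (integral {s..r} g) < 2 * \<epsilon>"
    unfolding comb using norm_triangle_ineq4[of "G r" "G s"] b2(2)[of s] b2(2)[of "r"] s rs by linarith
  ultimately have 2: "2 / 5 * ((norm P * norm c) * (r - s)) < 2 * \<epsilon>" using 1 n by linarith
  have "norm P * s = s powr Re \<alpha>"
    using s powr_add[of s "Re \<alpha> - 1" 1] by (simp add: P_def norm_of_real_powr)
  moreover have "s powr Re \<alpha> \<ge> 1"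
    using s \<alpha> powr_mono2'[of "- Re \<alpha>" s 1] ge_one_powr_ge_zero powr_mono'[of "Re \<alpha>" 0 s] by simp
  ultimately have "norm P * s \<ge> 1" by simp
  then have "norm c * (\<rho> - 1) * 1 \<le> norm c * (\<rho> - 1) * (norm P * s)"
    by (intro mult_left_mono) (use \<rho> in auto)
  also have "\<dots> = (norm P * norm c) * (r - s)" by (simp add: r_def algebra_simps)
  finally have "2 / 5 * (norm c * (\<rho> - 1)) < 2 * \<epsilon>" using 2 by linarith
  then show False using \<epsilon> unfolding \<epsilon>_def by simp
qed

lemma integrable_on_unit_reflect:
  fixes g :: "real \<Rightarrow> complex"
  assumes "g integrable_on {0<..<1}"
  shows "(\<lambda>t. g (1 - t)) integrable_on {0<..<1}"
proof -
  have "g integrable_on {0..1}" using assms by (simp only: integrable_on_Icc_iff_Ioo)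
  then obtain i where "(g has_integral i) (cbox 0 1)" by (auto simp: integrable_on_def)
  from has_integral_affinity[OF this, of "-1" 1]
  have "((\<lambda>t. g (1 - t)) has_integral i) ((\<lambda>x. 1 - x) ` {0..1})" by (simp add: add.commute)
  then show ?thesis unfolding integrable_on_Icc_iff_Ioo[symmetric] by (auto simp: integrable_on_def)
qed

text \<open>At an end point \<open>h\<close> may lie on the cut, where the value of
  \<open>Ln\<close> need not be the limit from inside. A continuous logarithm exists on the whole
  interval; in the interior it differs from \<open>Ln\<close> by a continuous multiple of
  \<open>2 * pi * \<i>\<close>, so by a constant, which can be added.\<close>

lemma continuous_Ln_extends:
  fixes h :: "real \<Rightarrow> complex"
  assumes c: "continuous_on {0..1} h" and nz: "\<And>t. t \<in> {0..1} \<Longrightarrow> h t \<noteq> 0"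
    and cut: "\<And>t. t \<in> {0<..<1} \<Longrightarrow> h t \<notin> \<real>\<^sub>\<le>\<^sub>0"
  shows "\<exists>L. continuous_on {0..1} L \<and> (\<forall>t\<in>{0..1}. exp (L t) = h t) \<and> (\<forall>t\<in>{0<..<1}. L t = Ln (h t))"
proof -
  have "contractible {0..1::real}" by (rule convex_imp_contractible) simp
  then obtain g where g: "continuous_on {0..1} g" "\<And>t. t \<in> {0..1} \<Longrightarrow> h t = exp (g t)"
    using continuous_logarithm_on_contractible[OF c _ nz] by blast
  define D where "D = (\<lambda>t. Ln (h t) - g t)"
  have hc: "continuous_on {0<..<1} h" "continuous_on {0<..<1} g"
    by (rule continuous_on_subset[OF c] continuous_on_subset[OF g(1)]; force)+
  have Dc: "continuous_on {0<..<1} D"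
    unfolding D_def by (intro continuous_on_diff continuous_on_Ln' hc) (use cut in auto)
  have ex: "exp (D t) = 1" if "t \<in> {0<..<1}" for t
  proof -
    have t: "t \<in> {0..1}" using that by auto
    show ?thesis using nz[OF t] g(2)[OF t] by (simp add: D_def exp_diff)
  qed
  have "D constant_on {0<..<1}"
  proof (rule continuous_discrete_range_constant[OF _ Dc])
    fix x assume x: "x \<in> {0<..<1::real}"
    have "2 * pi \<le> norm (D y - D x)" if "y \<in> {0<..<1}" "D y \<noteq> D x" for y
    proof -
      have "exp (D y) = exp (D x)" using ex x that by simp
      then obtain n :: int where n: "D y = D x + (of_int (2 * n) * pi) * \<i>" unfolding exp_eq by blast
      then have "n \<noteq> 0" using that by auto
      then have "1 \<le> \<bar>real_of_int n\<bar>" by linarith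
      then have "2 * pi * 1 \<le> 2 * pi * \<bar>real_of_int n\<bar>" by (intro mult_left_mono) auto
      then show ?thesis unfolding n by (simp add: norm_mult abs_mult mult.commute mult.left_commute)
    qed
    then show "\<exists>e>0. \<forall>y. y \<in> {0<..<1} \<and> D y \<noteq> D x \<longrightarrow> e \<le> norm (D y - D x)"
      by (intro exI[of _ "2 * pi"]) auto
  qed simp
  then obtain a where a: "\<And>t. t \<in> {0<..<1} \<Longrightarrow> D t = a" unfolding constant_on_def by blast
  have "exp a = 1" using ex[of "1 / 2"] a[of "1 / 2"] by simp
  then show ?thesis
    using a g by (intro exI[of _ "\<lambda>t. g t + a"]) (auto intro!: continuous_intros simp: exp_add D_def algebra_simps)
qed

text \<open>Cauchy's estimate bounds the derivative in \<open>z\<close> by the local bound of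
  \<open>F\<close>, which is uniform for parameters near \<open>s\<close>; the mean value inequality
  does the rest.\<close>

lemma locally_uniformly_lipschitz:
  fixes F :: "'a::metric_space \<times> complex \<Rightarrow> complex"
  assumes cont: "continuous_on (D \<times> cball c r) F" and r: "r > 0" and s: "s \<in> D"
    and hol: "\<And>s. s \<in> D \<Longrightarrow> (\<lambda>z. F (s, z)) holomorphic_on ball c r"
  shows "\<exists>e>0. \<exists>M. \<forall>s'\<in>D. dist s s' < e \<longrightarrow> (\<forall>z\<in>ball c (r / 2). norm (F (s', z) - F (s', c)) \<le> M * norm (z - c))"
proof -
  obtain e M where e: "e > 0" and M: "\<forall>s'\<in>D. dist s s' < e \<longrightarrow> (\<forall>z\<in>cball c r. norm (F (s', z)) \<le> M)"
    using continuous_on_locally_bounded[OF cont compact_cball s] by blast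
  have "norm (F (s', z) - F (s', c)) \<le> M / (r / 4) * norm (z - c)" if s': "s' \<in> D" "dist s s' < e" and z: "z \<in> ball c (r / 2)" for s' z
  proof (rule field_differentiable_bound[where S = "ball c (r / 2)" and f = "\<lambda>z. F (s', z)" and f' = "deriv (\<lambda>z. F (s', z))"])
    fix w assume w: "w \<in> ball c (r / 2)"
    then have w': "w \<in> ball c r" using r by auto
    show "((\<lambda>z. F (s', z)) has_field_derivative deriv (\<lambda>z. F (s', z)) w) (at w within ball c (r / 2))"
      by (rule has_field_derivative_at_within, rule holomorphic_derivI[OF hol[OF s'(1)] _ w']) simp
    show "norm (deriv (\<lambda>z. F (s', z)) w) \<le> M / (r / 4)"
      by (rule holomorphic_deriv_bound[OF hol[OF s'(1)] _ w]) (use M s' in auto)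
  qed (use z r in auto)
  then show ?thesis using e by blast
qed

context whipple
begin

lemma kernel_Ln_extends:
  assumes p: "p \<in> regular_pairs"
  shows "\<exists>L. continuous_on {0..1} L \<and> (\<forall>t\<in>{0..1}. exp (L t) = kernel_normalised p t) \<and>
    (\<forall>t\<in>{0<..<1}. L t = Ln (kernel_normalised p t))"
proof (rule continuous_Ln_extends)
  show "continuous_on {0..1} (kernel_normalised p)"
    using pair_continuous(5)[of "{0..1}" "\<lambda>_. p" "\<lambda>t. t"] p by (simp add: continuous_on_id)
qed (use kernel_normalised_nonzero(1)[OF p] kernel_normalised_not_nonpos(2)[OF p] in auto)

text \<open>
  A zero of \<open>f\<close> at the upper limit is simple, because \<open>f\<close> solves a second order equation that is regular
  there; it improves the exponent of the integrand by one.
\<close>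

lemma exponents_of_integrable:
  assumes p: "p \<in> regular_pairs" and int: "seg_integrand p integrable_on {0<..<1}"
    and mu: "\<And>n::nat. \<mu> \<noteq> - of_nat (Suc n)"
  shows "Re (\<nu> + \<mu>) > -1" "Re \<nu> < 0 \<or> f ((1 - segment_point p 1) / 2) = 0 \<and> Re \<nu> < 1"
proof -
  obtain L where L: "continuous_on {0..1} L" "\<forall>t\<in>{0..1}. exp (L t) = kernel_normalised p t"
      "\<forall>t\<in>{0<..<1}. L t = Ln (kernel_normalised p t)"
    using kernel_Ln_extends[OF p] by blast
  \<comment> \<open>The zero-free part of the integrand. With \<open>L\<close> in place of
    \<open>Ln\<close> it is continuous up to both ends, so that only \<open>f\<close> can affect the
    exponents there.\<close>
  define h where "h = (\<lambda>t. ((segment_point p t + 1) / w_of p) powr (-\<mu> / 2) * segment_point p t powr (- \<nu> - 1) * w_of p /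
    (segment_root p t)\<^sup>2 * exp ((- \<nu> - 1) * L t))"
  define x where "x = (\<lambda>t. (1 - segment_point p t) / 2)"
  have xt: "x t = - of_real t * w_of p / 2" for t by (simp add: x_def segment_point_w)
  have b: "bounded_part p t = f (x t) * h t" if "t \<in> {0<..<1}" for t
  proof -
    have "kernel_normalised p t \<noteq> 0" using kernel_normalised_nonzero(1)[OF p, of t] that by auto
    then show ?thesis
      using L(3) that by (simp add: bounded_part_def smooth_part_def h_def x_def powr_def)
  qed
  have c: "continuous_on {0..1} (\<lambda>_::real. p)" "continuous_on {0..1} (\<lambda>t::real. t)" by (intro continuous_intros)+
  note C = pair_continuous[OF c]
  have w0: "w_of p \<noteq> 0" by (rule regular_pairs_D(5)[OF p])
  note F = seg_facts[OF p]
  have hc: "continuous_on {0..1} h"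
    unfolding h_def
    by (intro continuous_on_mult continuous_on_divide continuous_on_cpowr continuous_on_add continuous_on_power
        continuous_on_exp continuous_on_const C L(1)) (use p w0 F in auto)
  have h0: "h t \<noteq> 0" if "t \<in> {0..1}" for t
  proof -
    have "segment_point p t \<noteq> 0" "(segment_point p t + 1) / w_of p \<noteq> 0" "segment_root p t \<noteq> 0"
      using F(1,4,5)[OF that] by auto
    then show ?thesis using w0 by (simp add: h_def)
  qed
  have fx: "continuous_on {0..1} (\<lambda>t. f (x t))"
    unfolding x_def
    by (intro continuous_on_compose2[OF holomorphic_on_imp_continuous_on[OF f_holomorphic]] continuous_intros C) (use p F in auto)
  have eq0: "seg_integrand p t = of_real t powr (A_exp - 1) * (of_real (1 - t) powr (- \<nu> - 1) * (f (x t) * h t))"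
    if "t \<in> {0<..<1}" for t unfolding seg_integrand_def b[OF that] by (simp add: mult.assoc)
  have f0: "f 0 \<noteq> 0"
  proof -
    have "1 + \<mu> \<notin> \<int>\<^sub>\<le>\<^sub>0"
    proof
      assume "1 + \<mu> \<in> \<int>\<^sub>\<le>\<^sub>0"
      then obtain n :: nat where "1 + \<mu> = - of_nat n" by (auto elim: nonpos_Ints_cases')
      then have "\<mu> = - of_nat (Suc n)" by (simp add: algebra_simps eq_neg_iff_add_eq_0)
      then show False using mu by blast
    qed
    then show ?thesis unfolding f_0 by (simp add: rGamma_eq_zero_iff)
  qed
  have "Re A_exp > 0"
  proof (rule powr_integrable_imp_Re_pos)
    show "(\<lambda>t. of_real t powr (A_exp - 1) * (of_real (1 - t) powr (- \<nu> - 1) * (f (x t) * h t))) integrable_on {0<..<1}"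
      using int by (rule integrable_eq) (rule eq0)
    have "isCont (\<lambda>t. complex_of_real (1 - t) powr (- \<nu> - 1)) 0" by (intro continuous_intros) auto
    then have "((\<lambda>t. complex_of_real (1 - t) powr (- \<nu> - 1)) \<longlongrightarrow> 1) (at_right 0)"
      by (auto simp: isCont_def intro: filterlim_at_split[THEN iffD1, THEN conjunct2])
    then show "((\<lambda>t. of_real (1 - t) powr (- \<nu> - 1) * (f (x t) * h t)) \<longlongrightarrow> 1 * (f (x 0) * h 0)) (at_right 0)"
      by (intro tendsto_mult continuous_on_Icc_at_rightD[OF fx] continuous_on_Icc_at_rightD[OF hc]) auto
    show "1 * (f (x 0) * h 0) \<noteq> 0" using f0 h0[of 0] xt[of 0] by simp
  qed
  then show "Re (\<nu> + \<mu>) > -1" by (simp add: A_exp_def)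
  have int': "(\<lambda>t. seg_integrand p (1 - t)) integrable_on {0<..<1}" by (rule integrable_on_unit_reflect[OF int])
  have refl: "((\<lambda>t. g (1 - t)) \<longlongrightarrow> g 1) (at_right 0)" if "continuous_on {0..1} g" for g :: "real \<Rightarrow> complex"
  proof -
    have "continuous_on {0..1} (\<lambda>t. g (1 - t))"
      by (rule continuous_on_compose2[OF that]) (auto intro!: continuous_intros)
    from continuous_on_Icc_at_rightD[OF this] show ?thesis by simp
  qed
  have l1: "((\<lambda>t. complex_of_real (1 - t) powr (A_exp - 1)) \<longlongrightarrow> 1) (at_right 0)"
  proof -
    have "isCont (\<lambda>t. complex_of_real (1 - t) powr (A_exp - 1)) 0" by (intro continuous_intros) auto
    then show ?thesis by (auto simp: isCont_def intro: filterlim_at_split[THEN iffD1, THEN conjunct2])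
  qed
  show "Re \<nu> < 0 \<or> f ((1 - segment_point p 1) / 2) = 0 \<and> Re \<nu> < 1"
  proof (cases "f (x 1) = 0")
    case False
    have "Re (- \<nu>) > 0"
    proof (rule powr_integrable_imp_Re_pos)
      show "(\<lambda>t. of_real t powr (- \<nu> - 1) * (of_real (1 - t) powr (A_exp - 1) * (f (x (1 - t)) * h (1 - t)))) integrable_on {0<..<1}"
        using int' by (rule integrable_eq) (use eq0 in \<open>auto simp: mult_ac\<close>)
      show "((\<lambda>t. of_real (1 - t) powr (A_exp - 1) * (f (x (1 - t)) * h (1 - t))) \<longlongrightarrow> 1 * (f (x 1) * h 1)) (at_right 0)"
        by (intro tendsto_mult l1 refl[OF fx] refl[OF hc])
      show "1 * (f (x 1) * h 1) \<noteq> 0" using False h0[of 1] by simp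
    qed
    then show ?thesis by simp
  next
    case True
    have x1: "x 1 \<in> slit_plane" unfolding x_def using F(6)[of 1] by simp
    have x1': "x 1 \<noteq> 0" "1 - x 1 \<noteq> 0"
      using w0 x1 by (auto simp: xt mem_slit_plane_iff)
    have d1: "deriv f (x 1) \<noteq> 0"
    proof
      assume d0: "deriv f (x 1) = 0"
      have "f 0 = 0"
      \<comment> \<open>\<open>x 1\<close> is an ordinary point of the hypergeometric equation,
        which is multiplied by \<open>y - x 1\<close> to fit \<open>ode_unique\<close>; a double
        zero would propagate to the origin, where \<open>f\<close> is not 0.\<close>
      proof (rule ode_unique[where N = f and ?N1.0 = "deriv f" and ?N2.0 = "deriv (deriv f)" and ?x0.0 = "x 1" and A = slit_plane
          and p = "\<lambda>y. y * (1 - y)" and q = "\<lambda>y. (y - x 1) * (1 + \<mu> - 2 * y)" and r = "\<lambda>y. (y - x 1) * (\<nu> * (\<nu> + 1))"])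
        show "(y - x 1) * (y * (1 - y)) * deriv (deriv f) y + (y - x 1) * (1 + \<mu> - 2 * y) * deriv f y + (y - x 1) * (\<nu> * (\<nu> + 1)) * f y = 0"
          if "y \<in> slit_plane" for y
        proof -
          have alg: "(y - a) * c * d + (y - a) * e * g + (y - a) * k * m = (y - a) * (c * d + e * g + k * m)" for a c d e g k m :: complex
            by (simp add: algebra_simps)
          show ?thesis unfolding alg f_ode[OF that] by simp
        qed
        show "of_nat n * (x 1 * (1 - x 1)) + (x 1 - x 1) * (1 + \<mu> - 2 * x 1) \<noteq> 0" if "n > 0" for n :: nat
          using that x1' by simp
      qed (use True d0 x1 f_derivs open_slit_plane connected_slit_plane zero_in_slit_plane in \<open>auto intro!: holomorphic_intros\<close>)
      then show False using f0 by simp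
    qed
    have lf: "((\<lambda>t. f (x (1 - t)) / of_real t) \<longlongrightarrow> deriv f (x 1) * (w_of p / 2)) (at_right 0)"
    proof -
      have x': "x (1 - t) = x 1 + of_real t * (w_of p / 2)" for t by (simp add: xt field_simps)
      have "((\<lambda>z. f (x 1 + z * (w_of p / 2))) has_field_derivative deriv f (x 1) * (w_of p / 2)) (at 0)"
      proof -
        have "(f has_field_derivative deriv f (x 1)) (at (x 1 + 0 * (w_of p / 2)))" using f_derivs(1)[OF x1] by simp
        moreover have "((\<lambda>z. x 1 + z * (w_of p / 2)) has_field_derivative w_of p / 2) (at 0)"
          by (auto intro!: derivative_eq_intros)
        ultimately show ?thesis by (rule DERIV_chain2)
      qed
      then have "((\<lambda>z. f (x 1 + z * (w_of p / 2)) / z) \<longlongrightarrow> deriv f (x 1) * (w_of p / 2)) (at 0)"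
        using True by (simp add: has_field_derivative_iff)
      moreover have "filterlim complex_of_real (at 0) (at_right 0)"
      proof -
        have "(complex_of_real \<longlongrightarrow> of_real 0) (at_right 0)" by (intro tendsto_intros)
        moreover have "eventually (\<lambda>t. complex_of_real t \<noteq> 0) (at_right 0)"
          by (auto simp: eventually_at_right_field intro: exI[of _ 1])
        ultimately show ?thesis by (simp add: filterlim_at)
      qed
      ultimately show ?thesis unfolding x' by (rule filterlim_compose)
    qed
    have "Re (1 - \<nu>) > 0"
    proof (rule powr_integrable_imp_Re_pos)
      show "(\<lambda>t. of_real t powr ((1 - \<nu>) - 1) * (of_real (1 - t) powr (A_exp - 1) * (f (x (1 - t)) / of_real t * h (1 - t)))) integrable_on {0<..<1}"
        using int'
      proof (rule integrable_eq)
        fix t :: real assume t: "t \<in> {0<..<1}"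
        then have t': "1 - t \<in> {0<..<1}" "complex_of_real t \<noteq> 0" by auto
        have "complex_of_real t powr (- \<nu> - 1) = of_real t powr ((1 - \<nu>) - 1) / of_real t"
          using t powr_diff[of "complex_of_real t" "- \<nu>" 1] by simp
        then show "seg_integrand p (1 - t) =
          of_real t powr ((1 - \<nu>) - 1) * (of_real (1 - t) powr (A_exp - 1) * (f (x (1 - t)) / of_real t * h (1 - t)))"
          unfolding eq0[OF t'(1)] using t'(2) by simp
      qed
      show "((\<lambda>t. of_real (1 - t) powr (A_exp - 1) * (f (x (1 - t)) / of_real t * h (1 - t))) \<longlongrightarrow>
          1 * (deriv f (x 1) * (w_of p / 2) * h 1)) (at_right 0)"
        by (intro tendsto_mult l1 lf refl[OF hc])
      show "1 * (deriv f (x 1) * (w_of p / 2) * h 1) \<noteq> 0" using d1 w0 h0[of 1] by simp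
    qed
    then show ?thesis using True by (simp add: x_def)
  qed
qed

end

section \<open>Continuation in the degree\<close>

lemma holomorphic_on_const_powr:
  assumes "g holomorphic_on S"
  shows "(\<lambda>s. (c::complex) powr g s) holomorphic_on S"
proof (cases "c = 0")
  case False
  then show ?thesis unfolding powr_def by (simp add: assms) (intro holomorphic_intros assms)
qed (simp add: powr_def)

text \<open>
  The degree \<open>s\<close> and the order \<open>k - s\<close> move with constant sum, so that the exponent at the lower end
  point stays fixed.
\<close>

locale degree_family =
  fixes p :: "complex \<times> complex" and k :: complex and L :: "real \<Rightarrow> complex"
  assumes p: "p \<in> regular_pairs" and k: "Re k > -1"
    and L_cont: "continuous_on {0..1} L" and L_exp: "\<And>t. t \<in> {0..1} \<Longrightarrow> exp (L t) = kernel_normalised p t"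
    and L_Ln: "\<And>t. t \<in> {0<..<1} \<Longrightarrow> L t = Ln (kernel_normalised p t)"
begin

text \<open>An open set containing the closed segment, on which all powers in \<open>G\<close> are
  holomorphic in \<open>z\<close>; openness is what admits Cauchy's estimate at the upper end
  point.\<close>

definition Z :: "complex set" where
  "Z = {z. (z + 1) / w_of p \<notin> \<real>\<^sub>\<le>\<^sub>0 \<and> z \<notin> \<real>\<^sub>\<le>\<^sub>0 \<and> z + 1 \<notin> \<real>\<^sub>\<le>\<^sub>0}"

text \<open>The logarithm of the kernel is an independent variable \<open>l\<close>, so that the
  power of the kernel is entire in \<open>s\<close> and meets no branch problem at the ends of the
  segment. The divisor \<open>z + 1\<close> is what remains of
  \<open>w_of p / (segment_root p t)\<^sup>2\<close>.\<close>

definition G :: "complex \<Rightarrow> complex \<Rightarrow> complex \<Rightarrow> complex" where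
  "G s z l = ((z + 1) / w_of p) powr (- (k - s) / 2) * hyp2F1_reg (- s) (s + 1) (1 + (k - s)) ((1 - z) / 2) *
     z powr (- s - 1) / (z + 1) * exp ((- s - 1) * l)"

definition \<phi> :: "complex \<Rightarrow> real \<Rightarrow> complex" where "\<phi> s t = G s (segment_point p t) (L t)"

lemma w_nonzero: "w_of p \<noteq> 0"
  by (rule regular_pairs_D(5)[OF p])

lemma open_Z: "open Z"
proof -
  have o: "open ((\<lambda>z. (z + 1) / w_of p) -` (- \<real>\<^sub>\<le>\<^sub>0))" "open ((\<lambda>z. z) -` (- \<real>\<^sub>\<le>\<^sub>0 :: complex set))"
      "open ((\<lambda>z. z + 1) -` (- \<real>\<^sub>\<le>\<^sub>0 :: complex set))"
    by (intro open_vimage continuous_intros open_Compl closed_nonpos_Reals_complex; simp add: w_nonzero)+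
  have "Z = (\<lambda>z. (z + 1) / w_of p) -` (- \<real>\<^sub>\<le>\<^sub>0) \<inter> (\<lambda>z. z) -` (- \<real>\<^sub>\<le>\<^sub>0) \<inter> (\<lambda>z. z + 1) -` (- \<real>\<^sub>\<le>\<^sub>0)"
    by (auto simp: Z_def)
  then show ?thesis using o by (simp only:) (intro open_Int)
qed

lemma Z_D:
  assumes "z \<in> Z"
  shows "(z + 1) / w_of p \<notin> \<real>\<^sub>\<le>\<^sub>0" "z \<notin> \<real>\<^sub>\<le>\<^sub>0" "z + 1 \<noteq> 0" "(1 - z) / 2 \<in> slit_plane"
proof -
  show "(z + 1) / w_of p \<notin> \<real>\<^sub>\<le>\<^sub>0" "z \<notin> \<real>\<^sub>\<le>\<^sub>0" "z + 1 \<noteq> 0" using assms by (auto simp: Z_def)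
  have n: "z + 1 \<notin> \<real>\<^sub>\<le>\<^sub>0" using assms by (simp add: Z_def)
  have e: "1 - (1 - z) / 2 = of_real 0 + of_real (1 / 2) * (z + 1)" by (simp add: field_simps)
  show "(1 - z) / 2 \<in> slit_plane"
    unfolding mem_slit_plane_iff e using nonpos_affine(2)[OF n, of "1 / 2" 0] by simp
qed

lemma segment_point_Z:
  assumes t: "t \<in> {0..1}" shows "segment_point p t \<in> Z"
proof -
  have "segment_point p t + 1 = 2 + of_real t * w_of p" by (simp add: segment_point_w)
  then show ?thesis using seg_facts[OF p t] by (simp add: Z_def)
qed

lemma G_continuous:
  fixes T :: "'a::metric_space set"
  assumes c: "continuous_on T S" "continuous_on T z" "continuous_on T l" and Z: "\<And>x. x \<in> T \<Longrightarrow> z x \<in> Z"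
  shows "continuous_on T (\<lambda>x. G (S x) (z x) (l x))"
proof -
  note F = Z_D[OF Z]
  have "Re (- S x) > 0 \<or> Re (S x + 1) > 0" for x by auto
  then have h: "continuous_on T (\<lambda>x. hyp2F1_reg (- S x) (S x + 1) (1 + (k - S x)) ((1 - z x) / 2))"
    by (intro hyp2F1_reg_continuous continuous_intros c F) simp_all
  have q: "continuous_on T (\<lambda>x. (z x + 1) / w_of p)"
    by (intro continuous_intros c) (use w_nonzero in auto)
  have e: "continuous_on T (\<lambda>x. - (k - S x) / 2)" "continuous_on T (\<lambda>x. - S x - 1)" by (intro continuous_intros c; simp)+
  show ?thesis unfolding G_def
    by (intro continuous_on_mult continuous_on_divide continuous_on_cpowr continuous_on_exp continuous_on_add continuous_on_const c q h e)
      (use F in auto)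
qed

lemma G_holomorphic:
  assumes c: "S holomorphic_on T" "z holomorphic_on T" "l holomorphic_on T" and Z: "\<And>x. x \<in> T \<Longrightarrow> z x \<in> Z" and T: "open T"
  shows "(\<lambda>x. G (S x) (z x) (l x)) holomorphic_on T"
proof -
  note F = Z_D[OF Z]
  have "Re (- S x) > 0 \<or> Re (S x + 1) > 0" for x by auto
  then have h: "(\<lambda>x. hyp2F1_reg (- S x) (S x + 1) (1 + (k - S x)) ((1 - z x) / 2)) holomorphic_on T"
    by (intro hyp2F1_reg_holomorphic holomorphic_intros c F T) simp
  have q: "(\<lambda>x. (z x + 1) / w_of p) holomorphic_on T"
    by (intro holomorphic_intros c) (use w_nonzero in auto)
  have e: "(\<lambda>x. - (k - S x) / 2) holomorphic_on T" "(\<lambda>x. - S x - 1) holomorphic_on T" by (intro holomorphic_intros c; simp)+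
  have x: "(\<lambda>x. exp ((- S x - 1) * l x)) holomorphic_on T" by (intro holomorphic_intros c)
  show ?thesis unfolding G_def
    by (intro holomorphic_on_mult holomorphic_on_divide holomorphic_on_powr holomorphic_on_add holomorphic_on_const c q h e x)
      (use F in auto)
qed

lemma \<phi>_continuous: "continuous_on (UNIV \<times> {0..1}) (\<lambda>x. \<phi> (fst x) (snd x))"
proof -
  have c: "continuous_on (UNIV \<times> {0..1::real}) (fst :: complex \<times> real \<Rightarrow> complex)" "continuous_on (UNIV \<times> {0..1::real}) (snd :: complex \<times> real \<Rightarrow> real)"
    by (intro continuous_intros)+
  have z: "continuous_on (UNIV \<times> {0..1}) (\<lambda>x :: complex \<times> real. segment_point p (snd x))"
    unfolding segment_point_w by (intro continuous_intros c)
  have l: "continuous_on (UNIV \<times> {0..1}) (\<lambda>x :: complex \<times> real. L (snd x))"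
    by (rule continuous_on_compose2[OF L_cont c(2)]) auto
  show ?thesis unfolding \<phi>_def by (rule G_continuous[OF c(1) z l]) (use segment_point_Z in auto)
qed

lemma \<phi>_continuous_t: "continuous_on {0..1} (\<phi> s)"
proof -
  have "continuous_on {0..1} (\<lambda>t. \<phi> (fst (s, t)) (snd (s, t)))"
    by (rule continuous_on_compose2[OF \<phi>_continuous]) (auto intro!: continuous_intros)
  then show ?thesis by simp
qed

lemma \<phi>_holomorphic: "t \<in> {0..1} \<Longrightarrow> (\<lambda>s. \<phi> s t) holomorphic_on UNIV"
  unfolding \<phi>_def by (rule G_holomorphic) (use segment_point_Z in \<open>auto intro!: holomorphic_intros\<close>)

lemma bounded_part_eq_\<phi>:
  assumes t: "t \<in> {0<..<1}"
  shows "whipple.bounded_part s (k - s) p t = \<phi> s t"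
proof -
  have t': "t \<in> {0..1}" using t by auto
  have sr: "(segment_root p t)\<^sup>2 = w_of p * (segment_point p t + 1)"
    unfolding segment_root_w segment_point_w by (simp add: power_mult_distrib)
  have kn: "kernel_normalised p t \<noteq> 0" by (rule kernel_normalised_nonzero(1)[OF p t'])
  have alg: "q * F * P * w / (w * y) * E = q * F * P / y * E" if "w \<noteq> 0" for q F P w y E :: complex
    using that by simp
  show ?thesis
    unfolding whipple.bounded_part_def whipple.smooth_part_def whipple.f_def \<phi>_def G_def sr alg[OF w_nonzero]
    using kn L_Ln[OF t] by (simp add: powr_def)
qed

text \<open>With \<open>csqrt z\<close> in place of \<open>sqrt t\<close> the formula for
  \<open>kernel_normalised\<close> is analytic near \<open>t = 1\<close> and nonzero there, so its
  logarithm continues to complex \<open>t\<close>. Mere continuity of \<open>L\<close> at the end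
  point would not bound a difference quotient.\<close>

lemma L_continues:
  "\<exists>r>0. \<exists>\<Lambda>. continuous_on (cball 1 r) \<Lambda> \<and> \<Lambda> holomorphic_on ball 1 r \<and> (\<forall>z\<in>cball 1 r. 1 + z * w_of p \<in> Z) \<and>
     (\<forall>t\<in>{0..1}. \<bar>t - 1\<bar> \<le> r \<longrightarrow> \<Lambda> (of_real t) = L t)"
proof -
  define sr where "sr = (\<lambda>z. csqrt (w_of p) * csqrt (2 + z * w_of p))"
  define num where "num = (\<lambda>z. (1 + z * w_of p) * root_product p - (fst p * snd p - 1) * csqrt z * sr z)"
  define den where "den = (\<lambda>z. (1 + z * w_of p) * root_product p + (fst p * snd p + 1) * csqrt z * sr z)"
  define kc where "kc = (\<lambda>z. (fst p + snd p)\<^sup>2 * w_of p * (2 + w_of p + z * w_of p) * num z /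
     (den z * (2 * fst p * snd p * (1 + z * w_of p) * sr z * root_product p)))"
  have sr: "sr (of_real t) = segment_root p t" for t by (simp add: sr_def segment_root_w)
  have cs: "csqrt (of_real t) = of_real (sqrt t)" if "t \<ge> 0" for t by (rule csqrt_of_real[OF that])
  have nd: "num (of_real t) = seg_num p t" "den (of_real t) = seg_den p t" if "t \<ge> 0" for t
    unfolding num_def den_def seg_num_def seg_den_def sr cs[OF that] segment_point_w by (rule refl)+
  have kc: "kc (of_real t) = kernel_normalised p t" if "t \<ge> 0" for t
    unfolding kc_def kernel_normalised_eq nd[OF that] sr segment_point_w ..
  have one: "(1::real) \<in> {0..1}" by simp
  have kn1: "kc 1 \<noteq> 0" using kc[of 1] kernel_normalised_nonzero(1)[OF p one] by simp
  have den1: "den 1 * (2 * fst p * snd p * (1 + 1 * w_of p) * sr 1 * root_product p) \<noteq> 0"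
    using kernel_normalised_nonzero(2)[OF p one] nd(2)[of 1] sr[of 1] segment_point_w[of p 1] by simp
  have "2 + 1 * w_of p \<notin> \<real>\<^sub>\<le>\<^sub>0" using seg_facts(2)[OF p one] by simp
  then have sra: "sr analytic_on {1}" unfolding sr_def by (intro analytic_intros) auto
  have ca: "csqrt analytic_on {1}" by (rule analytic_on_subset[OF analytic_on_csqrt]) auto
  have "kc analytic_on {1}"
    unfolding kc_def
  proof (rule analytic_on_divide)
    show "(\<lambda>z. (fst p + snd p)\<^sup>2 * w_of p * (2 + w_of p + z * w_of p) * num z) analytic_on {1}"
      unfolding num_def by (intro analytic_intros sra ca)
    show "(\<lambda>z. den z * (2 * fst p * snd p * (1 + z * w_of p) * sr z * root_product p)) analytic_on {1}"
      unfolding den_def by (intro analytic_intros sra ca)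
  qed (use den1 in auto)
  then obtain O1 where O1: "open O1" "1 \<in> O1" "kc holomorphic_on O1" unfolding analytic_at by blast
  have q: "(\<lambda>z. kc z / kc 1) holomorphic_on O1" by (intro holomorphic_intros O1(3)) (use kn1 in auto)
  have "open (O1 \<inter> (\<lambda>z. kc z / kc 1) -` {z. Re z > 0})"
    by (intro continuous_open_preimage holomorphic_on_imp_continuous_on[OF q] O1 open_halfplane_Re)
  moreover have "open ((\<lambda>z. 1 + z * w_of p) -` Z)"
    by (intro open_vimage open_Z continuous_intros)
  ultimately have oW: "open (O1 \<inter> (\<lambda>z. kc z / kc 1) -` {z. Re z > 0} \<inter> (\<lambda>z. 1 + z * w_of p) -` Z)"
    by (rule open_Int)
  have "1 \<in> O1 \<inter> (\<lambda>z. kc z / kc 1) -` {z. Re z > 0} \<inter> (\<lambda>z. 1 + z * w_of p) -` Z"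
    using O1 kn1 segment_point_Z[OF one] by (simp add: segment_point_w)
  then obtain r1 where r1: "r1 > 0" "ball 1 r1 \<subseteq> O1 \<inter> (\<lambda>z. kc z / kc 1) -` {z. Re z > 0} \<inter> (\<lambda>z. 1 + z * w_of p) -` Z"
    using openE[OF oW] by blast
  have "\<exists>d>0. \<forall>t\<in>{0..1}. dist t 1 < d \<longrightarrow> dist (L t) (L 1) < 1"
    using L_cont[unfolded continuous_on_iff, rule_format, OF one, of 1] by simp
  then obtain d where d: "d > 0" "\<forall>t\<in>{0..1}. dist t 1 < d \<longrightarrow> dist (L t) (L 1) < 1" by blast
  define r where "r = min r1 d / 2"
  have r: "r > 0" "r < r1" "r < d" using r1(1) d(1) by (auto simp: r_def min_def)
  define \<Lambda> where "\<Lambda> = (\<lambda>z. L 1 + Ln (kc z / kc 1))"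
  have inW: "z \<in> O1" "Re (kc z / kc 1) > 0" "1 + z * w_of p \<in> Z" if "z \<in> ball 1 r1" for z
    using subsetD[OF r1(2) that] by auto
  have sub: "ball 1 r1 \<subseteq> O1" using inW(1) by blast
  have hol: "\<Lambda> holomorphic_on ball 1 r1"
    unfolding \<Lambda>_def
  proof (intro holomorphic_on_add holomorphic_on_const holomorphic_on_Ln' holomorphic_on_subset[OF q sub])
    show "kc z / kc 1 \<notin> \<real>\<^sub>\<le>\<^sub>0" if "z \<in> ball 1 r1" for z
      using inW(2)[OF that] by (auto simp: complex_nonpos_Reals_iff)
  qed
  have cb: "cball 1 r \<subseteq> ball (1::complex) r1" "ball 1 r \<subseteq> ball (1::complex) r1" using r by auto
  have "\<Lambda> (of_real t) = L t" if t: "t \<in> {0..1}" "\<bar>t - 1\<bar> \<le> r" for t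
  proof -
    have "dist (L t) (L 1) < 1" using d(2) t r by (auto simp: dist_real_def)
    then have n: "norm (L t - L 1) < 1" by (simp add: dist_norm)
    have "\<bar>Im (L t - L 1)\<bar> < 1" using n abs_Im_le_cmod[of "L t - L 1"] by linarith
    then have I: "\<bar>Im (L t - L 1)\<bar> < pi" using pi_gt3 by linarith
    have "kc (of_real t) / kc 1 = exp (L t - L 1)"
      unfolding exp_diff L_exp[OF t(1)] L_exp[OF one] using kc[of t] kc[of 1] t by simp
    then have "Ln (kc (of_real t) / kc 1) = L t - L 1" using I by (simp only:) (rule Ln_exp, auto)
    then show ?thesis by (simp add: \<Lambda>_def)
  qed
  then show ?thesis
    using r(1) holomorphic_on_imp_continuous_on[OF holomorphic_on_subset[OF hol cb(1)]] holomorphic_on_subset[OF hol cb(2)]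
      inW(3) subsetD[OF cb(1)]
    by (intro exI[of _ r] exI[of _ \<Lambda>] conjI) auto
qed

text \<open>Near \<open>t = 1\<close> the bound comes from Cauchy's estimate for the continuation to
  complex \<open>t\<close>; for \<open>1 - t \<ge> r / 2\<close> it is boundedness of the numerator
  divided by \<open>r / 2\<close>.\<close>

lemma \<phi>_lipschitz:
  "\<exists>e>0. \<exists>M. \<forall>s'. dist s s' < e \<longrightarrow> (\<forall>t\<in>{0<..<1}. norm ((\<phi> s' t - \<phi> s' 1) / of_real (1 - t)) \<le> M)"
proof -
  obtain r \<Lambda> where r: "r > 0" and \<Lambda>: "continuous_on (cball 1 r) \<Lambda>" "\<Lambda> holomorphic_on ball 1 r"
      "\<forall>z\<in>cball 1 r. 1 + z * w_of p \<in> Z" "\<forall>t\<in>{0..1}. \<bar>t - 1\<bar> \<le> r \<longrightarrow> \<Lambda> (of_real t) = L t"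
    using L_continues by blast
  define F where "F = (\<lambda>x. G (fst x) (1 + snd x * w_of p) (\<Lambda> (snd x)))"
  have c: "continuous_on (UNIV \<times> cball 1 r) (fst :: complex \<times> complex \<Rightarrow> complex)" "continuous_on (UNIV \<times> cball 1 r) (snd :: complex \<times> complex \<Rightarrow> complex)"
    by (intro continuous_intros)+
  have l: "continuous_on (UNIV \<times> cball 1 r) (\<lambda>x :: complex \<times> complex. \<Lambda> (snd x))"
    by (rule continuous_on_compose2[OF \<Lambda>(1) c(2)]) auto
  have Fc: "continuous_on (UNIV \<times> cball 1 r) F"
    unfolding F_def by (intro G_continuous continuous_intros c l) (use \<Lambda>(3) in auto)
  have Fh: "(\<lambda>z. F (s, z)) holomorphic_on ball 1 r" for s
    unfolding F_def fst_conv snd_conv by (intro G_holomorphic holomorphic_intros \<Lambda>(2)) (use \<Lambda>(3) in auto)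
  obtain e1 M1 where e1: "e1 > 0" and M1: "\<forall>s'\<in>UNIV. dist s s' < e1 \<longrightarrow> (\<forall>z\<in>ball 1 (r / 2). norm (F (s', z) - F (s', 1)) \<le> M1 * norm (z - 1))"
    using locally_uniformly_lipschitz[OF Fc r UNIV_I Fh] by blast
  obtain e2 M2 where e2: "e2 > 0" and M2: "\<forall>s'\<in>UNIV. dist s s' < e2 \<longrightarrow> (\<forall>t\<in>{0..1::real}. norm ((\<lambda>x. \<phi> (fst x) (snd x)) (s', t)) \<le> M2)"
    using continuous_on_locally_bounded[OF \<phi>_continuous compact_Icc UNIV_I[of s]] by blast
  have F\<phi>: "F (s', of_real t) = \<phi> s' t" if "t \<in> {0..1}" "\<bar>t - 1\<bar> \<le> r" for s' t
    using \<Lambda>(4) that by (simp add: F_def \<phi>_def segment_point_w)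
  have "norm ((\<phi> s' t - \<phi> s' 1) / of_real (1 - t)) \<le> max M1 (2 * M2 / (r / 2))"
    if s': "dist s s' < min e1 e2" and t: "t \<in> {0<..<1}" for s' t
  proof -
    have "norm (complex_of_real (1 - t)) = 1 - t" using t by (subst norm_of_real) simp
    then have nt: "norm (complex_of_real t - 1) = 1 - t" "norm (1 - complex_of_real t) = 1 - t"
      by (simp_all add: norm_minus_commute)
    have nd: "norm ((\<phi> s' t - \<phi> s' 1) / of_real (1 - t)) = norm (\<phi> s' t - \<phi> s' 1) / (1 - t)"
      by (simp add: norm_divide nt)
    show ?thesis
    proof (cases "1 - t < r / 2")
      case True
      have "complex_of_real t \<in> ball 1 (r / 2)"
        using True by (simp add: dist_norm nt)
      then have "norm (F (s', of_real t) - F (s', 1)) \<le> M1 * norm (complex_of_real t - 1)" using M1 s' by simp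
      moreover note nt(1)
      moreover have "F (s', of_real t) = \<phi> s' t" by (rule F\<phi>) (use t True r in auto)
      moreover have "F (s', 1) = \<phi> s' 1" using F\<phi>[of 1 s'] r by simp
      ultimately have "norm (\<phi> s' t - \<phi> s' 1) \<le> M1 * (1 - t)" by simp
      then have "norm (\<phi> s' t - \<phi> s' 1) / (1 - t) \<le> M1" using t by (simp add: field_simps)
      then show ?thesis unfolding nd by (rule max.coboundedI1)
    next
      case False
      have "norm (\<phi> s' t) \<le> M2" "norm (\<phi> s' 1) \<le> M2" using M2 s' t by auto
      then have n: "norm (\<phi> s' t - \<phi> s' 1) \<le> 2 * M2" using norm_triangle_ineq4[of "\<phi> s' t" "\<phi> s' 1"] by linarith
      have "norm (\<phi> s' t - \<phi> s' 1) / (1 - t) \<le> 2 * M2 / (r / 2)"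
        by (rule frac_le) (use n False r order_trans[OF norm_ge_zero n] in auto)
      then show ?thesis unfolding nd by (rule max.coboundedI2)
    qed
  qed
  then show ?thesis using e1 e2 by (intro exI[of _ "min e1 e2"] conjI exI[of _ "max M1 (2 * M2 / (r / 2))"]) auto
qed

section \<open>Subtraction of the value at the upper end point\<close>

definition A :: complex where "A = (k + 1) / 2"

lemma A_pos: "Re A > 0"
  using k by (simp add: A_def)

text \<open>
  Subtracting the value of the bounded factor at the upper end point leaves an integrand that is integrable
  up to \<open>Re s < 1\<close>; the subtracted term is a Beta integral.
\<close>

definition J :: "complex \<Rightarrow> real \<Rightarrow> complex" where
  "J s t = of_real t powr (A - 1) * of_real (1 - t) powr ((1 - s) - 1) * ((\<phi> s t - \<phi> s 1) / of_real (1 - t))"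

lemma J_dominated: "beta_dominated {s. Re s < 1} J"
  unfolding J_def[abs_def]
proof (rule beta_dominatedI[where A = "\<lambda>_. A" and B = "\<lambda>s. 1 - s"])
  show "continuous_on {0<..<1} (\<lambda>t. (\<phi> s t - \<phi> s 1) / of_real (1 - t))" for s
    by (intro continuous_intros continuous_on_subset[OF \<phi>_continuous_t]) auto
  show "\<exists>e>0. \<exists>M. \<forall>s'\<in>{s. Re s < 1}. dist s s' < e \<longrightarrow>
      (\<forall>t\<in>{0<..<1}. norm ((\<phi> s' t - \<phi> s' 1) / of_real (1 - t)) \<le> M)" for s
    using \<phi>_lipschitz[of s] by blast
qed (use A_pos in \<open>auto intro!: continuous_intros\<close>)

lemma J_integral_holomorphic: "(\<lambda>s. integral {0<..<1} (J s)) holomorphic_on {s. Re s < 1}"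
proof (rule beta_dominated_holomorphic[OF J_dominated open_halfspace_Re_lt])
  show "(\<lambda>s. J s t) holomorphic_on {s. Re s < 1}" if t: "t \<in> {0<..<1}" for t
    unfolding J_def
    by (intro holomorphic_intros of_real_powr_holomorphic holomorphic_on_subset[OF \<phi>_holomorphic])
      (use t in auto)
qed

lemma seg_integrand_eq_J:
  assumes t: "t \<in> {0<..<1}"
  shows "whipple.seg_integrand s (k - s) p t = J s t + \<phi> s 1 * (of_real t powr (A - 1) * of_real (1 - t) powr (- s - 1))"
proof -
  have t1: "complex_of_real (1 - t) \<noteq> 0" using t by auto
  have e: "whipple.A_exp s (k - s) = A" by (simp add: whipple.A_exp_def A_def)
  have "complex_of_real (1 - t) powr ((1 - s) - 1) = of_real (1 - t) powr (- s - 1) * of_real (1 - t)"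
    using t1 powr_add[of "complex_of_real (1 - t)" "- s - 1" 1] by simp
  then have "J s t = of_real t powr (A - 1) * of_real (1 - t) powr (- s - 1) * (\<phi> s t - \<phi> s 1)"
    unfolding J_def using t1 by (simp only:) simp
  then show ?thesis
    unfolding whipple.seg_integrand_def e bounded_part_eq_\<phi>[OF t] by (simp add: algebra_simps)
qed

text \<open>Multiplication by \<open>rGamma (- s)\<close> removes \<open>Gamma (- s)\<close>, whose
  pole at \<open>s = 0\<close> obstructs the continuation; after that both sides are holomorphic for
  \<open>Re s < 1\<close>. For \<open>Re s < 0\<close> the order \<open>k - s\<close> has real part
  above -1, so it is never a negative integer and the convergent case applies to every such
  \<open>s\<close>.\<close>

lemma continued_product_formula:
  assumes pr: "p \<in> principal_region" and s: "Re s < 1"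
  shows "fst p powr (s + 1) * snd p powr (s + 1) * Gamma (k + 1) *
      (Legendre_P s (- (k - s)) (fst p) * Legendre_P s (- (k - s)) (snd p)) =
    rGamma (- s) * integral {0<..<1} (J s) + \<phi> s 1 * (Gamma A * rGamma (A - s))"
    (is "?l s = ?r s")
proof (rule analytic_continuation_open[where s = "{s. Re s < 0}" and s' = "{s. Re s < 1}" and f = ?l and g = ?r and z = s])
  have "Re (- s) > 0 \<or> Re (s + 1) > 0" for s by auto
  then have P: "(\<lambda>s. Legendre_P s (- (k - s)) z) holomorphic_on {s. Re s < 1}" if "z \<in> cut_plane" for z
  proof -
    assume ab: "\<And>s. Re (- s) > 0 \<or> Re (s + 1) > 0"
    have e: "1 - (1 - z) / 2 = of_real 1 + of_real (1 / 2) * (z - 1)" by (simp add: field_simps)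
    have "z - 1 \<notin> \<real>\<^sub>\<le>\<^sub>0" using that by (simp add: in_cut_plane_iff)
    then have "(1 - z) / 2 \<in> slit_plane"
      unfolding mem_slit_plane_iff e using nonpos_affine(1)[of "z - 1" 1 "1/2"] by simp
    then show ?thesis
      unfolding Legendre_P_def
      by (intro holomorphic_on_mult holomorphic_on_const_powr hyp2F1_reg_holomorphic open_halfspace_Re_lt ab)
        (auto intro!: holomorphic_intros)
  qed
  show "?l holomorphic_on {s. Re s < 1}"
    by (intro holomorphic_on_mult holomorphic_on_const_powr holomorphic_on_const P regular_pairs_D(1,2)[OF p])
      (auto intro!: holomorphic_intros)
  have "(\<lambda>s. \<phi> s 1) holomorphic_on {s. Re s < 1}" by (rule holomorphic_on_subset[OF \<phi>_holomorphic]) auto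
  then show "?r holomorphic_on {s. Re s < 1}"
    by (intro holomorphic_intros J_integral_holomorphic) auto
  show "?l s = ?r s" if "s \<in> {s. Re s < 0}" for s
  proof -
    from that have s: "Re s < 0" by simp
    have "k - s \<noteq> - of_nat (Suc n)" for n
    proof
      assume "k - s = - of_nat (Suc n)"
      then have "Re (k - s) = Re (- of_nat (Suc n))" by (rule arg_cong)
      then show False using s k by simp
    qed
    then have nw: "convergent_whipple s (k - s)" unfolding convergent_whipple_def using s k by simp
    let ?g = "whipple.seg_integrand s (k - s) p"
    have I: "(?g has_integral convergent_whipple.product_rhs s (k - s) p) {0<..<1}"
      by (rule convergent_whipple.product_formula_convergent[OF nw pr])
    have "(J s has_integral integral {0<..<1} (J s)) {0<..<1}"
      by (rule integrable_integral[OF beta_dominated_integrable[OF J_dominated]]) (use s in simp)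
    moreover have "((\<lambda>t. of_real t powr (A - 1) * of_real (1 - t) powr (- s - 1)) has_integral
        Gamma A * Gamma (- s) * rGamma (A + - s)) {0<..<1}"
      by (rule complex_Beta_integral) (use A_pos s in auto)
    ultimately have "((\<lambda>t. J s t + \<phi> s 1 * (of_real t powr (A - 1) * of_real (1 - t) powr (- s - 1))) has_integral
        integral {0<..<1} (J s) + \<phi> s 1 * (Gamma A * Gamma (- s) * rGamma (A + - s))) {0<..<1}"
      by (intro has_integral_add has_integral_mult_right)
    then have "(?g has_integral
        integral {0<..<1} (J s) + \<phi> s 1 * (Gamma A * Gamma (- s) * rGamma (A + - s))) {0<..<1}"
      by (subst has_integral_cong[OF seg_integrand_eq_J])
    from has_integral_unique[OF this I]
    have e: "integral {0<..<1} (J s) + \<phi> s 1 * (Gamma A * Gamma (- s) * rGamma (A + - s)) =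
       convergent_whipple.product_rhs s (k - s) p" .
    have g: "rGamma (- s) * Gamma (- s) = 1"
    proof -
      have "- s \<notin> \<int>\<^sub>\<le>\<^sub>0" using s by (auto elim!: nonpos_Ints_cases')
      then show ?thesis by (simp add: rGamma_inverse_Gamma Gamma_eq_zero_iff)
    qed
    have alg: "r * I' + a * (b * c) = r * (I' + a * (b * g * c))" if "r * g = 1" for r g I' a b c :: complex
    proof -
      have "r * (I' + a * (b * g * c)) = r * I' + (r * g) * (a * (b * c))" by (simp add: algebra_simps)
      then show ?thesis using that by simp
    qed
    have alg2: "a * b * c * (d * e) = r * (a * b * c * g * (d * e))" if "r * g = 1" for a b c d e r g :: complex
    proof -
      have "r * (a * b * c * g * (d * e)) = (r * g) * (a * b * c * (d * e))" by (simp add: algebra_simps)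
      then show ?thesis using that by simp
    qed
    have "?r s = rGamma (- s) * convergent_whipple.product_rhs s (k - s) p"
      unfolding e[symmetric] by (simp add: alg[OF g])
    also have "\<dots> = ?l s"
      unfolding convergent_whipple.product_rhs_def[OF nw] using alg2[OF g] by (simp add: mult.assoc)
    finally show ?thesis ..
  qed
  have "- 1 \<in> {s. Re s < 0}" by simp
  then show "{s. Re s < 0} \<noteq> {}" by blast
qed (use s in \<open>auto intro: open_halfspace_Re_lt convex_connected convex_halfspace_Re_lt\<close>)

end

section \<open>The product formula\<close>

text \<open>The reflection formula. At a negative integer \<nu> a zero of the sine meets a pole of
  Gamma; the convention \<open>Gamma = 0\<close> at poles would give 0, whereas the limit
  \<open>- pi * rGamma (- \<nu>)\<close> is not 0.\<close>

lemma remove_sings_sin_Gamma: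
  "remove_sings (\<lambda>w. sin (of_real pi * w) * Gamma (w + 1)) \<nu> = - of_real pi * rGamma (- \<nu>)"
proof (rule remove_sings_eqI)
  have "\<forall>\<^sub>F w in at \<nu>. rGamma (w + 1) \<noteq> 0 \<and> w \<in> UNIV"
    by (rule non_zero_neighbour_alt[where \<beta> = 0]) (auto intro!: holomorphic_intros)
  then have "\<forall>\<^sub>F w in at \<nu>. - of_real pi * rGamma (- w) = sin (of_real pi * w) * Gamma (w + 1)"
  proof eventually_elim
    case (elim w)
    then have g: "rGamma (w + 1) * Gamma (w + 1) = 1" by (simp add: rGamma_inverse_Gamma)
    have "rGamma (- w) * rGamma (w + 1) = - (sin (of_real pi * w) / of_real pi)"
      using rGamma_reflection_complex[of "- w"] by (simp add: add.commute)
    then have s: "sin (of_real pi * w) = - of_real pi * (rGamma (- w) * rGamma (w + 1))" by simp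
    have "sin (of_real pi * w) * Gamma (w + 1) = - of_real pi * rGamma (- w) * (rGamma (w + 1) * Gamma (w + 1))"
      unfolding s by (simp only: mult.assoc)
    then show ?case unfolding g by simp
  qed
  moreover have "isCont (\<lambda>w. - of_real pi * rGamma (- w)) \<nu>"
    by (intro continuous_intros)
  then have "((\<lambda>w. - of_real pi * rGamma (- w)) \<longlongrightarrow> - of_real pi * rGamma (- \<nu>)) (at \<nu>)"
    by (simp only: isCont_def)
  ultimately show "((\<lambda>w. sin (of_real pi * w) * Gamma (w + 1)) \<longlongrightarrow> - of_real pi * rGamma (- \<nu>)) (at \<nu>)"
    by (blast intro: Lim_transform_eventually)
qed

lemma segment_point_cut_plane:
  assumes "p \<in> regular_pairs" "t \<in> {0<..<1}"
  shows "segment_point p t \<in> cut_plane"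
proof -
  have e: "segment_point p t - 1 = of_real 0 + of_real t * w_of p" by (simp add: segment_point_w)
  show ?thesis
    unfolding in_cut_plane_iff e using nonpos_affine(2)[OF regular_pairs_D(4)[OF assms(1)], of t 0] assms(2) by simp
qed

context whipple
begin

text \<open>Convergence leaves two cases. If \<open>Re \<nu> < 0\<close>, the convergent formula
  applies. In the other case \<open>f\<close> vanishes at the upper limit, and so does the
  subtracted value \<open>\<phi> \<nu> 1\<close>; the integrand \<open>J\<close> is then the
  original one, and the continued formula loses its second term.\<close>

lemma product_formula_regular_order:
  assumes pr: "p \<in> principal_region" and int: "seg_integrand p integrable_on {0<..<1}"
    and mu: "\<And>n::nat. \<mu> \<noteq> - of_nat (Suc n)"
  shows "Legendre_P \<nu> (-\<mu>) (fst p) * Legendre_P \<nu> (-\<mu>) (snd p) =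
    rGamma (-\<nu>) * rGamma (\<nu> + \<mu> + 1) / (fst p powr (\<nu> + 1) * snd p powr (\<nu> + 1)) * integral {0<..<1} (seg_integrand p)"
proof -
  have p: "p \<in> regular_pairs" by (rule subsetD[OF principal_region_regular pr])
  note N = exponents_of_integrable[OF p int mu]
  let ?P = "Legendre_P \<nu> (-\<mu>) (fst p) * Legendre_P \<nu> (-\<mu>) (snd p)"
  have main: "fst p powr (\<nu> + 1) * snd p powr (\<nu> + 1) * Gamma (\<nu> + \<mu> + 1) * ?P = rGamma (-\<nu>) * integral {0<..<1} (seg_integrand p)"
    using N(2)
  proof
    assume "Re \<nu> < 0"
    then have nw: "convergent_whipple \<nu> \<mu>" unfolding convergent_whipple_def using N(1) mu by simp
    have e: "integral {0<..<1} (seg_integrand p) = convergent_whipple.product_rhs \<nu> \<mu> p"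
      by (rule integral_unique[OF convergent_whipple.product_formula_convergent[OF nw pr]])
    have g: "rGamma (-\<nu>) * Gamma (-\<nu>) = 1"
    proof -
      have "- \<nu> \<notin> \<int>\<^sub>\<le>\<^sub>0" using \<open>Re \<nu> < 0\<close> by (auto elim!: nonpos_Ints_cases')
      then show ?thesis by (simp add: rGamma_inverse_Gamma Gamma_eq_zero_iff)
    qed
    have alg: "a * b * c * P = r * (a * b * c * g * P)" if "r * g = 1" for a b c P r g :: complex
    proof -
      have "r * (a * b * c * g * P) = (r * g) * (a * b * c * P)" by (simp add: algebra_simps)
      then show ?thesis using that by simp
    qed
    show ?thesis
      unfolding e convergent_whipple.product_rhs_def[OF nw] by (rule alg[OF g])
  next
    assume z: "f ((1 - segment_point p 1) / 2) = 0 \<and> Re \<nu> < 1"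
    obtain L where L: "continuous_on {0..1} L" "\<forall>t\<in>{0..1}. exp (L t) = kernel_normalised p t"
        "\<forall>t\<in>{0<..<1}. L t = Ln (kernel_normalised p t)"
      using kernel_Ln_extends[OF p] by blast
    interpret fam: degree_family p "\<nu> + \<mu>" L
      by (unfold_locales) (use p N(1) L in auto)
    have \<phi>: "fam.\<phi> \<nu> 1 = 0"
    proof -
      have "hyp2F1_reg (-\<nu>) (\<nu> + 1) (1 + (\<nu> + \<mu> - \<nu>)) ((1 - segment_point p 1) / 2) = 0"
        using conjunct1[OF z] unfolding f_def add_diff_cancel_left' .
      then show ?thesis unfolding fam.\<phi>_def fam.G_def by (simp only: mult_zero_left mult_zero_right div_0)
    qed
    have "seg_integrand p t = fam.J \<nu> t" if "t \<in> {0<..<1}" for t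
      using fam.seg_integrand_eq_J[OF that, of \<nu>]
      unfolding \<phi> mult_zero_left add_0_right add_diff_cancel_left' .
    then have "integral {0<..<1} (seg_integrand p) = integral {0<..<1} (fam.J \<nu>)" by (rule integral_cong)
    then show ?thesis
      using fam.continued_product_formula[OF pr conjunct2[OF z]]
      unfolding \<phi> mult_zero_left add_0_right add_diff_cancel_left' by (simp only:)
  qed
  have "\<nu> + \<mu> + 1 \<notin> \<int>\<^sub>\<le>\<^sub>0"
  proof
    assume "\<nu> + \<mu> + 1 \<in> \<int>\<^sub>\<le>\<^sub>0"
    then obtain n :: nat where "\<nu> + \<mu> + 1 = - of_nat n" by (auto elim: nonpos_Ints_cases')
    then have "Re (\<nu> + \<mu> + 1) = Re (- of_nat n)" by (rule arg_cong)
    then show False using N(1) by simp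
  qed
  then have "Gamma (\<nu> + \<mu> + 1) \<noteq> 0" by (simp add: Gamma_eq_zero_iff)
  moreover have "fst p \<noteq> 0" "snd p \<noteq> 0" using cut_plane_nonzero(1) regular_pairs_D(1,2)[OF p] by auto
  moreover have "P = r * inverse g / (a * b) * i" if "a * b * g * P = r * i" "g \<noteq> 0" "a \<noteq> 0" "b \<noteq> 0" for P r g a b i :: complex
  proof -
    have "P = (a * b * g * P) / (a * b * g)" using that(2-4) by simp
    then show ?thesis unfolding that(1) by (simp add: divide_inverse mult_ac)
  qed
  ultimately show ?thesis unfolding rGamma_inverse_Gamma[of "\<nu> + \<mu> + 1"] using main by simp
qed

end

text \<open>At a lower parameter \<open>1 - m\<close> the regularized series starts at degree
  \<open>m\<close>, which produces the Pochhammer factors. With \<open>B = (z + 1) / (z - 1)\<close>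
  its variable satisfies \<open>x / (1 - x) = - 1 / B\<close>: the \<open>m\<close>-th power of this
  gives the sign and turns \<open>B powr (m / 2)\<close> into
  \<open>B powr (- m / 2)\<close>.\<close>

lemma Legendre_P_negative_order:
  assumes z: "z \<in> cut_plane"
  shows "Legendre_P \<nu> (of_nat m) z =
    (-1) ^ m * (pochhammer (-\<nu>) m * pochhammer (\<nu> + 1) m) * Legendre_P \<nu> (- of_nat m) z"
proof -
  define B where "B = (z + 1) / (z - 1)"
  have z0: "z - 1 \<noteq> 0" "z + 1 \<noteq> 0" using cut_plane_nonzero(2,3)[OF z] by (simp_all add: eq_neg_iff_add_eq_0)
  then have B0: "B \<noteq> 0" by (simp add: B_def)
  have x: "((1 - z) / 2) / (1 - (1 - z) / 2) = - (1 / B)"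
  proof -
    have h: "1 - (1 - z) / 2 = (z + 1) / 2" by (simp add: field_simps)
    have "((1 - z) / 2) / (1 - (1 - z) / 2) = (1 - z) / (z + 1)"
    proof -
      have "(a / 2) / (b / 2) = a / b" for a b :: complex by simp
      then show ?thesis unfolding h .
    qed
    also have "\<dots> = - (1 / B)" by (simp add: B_def minus_divide_left)
    finally show ?thesis .
  qed
  have e: "1 - (1 - z) / 2 = of_real 1 + of_real (1 / 2) * (z - 1)" by (simp add: field_simps)
  have "z - 1 \<notin> \<real>\<^sub>\<le>\<^sub>0" using z by (simp add: in_cut_plane_iff)
  then have s: "(1 - z) / 2 \<in> slit_plane"
    unfolding mem_slit_plane_iff e using nonpos_affine(1)[of "z - 1" 1 "1/2"] by simp
  have pw: "B powr (of_nat m / 2) * (- (1 / B)) ^ m = (-1) ^ m * B powr (- of_nat m / 2)"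
  proof -
    have "B powr (of_nat m / 2) = B powr (- of_nat m / 2 + of_nat m)" by (simp add: field_simps)
    also have "\<dots> = B powr (- of_nat m / 2) * B powr of_nat m" by (rule powr_add)
    also have "B powr of_nat m = B ^ m" using B0 by (simp add: powr_nat')
    finally have "B powr (of_nat m / 2) * (- (1 / B)) ^ m = B powr (- of_nat m / 2) * (B * (- (1 / B))) ^ m"
      by (simp only: power_mult_distrib mult.assoc)
    also have "B * (- (1 / B)) = - 1" using B0 by simp
    finally show ?thesis by (simp only: mult.commute)
  qed
  have ab: "Re (-\<nu>) > 0 \<or> Re (\<nu> + 1) > 0" by auto
  have "Legendre_P \<nu> (of_nat m) z = (B powr (of_nat m / 2) * (- (1 / B)) ^ m) * (pochhammer (-\<nu>) m * pochhammer (\<nu> + 1) m) *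
      hyp2F1_reg (-\<nu>) (\<nu> + 1) (1 + of_nat m) ((1 - z) / 2)"
    unfolding Legendre_P_def B_def[symmetric]
    using hyp2F1_reg_degenerate[OF ab _ s, of m, unfolded x] by simp
  then show ?thesis unfolding pw by (simp add: Legendre_P_def B_def)
qed

text \<open>
  For \<open>\<mu> = -m\<close> the lower end point gives no bound on \<open>Re (\<nu> + \<mu>)\<close>, since \<open>f 0 = rGamma (1 + \<mu>) = 0\<close>; there the
  formula for the order \<open>m\<close> applies, both sides differing by the same factor.
\<close>

lemma product_formula_segment:
  assumes pr: "p \<in> principal_region" and int: "whipple.seg_integrand \<nu> \<mu> p integrable_on {0<..<1}"
  shows "Legendre_P \<nu> (-\<mu>) (fst p) * Legendre_P \<nu> (-\<mu>) (snd p) =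
    rGamma (-\<nu>) * rGamma (\<nu> + \<mu> + 1) / (fst p powr (\<nu> + 1) * snd p powr (\<nu> + 1)) *
      integral {0<..<1} (whipple.seg_integrand \<nu> \<mu> p)"
proof (cases "\<exists>n::nat. \<mu> = - of_nat (Suc n)")
  case False
  then show ?thesis using whipple.product_formula_regular_order[OF pr int] by blast
next
  case True
  then obtain m :: nat where \<mu>: "\<mu> = - of_nat m" by blast
  have p: "p \<in> regular_pairs" by (rule subsetD[OF principal_region_regular pr])
  define K where "K = (-1) ^ m * (pochhammer (-\<nu>) m * pochhammer (\<nu> + 1) m)"
  have L: "Legendre_P \<nu> (-\<mu>) z = K * Legendre_P \<nu> (- of_nat m) z" if "z \<in> cut_plane" for z
    using Legendre_P_negative_order[OF that, of \<nu> m] by (simp add: \<mu> K_def)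
  have seg: "whipple.seg_integrand \<nu> \<mu> p t = K * whipple.seg_integrand \<nu> (of_nat m) p t" if t: "t \<in> {0<..<1}" for t
  proof -
    have "product_integrand \<nu> \<mu> (fst p) (snd p) (segment_point p t) =
        K * product_integrand \<nu> (of_nat m) (fst p) (snd p) (segment_point p t)"
      unfolding product_integrand_def L[OF segment_point_cut_plane[OF p t]] by simp
    then have "- whipple.seg_integrand \<nu> \<mu> p t = K * (- whipple.seg_integrand \<nu> (of_nat m) p t)"
      unfolding whipple.product_integrand_eq[OF p t, symmetric] by simp
    then show ?thesis by simp
  qed
  have I: "integral {0<..<1} (whipple.seg_integrand \<nu> \<mu> p) = K * integral {0<..<1} (whipple.seg_integrand \<nu> (of_nat m) p)"
  proof -
    have "integral {0<..<1} (whipple.seg_integrand \<nu> \<mu> p) =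
        integral {0<..<1} (\<lambda>t. K * whipple.seg_integrand \<nu> (of_nat m) p t)"
      by (rule integral_cong) (rule seg)
    then show ?thesis by simp
  qed
  note L12 = L[OF regular_pairs_D(1)[OF p]] L[OF regular_pairs_D(2)[OF p]]
  show ?thesis
  proof (cases "K = 0")
    \<comment> \<open>This happens for integers \<nu> with \<open>- m \<le> \<nu> < m\<close>; both
      sides are then 0.\<close>
    case True
    then show ?thesis unfolding I L12 by simp
  next
    case False
    have "(\<lambda>t. inverse K * whipple.seg_integrand \<nu> \<mu> p t) integrable_on {0<..<1}"
      by (rule integrable_on_mult_right[OF int])
    then have int': "whipple.seg_integrand \<nu> (of_nat m) p integrable_on {0<..<1}"
      by (rule integrable_eq) (use seg False in simp)
    have m: "of_nat m \<noteq> (- of_nat (Suc n) :: complex)" for n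
    proof
      assume "of_nat m = (- of_nat (Suc n) :: complex)"
      then have "Re (of_nat m) = Re (- of_nat (Suc n))" by (rule arg_cong)
      then show False by simp
    qed
    \<comment> \<open>The left-hand side of the formula is quadratic in the Legendre function, the
      integral only linear; the second factor \<open>K\<close> comes from the quotient of the Gamma
      factors.\<close>
    have G: "K * rGamma (\<nu> + of_nat m + 1) = rGamma (\<nu> + \<mu> + 1)"
    proof -
      have "rGamma (\<nu> + \<mu> + 1) = pochhammer (\<nu> - of_nat m + 1) m * rGamma (\<nu> + 1)"
        using pochhammer_rGamma[of "\<nu> - of_nat m + 1" m] by (simp add: \<mu> algebra_simps)
      also have "rGamma (\<nu> + 1) = pochhammer (\<nu> + 1) m * rGamma (\<nu> + of_nat m + 1)"
        using pochhammer_rGamma[of "\<nu> + 1" m] by (simp add: algebra_simps)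
      also have "pochhammer (\<nu> - of_nat m + 1) m = (-1) ^ m * pochhammer (-\<nu>) m"
        using pochhammer_minus[of \<nu> m] by (simp flip: power_mult_distrib mult.assoc)
      finally show ?thesis by (simp add: K_def mult_ac)
    qed
    have alg: "(K * P) * (K * Q) = r * (K * g) / d * (K * j)" if "P * Q = r * g / d * j" for P Q r g d j
    proof -
      have "(K * P) * (K * Q) = K * K * (P * Q)" by simp
      then show ?thesis unfolding that by simp
    qed
    show ?thesis
      unfolding I L12 G[symmetric] by (rule alg) (rule whipple.product_formula_regular_order[OF pr int' m])
  qed
qed

theorem corollary42:
  fixes z1 z2 \<nu> \<mu> :: complex
  assumes "z1 \<in> cut_plane" and "z2 \<in> cut_plane"
    and "\<nu> \<noteq> 0" and "\<mu> \<noteq> 0"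
    and "Re (\<nu> + \<mu>) > -3"
    and branch: "(z1, z2) \<in> principal_region"
    and convergent: "product_integrand \<nu> \<mu> z1 z2 contour_integrable_on
                       linepath 1 (upper_limit z1 z2)"
  shows "Legendre_P \<nu> (-\<mu>) z1 * Legendre_P \<nu> (-\<mu>) z2 =
           remove_sings (\<lambda>w. sin (of_real pi * w) * Gamma (w + 1)) \<nu> /
           (of_real pi * Gamma (\<nu> + \<mu> + 1) * (z1 powr (\<nu> + 1) * z2 powr (\<nu> + 1))) *
           contour_integral (linepath 1 (upper_limit z1 z2)) (product_integrand \<nu> \<mu> z1 z2)"
proof -
  have p: "(z1, z2) \<in> regular_pairs" by (rule subsetD[OF principal_region_regular branch])
  define i where "i = contour_integral (linepath 1 (upper_limit z1 z2)) (product_integrand \<nu> \<mu> z1 z2)"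
  have "(product_integrand \<nu> \<mu> z1 z2 has_contour_integral i) (linepath 1 (upper_limit z1 z2))"
    unfolding i_def by (rule has_contour_integral_integral[OF convergent])
  then have I: "(whipple.seg_integrand \<nu> \<mu> (z1, z2) has_integral - i) {0<..<1}"
    using whipple.contour_integral_iff[OF p, of \<nu> \<mu> i] by simp
  have "Legendre_P \<nu> (-\<mu>) z1 * Legendre_P \<nu> (-\<mu>) z2 =
      rGamma (-\<nu>) * rGamma (\<nu> + \<mu> + 1) / (z1 powr (\<nu> + 1) * z2 powr (\<nu> + 1)) * (- i)"
    using product_formula_segment[OF branch has_integral_integrable[OF I]] integral_unique[OF I] by simp
  \<comment> \<open>The minus sign of the segment integral goes into the limit value of the sine
    factor. At poles of Gamma the division by 0 agrees with \<open>rGamma = 0\<close>.\<close>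
  also have "\<dots> = - of_real pi * rGamma (-\<nu>) / (of_real pi * Gamma (\<nu> + \<mu> + 1) * (z1 powr (\<nu> + 1) * z2 powr (\<nu> + 1))) * i"
    by (simp add: rGamma_inverse_Gamma[of "\<nu> + \<mu> + 1"] divide_inverse)
  finally show ?thesis unfolding remove_sings_sin_Gamma i_def .
qed

end
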